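(* Let $S,\kappa,\varepsilon,\varrho,\xi,\mu_i,M,N,T,\varphi_m,Y$ be as in the context. Let $y=(y_1,\dots,y_M)\in T^M$ with $P(Y=y)>0$, and let $\{(t^k,\boldsymbol u_M^{*,k})\}_{k=1}^\infty$, $\boldsymbol u_M^{*,k}=(u_1^{*,k},\dots,u_M^{*,k})$, be independent weighted simulations (each constructed from $y$ as in the context), with corresponding total weights $V_k$. Then, almost surely, in the sense of weak convergence of Borel probability measures on $M_1$, $$\mathcal L(\mu_{M+1}\mid Y=y)=\lim_{K\to\infty}\frac{1}{\kappa+M}\left(\kappa\,\mathcal D(\varepsilon\varrho)+\sum_{m=1}^M\frac{\sum_{k=1}^K V_k\,\delta(u_m^{*,k})}{\sum_{k=1}^K V_k}\right),$$ where $\delta(\cdot)$ denotes a point mass. Consequently, if $\Phi$ is a measurable function on $M_1$ taking values in a metric space and $P(\mu_{M+1}\in D^c\mid Y=y)=1$, where $D\subseteq M_1$ is the set of discontinuities of $\Phi$, then, almost surely and in the sense of weak convergence, $$\mathcal L(\Phi(\mu_{M+1})\mid Y=y)=\lim_{K\to\infty}\frac{1}{\kappa+M}\left(\kappa\,\mathcal D(\varepsilon\varrho)\circ\Phi^{-1}+\sum_{m=1}^M\frac{\sum_{k=1}^K V_k\,\delta(\Phi(u_m^{*,k}))}{\sum_{k=1}^K V_k}\right).$$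
   Context: $S$ is a complete separable metric space with Borel $\sigma$-algebra $\mathcal S$; $M_1=M_1(S)$ is the set of Borel probability measures on $S$ with the Prohorov metric (a complete separable metric space). For a nonzero finite measure $\alpha$ on a complete separable metric space, $\mathcal D(\alpha)$ is the law of a Dirichlet process with parameter $\alpha$, i.e. of a random probability measure $\lambda$ with $(\lambda(B_0),\dots,\lambda(B_d))\sim\mathrm{Dir}(\alpha(B_0),\dots,\alpha(B_d))$ for every measurable partition $\{B_0,\dots,B_d\}$. $\mathcal L(X)$ and $\mathcal L(X\mid\cdot)$ denote law and (regular) conditional law. Nested Dirichlet process: fix $\kappa,\varepsilon>0$ and a Borel probability measure $\varrho$ on $S$. Let $\varpi$ be a random probability measure on $M_1$ with $\varpi\sim\mathcal D(\kappa\,\mathcal D(\varepsilon\varrho))$. Given $\varpi$, the random measures $\mu_1,\mu_2,\dots$ are i.i.d. with law $\varpi$. The array $\xi=\{\xi_{ij}\}_{i,j\in\mathbb N}$ of $S$-valued random variables is such that, given $\varpi$ and $\mu=\{\mu_i\}$, all entries are independent with $\xi_{ij}\sim\mu_i$. Put $X_{in}=(\xi_{i1},\dots,\xi_{in})$ and $\varrho_n=\mathcal L(X_{in})$, a probability measure on $S^n$ (not depending on $i$). Observations: fix $M,N\in\mathbb N$, a countable set $T$ (with the discrete $\sigma$-algebra), and measurable $\varphi_m:S^N\to T$, $1\le m\le M$. Let $Y_m=\varphi_m(X_{mN})$ and $Y=(Y_1,\dots,Y_M)$. For $y_m\in T$ let $A_m=\varphi_m^{-1}(\{y_m\})\subseteq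 S^N$ and, when $\varrho_N(A_m)>0$, let $\varrho_N(\cdot\mid A_m)=\varrho_N(\cdot\cap A_m)/\varrho_N(A_m)$. Weighted simulation: given $y=(y_1,\dots,y_M)\in T^M$ with $P(Y=y)>0$, a weighted simulation is a pair $(t,\boldsymbol u_M^* )$, independent of $Y$, where $t=\{t_{mi}:1\le m\le M,1\le i\le m\}$ are $[0,\infty)$-valued random variables and $\boldsymbol u_M^*=(u_1^*,\dots,u_M^* )$ are $M_1$-valued random variables, constructed recursively in $m$ by $$t_{mi}=(u_i^* )^N(A_m)\ \ (1\le i<m),\qquad t_{mm}=\kappa\,\varrho_N(A_m),$$ where $(u_i^* )^N$ is the $N$-fold product measure, and, with $\boldsymbol u_{m-1}^*=(u_1^*,\dots,u_{m-1}^* )$, $$\mathcal L(u_m^*\mid\boldsymbol u_{m-1}^* )=\frac{1}{\sum_{i=1}^m t_{mi}}\Big(t_{mm}\int_{S^N}\mathcal D\Big(\varepsilon\varrho+\sum_{n=1}^N\delta_{x_n}\Big)\,\varrho_N(dx\mid A_m)+\sum_{i=1}^{m-1}t_{mi}\,\delta_{u_i^*}\Big).$$ Its total weight is $V=\prod_{m=1}^M\frac{1}{\kappa+m-1}\sum_{i=1}^m t_{mi}$. *)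

theory Defs
  imports "HOL-Probability.Probability"
begin

section \<open>The space of Borel probability measures with the Prohorov metric\<close>

typedef (overloaded) ('a::topological_space) borel_prob =
    "{\<nu> :: 'a measure. sets \<nu> = sets borel \<and> prob_space \<nu>}"
  morphisms meas Borel_prob
  by (intro exI[of _ "return borel undefined"]) (simp add: prob_space_return)

lemma sets_meas [simp, measurable_cong]: "sets (meas u) = sets borel"
  using meas[of u] by simp

lemma space_meas [simp]: "space (meas u) = UNIV"
  using sets_eq_imp_space_eq[OF sets_meas[of u]] by simp

lemma prob_space_meas [simp]: "prob_space (meas u)"
  using meas[of u] by simp

definition enlarge :: "'a::metric_space set \<Rightarrow> real \<Rightarrow> 'a set" where
  "enlarge A e = {x. \<exists>y\<in>A. dist x y < e}"

definition prohorov_bounds :: "'a::metric_space borel_prob \<Rightarrow> 'a borel_prob \<Rightarrow> real set" where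
  "prohorov_bounds u v = {e. e > 0 \<and> (\<forall>A\<in>sets borel.
     measure (meas u) A \<le> measure (meas v) (enlarge A e) + e \<and>
     measure (meas v) A \<le> measure (meas u) (enlarge A e) + e)}"

lemma open_enlarge: "open (enlarge A e)"
proof -
  have "enlarge A e = (\<Union>y\<in>A. ball y e)"
    by (auto simp: enlarge_def dist_commute)
  then show ?thesis by auto
qed

lemma enlarge_borel [measurable, simp]: "enlarge A e \<in> sets borel"
  by (simp add: open_enlarge)

lemma enlarge_enlarge: "enlarge (enlarge A d) e \<subseteq> enlarge A (d + e)"
proof
  fix x assume "x \<in> enlarge (enlarge A d) e"
  then obtain y z where "z \<in> A" "dist y z < d" "dist x y < e"
    by (auto simp: enlarge_def)
  then show "x \<in> enlarge A (d + e)"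
    using dist_triangle[of x z y] by (auto simp: enlarge_def intro!: bexI[of _ z])
qed

lemma enlarge_mono: "d \<le> e \<Longrightarrow> enlarge A d \<subseteq> enlarge A e"
  by (force simp: enlarge_def)

lemma meas_mono: "A \<subseteq> B \<Longrightarrow> B \<in> sets borel \<Longrightarrow> measure (meas u) A \<le> measure (meas u) B"
  by (intro finite_measure.finite_measure_mono prob_space.finite_measure) auto

lemma meas_eqI:
  assumes "\<And>C. closed C \<Longrightarrow> measure (meas u) C = measure (meas v) C"
  shows "u = v"
proof -
  have e: "emeasure (meas u) C = emeasure (meas v) C" if "closed C" for C
    using assms[OF that] finite_measure.emeasure_eq_measure[OF prob_space.finite_measure[OF prob_space_meas]]
    by metis
  have "meas u = meas v"
  proof (rule measure_eqI_generator_eq[where E="Collect closed" and \<Omega>=UNIV and A="\<lambda>_. UNIV"])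
    show "Int_stable (Collect closed)" by (auto simp: Int_stable_def)
    show "sets (meas u) = sigma_sets UNIV (Collect closed)"
      by (simp add: borel_eq_closed)
    show "sets (meas v) = sigma_sets UNIV (Collect closed)"
      by (simp add: borel_eq_closed)
    show "emeasure (meas u) UNIV \<noteq> \<infinity>"
      using prob_space.emeasure_space_1[OF prob_space_meas, of u] by simp
  qed (auto simp: e)
  then show ?thesis by (simp add: meas_inject)
qed

instantiation borel_prob :: (metric_space) metric_space
begin

definition dist_borel_prob :: "'a borel_prob \<Rightarrow> 'a borel_prob \<Rightarrow> real" where
  "dist_borel_prob u v = Inf (prohorov_bounds u v)"

definition uniformity_borel_prob :: "('a borel_prob \<times> 'a borel_prob) filter" where
  "uniformity_borel_prob = (INF e\<in>{0<..}. principal {(u, v). dist u v < e})"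

definition open_borel_prob :: "'a borel_prob set \<Rightarrow> bool" where
  "open_borel_prob U \<longleftrightarrow> (\<forall>x\<in>U. eventually (\<lambda>(x', y). x' = x \<longrightarrow> y \<in> U) uniformity)"

instance
proof
  fix u v w :: "'a borel_prob"
  have one: "1 \<in> prohorov_bounds u v" for u v :: "'a borel_prob"
    unfolding prohorov_bounds_def
    by (auto intro!: order_trans[OF prob_space.prob_le_1])
  have bdd: "bdd_below (prohorov_bounds u v)" for u v :: "'a borel_prob"
    by (intro bdd_belowI[of _ 0]) (auto simp: prohorov_bounds_def)
  have less: "e \<in> prohorov_bounds u v" if lt: "dist u v < e" for e and u v :: "'a borel_prob"
  proof -
    obtain d where d: "d \<in> prohorov_bounds u v" "d < e"
      using lt one[of u v] cInf_lessD[of "prohorov_bounds u v" e] by (auto simp: dist_borel_prob_def)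
    have m: "measure (meas w) (enlarge A d) \<le> measure (meas w) (enlarge A e)" for A w
      using d by (intro meas_mono enlarge_mono) auto
    have m': "x \<le> measure (meas w) (enlarge A e) + e"
      if "x \<le> measure (meas w) (enlarge A d) + d" for x A w
      using that m[of w A] d(2) by linarith
    show ?thesis
      unfolding prohorov_bounds_def
    proof (intro CollectI conjI ballI)
      show "e > 0" using d by (simp add: prohorov_bounds_def)
    qed (use d(1) in \<open>auto simp: prohorov_bounds_def intro!: m'\<close>)
  qed
  have sym: "prohorov_bounds u v = prohorov_bounds v u" for u v :: "'a borel_prob"
    by (auto simp: prohorov_bounds_def)
  have le: "dist u v \<le> e" if "e \<in> prohorov_bounds u v" for e and u v :: "'a borel_prob"
    unfolding dist_borel_prob_def using that bdd by (rule cInf_lower)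
  have nonneg: "0 \<le> dist u v" for u v :: "'a borel_prob"
    unfolding dist_borel_prob_def
  proof (rule cInf_greatest)
    show "prohorov_bounds u v \<noteq> {}" using one[of u v] by blast
  qed (simp add: prohorov_bounds_def)
  show "dist u v = 0 \<longleftrightarrow> u = v"
  proof
    assume "u = v"
    have "e \<in> prohorov_bounds u u" if "e > 0" for e
    proof -
      have "measure (meas u) A \<le> measure (meas u) (enlarge A e)" if "A \<in> sets borel" for A
        using \<open>e > 0\<close> by (intro meas_mono) (force simp: enlarge_def, simp)
      then have "measure (meas u) A \<le> measure (meas u) (enlarge A e) + e" if "A \<in> sets borel" for A
        using \<open>e > 0\<close> that by (meson add_increasing2 less_imp_le)
      then show ?thesis using that by (simp add: prohorov_bounds_def)
    qed
    then have "dist u v \<le> 0 + e" if "e > 0" for e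
      using le[of e u u] \<open>u = v\<close> that by simp
    then have "dist u v \<le> 0"
      by (rule field_le_epsilon)
    then show "dist u v = 0" using nonneg[of u v] by simp
  next
    assume 0: "dist u v = 0"
    have *: "measure (meas u) C \<le> measure (meas v) C"
      if C: "closed C" and 0: "dist u v = 0" for C and u v :: "'a borel_prob"
    proof -
      define E where "E n = enlarge C (inverse (real (Suc n)))" for n
      have "(\<Inter>n. E n) = C"
      proof (intro equalityI subsetI)
        fix x assume x: "x \<in> (\<Inter>n. E n)"
        have "x \<in> closure C"
          unfolding closure_approachable
        proof (intro allI impI)
          fix e :: real assume "e > 0"
          then obtain n where n: "inverse (real (Suc n)) < e"
            using reals_Archimedean by blast
          from x obtain y where "y \<in> C" "dist x y < inverse (real (Suc n))"
            by (auto simp: E_def enlarge_def)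
          with n show "\<exists>y\<in>C. dist y x < e" by (auto simp: dist_commute intro!: bexI[of _ y])
        qed
        with C show "x \<in> C" by simp
      next
        fix x assume "x \<in> C"
        then show "x \<in> (\<Inter>n. E n)"
          by (auto simp: E_def enlarge_def intro!: bexI[of _ x])
      qed
      moreover have "(\<lambda>n. measure (meas v) (E n)) \<longlonglongrightarrow> measure (meas v) (\<Inter>n. E n)"
      proof (intro finite_measure.finite_Lim_measure_decseq prob_space.finite_measure)
        show "decseq E"
          unfolding E_def by (intro decseq_SucI enlarge_mono) (simp add: field_simps)
      qed (auto simp: E_def)
      ultimately have lim: "(\<lambda>n. measure (meas v) (E n) + inverse (real (Suc n)))
          \<longlonglongrightarrow> measure (meas v) C + 0"
        by (intro tendsto_add LIMSEQ_inverse_real_of_nat) simp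
      have "measure (meas u) C \<le> measure (meas v) (E n) + inverse (real (Suc n))" for n
      proof -
        have "inverse (real (Suc n)) \<in> prohorov_bounds u v"
          using 0 by (intro less) simp
        moreover have "C \<in> sets borel" using C by simp
        ultimately show ?thesis unfolding prohorov_bounds_def E_def by blast
      qed
      with lim show ?thesis
        by (intro LIMSEQ_le_const[of _ "measure (meas v) C"]) auto
    qed
    have "dist v u = 0" using 0 sym[of u v] by (simp add: dist_borel_prob_def)
    then show "u = v"
      using 0 by (intro meas_eqI antisym *) simp_all
  qed
  show "dist u v \<le> dist u w + dist v w"
  proof (rule field_le_epsilon)
    fix e :: real assume "e > 0"
    define a b where "a = dist u w + e / 2" and "b = dist v w + e / 2"
    have a: "a \<in> prohorov_bounds u w" and b: "b \<in> prohorov_bounds v w"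
      using \<open>e > 0\<close> by (auto simp: a_def b_def intro!: less)
    have "a + b \<in> prohorov_bounds u v"
      unfolding prohorov_bounds_def
    proof (safe)
      show "0 < a + b" using a b by (auto simp: prohorov_bounds_def)
    next
      fix A :: "'a set" assume A: "A \<in> sets borel"
      have "measure (meas u) A \<le> measure (meas w) (enlarge A a) + a"
        using a A by (auto simp: prohorov_bounds_def)
      also have "measure (meas w) (enlarge A a) \<le> measure (meas v) (enlarge (enlarge A a) b) + b"
        using b by (auto simp: prohorov_bounds_def)
      also have "measure (meas v) (enlarge (enlarge A a) b) \<le> measure (meas v) (enlarge A (a + b))"
        by (intro meas_mono enlarge_enlarge) simp
      finally show "measure (meas u) A \<le> measure (meas v) (enlarge A (a + b)) + (a + b)" by simp
      have "measure (meas v) A \<le> measure (meas w) (enlarge A b) + b"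
        using b A by (auto simp: prohorov_bounds_def)
      also have "measure (meas w) (enlarge A b) \<le> measure (meas u) (enlarge (enlarge A b) a) + a"
        using a by (auto simp: prohorov_bounds_def)
      also have "measure (meas u) (enlarge (enlarge A b) a) \<le> measure (meas u) (enlarge A (a + b))"
        using enlarge_enlarge[of A b a] by (intro meas_mono) (simp_all add: add.commute)
      finally show "measure (meas v) A \<le> measure (meas u) (enlarge A (a + b)) + (a + b)" by simp
    qed
    from le[OF this] show "dist u v \<le> dist u w + dist v w + e"
      by (simp add: a_def b_def)
  qed
qed (simp_all add: uniformity_borel_prob_def open_borel_prob_def)

end

section \<open>Sums of Borel measures, weak convergence, conditional laws\<close>

definition add_measure :: "'a::topological_space measure \<Rightarrow> 'a measure \<Rightarrow> 'a measure" where
  "add_measure \<alpha> \<beta> = measure_of UNIV (sets borel) (\<lambda>B. emeasure \<alpha> B + emeasure \<beta> B)"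

definition sum_measure :: "'i set \<Rightarrow> ('i \<Rightarrow> 'a::topological_space measure) \<Rightarrow> 'a measure" where
  "sum_measure I \<alpha> = measure_of UNIV (sets borel) (\<lambda>B. \<Sum>i\<in>I. emeasure (\<alpha> i) B)"

definition weakly_converges ::
  "(nat \<Rightarrow> 'a::topological_space measure) \<Rightarrow> 'a measure \<Rightarrow> bool" where
  "weakly_converges \<nu> \<nu>' \<longleftrightarrow> (\<forall>f :: 'a \<Rightarrow> real. continuous_on UNIV f \<and> bounded (range f) \<longrightarrow>
     (\<lambda>n. \<integral>x. f x \<partial>\<nu> n) \<longlonglongrightarrow> (\<integral>x. f x \<partial>\<nu>'))"

text \<open>\<open>K\<close> is a regular version of the conditional law of \<open>X\<close> given \<open>Z\<close>.\<close>

definition has_cond_law ::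
  "'w measure \<Rightarrow> ('w \<Rightarrow> 'x) \<Rightarrow> 'x measure \<Rightarrow> ('w \<Rightarrow> 'z) \<Rightarrow> 'z measure \<Rightarrow> ('z \<Rightarrow> 'x measure) \<Rightarrow> bool"
  where
  "has_cond_law P X MX Z MZ K \<longleftrightarrow>
     X \<in> P \<rightarrow>\<^sub>M MX \<and> Z \<in> P \<rightarrow>\<^sub>M MZ \<and> K \<in> MZ \<rightarrow>\<^sub>M prob_algebra MX \<and>
     (\<forall>A\<in>sets MX. \<forall>B\<in>sets MZ.
        emeasure P {\<omega>\<in>space P. X \<omega> \<in> A \<and> Z \<omega> \<in> B} =
        (\<integral>\<^sup>+\<omega>. emeasure (K (Z \<omega>)) A * indicator B (Z \<omega>) \<partial>P))"

definition law_given ::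
  "'w measure \<Rightarrow> ('w \<Rightarrow> 'x::topological_space) \<Rightarrow> ('w \<Rightarrow> bool) \<Rightarrow> 'x measure" where
  "law_given P X E = distr (uniform_measure P {\<omega>\<in>space P. E \<omega>}) borel X"

text \<open>Independence of two random elements. (The library's \<open>indep_var\<close> requires both
  to take values in the same type.)\<close>

definition indep_elements ::
  "'w measure \<Rightarrow> 'x measure \<Rightarrow> ('w \<Rightarrow> 'x) \<Rightarrow> 'z measure \<Rightarrow> ('w \<Rightarrow> 'z) \<Rightarrow> bool" where
  "indep_elements P MX X MZ Z \<longleftrightarrow>
     X \<in> P \<rightarrow>\<^sub>M MX \<and> Z \<in> P \<rightarrow>\<^sub>M MZ \<and>
     prob_space.indep_set P {X -` A \<inter> space P | A. A \<in> sets MX}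
                            {Z -` B \<inter> space P | B. B \<in> sets MZ}"

section \<open>Dirichlet processes\<close>

text \<open>The Dirichlet distribution is the law of normalised independent gamma variables;
  with the convention that a gamma variable of shape 0 is identically 0, this covers
  vanishing parameters (cells of a partition that are null for the base measure).\<close>

definition gamma_law :: "real \<Rightarrow> real measure" where
  "gamma_law a = (if a = 0 then return borel 0
     else density lborel (\<lambda>x. if 0 < x then ennreal (x powr (a - 1) * exp (- x) / Gamma a) else 0))"

definition Dir :: "'i set \<Rightarrow> ('i \<Rightarrow> real) \<Rightarrow> ('i \<Rightarrow> real) measure" where
  "Dir I a = distr (PiM I (\<lambda>i. gamma_law (a i))) (PiM I (\<lambda>_. borel))
     (\<lambda>z. \<lambda>i\<in>I. z i / (\<Sum>j\<in>I. z j))"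

text \<open>The law of the process is determined by its finite-dimensional distributions on separable
  metric spaces, where the Borel sets of the Prohorov metric are generated by the evaluations
  \<open>l \<mapsto> l(B)\<close>; hence the definite description in \<open>\<D>\<close>. Cells of a partition may be empty.\<close>

definition is_dirichlet_process ::
  "'a::metric_space measure \<Rightarrow> 'a borel_prob measure \<Rightarrow> bool" where
  "is_dirichlet_process \<alpha> Q \<longleftrightarrow> sets Q = sets borel \<and> prob_space Q \<and>
     (\<forall>(d::nat) B. (\<forall>i\<le>d. B i \<in> sets borel) \<and> disjoint_family_on B {..d} \<and> (\<Union>i\<le>d. B i) = UNIV \<longrightarrow>
        distr Q (PiM {..d} (\<lambda>_. borel)) (\<lambda>l. \<lambda>i\<in>{..d}. measure (meas l) (B i)) =
        Dir {..d} (\<lambda>i. measure \<alpha> (B i)))"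

definition dirichlet_process :: "'a::metric_space measure \<Rightarrow> 'a borel_prob measure"
  (\<open>\<D>\<close>) where
  "\<D> \<alpha> = (THE Q. is_dirichlet_process \<alpha> Q)"

section \<open>The nested Dirichlet process\<close>

definition nested_dirichlet ::
  "'w measure \<Rightarrow> real \<Rightarrow> real \<Rightarrow> 'a::polish_space borel_prob \<Rightarrow>
   ('w \<Rightarrow> 'a borel_prob borel_prob) \<Rightarrow> (nat \<Rightarrow> 'w \<Rightarrow> 'a borel_prob) \<Rightarrow>
   (nat \<Rightarrow> nat \<Rightarrow> 'w \<Rightarrow> 'a) \<Rightarrow> bool" where
  "nested_dirichlet P \<kappa> \<epsilon> \<rho> \<pi> \<mu> \<xi> \<longleftrightarrow>
     \<pi> \<in> P \<rightarrow>\<^sub>M borel \<and>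
     distr P borel \<pi> = \<D> (scale_measure \<kappa> (\<D> (scale_measure \<epsilon> (meas \<rho>)))) \<and>
     has_cond_law P (\<lambda>\<omega>. \<lambda>i\<in>{1..}. \<mu> i \<omega>) (PiM {1..} (\<lambda>_. borel))
       \<pi> borel (\<lambda>w. PiM {1..} (\<lambda>_. meas w)) \<and>
     has_cond_law P (\<lambda>\<omega>. \<lambda>(i, j)\<in>{1..}\<times>{1..}. \<xi> i j \<omega>) (PiM ({1..}\<times>{1..}) (\<lambda>_. borel))
       (\<lambda>\<omega>. (\<pi> \<omega>, \<lambda>i\<in>{1..}. \<mu> i \<omega>)) (borel \<Otimes>\<^sub>M PiM {1..} (\<lambda>_. borel))
       (\<lambda>(w, m). PiM ({1..}\<times>{1..}) (\<lambda>(i, j). meas (m i)))"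

text \<open>\<open>row \<xi> i n\<close> is $X_{in}$. The law of the row, $\varrho_n$, does not depend on \<open>i\<close>; the first
  row is used to define it.\<close>

definition row :: "(nat \<Rightarrow> nat \<Rightarrow> 'w \<Rightarrow> 'a) \<Rightarrow> nat \<Rightarrow> nat \<Rightarrow> 'w \<Rightarrow> nat \<Rightarrow> 'a" where
  "row \<xi> i n \<omega> = (\<lambda>j\<in>{1..n}. \<xi> i j \<omega>)"

definition row_law ::
  "'w measure \<Rightarrow> (nat \<Rightarrow> nat \<Rightarrow> 'w \<Rightarrow> 'a::polish_space) \<Rightarrow> nat \<Rightarrow> (nat \<Rightarrow> 'a) measure" where
  "row_law P \<xi> n = distr P (PiM {1..n} (\<lambda>_. borel)) (row \<xi> 1 n)"

definition obs ::
  "(nat \<Rightarrow> (nat \<Rightarrow> 'a) \<Rightarrow> 't) \<Rightarrow> (nat \<Rightarrow> nat \<Rightarrow> 'w \<Rightarrow> 'a) \<Rightarrow> nat \<Rightarrow> nat \<Rightarrow> 'w \<Rightarrow> nat \<Rightarrow> 't" where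
  "obs \<phi> \<xi> M N \<omega> = (\<lambda>m\<in>{1..M}. \<phi> m (row \<xi> m N \<omega>))"

definition obs_set ::
  "(nat \<Rightarrow> (nat \<Rightarrow> 'a::polish_space) \<Rightarrow> 't) \<Rightarrow> (nat \<Rightarrow> 't) \<Rightarrow> nat \<Rightarrow> nat \<Rightarrow> (nat \<Rightarrow> 'a) set" where
  "obs_set \<phi> y N m = {x \<in> space (PiM {1..N} (\<lambda>_. borel)). \<phi> m x = y m}"

section \<open>Weighted simulations\<close>

text \<open>In the following, \<open>A m\<close> is the set of rows compatible with the \<open>m\<close>-th observation
  and \<open>\<rho>\<^sub>N\<close> is the row law.\<close>

definition sim_weight ::
  "real \<Rightarrow> nat \<Rightarrow> (nat \<Rightarrow> 'a::polish_space) measure \<Rightarrow> (nat \<Rightarrow> (nat \<Rightarrow> 'a) set) \<Rightarrow>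
   nat \<Rightarrow> (nat \<Rightarrow> 'a borel_prob) \<Rightarrow> nat \<Rightarrow> real" where
  "sim_weight \<kappa> N \<rho>\<^sub>N A m v i =
     (if i < m then measure (PiM {1..N} (\<lambda>_. meas (v i))) (A m) else \<kappa> * measure \<rho>\<^sub>N (A m))"

definition sim_kernel ::
  "real \<Rightarrow> real \<Rightarrow> 'a::polish_space borel_prob \<Rightarrow> nat \<Rightarrow> (nat \<Rightarrow> 'a) measure \<Rightarrow>
   (nat \<Rightarrow> (nat \<Rightarrow> 'a) set) \<Rightarrow> nat \<Rightarrow> (nat \<Rightarrow> 'a borel_prob) \<Rightarrow> 'a borel_prob measure" where
  "sim_kernel \<kappa> \<epsilon> \<rho> N \<rho>\<^sub>N A m v =
     (let t = sim_weight \<kappa> N \<rho>\<^sub>N A m v in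
      scale_measure (ennreal (1 / (\<Sum>i=1..m. t i)))
        (add_measure
          (scale_measure (t m)
            (uniform_measure \<rho>\<^sub>N (A m) \<bind>
              (\<lambda>x. \<D> (add_measure (scale_measure \<epsilon> (meas \<rho>))
                                  (sum_measure {1..N} (\<lambda>n. return borel (x n)))))))
          (sum_measure {1..<m} (\<lambda>i. scale_measure (t i) (return borel (v i))))))"

definition sim_space ::
  "nat \<Rightarrow> ((nat \<times> nat \<Rightarrow> real) \<times> (nat \<Rightarrow> 'a::polish_space borel_prob)) measure" where
  "sim_space M = PiM (SIGMA m:{1..M}. {1..m}) (\<lambda>_. borel) \<Otimes>\<^sub>M PiM {1..M} (\<lambda>_. borel)"

definition sim_element ::
  "nat \<Rightarrow> (nat \<Rightarrow> nat \<Rightarrow> 'w \<Rightarrow> real) \<Rightarrow> (nat \<Rightarrow> 'w \<Rightarrow> 'a::polish_space borel_prob) \<Rightarrow>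
   'w \<Rightarrow> (nat \<times> nat \<Rightarrow> real) \<times> (nat \<Rightarrow> 'a borel_prob)" where
  "sim_element M t u \<omega> =
     (\<lambda>(m, i)\<in>(SIGMA m:{1..M}. {1..m}). t m i \<omega>, \<lambda>m\<in>{1..M}. u m \<omega>)"

definition weighted_simulation ::
  "'w measure \<Rightarrow> real \<Rightarrow> real \<Rightarrow> 'a::polish_space borel_prob \<Rightarrow> nat \<Rightarrow> nat \<Rightarrow>
   (nat \<Rightarrow> 'a) measure \<Rightarrow> (nat \<Rightarrow> (nat \<Rightarrow> 'a) set) \<Rightarrow> 't set \<Rightarrow> ('w \<Rightarrow> nat \<Rightarrow> 't) \<Rightarrow>
   (nat \<Rightarrow> nat \<Rightarrow> 'w \<Rightarrow> real) \<Rightarrow> (nat \<Rightarrow> 'w \<Rightarrow> 'a borel_prob) \<Rightarrow> bool" where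
  "weighted_simulation P \<kappa> \<epsilon> \<rho> M N \<rho>\<^sub>N A T Y t u \<longleftrightarrow>
     indep_elements P (sim_space M) (sim_element M t u) (PiM {1..M} (\<lambda>_. count_space T)) Y \<and>
     (\<forall>m\<in>{1..M}. \<forall>i\<in>{1..m}. \<forall>\<omega>\<in>space P.
        t m i \<omega> = sim_weight \<kappa> N \<rho>\<^sub>N A m (\<lambda>i. u i \<omega>) i) \<and>
     (\<forall>m\<in>{1..M}. has_cond_law P (u m) borel
        (\<lambda>\<omega>. \<lambda>i\<in>{1..<m}. u i \<omega>) (PiM {1..<m} (\<lambda>_. borel))
        (sim_kernel \<kappa> \<epsilon> \<rho> N \<rho>\<^sub>N A m))"

definition total_weight ::
  "real \<Rightarrow> nat \<Rightarrow> (nat \<Rightarrow> nat \<Rightarrow> 'w \<Rightarrow> real) \<Rightarrow> 'w \<Rightarrow> real" where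
  "total_weight \<kappa> M t \<omega> = (\<Prod>m=1..M. 1 / (\<kappa> + real m - 1) * (\<Sum>i=1..m. t m i \<omega>))"

end

theory Submission
  imports Defs
begin

text \<open>Write \<open>Q = \<D>(\<epsilon>\<rho>)\<close> for the mean law of a hidden measure, \<open>q\<^sub>m(l) = l\<^sup>N(A\<^sub>m)\<close> for the likelihood of
the \<open>m\<close>-th observation (\<open>row_prob\<close>) and \<open>L(x) = q\<^sub>1(x\<^sub>1) \<cdots> q\<^sub>M(x\<^sub>M)\<close>. Given the hidden measures the
rows are independent, so that \<open>E[h(\<mu>\<^sub>1, \<dots>, \<mu>\<^sub>n); Y = y] = E[h(\<mu>\<^sub>1, \<dots>, \<mu>\<^sub>n) L(\<mu>)]\<close>
(\<open>nested_rows_law\<close>). The hidden measures are a sample from a Dirichlet process with parameter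
\<open>\<kappa>Q\<close>, hence a Polya sequence: \<open>\<mu>\<^sub>n\<^sub>+\<^sub>1\<close> is a fresh draw from \<open>Q\<close> with probability \<open>\<kappa> / (\<kappa> + n)\<close> and
otherwise a copy of a uniformly chosen predecessor. Since \<open>L\<close> ignores \<open>\<mu>\<^sub>M\<^sub>+\<^sub>1\<close>, conditioning
preserves this rule in the form
\<open>P(\<mu>\<^sub>M\<^sub>+\<^sub>1 \<in> B | Y = y) = (\<kappa> Q(B) + \<Sum>\<^sub>m P(\<mu>\<^sub>m \<in> B | Y = y)) / (\<kappa> + M)\<close>
(\<open>nested_predictive_given_rows\<close>), and only the conditional laws of \<open>\<mu>\<^sub>1, \<dots>, \<mu>\<^sub>M\<close> have to be
approximated.

The simulation is sequential importance sampling for these laws. Its \<open>m\<close>-th step is the Polya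
step tilted by \<open>q\<^sub>m\<close> and normalised: a copy of \<open>u\<^sub>i\<close> has tilted weight \<open>q\<^sub>m(u\<^sub>i) = t\<^sub>m\<^sub>i\<close>, and for a fresh
draw conjugacy gives
\<open>q\<^sub>m(l) Q(dl) = \<integral>\<^bsub>A\<^sub>m\<^esub> \<D>(\<epsilon>\<rho> + \<Sum>\<^sub>n \<delta>(x\<^sub>n))(dl) \<rho>\<^sub>N(dx)\<close>,
of total mass \<open>\<rho>\<^sub>N(A\<^sub>m)\<close> (\<open>nn_integral_row_posterior\<close>). The product of the normalising constants
is the total weight \<open>V\<close>, and so \<open>E[V h(u\<^sub>1, \<dots>, u\<^sub>M)] = E[h(\<mu>\<^sub>1, \<dots>, \<mu>\<^sub>M); Y = y]\<close>
(\<open>simulation_identity\<close>). The strong law of large numbers for the bounded variables \<open>V\<^sub>k\<close> and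
\<open>V\<^sub>k 1\<^sub>B(u\<^sub>m\<^sup>k)\<close> then yields almost sure convergence of the ratios, for each fixed Borel set \<open>B\<close>.

To find one null set for all test functions, \<open>B\<close> is restricted to the finite unions of a countable
base of the space of probability measures; these bound the mass of every open set from below, and
the portmanteau argument (\<open>weakly_convergesI\<close>) turns these bounds into weak convergence. For a map \<open>\<Phi>\<close> that is almost surely
continuous under the limit law, the open set \<open>G\<close> is replaced by the interior of its preimage, which
has the same mass under the limit law.

The facts about Dirichlet processes come from a single transformation: with \<open>r / (1 + r)\<close>
distributed as \<open>Beta(1, s)\<close>, \<open>s = \<alpha>(S)\<close>, and \<open>l\<close> distributed as \<open>\<D>(\<alpha>)\<close>, the law of
\<open>(l + r \<delta>\<^sub>x) / (1 + r)\<close> is \<open>\<D>(\<alpha> + \<delta>\<^sub>x)\<close>. On finite partitions this is a computation with gamma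
variables (\<open>Dir_stick\<close>). Averaging over \<open>x\<close> distributed as \<open>\<alpha> / s\<close> gives back \<open>\<D>(\<alpha>)\<close>; the averaged map
contracts Lipschitz functions by the factor \<open>s / (s + 1)\<close>, so its invariant law on a finite partition
is unique, and the stick-breaking measure, invariant by construction, has Dirichlet
finite-dimensional laws (\<open>is_dirichlet_process_exists\<close>). The same description makes
\<open>\<D>(\<alpha> + \<delta>\<^sub>x)\<close> a kernel in \<open>x\<close>. Conjugacy is the size-biasing identity of Dirichlet vectors
(\<open>Dir_size_bias\<close>), extended from partitions to all Borel sets.\<close>

section \<open>Topology and Borel sets of the space of probability measures\<close>

lemma prohorov_bounds_if_dist_less:
  assumes lt: "dist u v < e"
  shows "e \<in> prohorov_bounds u v"
proof -
  have "1 \<in> prohorov_bounds u v"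
    unfolding prohorov_bounds_def by (auto intro!: order_trans[OF prob_space.prob_le_1])
  then obtain d where d: "d \<in> prohorov_bounds u v" "d < e"
    using lt cInf_lessD[of "prohorov_bounds u v" e] by (auto simp: dist_borel_prob_def)
  have m: "x \<le> measure (meas w) (enlarge A e) + e"
    if "x \<le> measure (meas w) (enlarge A d) + d" for x A w
    using that meas_mono[OF enlarge_mono[of d e A], of w] d(2) by simp
  show ?thesis
    using d by (auto simp: prohorov_bounds_def intro!: m)
qed

lemma prob_meas_Compl: "A \<in> sets borel \<Longrightarrow> measure (meas u) (- A) = 1 - measure (meas u) A"
  using prob_space.prob_compl[OF prob_space_meas, of A u] by (simp add: Compl_eq_Diff_UNIV)

text \<open>One of the two inequalities in the definition of the Prohorov metric suffices: applied to the
complement of the enlargement of \<open>A\<close>, it gives the other one for \<open>A\<close>.\<close>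

lemma dist_borel_prob_le:
  assumes e: "e > 0"
    and le: "\<And>A. A \<in> sets borel \<Longrightarrow> measure (meas u) A \<le> measure (meas v) (enlarge A e) + e"
  shows "dist u v \<le> e"
proof -
  have "measure (meas v) A \<le> measure (meas u) (enlarge A e) + e" if A: "A \<in> sets borel" for A
  proof -
    have "enlarge (- enlarge A e) e \<subseteq> - A"
      by (auto simp: enlarge_def) (metis dist_commute)
    then have "measure (meas v) (enlarge (- enlarge A e) e) \<le> measure (meas v) (- A)"
      using A by (intro meas_mono) auto
    moreover have "- enlarge A e \<in> sets borel"
      by (simp add: open_enlarge borel_closed closed_Compl)
    ultimately show ?thesis
      using le[of "- enlarge A e"] A by (simp add: prob_meas_Compl)
  qed
  then have "e \<in> prohorov_bounds u v"
    using e le by (simp add: prohorov_bounds_def)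
  then show ?thesis
    unfolding dist_borel_prob_def
    by (intro cInf_lower bdd_belowI[of _ 0]) (auto simp: prohorov_bounds_def)
qed

lemma measure_enlarge_tendsto:
  assumes "closed C"
  shows "(\<lambda>n. measure (meas u) (enlarge C (inverse (real (Suc n))))) \<longlonglongrightarrow> measure (meas u) C"
proof -
  have "(\<Inter>n. enlarge C (inverse (real (Suc n)))) = C"
  proof (intro equalityI subsetI)
    fix x assume x: "x \<in> (\<Inter>n. enlarge C (inverse (real (Suc n))))"
    have "x \<in> closure C"
      unfolding closure_approachable
    proof (intro allI impI)
      fix e :: real assume "e > 0"
      then obtain n where n: "inverse (real (Suc n)) < e"
        using reals_Archimedean by blast
      from x obtain y where "y \<in> C" "dist x y < inverse (real (Suc n))"
        by (auto simp: enlarge_def)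
      with n show "\<exists>y\<in>C. dist y x < e" by (auto simp: dist_commute intro!: bexI[of _ y])
    qed
    with assms show "x \<in> C" by simp
  qed (auto simp: enlarge_def intro!: bexI)
  moreover have "decseq (\<lambda>n. enlarge C (inverse (real (Suc n))))"
    by (intro decseq_SucI enlarge_mono) (simp add: field_simps)
  ultimately show ?thesis
    using finite_measure.finite_Lim_measure_decseq[OF prob_space.finite_measure[OF prob_space_meas],
        of "\<lambda>n. enlarge C (inverse (real (Suc n)))" u] by (auto simp: image_subset_iff)
qed

text \<open>Evaluation at an open set is lower semicontinuous. If \<open>v\<close> is close to \<open>u\<close>, then \<open>v\<close> gives the closed
complement of \<open>G\<close> hardly more mass than \<open>u\<close> gives to a small enlargement of it, and the mass of the
enlargements decreases to the mass of the closed set.\<close>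

lemma open_eval_greater:
  assumes G: "open G"
  shows "open {l. r < measure (meas l) G}"
  unfolding open_dist
proof (safe)
  fix u assume u: "r < measure (meas u) G"
  have C: "closed (- G)" using G by (simp add: closed_Compl)
  have "(\<lambda>n. measure (meas u) (enlarge (- G) (inverse (real (Suc n)))) + inverse (real (Suc n)))
      \<longlonglongrightarrow> measure (meas u) (- G) + 0"
    by (intro tendsto_add LIMSEQ_inverse_real_of_nat measure_enlarge_tendsto C)
  then have "\<forall>\<^sub>F n in sequentially. measure (meas u) (enlarge (- G) (inverse (real (Suc n)))) + inverse (real (Suc n)) < 1 - r"
    using u G by (intro order_tendstoD) (auto simp: prob_meas_Compl)
  then obtain n where n: "measure (meas u) (enlarge (- G) (inverse (real (Suc n)))) + inverse (real (Suc n)) < 1 - r"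
    by (auto simp: eventually_sequentially)
  show "\<exists>e>0. \<forall>v. dist v u < e \<longrightarrow> v \<in> {l. r < measure (meas l) G}"
  proof (intro exI[of _ "inverse (real (Suc n))"] conjI allI impI CollectI)
    fix v assume "dist v u < inverse (real (Suc n))"
    then have "inverse (real (Suc n)) \<in> prohorov_bounds v u"
      by (rule prohorov_bounds_if_dist_less)
    moreover have "- G \<in> sets borel" using C by simp
    ultimately have "measure (meas v) (- G) \<le> measure (meas u) (enlarge (- G) (inverse (real (Suc n)))) + inverse (real (Suc n))"
      unfolding prohorov_bounds_def by blast
    with n show "r < measure (meas v) G"
      using G by (simp add: prob_meas_Compl)
  qed simp
qed

text \<open>The finite intersections of the half-spaces \<open>{l. r < l(G)}\<close>; they will form a base of the topology,
and are closed under intersection.\<close>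

definition eval_nhd :: "('a::topological_space set \<times> real) set \<Rightarrow> 'a borel_prob set" where
  "eval_nhd F = {l. \<forall>p\<in>F. snd p < measure (meas l) (fst p)}"

lemma eval_nhd_Un: "eval_nhd (F \<union> F') = eval_nhd F \<inter> eval_nhd F'"
  by (auto simp: eval_nhd_def)

lemma open_eval_nhd:
  fixes F :: "('a::metric_space set \<times> real) set"
  assumes "finite F" "\<And>G r. (G, r) \<in> F \<Longrightarrow> open G"
  shows "open (eval_nhd F)"
proof -
  have "eval_nhd F = (\<Inter>x\<in>F. {l. snd x < measure (meas l) (fst x)})"
    by (auto simp: eval_nhd_def)
  then show ?thesis
    using assms by (auto intro!: open_INT open_eval_greater)
qed

text \<open>Finitely many small basic sets carry almost all mass of \<open>u\<close>. If \<open>v\<close> gives nearly as much mass as \<open>u\<close>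
to each union of some of them, then the inequality \<open>u(A) \<le> v(A\<^sup>e) + e\<close> holds for every Borel set \<open>A\<close>,
since \<open>A\<close> is covered, up to small mass, by those of the sets that meet it. Only
countably many neighbourhoods of this kind exist.\<close>

lemma eval_nhd_in_ball:
  fixes u :: "'a::{metric_space, second_countable_topology} borel_prob"
  assumes \<B>: "topological_basis \<B>" "countable \<B>" and e: "e > 0"
  obtains F where "finite F" "F \<subseteq> {\<Union>S | S. finite S \<and> S \<subseteq> \<B>} \<times> \<rat>"
    "u \<in> eval_nhd F" "eval_nhd F \<subseteq> ball u e"
proof -
  interpret u: prob_space "meas u" by simp
  define \<delta> where "\<delta> = e / 4"
  have \<delta>: "\<delta> > 0" using e by (simp add: \<delta>_def)
  have opn: "open B" if "B \<in> \<B>" for B using \<B>(1) that by (rule topological_basis_open)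
  define \<C> where "\<C> = {B\<in>\<B>. \<forall>x\<in>B. \<forall>y\<in>B. dist x y < \<delta>}"
  have cov: "\<Union>\<C> = UNIV"
  proof -
    have "\<exists>B\<in>\<C>. x \<in> B" for x
    proof -
      obtain B where "B \<in> \<B>" "x \<in> B" "B \<subseteq> ball x (\<delta> / 2)"
        using topological_basisE[OF \<B>(1), of "ball x (\<delta>/2)" x] \<delta> by auto
      moreover have "dist y z < \<delta>" if "y \<in> ball x (\<delta> / 2)" "z \<in> ball x (\<delta> / 2)" for y z
        using dist_triangle_half_l[of y x \<delta> z] that by (auto simp: dist_commute)
      ultimately show ?thesis unfolding \<C>_def by blast
    qed
    then show ?thesis by blast
  qed
  have "countable \<C>" "\<C> \<noteq> {}" using \<B>(2) cov by (auto simp: \<C>_def)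
  then have range: "range (from_nat_into \<C>) = \<C>" by (rule range_from_nat_into[rotated])
  define W where "W n = from_nat_into \<C> ` {..n::nat}" for n
  have WC: "W n \<subseteq> \<C>" for n using range by (auto simp: W_def)
  have finW: "finite (W n)" for n by (simp add: W_def)
  have oW: "open (\<Union>S)" if "S \<subseteq> W n" for S n
    using that WC[of n] opn by (intro open_Union) (auto simp: \<C>_def)
  have "(\<lambda>n. measure (meas u) (\<Union>(W n))) \<longlonglongrightarrow> measure (meas u) (\<Union>n. \<Union>(W n))"
  proof (rule u.finite_Lim_measure_incseq)
    show "range (\<lambda>n. \<Union>(W n)) \<subseteq> sets (meas u)" using oW[OF order_refl] by auto
    show "incseq (\<lambda>n. \<Union>(W n))" by (force simp: W_def incseq_def)
  qed
  also have "(\<Union>n. \<Union>(W n)) = UNIV"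
  proof -
    have "(\<Union>n. W n) = range (from_nat_into \<C>)" by (auto simp: W_def)
    then have "(\<Union>n. W n) = \<C>" using range by simp
    moreover have "(\<Union>n. \<Union>(W n)) = \<Union>(\<Union>n. W n)" by blast
    ultimately show ?thesis using cov by simp
  qed
  finally have "\<forall>\<^sub>F n in sequentially. 1 - \<delta> < measure (meas u) (\<Union>(W n))"
    using \<delta> u.prob_space by (intro order_tendstoD) auto
  then obtain n where n: "1 - \<delta> < measure (meas u) (\<Union>(W n))"
    by (auto simp: eventually_sequentially)
  have "\<exists>r\<in>\<rat>. measure (meas u) (\<Union>S) - \<delta> < r \<and> r < measure (meas u) (\<Union>S)" for S
    using Rats_dense_in_real[of "measure (meas u) (\<Union>S) - \<delta>" "measure (meas u) (\<Union>S)"] \<delta> by auto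
  then have "\<forall>S. \<exists>r. r \<in> \<rat> \<and> measure (meas u) (\<Union>S) - \<delta> < r \<and> r < measure (meas u) (\<Union>S)"
    by blast
  from choice[OF this] obtain r where r: "\<And>S. r S \<in> \<rat>" "\<And>S. measure (meas u) (\<Union>S) - \<delta> < r S"
     "\<And>S. r S < measure (meas u) (\<Union>S)" by blast
  \<comment> \<open>one threshold, less than \<open>\<delta>\<close> below the mass under \<open>u\<close>, for each union of sets from \<open>W n\<close>\<close>
  define F where "F = (\<lambda>S. (\<Union>S, r S)) ` Pow (W n)"
  show thesis
  proof
    show "finite F" using finW by (simp add: F_def)
    show "F \<subseteq> {\<Union>S | S. finite S \<and> S \<subseteq> \<B>} \<times> \<rat>"
    proof
      fix p assume "p \<in> F"
      then obtain S where S: "S \<subseteq> W n" "p = (\<Union>S, r S)" by (auto simp: F_def)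
      have "finite S" "S \<subseteq> \<B>" using S(1) finW finite_subset WC[of n] by (auto simp: \<C>_def)
      then show "p \<in> {\<Union>S | S. finite S \<and> S \<subseteq> \<B>} \<times> \<rat>" using S(2) r(1) by blast
    qed
    show "u \<in> eval_nhd F" using r(3) by (auto simp: F_def eval_nhd_def)
    show "eval_nhd F \<subseteq> ball u e"
    proof
      fix v assume v: "v \<in> eval_nhd F"
      interpret v: prob_space "meas v" by simp
      have "dist u v \<le> 2 * \<delta>"
      proof (rule dist_borel_prob_le)
        fix A :: "'a set" assume A: "A \<in> sets borel"
        define S where "S = {B\<in>W n. B \<inter> A \<noteq> {}}"
        have S: "S \<subseteq> W n" by (auto simp: S_def)
        have [measurable]: "\<Union>S \<in> sets borel" "\<Union>(W n) \<in> sets borel"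
          using oW[OF S] oW[OF order_refl] by auto
        have "A \<subseteq> \<Union>S \<union> - \<Union>(W n)" by (auto simp: S_def)
        then have "measure (meas u) A \<le> measure (meas u) (\<Union>S \<union> - \<Union>(W n))"
          by (intro meas_mono) auto
        also have "\<dots> \<le> measure (meas u) (\<Union>S) + measure (meas u) (- \<Union>(W n))"
          by (intro measure_Un_le) auto
        also have "measure (meas u) (- \<Union>(W n)) < \<delta>"
          using n by (subst prob_meas_Compl) auto
        also have "measure (meas u) (\<Union>S) < r S + \<delta>" using r(2)[of S] by simp
        also have "r S < measure (meas v) (\<Union>S)"
          using v S by (auto simp: eval_nhd_def F_def)
        also have "measure (meas v) (\<Union>S) \<le> measure (meas v) (enlarge A (2 * \<delta>))"
        proof (intro meas_mono subsetI)
          fix x assume "x \<in> \<Union>S"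
          then obtain B y where "B \<in> W n" "x \<in> B" "y \<in> B" "y \<in> A" by (auto simp: S_def)
          moreover from this have "dist x y < \<delta>" using WC[of n] by (auto simp: \<C>_def)
          ultimately show "x \<in> enlarge A (2 * \<delta>)" using \<delta> by (force simp: enlarge_def)
        qed simp
        finally show "measure (meas u) A \<le> measure (meas v) (enlarge A (2 * \<delta>)) + 2 * \<delta>" by simp
      qed (use \<delta> in simp)
      then show "v \<in> ball u e" using e by (simp add: \<delta>_def)
    qed
  qed
qed

text \<open>Second countability serves twice: it makes the Borel sets of the space of probability measures
generated by evaluations, and it later reduces weak convergence to countably many limits.\<close>

lemma countable_eval_basis:
  "\<exists>\<B> :: 'a::{metric_space, second_countable_topology} borel_prob set set.
     countable \<B> \<and> topological_basis \<B> \<and>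
     (\<forall>U\<in>\<B>. \<exists>F. finite F \<and> F \<subseteq> {G. open G} \<times> UNIV \<and> U = eval_nhd F)"
proof -
  obtain \<B> :: "'a set set" where \<B>: "topological_basis \<B>" "countable \<B>"
    using ex_countable_basis by auto
  define \<G> where "\<G> = {\<Union>S | S. finite S \<and> S \<subseteq> \<B>}"
  have "\<G> = Union ` {S. finite S \<and> S \<subseteq> \<B>}" by (auto simp: \<G>_def)
  then have c: "countable \<G>"
    using countable_Collect_finite_subset[OF \<B>(2)] by simp
  have opn: "G \<in> \<G> \<Longrightarrow> open G" for G
    using topological_basis_open[OF \<B>(1)] by (auto simp: \<G>_def)
  define \<U> where "\<U> = eval_nhd ` {F. finite F \<and> F \<subseteq> \<G> \<times> \<rat>}"
  have "countable \<U>"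
    unfolding \<U>_def
    by (intro countable_image countable_Collect_finite_subset countable_SIGMA c countable_rat)
  moreover have "topological_basis \<U>"
  proof (rule topological_basisI)
    show "open U" if "U \<in> \<U>" for U
      using that opn by (auto simp: \<U>_def intro!: open_eval_nhd)
    fix U and u :: "'a borel_prob" assume "open U" "u \<in> U"
    then obtain e where e: "e > 0" "ball u e \<subseteq> U" by (meson open_contains_ball)
    obtain F where "finite F" "F \<subseteq> \<G> \<times> \<rat>" "u \<in> eval_nhd F" "eval_nhd F \<subseteq> ball u e"
      using eval_nhd_in_ball[OF \<B> e(1), of u] unfolding \<G>_def by blast
    then show "\<exists>B'\<in>\<U>. u \<in> B' \<and> B' \<subseteq> U"
      using e(2) by (intro bexI[of _ "eval_nhd F"]) (auto simp: \<U>_def)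
  qed
  moreover have "\<forall>U\<in>\<U>. \<exists>F. finite F \<and> F \<subseteq> {G. open G} \<times> UNIV \<and> U = eval_nhd F"
  proof
    fix U assume "U \<in> \<U>"
    then obtain F where F: "finite F" "F \<subseteq> \<G> \<times> \<rat>" "U = eval_nhd F" by (auto simp: \<U>_def)
    moreover have "F \<subseteq> {G. open G} \<times> UNIV" using F(2) opn by auto
    ultimately show "\<exists>F. finite F \<and> F \<subseteq> {G. open G} \<times> UNIV \<and> U = eval_nhd F" by blast
  qed
  ultimately show ?thesis by blast
qed

instance borel_prob :: ("{metric_space, second_countable_topology}") second_countable_topology
proof
  show "\<exists>B::'a borel_prob set set. countable B \<and> open = generate_topology B"
    using countable_eval_basis topological_basis_imp_subbasis by blast
qed

lemma finite_measure_meas [simp]: "finite_measure (meas u)"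
  by (simp add: prob_space.finite_measure)

lemma emeasure_meas: "emeasure (meas u) A = ennreal (measure (meas u) A)"
  by (simp add: finite_measure.emeasure_eq_measure)

lemma eval_measurable_open:
  fixes G :: "'a::metric_space set"
  assumes "open G"
  shows "(\<lambda>l. measure (meas l) G) \<in> borel_measurable borel"
  using open_eval_greater[OF assms] by (auto simp: borel_measurable_iff_greater)

lemma measurable_meas [measurable]:
  "(meas :: 'a::metric_space borel_prob \<Rightarrow> _) \<in> borel \<rightarrow>\<^sub>M prob_algebra borel"
proof (rule measurable_prob_algebra_generated[where G="{G. open G}" and \<Omega>=UNIV])
  show "Int_stable {G. open (G::'a set)}" by (auto simp: Int_stable_def)
  show "sets borel = sigma_sets UNIV {G. open (G::'a set)}" by (simp add: borel_def)
qed (auto simp: emeasure_meas intro!: eval_measurable_open)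

lemma measurable_eval [measurable]:
  "A \<in> sets borel \<Longrightarrow> (\<lambda>l. measure (meas l) (A :: 'a::metric_space set)) \<in> borel_measurable borel"
  by (rule measurable_compose[OF measurable_meas measurable_measure_prob_algebra])

text \<open>The countable base consists of sets that are described by evaluations at open sets, so that
measurability of these evaluations is enough.\<close>

lemma measurable_borel_probI:
  fixes f :: "'b \<Rightarrow> 'a::{metric_space, second_countable_topology} borel_prob"
  assumes "\<And>G. open G \<Longrightarrow> (\<lambda>x. measure (meas (f x)) G) \<in> borel_measurable N"
  shows "f \<in> N \<rightarrow>\<^sub>M borel"
proof -
  obtain \<B> :: "'a borel_prob set set" where \<B>: "countable \<B>" "topological_basis \<B>"
    "\<And>U. U \<in> \<B> \<Longrightarrow> \<exists>F. finite F \<and> F \<subseteq> {G. open G} \<times> UNIV \<and> U = eval_nhd F"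
    using countable_eval_basis by blast
  have "f \<in> N \<rightarrow>\<^sub>M sigma UNIV \<B>"
  proof (rule measurable_measure_of)
    fix U assume "U \<in> \<B>"
    then obtain F where F: "finite F" "F \<subseteq> {G. open G} \<times> UNIV" "U = eval_nhd F" using \<B>(3) by blast
    have "f -` U \<inter> space N = {x\<in>space N. \<forall>p\<in>F. snd p < measure (meas (f x)) (fst p)}"
      using F(3) by (auto simp: eval_nhd_def)
    also have "\<dots> \<in> sets N"
      using F by (intro sets.sets_Collect_finite_All borel_measurable_less) (auto intro!: assms)
    finally show "f -` U \<inter> space N \<in> sets N" .
  qed auto
  then show ?thesis using borel_eq_countable_basis[OF \<B>(1,2)] by simp
qed

lemma meas_Borel_prob [simp]: "sets \<nu> = sets borel \<Longrightarrow> prob_space \<nu> \<Longrightarrow> meas (Borel_prob \<nu>) = \<nu>"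
  by (simp add: Borel_prob_inverse)

section \<open>Evaluations on finite partitions\<close>

definition borel_partition :: "nat \<Rightarrow> (nat \<Rightarrow> 'a::topological_space set) \<Rightarrow> bool" where
  "borel_partition d B \<longleftrightarrow>
     (\<forall>i\<le>d. B i \<in> sets borel) \<and> disjoint_family_on B {..d} \<and> (\<Union>i\<le>d. B i) = UNIV"

text \<open>Each new set splits every cell in two; even indices hold the intersections and odd
indices the differences.\<close>

lemma borel_partition_refine:
  assumes "finite \<G>" "\<And>G. G \<in> \<G> \<Longrightarrow> G \<in> sets borel"
  shows "\<exists>d B. borel_partition d B \<and> (\<forall>G\<in>\<G>. \<exists>J\<subseteq>{..d}. G = (\<Union>i\<in>J. B i))"
  using assms
proof (induction \<G>)
  case empty
  show ?case
    by (intro exI[of _ 0] exI[of _ "\<lambda>_. UNIV"]) (auto simp: borel_partition_def disjoint_family_on_def)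
next
  case (insert H \<G>)
  then obtain d B where B: "borel_partition d B" "\<forall>G\<in>\<G>. \<exists>J\<subseteq>{..d}. G = (\<Union>i\<in>J. B i)" by auto
  define B' where "B' i = (if even i then B (i div 2) \<inter> H else B (i div 2) - H)" for i
  have e: "B' (2 * i) = B i \<inter> H" "B' (Suc (2 * i)) = B i - H" for i by (auto simp: B'_def)
  have B'_un: "B i = B' (2 * i) \<union> B' (Suc (2 * i))" for i by (auto simp: e)
  have [measurable]: "H \<in> sets borel" using insert by simp
  have part: "borel_partition (2 * d + 1) B'"
    unfolding borel_partition_def
  proof (intro conjI allI impI)
    fix i assume "i \<le> 2 * d + 1"
    then have "i div 2 \<le> d" by auto
    then show "B' i \<in> sets borel" using B(1) by (auto simp: B'_def borel_partition_def)
  next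
    show "disjoint_family_on B' {..2 * d + 1}"
      unfolding disjoint_family_on_def
    proof (intro ballI impI)
      fix i j assume ij: "i \<in> {..2 * d + 1}" "j \<in> {..2 * d + 1}" "i \<noteq> j"
      have "i div 2 \<le> d" "j div 2 \<le> d" using ij by auto
      moreover have "i div 2 \<noteq> j div 2 \<or> even i \<noteq> even j"
        using ij(3) by (metis dvd_mult_div_cancel odd_two_times_div_two_succ)
      ultimately show "B' i \<inter> B' j = {}"
        using B(1) by (auto simp: B'_def borel_partition_def disjoint_family_on_def)
    qed
  next
    have "x \<in> (\<Union>i\<le>2 * d + 1. B' i)" for x
    proof -
      have "x \<in> (\<Union>i\<le>d. B i)" using B(1) by (simp add: borel_partition_def)
      then obtain i where i: "i \<le> d" "x \<in> B i" by blast
      have "2 * i \<le> 2 * d + 1" "Suc (2 * i) \<le> 2 * d + 1" using i by auto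
      moreover have "x \<in> B' (2 * i) \<or> x \<in> B' (Suc (2 * i))" using i B'_un[of i] by auto
      ultimately show ?thesis by blast
    qed
    then show "(\<Union>i\<le>2 * d + 1. B' i) = UNIV" by blast
  qed
  moreover have "\<exists>J\<subseteq>{..2 * d + 1}. G = (\<Union>i\<in>J. B' i)" if G: "G \<in> insert H \<G>" for G
  proof (cases "G = H")
    case True
    have "H = (\<Union>i\<in>(\<lambda>i. 2 * i) ` {..d}. B' i)"
      using B(1) by (auto simp: e borel_partition_def)
    then show ?thesis using True by (intro exI[of _ "(\<lambda>i. 2 * i) ` {..d}"]) auto
  next
    case False
    then have "G \<in> \<G>" using G by simp
    then obtain J where J: "J \<subseteq> {..d}" "G = (\<Union>i\<in>J. B i)" using B(2) by blast
    have "G = (\<Union>i\<in>(\<lambda>i. 2 * i) ` J \<union> (\<lambda>i. Suc (2 * i)) ` J. B' i)"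
      unfolding J(2) by (auto simp: e)
    then show ?thesis using J(1) by (intro exI[of _ "(\<lambda>i. 2 * i) ` J \<union> (\<lambda>i. Suc (2 * i)) ` J"]) auto
  qed
  ultimately show ?case by blast
qed

definition eval_vec :: "nat \<Rightarrow> (nat \<Rightarrow> 'a::topological_space set) \<Rightarrow> 'a borel_prob \<Rightarrow> nat \<Rightarrow> real" where
  "eval_vec d B l = (\<lambda>i\<in>{..d}. measure (meas l) (B i))"

lemma measurable_eval_vec [measurable]:
  fixes B :: "nat \<Rightarrow> 'a::metric_space set"
  assumes "borel_partition d B"
  shows "eval_vec d B \<in> borel \<rightarrow>\<^sub>M PiM {..d} (\<lambda>_. borel)"
  using assms unfolding eval_vec_def
  by (intro measurable_restrict) (auto simp: borel_partition_def)

lemma measure_meas_UN: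
  assumes B: "borel_partition d B" and J: "J \<subseteq> {..d}"
  shows "measure (meas l) (\<Union>i\<in>J. B i) = (\<Sum>i\<in>J. measure (meas l) (B i))"
proof (rule finite_measure.finite_measure_finite_Union)
  show "finite J" using J finite_subset by blast
  show "B ` J \<subseteq> sets (meas l)" using B J by (auto simp: borel_partition_def)
  show "disjoint_family_on B J"
    using B J by (auto simp: borel_partition_def intro: disjoint_family_on_mono)
qed simp

text \<open>The sets \<open>eval_nhd F\<close> are an intersection-stable generator, and each of them is an event about one
evaluation vector, namely that of a partition refining the finitely many open sets in \<open>F\<close>.
Only partitions that refine a given set \<open>C\<close> are required to agree; in the conjugacy identity the set
by which a law is size-biased takes the role of \<open>C\<close>.\<close>

lemma measure_eqI_eval_vec:
  fixes Q Q' :: "'a::{metric_space, second_countable_topology} borel_prob measure"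
  assumes sets: "sets Q = sets borel" "sets Q' = sets borel"
    and fin: "emeasure Q UNIV \<noteq> \<infinity>" and C: "C \<in> sets borel"
    and eq: "\<And>d B J. borel_partition d B \<Longrightarrow> J \<subseteq> {..d} \<Longrightarrow> C = (\<Union>i\<in>J. B i) \<Longrightarrow>
        distr Q (PiM {..d} (\<lambda>_. borel)) (eval_vec d B) = distr Q' (PiM {..d} (\<lambda>_. borel)) (eval_vec d B)"
  shows "Q = Q'"
proof -
  define \<E> where "\<E> = (eval_nhd ` {F. finite F \<and> F \<subseteq> {G. open (G :: 'a set)} \<times> UNIV})"
  have op: "open U" if "U \<in> \<E>" for U
    using that by (auto simp: \<E>_def intro!: open_eval_nhd)
  have sig: "sets borel = sigma_sets UNIV \<E>"
  proof
    obtain \<B> :: "'a borel_prob set set" where \<B>: "countable \<B>" "topological_basis \<B>"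
      "\<And>U. U \<in> \<B> \<Longrightarrow> \<exists>F. finite F \<and> F \<subseteq> {G. open G} \<times> UNIV \<and> U = eval_nhd F"
      using countable_eval_basis by blast
    have "\<B> \<subseteq> \<E>" using \<B>(3) by (auto simp: \<E>_def)
    then show "sets borel \<subseteq> sigma_sets UNIV \<E>"
      unfolding borel_eq_countable_basis[OF \<B>(1,2)] by (simp add: sigma_sets_mono')
    show "sigma_sets UNIV \<E> \<subseteq> sets borel"
    proof -
      have "\<E> \<subseteq> sets borel" using op by auto
      from sets.sigma_sets_subset[OF this] show ?thesis by simp
    qed
  qed
  show ?thesis
  proof (rule measure_eqI_generator_eq[where E=\<E> and \<Omega>=UNIV and A="\<lambda>_. UNIV"])
    show "Int_stable \<E>"
      unfolding Int_stable_def \<E>_def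
    proof safe
      fix F F' :: "('a set \<times> real) set"
      assume "finite F" "F \<subseteq> {G. open G} \<times> UNIV" "finite F'" "F' \<subseteq> {G. open G} \<times> UNIV"
      then show "eval_nhd F \<inter> eval_nhd F' \<in> eval_nhd ` {F. finite F \<and> F \<subseteq> {G. open G} \<times> UNIV}"
        by (intro image_eqI[of _ _ "F \<union> F'"]) (auto simp: eval_nhd_Un)
    qed
    show "range (\<lambda>_. UNIV) \<subseteq> \<E>"
      by (auto simp: \<E>_def eval_nhd_def intro!: image_eqI[of _ _ "{}"])
    fix U assume "U \<in> \<E>"
    then obtain F where F: "finite F" "F \<subseteq> {G. open (G :: 'a set)} \<times> UNIV" "U = eval_nhd F"
      by (auto simp: \<E>_def)
    obtain d B where B: "borel_partition d B"
      "\<forall>G\<in>insert C (fst ` F). \<exists>J\<subseteq>{..d}. G = (\<Union>i\<in>J. B i)"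
    proof -
      have "finite (insert C (fst ` F))" using F by simp
      moreover have "G \<in> sets borel" if "G \<in> insert C (fst ` F)" for G
        using that F C by auto
      ultimately show thesis using borel_partition_refine[of "insert C (fst ` F)"] that by blast
    qed
    from bchoice[OF B(2)] obtain J where
      J': "\<forall>G\<in>insert C (fst ` F). J G \<subseteq> {..d} \<and> G = (\<Union>i\<in>J G. B i)" ..
    have J: "J G \<subseteq> {..d} \<and> G = (\<Union>i\<in>J G. B i)" if "G \<in> insert C (fst ` F)" for G
      using J' that by (rule bspec)
    define R where "R = {z\<in>space (PiM {..d} (\<lambda>_. borel)). \<forall>p\<in>F. snd p < (\<Sum>i\<in>J (fst p). z i :: real)}"
    have R: "R \<in> sets (PiM {..d} (\<lambda>_. borel))"
      unfolding R_def
    proof (intro sets.sets_Collect_finite_All borel_measurable_less borel_measurable_sum F(1))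
      fix p i assume "p \<in> F" "i \<in> J (fst p)"
      then have "i \<in> {..d}" using J[of "fst p"] by auto
      then show "(\<lambda>z. z i) \<in> borel_measurable (PiM {..d} (\<lambda>_. borel))" by (rule measurable_component_singleton)
    qed simp
    have "U = eval_vec d B -` R \<inter> UNIV"
    proof -
      have "measure (meas l) (fst p) = (\<Sum>i\<in>J (fst p). eval_vec d B l i)" if p: "p \<in> F" for p l
      proof -
        have "measure (meas l) (fst p) = measure (meas l) (\<Union>i\<in>J (fst p). B i)"
          using J[of "fst p"] p by auto
        also have "\<dots> = (\<Sum>i\<in>J (fst p). measure (meas l) (B i))"
          using J[of "fst p"] p by (intro measure_meas_UN[OF B(1)]) auto
        also have "\<dots> = (\<Sum>i\<in>J (fst p). eval_vec d B l i)"
          using J[of "fst p"] p by (intro sum.cong) (auto simp: eval_vec_def)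
        finally show ?thesis .
      qed
      then show ?thesis
        unfolding F(3) eval_nhd_def R_def by (auto simp: eval_vec_def space_PiM)
    qed
    moreover have "emeasure P' (eval_vec d B -` R \<inter> UNIV) = emeasure (distr P' (PiM {..d} (\<lambda>_. borel)) (eval_vec d B)) R"
      if "sets P' = sets borel" for P' :: "'a borel_prob measure"
      using that R sets_eq_imp_space_eq[OF that] measurable_eval_vec[OF B(1)]
      by (subst emeasure_distr) (auto cong: measurable_cong_sets)
    ultimately show "emeasure Q U = emeasure Q' U"
      using eq[OF B(1), of "J C"] J[of C] sets by simp
  qed (use sets sig fin in auto)
qed

section \<open>Gamma laws\<close>

lemma sets_gamma_law [simp, measurable_cong]: "sets (gamma_law a) = sets borel"
  by (simp add: gamma_law_def)

lemma space_gamma_law [simp]: "space (gamma_law a) = UNIV"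
  using sets_eq_imp_space_eq[OF sets_gamma_law] by simp

lemma nn_integral_gamma_law:
  assumes "a > 0" and [measurable]: "h \<in> borel_measurable borel"
  shows "(\<integral>\<^sup>+x. h x \<partial>gamma_law a) =
    (\<integral>\<^sup>+x. ennreal (x powr (a - 1) * exp (- x) / Gamma a) * h x * indicator {0<..} x \<partial>lborel)"
  using assms unfolding gamma_law_def
  by (auto simp: nn_integral_density indicator_def intro!: nn_integral_cong)

lemma nn_integral_gamma_law_0:
  "h \<in> borel_measurable borel \<Longrightarrow> (\<integral>\<^sup>+x. h x \<partial>gamma_law 0) = h 0"
  by (simp add: gamma_law_def nn_integral_return)

lemma nn_integral_indicator_greaterThan:
  "(\<integral>\<^sup>+x. f x * indicator {0<..} x \<partial>lborel) = (\<integral>\<^sup>+x. f x * indicator {0..} (x::real) \<partial>lborel)"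
proof (rule nn_integral_cong_AE)
  show "AE x in lborel. f x * indicator {0<..} x = f x * indicator {0..} (x::real)"
    using AE_lborel_singleton[of 0] by eventually_elim (auto simp: indicator_def)
qed

lemma prob_space_gamma_law:
  assumes "a \<ge> 0"
  shows "prob_space (gamma_law a)"
proof (cases "a = 0")
  case True
  then show ?thesis by (simp add: gamma_law_def prob_space_return)
next
  case False
  then have a: "a > 0" using assms by simp
  have "emeasure (gamma_law a) UNIV = (\<integral>\<^sup>+x. 1 \<partial>gamma_law a)"
    using emeasure_eq_0 by simp
  also have "\<dots> = (\<integral>\<^sup>+x. ennreal (x powr (a - 1) * exp (- x) / Gamma a) * indicator {0..} x \<partial>lborel)"
    using a by (subst nn_integral_gamma_law) (auto simp: nn_integral_indicator_greaterThan)
  also have "\<dots> = (\<integral>\<^sup>+x. ennreal (indicator {0..} x * x powr (a - 1) / exp x) * ennreal (1 / Gamma a) \<partial>lborel)"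
    using a by (intro nn_integral_cong)
      (auto simp: indicator_def exp_minus field_simps ennreal_mult[symmetric] Gamma_real_pos less_imp_le)
  also have "\<dots> = ennreal (Gamma a) * ennreal (1 / Gamma a)"
    using a by (simp add: nn_integral_multc Gamma_conv_nn_integral_real)
  also have "\<dots> = 1"
    using Gamma_real_pos[OF a] by (simp add: ennreal_mult[symmetric])
  finally show ?thesis by (intro prob_spaceI) simp
qed

lemma AE_gamma_law_nonneg: "AE x in gamma_law a. 0 \<le> x"
  unfolding gamma_law_def by (auto simp: AE_return AE_density)

lemma AE_gamma_law_pos: "a > 0 \<Longrightarrow> AE x in gamma_law a. 0 < x"
  unfolding gamma_law_def by (auto simp: AE_density)

text \<open>Exponential tilting of a gamma variable is rescaling; the factor is the Laplace transform. The
degenerate law of shape 0 obeys the same identity.\<close>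

lemma gamma_law_tilt:
  assumes a: "a \<ge> 0" and c: "c > 0" and h [measurable]: "h \<in> borel_measurable borel"
  shows "(\<integral>\<^sup>+x. h x * ennreal (exp (- (c - 1) * x)) \<partial>gamma_law a) =
    ennreal (c powr (- a)) * (\<integral>\<^sup>+x. h (x / c) \<partial>gamma_law a)"
proof (cases "a = 0")
  case True
  then show ?thesis using c by (simp add: nn_integral_gamma_law_0)
next
  case False
  with a have a: "a > 0" by simp
  have "(\<integral>\<^sup>+x. h x * ennreal (exp (- (c - 1) * x)) \<partial>gamma_law a) =
    (\<integral>\<^sup>+x. ennreal (x powr (a - 1) * exp (- x) / Gamma a) * (h x * ennreal (exp (- (c - 1) * x))) * indicator {0<..} x \<partial>lborel)"
    using a by (simp add: nn_integral_gamma_law)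
  also have "\<dots> = (\<integral>\<^sup>+x. ennreal (x powr (a - 1) * exp (- c * x) / Gamma a) * h x * indicator {0<..} x \<partial>lborel)"
  proof (intro nn_integral_cong)
    fix x :: real
    have "exp (- x) * exp (- (c - 1) * x) = exp (- c * x)"
      by (simp add: exp_add[symmetric] algebra_simps)
    then have "x powr (a - 1) * exp (- x) / Gamma a * exp (- (c - 1) * x) = x powr (a - 1) * exp (- c * x) / Gamma a"
      by (metis (no_types, opaque_lifting) mult.assoc times_divide_eq_left)
    then have "ennreal (x powr (a - 1) * exp (- x) / Gamma a) * ennreal (exp (- (c - 1) * x)) =
      ennreal (x powr (a - 1) * exp (- c * x) / Gamma a)"
      by (subst ennreal_mult''[symmetric]) (simp_all only: exp_ge_zero)
    then show "ennreal (x powr (a - 1) * exp (- x) / Gamma a) * (h x * ennreal (exp (- (c - 1) * x))) * indicator {0<..} x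
      = ennreal (x powr (a - 1) * exp (- c * x) / Gamma a) * h x * indicator {0<..} x"
      by (metis mult.assoc mult.commute)
  qed
  also have "\<dots> = ennreal \<bar>1 / c\<bar> * (\<integral>\<^sup>+x. ennreal ((0 + 1 / c * x) powr (a - 1) * exp (- c * (0 + 1 / c * x)) / Gamma a)
     * h (0 + 1 / c * x) * indicator {0<..} (0 + 1 / c * x) \<partial>lborel)"
    using c by (intro nn_integral_real_affine) auto
  also have "\<dots> = (\<integral>\<^sup>+x. ennreal \<bar>1 / c\<bar> * (ennreal ((0 + 1 / c * x) powr (a - 1) * exp (- c * (0 + 1 / c * x)) / Gamma a)
     * h (0 + 1 / c * x) * indicator {0<..} (0 + 1 / c * x)) \<partial>lborel)"
    by (rule nn_integral_cmult[symmetric]) measurable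
  also have "\<dots> = (\<integral>\<^sup>+x. ennreal (c powr (- a)) * (ennreal (x powr (a - 1) * exp (- x) / Gamma a)
     * h (x / c) * indicator {0<..} x) \<partial>lborel)"
  proof (intro nn_integral_cong)
    fix x :: real
    show "ennreal \<bar>1 / c\<bar> * (ennreal ((0 + 1 / c * x) powr (a - 1) * exp (- c * (0 + 1 / c * x)) / Gamma a)
     * h (0 + 1 / c * x) * indicator {0<..} (0 + 1 / c * x)) =
      ennreal (c powr (- a)) * (ennreal (x powr (a - 1) * exp (- x) / Gamma a) * h (x / c) * indicator {0<..} x)"
    proof (cases "x > 0")
      case True
      have "1 / c * (x / c) powr (a - 1) = c powr (- a) * x powr (a - 1)"
        using True c by (simp add: powr_divide powr_minus powr_diff field_simps)
      then have "ennreal \<bar>1 / c\<bar> * ennreal ((x / c) powr (a - 1) * exp (- x) / Gamma a) =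
        ennreal (c powr (- a)) * ennreal (x powr (a - 1) * exp (- x) / Gamma a)"
        using c by (subst (1 2) ennreal_mult'[symmetric]) (auto simp: field_simps)
      then show ?thesis using True c by (simp add: mult.assoc[symmetric])
    next
      case False
      then show ?thesis using c by (simp add: zero_less_divide_iff)
    qed
  qed
  also have "\<dots> = ennreal (c powr (- a)) * (\<integral>\<^sup>+x. h (x / c) \<partial>gamma_law a)"
    using a by (simp add: nn_integral_cmult nn_integral_gamma_law)
  finally show ?thesis .
qed

lemma Gamma_real_plus1: "(a::real) > 0 \<Longrightarrow> Gamma (a + 1) = a * Gamma a"
  by (intro Gamma_plus1) (auto dest: nonpos_Ints_nonpos)

text \<open>The density of shape \<open>a + 1\<close> is \<open>x / a\<close> times that of shape \<open>a\<close>, by \<open>\<Gamma>(a + 1) = a \<Gamma>(a)\<close>.\<close>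

lemma gamma_law_size_bias:
  assumes a: "a \<ge> 0" and h [measurable]: "h \<in> borel_measurable borel"
  shows "(\<integral>\<^sup>+x. ennreal x * h x \<partial>gamma_law a) = ennreal a * (\<integral>\<^sup>+x. h x \<partial>gamma_law (a + 1))"
proof (cases "a = 0")
  case True
  then show ?thesis by (simp add: nn_integral_gamma_law_0)
next
  case False
  with a have a: "a > 0" by simp
  have "(\<integral>\<^sup>+x. ennreal x * h x \<partial>gamma_law a) =
    (\<integral>\<^sup>+x. ennreal (x powr (a - 1) * exp (- x) / Gamma a) * (ennreal x * h x) * indicator {0<..} x \<partial>lborel)"
    using a by (simp add: nn_integral_gamma_law)
  also have "\<dots> = (\<integral>\<^sup>+x. ennreal a * (ennreal (x powr (a + 1 - 1) * exp (- x) / Gamma (a + 1)) * h x * indicator {0<..} x) \<partial>lborel)"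
  proof (intro nn_integral_cong)
    fix x :: real
    show "ennreal (x powr (a - 1) * exp (- x) / Gamma a) * (ennreal x * h x) * indicator {0<..} x =
      ennreal a * (ennreal (x powr (a + 1 - 1) * exp (- x) / Gamma (a + 1)) * h x * indicator {0<..} x)"
    proof (cases "x > 0")
      case True
      have "Gamma (a + 1) = a * Gamma a" using a by (rule Gamma_real_plus1)
      then have "x powr (a - 1) * exp (- x) / Gamma a * x = a * (x powr (a + 1 - 1) * exp (- x) / Gamma (a + 1))"
        using True a by (simp add: powr_diff)
      then have "ennreal (x powr (a - 1) * exp (- x) / Gamma a) * ennreal x =
        ennreal a * ennreal (x powr (a + 1 - 1) * exp (- x) / Gamma (a + 1))"
        using True a by (simp add: ennreal_mult'[symmetric] ennreal_mult''[symmetric])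
      then show ?thesis using True by (simp add: mult.assoc[symmetric])
    qed simp
  qed
  also have "\<dots> = ennreal a * (\<integral>\<^sup>+x. h x \<partial>gamma_law (a + 1))"
    using a by (simp add: nn_integral_cmult nn_integral_gamma_law)
  finally show ?thesis .
qed

lemma nn_integral_gamma_law_1:
  assumes [measurable]: "h \<in> borel_measurable borel"
  shows "(\<integral>\<^sup>+x. h x \<partial>gamma_law 1) = (\<integral>\<^sup>+x. ennreal (exp (- x)) * h x * indicator {0<..} x \<partial>lborel)"
  by (subst nn_integral_gamma_law) (auto intro!: nn_integral_cong simp: indicator_def)

text \<open>Adding an independent exponential variable raises the shape by one: the convolution integrates
\<open>x\<^sup>a\<^sup>-\<^sup>1\<close> from \<open>0\<close> to \<open>z\<close>, while the exponential factors combine to \<open>e\<^sup>-\<^sup>z\<close>.\<close>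

lemma gamma_law_add_exponential:
  assumes a: "a \<ge> 0" and h [measurable]: "h \<in> borel_measurable borel"
  shows "(\<integral>\<^sup>+x. \<integral>\<^sup>+y. h (x + y) \<partial>gamma_law 1 \<partial>gamma_law a) = (\<integral>\<^sup>+x. h x \<partial>gamma_law (a + 1))"
proof (cases "a = 0")
  case True
  interpret prob_space "gamma_law 1" by (simp add: prob_space_gamma_law)
  show ?thesis using True by (simp add: nn_integral_gamma_law_0)
next
  case False
  with a have a: "a > 0" by simp
  interpret prob_space "gamma_law 1" by (simp add: prob_space_gamma_law)
  \<comment> \<open>with \<open>z = x + y\<close> the integrand factors into \<open>w x\<close> and a function of \<open>z\<close>, up to the constraint \<open>x < z\<close>\<close>
  define w where "w x = ennreal (x powr (a - 1) / Gamma a) * indicator {0<..} x" for x :: real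
  have [measurable]: "w \<in> borel_measurable borel" unfolding w_def by measurable
  have "(\<integral>\<^sup>+x. \<integral>\<^sup>+y. h (x + y) \<partial>gamma_law 1 \<partial>gamma_law a) =
    (\<integral>\<^sup>+x. ennreal (x powr (a - 1) * exp (- x) / Gamma a) *
       (\<integral>\<^sup>+y. ennreal (exp (- y)) * h (x + y) * indicator {0<..} y \<partial>lborel) * indicator {0<..} x \<partial>lborel)"
    using a by (subst nn_integral_gamma_law) (auto simp: nn_integral_gamma_law_1)
  also have "\<dots> = (\<integral>\<^sup>+x. \<integral>\<^sup>+z. w x * (ennreal (exp (- z)) * h z) * (if x < z then 1 else 0) \<partial>lborel \<partial>lborel)"
  proof (intro nn_integral_cong)
    fix x :: real
    have "(\<integral>\<^sup>+z. w x * (ennreal (exp (- z)) * h z) * (if x < z then 1 else 0) \<partial>lborel) =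
      (\<integral>\<^sup>+y. w x * (ennreal (exp (- (x + 1 * y))) * h (x + 1 * y)) * (if x < x + 1 * y then 1 else 0) \<partial>lborel)"
      by (subst nn_integral_real_affine[where c=1 and t=x]) auto
    also have "\<dots> = (\<integral>\<^sup>+y. (ennreal (x powr (a - 1) * exp (- x) / Gamma a) * indicator {0<..} x) *
         (ennreal (exp (- y)) * h (x + y) * indicator {0<..} y) \<partial>lborel)"
    proof (intro nn_integral_cong)
      fix y :: real
      have "ennreal (x powr (a - 1) / Gamma a) * ennreal (exp (- (x + y))) =
        ennreal (x powr (a - 1) * exp (- x) / Gamma a) * ennreal (exp (- y))"
        using exp_add[of "- x" "- y"] by (simp add: ennreal_mult''[symmetric] mult.assoc)
      then show "w x * (ennreal (exp (- (x + 1 * y))) * h (x + 1 * y)) * (if x < x + 1 * y then 1 else 0) =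
       (ennreal (x powr (a - 1) * exp (- x) / Gamma a) * indicator {0<..} x) *
         (ennreal (exp (- y)) * h (x + y) * indicator {0<..} y)"
        by (auto simp: w_def indicator_def mult.assoc[symmetric])
    qed
    also have "\<dots> = ennreal (x powr (a - 1) * exp (- x) / Gamma a) *
       (\<integral>\<^sup>+y. ennreal (exp (- y)) * h (x + y) * indicator {0<..} y \<partial>lborel) * indicator {0<..} x"
      by (subst nn_integral_cmult) (auto simp: mult_ac)
    finally show "ennreal (x powr (a - 1) * exp (- x) / Gamma a) *
       (\<integral>\<^sup>+y. ennreal (exp (- y)) * h (x + y) * indicator {0<..} y \<partial>lborel) * indicator {0<..} x =
       (\<integral>\<^sup>+z. w x * (ennreal (exp (- z)) * h z) * (if x < z then 1 else 0) \<partial>lborel)" by simp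
  qed
  also have "\<dots> = (\<integral>\<^sup>+z. \<integral>\<^sup>+x. w x * (ennreal (exp (- z)) * h z) * (if x < z then 1 else 0) \<partial>lborel \<partial>lborel)"
    by (rule lborel_pair.Fubini') measurable
  also have "\<dots> = (\<integral>\<^sup>+z. ennreal (z powr (a + 1 - 1) * exp (- z) / Gamma (a + 1)) * h z * indicator {0<..} z \<partial>lborel)"
  proof (intro nn_integral_cong)
    fix z :: real
    have "(\<integral>\<^sup>+x. w x * (ennreal (exp (- z)) * h z) * (if x < z then 1 else 0) \<partial>lborel) =
      (\<integral>\<^sup>+x. (w x * indicator {..<z} x) * (ennreal (exp (- z)) * h z) \<partial>lborel)"
      by (intro nn_integral_cong) (auto simp: indicator_def)
    also have "\<dots> = (\<integral>\<^sup>+x. w x * indicator {..<z} x \<partial>lborel) * (ennreal (exp (- z)) * h z)"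
      by (rule nn_integral_multc) measurable
    also have "(\<integral>\<^sup>+x. w x * indicator {..<z} x \<partial>lborel) = ennreal (z powr a / Gamma (a + 1)) * indicator {0<..} z"
    proof (cases "z > 0")
      case True
      have "(\<integral>\<^sup>+x. w x * indicator {..<z} x \<partial>lborel) = (\<integral>\<^sup>+x. ennreal (x powr (a - 1)) * indicator {0..z} x * ennreal (1 / Gamma a) \<partial>lborel)"
      proof (rule nn_integral_cong_AE)
        show "AE x in lborel. w x * indicator {..<z} x = ennreal (x powr (a - 1)) * indicator {0..z} x * ennreal (1 / Gamma a)"
          using AE_lborel_singleton[of 0] AE_lborel_singleton[of z]
          by eventually_elim (auto simp: w_def indicator_def ennreal_mult'[symmetric])
      qed
      also have "\<dots> = ennreal (z powr (a - 1 + 1) / (a - 1 + 1)) * ennreal (1 / Gamma a)"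
        using a True has_integral_powr_from_0[of "a - 1" z]
        by (subst nn_integral_multc) (auto simp: nn_integral_has_integral_lebesgue')
      also have "\<dots> = ennreal (z powr a / Gamma (a + 1))"
        using a Gamma_real_plus1[OF a] by (simp add: ennreal_mult''[symmetric] mult.commute)
      finally show ?thesis using True by simp
    next
      case False
      have "(\<integral>\<^sup>+x. w x * indicator {..<z} x \<partial>lborel) = integral\<^sup>N lborel (\<lambda>x::real. 0)"
        by (intro nn_integral_cong) (use False in \<open>auto simp: w_def indicator_def\<close>)
      then show ?thesis using False by simp
    qed
    also have "\<dots> * (ennreal (exp (- z)) * h z) =
      ennreal (z powr (a + 1 - 1) * exp (- z) / Gamma (a + 1)) * h z * indicator {0<..} z"
      by (cases "z > 0") (auto simp: ennreal_mult''[symmetric] mult.assoc[symmetric])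
    finally show "(\<integral>\<^sup>+x. w x * (ennreal (exp (- z)) * h z) * (if x < z then 1 else 0) \<partial>lborel) =
      ennreal (z powr (a + 1 - 1) * exp (- z) / Gamma (a + 1)) * h z * indicator {0<..} z" .
  qed
  also have "\<dots> = (\<integral>\<^sup>+x. h x \<partial>gamma_law (a + 1))"
    using a by (subst nn_integral_gamma_law) auto
  finally show ?thesis .
qed

lemma nn_integral_exp_atLeast_0:
  assumes "s > 0"
  shows "(\<integral>\<^sup>+\<theta>. ennreal (exp (- \<theta> * s)) * indicator {0..} \<theta> \<partial>lborel) = ennreal (1 / s)"
proof -
  have "(\<integral>\<^sup>+\<theta>. ennreal (exp (- \<theta> * s)) * indicator {0..} \<theta> \<partial>lborel) = ennreal (0 - (- exp (- 0 * s) / s))"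
  proof (rule nn_integral_FTC_atLeast)
    show "((\<lambda>\<theta>. - exp (- \<theta> * s) / s) has_real_derivative exp (- x * s)) (at x)" for x
      using assms by (auto intro!: derivative_eq_intros)
    have "((\<lambda>\<theta>. exp (- \<theta> * s)) \<longlongrightarrow> 0) at_top"
      using filterlim_at_top_mult_tendsto_pos[OF tendsto_const[of s] assms filterlim_ident]
      by (intro filterlim_compose[OF exp_at_bot]) (simp add: filterlim_uminus_at_bot)
    from tendsto_divide[OF tendsto_minus[OF this] tendsto_const[of s]]
    show "((\<lambda>\<theta>. - exp (- \<theta> * s) / s) \<longlongrightarrow> 0) at_top"
      using assms by simp
  qed auto
  then show ?thesis by simp
qed

lemma nn_integral_cmult_exp_atLeast_0:
  assumes "s > 0"
  shows "(\<integral>\<^sup>+\<theta>. c * (ennreal (exp (- \<theta> * s)) * indicator {0..} \<theta>) \<partial>lborel) = c * ennreal (1 / s)"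
  unfolding nn_integral_exp_atLeast_0[OF assms, symmetric] by (rule nn_integral_cmult) measurable

lemma nn_integral_scale_greaterThan_0:
  assumes c: "c > 0" and [measurable]: "f \<in> borel_measurable borel"
  shows "(\<integral>\<^sup>+y. f y * indicator {0<..} y \<partial>lborel) =
    (\<integral>\<^sup>+r. ennreal c * (f (c * r) * indicator {0<..} (r::real)) \<partial>lborel)"
proof -
  have "(\<integral>\<^sup>+y. f y * indicator {0<..} y \<partial>lborel) =
    ennreal \<bar>c\<bar> * (\<integral>\<^sup>+r. f (0 + c * r) * indicator {0<..} (0 + c * r) \<partial>lborel)"
    using c by (intro nn_integral_real_affine) auto
  also have "\<dots> = ennreal c * (\<integral>\<^sup>+r. f (c * r) * indicator {0<..} r \<partial>lborel)"
    using c by (auto intro!: arg_cong2[where f="(*)"] nn_integral_cong simp: indicator_def zero_less_mult_iff)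
  also have "\<dots> = (\<integral>\<^sup>+r. ennreal c * (f (c * r) * indicator {0<..} r) \<partial>lborel)"
    by (rule nn_integral_cmult[symmetric]) measurable
  finally show ?thesis .
qed

lemma nn_integral_powr_atLeast_0:
  assumes "s > 0"
  shows "(\<integral>\<^sup>+r. ennreal ((1 + r) powr (- s - 1)) * indicator {0..} r \<partial>lborel) = ennreal (1 / s)"
proof -
  have "(\<integral>\<^sup>+r. ennreal ((1 + r) powr (- s - 1)) * indicator {0..} r \<partial>lborel) = ennreal (0 - (- ((1 + 0) powr (- s)) / s))"
  proof (rule nn_integral_FTC_atLeast)
    show "((\<lambda>r. - ((1 + r) powr (- s)) / s) has_real_derivative (1 + x) powr (- s - 1)) (at x)" if "0 \<le> x" for x
      using assms that by (auto intro!: derivative_eq_intros)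
    have "((\<lambda>r. (1 + r) powr (- s)) \<longlongrightarrow> 0) at_top"
      using assms by (intro tendsto_neg_powr filterlim_tendsto_add_at_top[OF tendsto_const]) (auto simp: filterlim_ident)
    from tendsto_divide[OF tendsto_minus[OF this] tendsto_const[of s]]
    show "((\<lambda>r. - ((1 + r) powr (- s)) / s) \<longlongrightarrow> 0) at_top"
      using assms by simp
  qed auto
  then show ?thesis by simp
qed

text \<open>If \<open>r\<close> has this law, then \<open>r / (1 + r)\<close> has the law \<open>Beta(1, s)\<close> of a piece broken off a stick. The
odds \<open>r\<close> arise as the ratio of an exponential variable and an independent gamma variable of
shape \<open>s\<close>, which is how they enter below.\<close>

definition stick_law :: "real \<Rightarrow> real measure" where
  "stick_law s = density lborel (\<lambda>r. ennreal (s * (1 + r) powr (- s - 1)) * indicator {0<..} r)"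

lemma sets_stick_law [simp, measurable_cong]: "sets (stick_law s) = sets borel"
  by (simp add: stick_law_def)

lemma space_stick_law [simp]: "space (stick_law s) = UNIV"
  by (simp add: stick_law_def)

lemma nn_integral_stick_law:
  assumes [measurable]: "h \<in> borel_measurable borel"
  shows "(\<integral>\<^sup>+r. h r \<partial>stick_law s) = (\<integral>\<^sup>+r. ennreal (s * (1 + r) powr (- s - 1)) * h r * indicator {0<..} r \<partial>lborel)"
  unfolding stick_law_def by (subst nn_integral_density) (auto intro!: nn_integral_cong simp: mult_ac)

lemma AE_stick_law_pos: "AE r in stick_law s. 0 < r"
  unfolding stick_law_def by (auto simp: AE_density indicator_def)

lemma prob_space_stick_law:
  assumes "s > 0"
  shows "prob_space (stick_law s)"
proof (rule prob_spaceI)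
  have "emeasure (stick_law s) (space (stick_law s)) = (\<integral>\<^sup>+r. 1 \<partial>stick_law s)" by simp
  also have "\<dots> = (\<integral>\<^sup>+r. ennreal s * (ennreal ((1 + r) powr (- s - 1)) * indicator {0<..} r) \<partial>lborel)"
    using assms by (subst nn_integral_stick_law) (auto simp: ennreal_mult mult.assoc)
  also have "\<dots> = 1"
    using assms nn_integral_powr_atLeast_0[OF assms]
    by (subst nn_integral_cmult) (auto simp: ennreal_mult[symmetric] nn_integral_indicator_greaterThan)
  finally show "emeasure (stick_law s) (space (stick_law s)) = 1" .
qed

text \<open>The contraction factor of the map that mixes in a random atom.\<close>

lemma integral_stick_law:
  assumes s: "s > 0"
  shows "(\<integral>r. 1 / (1 + r) \<partial>stick_law s) = s / (s + 1)"
proof (rule integral_eq_nn_integral[THEN trans])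
  show "AE r in stick_law s. 0 \<le> 1 / (1 + r)"
    using AE_stick_law_pos by eventually_elim simp
  have "(\<integral>\<^sup>+r. ennreal (1 / (1 + r)) \<partial>stick_law s) =
    (\<integral>\<^sup>+r. ennreal s * (ennreal ((1 + r) powr (- (s + 1) - 1)) * indicator {0<..} r) \<partial>lborel)"
    unfolding nn_integral_stick_law[of "\<lambda>r. ennreal (1 / (1 + r))", simplified]
  proof (intro nn_integral_cong)
    fix r :: real
    have "(1 + r) powr (- s - 1) / (1 + r) = (1 + r) powr (- (s + 1) - 1)" if "r > 0"
      using that powr_diff[of "1 + r" "- s - 1" 1] by (simp add: algebra_simps)
    then have "s * (1 + r) powr (- s - 1) * (1 / (1 + r)) = s * (1 + r) powr (- (s + 1) - 1)" if "r > 0"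
      using that by (metis mult.assoc mult.right_neutral times_divide_eq_right)
    then show "ennreal (s * (1 + r) powr (- s - 1)) * ennreal (1 / (1 + r)) * indicator {0<..} r =
      ennreal s * (ennreal ((1 + r) powr (- (s + 1) - 1)) * indicator {0<..} r)"
      using s by (cases "r > 0") (simp_all only: ennreal_mult'[symmetric] ennreal_mult''[symmetric]
        zero_le_divide_1_iff powr_ge_zero less_imp_le, simp_all add: ennreal_mult''[symmetric])
  qed
  also have "\<dots> = ennreal (s / (s + 1))"
    using s nn_integral_powr_atLeast_0[of "s + 1"]
    by (subst nn_integral_cmult) (auto simp: nn_integral_indicator_greaterThan ennreal_mult[symmetric])
  finally show "enn2real (\<integral>\<^sup>+r. ennreal (1 / (1 + r)) \<partial>stick_law s) = s / (s + 1)"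
    using s by simp
qed simp

section \<open>Dirichlet distributions\<close>

definition gamma_vec :: "'i set \<Rightarrow> ('i \<Rightarrow> real) \<Rightarrow> ('i \<Rightarrow> real) measure" where
  "gamma_vec I a = PiM I (\<lambda>i. gamma_law (a i))"

lemma sets_gamma_vec [simp, measurable_cong]: "sets (gamma_vec I a) = sets (PiM I (\<lambda>_. borel))"
  unfolding gamma_vec_def by (intro sets_PiM_cong) simp_all

lemma space_gamma_vec: "space (gamma_vec I a) = space (PiM I (\<lambda>_. borel))"
  by (rule sets_eq_imp_space_eq) simp

lemma prob_space_gamma_vec: "(\<And>i. a i \<ge> 0) \<Longrightarrow> prob_space (gamma_vec I a)"
  unfolding gamma_vec_def by (intro prob_space_PiM prob_space_gamma_law)

lemma product_sigma_finite_gamma_law: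
  "(\<And>i. a i \<ge> 0) \<Longrightarrow> product_sigma_finite (\<lambda>i. gamma_law (a i))"
  by (simp add: product_sigma_finite_def prob_space_imp_sigma_finite prob_space_gamma_law)

lemma nn_integral_gamma_vec_insert:
  assumes "\<And>i. a i \<ge> 0" "finite I" "i \<notin> I" and "f \<in> borel_measurable (PiM (insert i I) (\<lambda>_. borel))"
  shows "(\<integral>\<^sup>+z. f z \<partial>gamma_vec (insert i I) a) =
    (\<integral>\<^sup>+x. \<integral>\<^sup>+y. f (x(i := y)) \<partial>gamma_law (a i) \<partial>gamma_vec I a)"
proof -
  interpret product_sigma_finite "\<lambda>i. gamma_law (a i)"
    using assms(1) by (rule product_sigma_finite_gamma_law)
  have "f \<in> borel_measurable (PiM (insert i I) (\<lambda>i. gamma_law (a i)))"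
    using assms(4) by (simp cong: measurable_cong_sets sets_PiM_cong)
  then show ?thesis
    unfolding gamma_vec_def using assms(2,3) by (rule_tac product_nn_integral_insert)
qed

lemma gamma_vec_upd:
  "i \<notin> I \<Longrightarrow> gamma_vec I (a(i := b)) = gamma_vec I a"
  unfolding gamma_vec_def by (intro PiM_cong) auto

lemma gamma_vec_tilt:
  assumes a: "\<And>i. a i \<ge> 0" and c: "c > 0" and I: "finite I"
    and f: "f \<in> borel_measurable (PiM I (\<lambda>_. borel))"
  shows "(\<integral>\<^sup>+z. f z * ennreal (exp (- (c - 1) * (\<Sum>i\<in>I. z i))) \<partial>gamma_vec I a) =
    ennreal (c powr (- (\<Sum>i\<in>I. a i))) * (\<integral>\<^sup>+z. f (\<lambda>i\<in>I. z i / c) \<partial>gamma_vec I a)"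
  using I f
proof (induction I arbitrary: f)
  case empty
  show ?case using c by (simp add: gamma_vec_def PiM_empty nn_integral_count_space_finite)
next
  case (insert i I)
  note [measurable] = insert.prems
  interpret I: prob_space "gamma_vec I a" using a by (rule prob_space_gamma_vec)
  interpret i: prob_space "gamma_law (a i)" using a by (intro prob_space_gamma_law)
  have upd [measurable]: "(\<lambda>(x, y). x(i := y)) \<in> PiM I (\<lambda>_. borel) \<Otimes>\<^sub>M borel \<rightarrow>\<^sub>M PiM (insert i I) (\<lambda>_. borel :: real measure)"
    by (rule measurable_add_dim)
  have fm [measurable]: "(\<lambda>(x, y). f (x(i := y))) \<in> borel_measurable (PiM I (\<lambda>_. borel) \<Otimes>\<^sub>M borel)"
    using measurable_compose[OF upd insert.prems] by (simp add: case_prod_beta)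
  define g where "g x = (\<integral>\<^sup>+y. f (x(i := y / c)) \<partial>gamma_law (a i))" for x
  have gm: "g \<in> borel_measurable (PiM I (\<lambda>_. borel))"
    unfolding g_def using fm by measurable
  have "(\<integral>\<^sup>+z. f z * ennreal (exp (- (c - 1) * (\<Sum>i\<in>insert i I. z i))) \<partial>gamma_vec (insert i I) a) =
    (\<integral>\<^sup>+x. \<integral>\<^sup>+y. f (x(i := y)) * ennreal (exp (- (c - 1) * (\<Sum>j\<in>insert i I. (x(i := y)) j))) \<partial>gamma_law (a i) \<partial>gamma_vec I a)"
    using insert.hyps by (intro nn_integral_gamma_vec_insert a) auto
  also have "\<dots> = (\<integral>\<^sup>+x. (ennreal (c powr (- a i)) * g x) * ennreal (exp (- (c - 1) * (\<Sum>i\<in>I. x i))) \<partial>gamma_vec I a)"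
  proof (intro nn_integral_cong)
    fix x assume "x \<in> space (gamma_vec I a)"
    then have x: "x \<in> space (PiM I (\<lambda>_. borel))" by (simp add: space_gamma_vec)
    have [measurable]: "(\<lambda>y. f (x(i := y))) \<in> borel_measurable borel"
      using measurable_compose[OF measurable_Pair1'[OF x] fm] by simp
    have "(\<integral>\<^sup>+y. f (x(i := y)) * ennreal (exp (- (c - 1) * (\<Sum>j\<in>insert i I. (x(i := y)) j))) \<partial>gamma_law (a i)) =
      (\<integral>\<^sup>+y. (f (x(i := y)) * ennreal (exp (- (c - 1) * y))) * ennreal (exp (- (c - 1) * (\<Sum>i\<in>I. x i))) \<partial>gamma_law (a i))"
    proof (intro nn_integral_cong)
      fix y
      have "(\<Sum>j\<in>insert i I. (x(i := y)) j) = y + (\<Sum>j\<in>I. x j)"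
        using insert.hyps by (auto intro!: sum.cong)
      then show "f (x(i := y)) * ennreal (exp (- (c - 1) * (\<Sum>j\<in>insert i I. (x(i := y)) j))) =
        (f (x(i := y)) * ennreal (exp (- (c - 1) * y))) * ennreal (exp (- (c - 1) * (\<Sum>i\<in>I. x i)))"
        using exp_add[of "- (c - 1) * y" "- (c - 1) * (\<Sum>i\<in>I. x i)"]
        by (simp only: ring_distribs mult.assoc) (simp add: ennreal_mult''[symmetric] mult.assoc)
    qed
    also have "\<dots> = (\<integral>\<^sup>+y. f (x(i := y)) * ennreal (exp (- (c - 1) * y)) \<partial>gamma_law (a i)) * ennreal (exp (- (c - 1) * (\<Sum>i\<in>I. x i)))"
      by (rule nn_integral_multc) measurable
    also have "(\<integral>\<^sup>+y. f (x(i := y)) * ennreal (exp (- (c - 1) * y)) \<partial>gamma_law (a i)) = ennreal (c powr (- a i)) * g x"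
      unfolding g_def using a c by (intro gamma_law_tilt) auto
    finally show "(\<integral>\<^sup>+y. f (x(i := y)) * ennreal (exp (- (c - 1) * (\<Sum>j\<in>insert i I. (x(i := y)) j))) \<partial>gamma_law (a i)) =
      (ennreal (c powr (- a i)) * g x) * ennreal (exp (- (c - 1) * (\<Sum>i\<in>I. x i)))" .
  qed
  also have "\<dots> = ennreal (c powr (- (\<Sum>i\<in>I. a i))) * (\<integral>\<^sup>+x. ennreal (c powr (- a i)) * g (\<lambda>i\<in>I. x i / c) \<partial>gamma_vec I a)"
    using gm by (intro insert.IH) measurable
  also have "(\<integral>\<^sup>+x. ennreal (c powr (- a i)) * g (\<lambda>i\<in>I. x i / c) \<partial>gamma_vec I a) =
     ennreal (c powr (- a i)) * (\<integral>\<^sup>+x. g (\<lambda>i\<in>I. x i / c) \<partial>gamma_vec I a)"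
  proof (intro nn_integral_cmult)
    have "(\<lambda>x. \<lambda>i\<in>I. x i / c) \<in> gamma_vec I a \<rightarrow>\<^sub>M PiM I (\<lambda>_. borel)" by measurable
    from measurable_compose[OF this gm] show "(\<lambda>x. g (\<lambda>i\<in>I. x i / c)) \<in> borel_measurable (gamma_vec I a)" .
  qed
  also have "(\<integral>\<^sup>+x. g (\<lambda>i\<in>I. x i / c) \<partial>gamma_vec I a) =
    (\<integral>\<^sup>+x. \<integral>\<^sup>+y. f (\<lambda>j\<in>insert i I. (x(i := y)) j / c) \<partial>gamma_law (a i) \<partial>gamma_vec I a)"
    unfolding g_def using insert.hyps
    by (intro nn_integral_cong arg_cong[where f=f]) (auto simp: fun_eq_iff restrict_def)
  also have "\<dots> = (\<integral>\<^sup>+z. f (\<lambda>j\<in>insert i I. z j / c) \<partial>gamma_vec (insert i I) a)"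
    using insert.hyps by (intro nn_integral_gamma_vec_insert[symmetric] a) auto
  also have "ennreal (c powr - sum a I) * (ennreal (c powr - a i) * (\<integral>\<^sup>+z. f (\<lambda>j\<in>insert i I. z j / c) \<partial>gamma_vec (insert i I) a)) =
    ennreal (c powr (- (\<Sum>i\<in>insert i I. a i))) * (\<integral>\<^sup>+z. f (\<lambda>j\<in>insert i I. z j / c) \<partial>gamma_vec (insert i I) a)"
    using insert.hyps by (simp add: mult.assoc[symmetric] ennreal_mult''[symmetric] powr_add[symmetric] algebra_simps)
  finally show ?case .
qed

lemma gamma_vec_size_bias:
  assumes a: "\<And>i. a i \<ge> 0" and I: "finite I" and j: "j \<in> I"
    and f: "f \<in> borel_measurable (PiM I (\<lambda>_. borel))"
  shows "(\<integral>\<^sup>+z. ennreal (z j) * f z \<partial>gamma_vec I a) =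
    ennreal (a j) * (\<integral>\<^sup>+z. f z \<partial>gamma_vec I (a(j := a j + 1)))"
proof -
  define J where "J = I - {j}"
  have J: "I = insert j J" "finite J" "j \<notin> J" using I j by (auto simp: J_def)
  have [measurable]: "f \<in> borel_measurable (PiM (insert j J) (\<lambda>_. borel))" using f J by simp
  have a': "(a(j := a j + 1)) i \<ge> 0" for i using a by (simp add: add_nonneg_nonneg)
  interpret i: prob_space "gamma_law (a j)" using a by (intro prob_space_gamma_law)
  interpret i': prob_space "gamma_law (a j + 1)" using a by (intro prob_space_gamma_law) (simp add: add_nonneg_nonneg)
  have upd [measurable]: "(\<lambda>(x, y). x(j := y)) \<in> PiM J (\<lambda>_. borel) \<Otimes>\<^sub>M borel \<rightarrow>\<^sub>M PiM (insert j J) (\<lambda>_. borel :: real measure)"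
    by (rule measurable_add_dim)
  have fm [measurable]: "(\<lambda>(x, y). f (x(j := y))) \<in> borel_measurable (PiM J (\<lambda>_. borel) \<Otimes>\<^sub>M borel)"
    using measurable_compose[OF upd] by (simp add: case_prod_beta)
  have "(\<integral>\<^sup>+z. ennreal (z j) * f z \<partial>gamma_vec I a) =
    (\<integral>\<^sup>+x. \<integral>\<^sup>+y. ennreal ((x(j := y)) j) * f (x(j := y)) \<partial>gamma_law (a j) \<partial>gamma_vec J a)"
    unfolding J(1) using J by (intro nn_integral_gamma_vec_insert a) auto
  also have "\<dots> = (\<integral>\<^sup>+x. ennreal (a j) * (\<integral>\<^sup>+y. f (x(j := y)) \<partial>gamma_law (a j + 1)) \<partial>gamma_vec J a)"
  proof (intro nn_integral_cong)
    fix x assume "x \<in> space (gamma_vec J a)"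
    then have x: "x \<in> space (PiM J (\<lambda>_. borel))" by (simp add: space_gamma_vec)
    have "(\<lambda>y. f (x(j := y))) \<in> borel_measurable borel"
      using measurable_compose[OF measurable_Pair1'[OF x] fm] by simp
    then show "(\<integral>\<^sup>+y. ennreal ((x(j := y)) j) * f (x(j := y)) \<partial>gamma_law (a j)) =
      ennreal (a j) * (\<integral>\<^sup>+y. f (x(j := y)) \<partial>gamma_law (a j + 1))"
      using gamma_law_size_bias[OF a] by simp
  qed
  also have "\<dots> = ennreal (a j) * (\<integral>\<^sup>+x. \<integral>\<^sup>+y. f (x(j := y)) \<partial>gamma_law (a j + 1) \<partial>gamma_vec J a)"
    using fm by (intro nn_integral_cmult) measurable
  also have "(\<integral>\<^sup>+x. \<integral>\<^sup>+y. f (x(j := y)) \<partial>gamma_law (a j + 1) \<partial>gamma_vec J a) =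
    (\<integral>\<^sup>+z. f z \<partial>gamma_vec I (a(j := a j + 1)))"
    unfolding J(1) using J by (subst nn_integral_gamma_vec_insert[OF a']) (auto simp: gamma_vec_upd)
  finally show ?thesis .
qed

lemma gamma_vec_add_exponential:
  assumes a: "\<And>i. a i \<ge> 0" and I: "finite I" and j: "j \<in> I"
    and f: "f \<in> borel_measurable (PiM I (\<lambda>_. borel))"
  shows "(\<integral>\<^sup>+z. \<integral>\<^sup>+y. f (z(j := z j + y)) \<partial>gamma_law 1 \<partial>gamma_vec I a) =
    (\<integral>\<^sup>+z. f z \<partial>gamma_vec I (a(j := a j + 1)))"
proof -
  define J where "J = I - {j}"
  have J: "I = insert j J" "finite J" "j \<notin> J" using I j by (auto simp: J_def)
  have fm0 [measurable]: "f \<in> borel_measurable (PiM (insert j J) (\<lambda>_. borel))" using f J by simp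
  have a': "(a(j := a j + 1)) i \<ge> 0" for i using a by (simp add: add_nonneg_nonneg)
  interpret i: prob_space "gamma_law (a j)" using a by (intro prob_space_gamma_law)
  interpret i1: prob_space "gamma_law 1" by (intro prob_space_gamma_law) simp
  have upd [measurable]: "(\<lambda>(x, y). x(j := y)) \<in> PiM J (\<lambda>_. borel) \<Otimes>\<^sub>M borel \<rightarrow>\<^sub>M PiM (insert j J) (\<lambda>_. borel :: real measure)"
    by (rule measurable_add_dim)
  have fm [measurable]: "(\<lambda>(x, y). f (x(j := y))) \<in> borel_measurable (PiM J (\<lambda>_. borel) \<Otimes>\<^sub>M borel)"
    using measurable_compose[OF upd] by (simp add: case_prod_beta)
  have upd3: "(\<lambda>(z, y). z(j := z j + y)) \<in> PiM (insert j J) (\<lambda>_. borel) \<Otimes>\<^sub>M borel \<rightarrow>\<^sub>M PiM (insert j J) (\<lambda>_. borel :: real measure)"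
    by (auto intro!: measurable_fun_upd[where J="insert j J"] simp: case_prod_beta')
  have fm3 [measurable]: "(\<lambda>(z, y). f (z(j := z j + y))) \<in> borel_measurable (PiM (insert j J) (\<lambda>_. borel) \<Otimes>\<^sub>M borel)"
    using measurable_compose[OF upd3 fm0] by (simp add: case_prod_beta')
  have "(\<integral>\<^sup>+z. \<integral>\<^sup>+y. f (z(j := z j + y)) \<partial>gamma_law 1 \<partial>gamma_vec I a) =
    (\<integral>\<^sup>+x. \<integral>\<^sup>+y'. \<integral>\<^sup>+y. f ((x(j := y'))(j := (x(j := y')) j + y)) \<partial>gamma_law 1 \<partial>gamma_law (a j) \<partial>gamma_vec J a)"
    unfolding J(1) using J fm3 by (intro nn_integral_gamma_vec_insert a) measurable
  also have "\<dots> = (\<integral>\<^sup>+x. (\<integral>\<^sup>+y. f (x(j := y)) \<partial>gamma_law (a j + 1)) \<partial>gamma_vec J a)"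
  proof (intro nn_integral_cong)
    fix x assume "x \<in> space (gamma_vec J a)"
    then have x: "x \<in> space (PiM J (\<lambda>_. borel))" by (simp add: space_gamma_vec)
    have "(\<lambda>y. f (x(j := y))) \<in> borel_measurable borel"
      using measurable_compose[OF measurable_Pair1'[OF x] fm] by simp
    then show "(\<integral>\<^sup>+y'. \<integral>\<^sup>+y. f ((x(j := y'))(j := (x(j := y')) j + y)) \<partial>gamma_law 1 \<partial>gamma_law (a j)) =
      (\<integral>\<^sup>+y. f (x(j := y)) \<partial>gamma_law (a j + 1))"
      using gamma_law_add_exponential[OF a] by simp
  qed
  also have "\<dots> = (\<integral>\<^sup>+z. f z \<partial>gamma_vec I (a(j := a j + 1)))"
    unfolding J(1) using J by (subst nn_integral_gamma_vec_insert[OF a']) (auto simp: gamma_vec_upd)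
  finally show ?thesis .
qed

lemma AE_gamma_vec:
  assumes a: "\<And>i. a i \<ge> 0" and I: "finite I"
  shows "AE z in gamma_vec I a. \<forall>i\<in>I. 0 \<le> z i"
  unfolding gamma_vec_def using I
  by (intro AE_finite_allI) (auto intro!: AE_PiM_component prob_space_gamma_law a AE_gamma_law_nonneg)

lemma AE_gamma_vec_sum_pos:
  assumes a: "\<And>i. a i \<ge> 0" and I: "finite I" and s: "(\<Sum>i\<in>I. a i) > 0"
  shows "AE z in gamma_vec I a. 0 < (\<Sum>i\<in>I. z i)"
proof -
  obtain j where j: "j \<in> I" "a j > 0"
    using s sum_nonpos[of I a] by (meson not_le)
  have "AE z in gamma_vec I a. 0 < z j"
    unfolding gamma_vec_def using j by (intro AE_PiM_component prob_space_gamma_law a AE_gamma_law_pos)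
  then show ?thesis
    using AE_gamma_vec[where a=a and I=I, OF a I]
  proof eventually_elim
    case (elim z)
    then show ?case using I j by (intro sum_pos2[of I j]) auto
  qed
qed

definition normalize_vec :: "'i set \<Rightarrow> ('i \<Rightarrow> real) \<Rightarrow> 'i \<Rightarrow> real" where
  "normalize_vec I z = (\<lambda>i\<in>I. z i / (\<Sum>j\<in>I. z j))"

lemma measurable_normalize_vec [measurable]:
  "finite I \<Longrightarrow> normalize_vec I \<in> PiM I (\<lambda>_. borel) \<rightarrow>\<^sub>M PiM I (\<lambda>_. borel)"
  unfolding normalize_vec_def by measurable

lemma Dir_eq: "Dir I a = distr (gamma_vec I a) (PiM I (\<lambda>_. borel)) (normalize_vec I)"
  unfolding Dir_def gamma_vec_def normalize_vec_def ..

lemma sets_Dir [simp, measurable_cong]: "sets (Dir I a) = sets (PiM I (\<lambda>_. borel))"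
  by (simp add: Dir_def)

lemma prob_space_Dir: "(\<And>i. a i \<ge> 0) \<Longrightarrow> finite I \<Longrightarrow> prob_space (Dir I a)"
  unfolding Dir_eq by (intro prob_space.prob_space_distr prob_space_gamma_vec) measurable

lemma nn_integral_Dir:
  assumes "finite I" "g \<in> borel_measurable (PiM I (\<lambda>_. borel))"
  shows "(\<integral>\<^sup>+z. g z \<partial>Dir I a) = (\<integral>\<^sup>+z. g (normalize_vec I z) \<partial>gamma_vec I a)"
  unfolding Dir_eq using assms by (intro nn_integral_distr) measurable

lemma AE_Dir:
  assumes a: "\<And>i. a i \<ge> 0" and I: "finite I" and s: "(\<Sum>i\<in>I. a i) > 0"
  shows "AE z in Dir I a. (\<forall>i\<in>I. 0 \<le> z i) \<and> (\<Sum>i\<in>I. z i) = 1"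
  unfolding Dir_eq
proof (subst AE_distr_iff)
  show "AE z in gamma_vec I a. (\<forall>i\<in>I. 0 \<le> normalize_vec I z i) \<and> (\<Sum>i\<in>I. normalize_vec I z i) = 1"
    using AE_gamma_vec[where a=a and I=I, OF a I] AE_gamma_vec_sum_pos[where a=a and I=I, OF a I s]
    by eventually_elim (auto simp: normalize_vec_def sum_divide_distrib[symmetric])
  show "normalize_vec I \<in> gamma_vec I a \<rightarrow>\<^sub>M PiM I (\<lambda>_. borel)" using I by measurable
  show "{z \<in> space (PiM I (\<lambda>_. borel)). (\<forall>i\<in>I. 0 \<le> z i) \<and> (\<Sum>i\<in>I. z i) = (1::real)} \<in> sets (PiM I (\<lambda>_. borel))"
    using I by measurable
qed

text \<open>Size-biasing by the \<open>j\<close>-th coordinate adds one to the \<open>j\<close>-th parameter. For gamma vectors this is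
immediate; the normalising sum \<open>S\<close> in the denominator is dealt with by \<open>1/S = \<integral>\<^sub>0\<^sup>\<infinity> e\<^sup>-\<^sup>\<theta>\<^sup>S d\<theta>\<close>, where each
tilt by \<open>e\<^sup>-\<^sup>\<theta>\<^sup>S\<close> is a rescaling, invisible to the normalised vector.\<close>

lemma Dir_size_bias:
  assumes a: "\<And>i. a i \<ge> 0" and I: "finite I" and s: "(\<Sum>i\<in>I. a i) > 0" and j: "j \<in> I"
    and g [measurable]: "g \<in> borel_measurable (PiM I (\<lambda>_. borel))"
  shows "(\<integral>\<^sup>+z. ennreal (z j) * g z \<partial>Dir I a) =
    ennreal (a j / (\<Sum>i\<in>I. a i)) * (\<integral>\<^sup>+z. g z \<partial>Dir I (a(j := a j + 1)))"
proof -
  define s where "s = (\<Sum>i\<in>I. a i)"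
  have s: "s > 0" using assms by (simp add: s_def)
  define a' where "a' = a(j := a j + 1)"
  have a': "a' i \<ge> 0" for i using a by (simp add: a'_def add_nonneg_nonneg)
  have sa': "(\<Sum>i\<in>I. a' i) = s + 1"
    using I j unfolding s_def a'_def by (simp add: sum.remove[of I j])
  interpret G: prob_space "gamma_vec I a" using a by (rule prob_space_gamma_vec)
  interpret P: pair_sigma_finite lborel "gamma_vec I a" ..
  note [measurable] = measurable_normalize_vec[OF I]
  have jm [measurable]: "(\<lambda>z. z j) \<in> borel_measurable (PiM I (\<lambda>_. borel))"
    using j by measurable
  have "(\<integral>\<^sup>+z. ennreal (z j) * g z \<partial>Dir I a) = (\<integral>\<^sup>+z. ennreal (normalize_vec I z j) * g (normalize_vec I z) \<partial>gamma_vec I a)"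
    using I by (intro nn_integral_Dir) measurable
  \<comment> \<open>\<open>1 / S\<close> is the integral of the tilts by \<open>e\<^sup>-\<^sup>\<theta>\<^sup>S\<close>, where \<open>S\<close> is the sum of the \<open>z i\<close>\<close>
  also have "\<dots> = (\<integral>\<^sup>+z. \<integral>\<^sup>+\<theta>. (ennreal (z j) * g (normalize_vec I z)) * (ennreal (exp (- \<theta> * (\<Sum>i\<in>I. z i))) * indicator {0..} \<theta>) \<partial>lborel \<partial>gamma_vec I a)"
  proof (rule nn_integral_cong_AE)
    show "AE z in gamma_vec I a. ennreal (normalize_vec I z j) * g (normalize_vec I z) =
      (\<integral>\<^sup>+\<theta>. (ennreal (z j) * g (normalize_vec I z)) * (ennreal (exp (- \<theta> * (\<Sum>i\<in>I. z i))) * indicator {0..} \<theta>) \<partial>lborel)"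
      using AE_gamma_vec[where a=a and I=I, OF a I]
        AE_gamma_vec_sum_pos[where a=a and I=I, OF a I s[unfolded s_def]]
    proof eventually_elim
      case (elim z)
      then have "(\<integral>\<^sup>+\<theta>. (ennreal (z j) * g (normalize_vec I z)) * (ennreal (exp (- \<theta> * (\<Sum>i\<in>I. z i))) * indicator {0..} \<theta>) \<partial>lborel) =
         ennreal (z j) * g (normalize_vec I z) * ennreal (1 / (\<Sum>i\<in>I. z i))"
        by (intro nn_integral_cmult_exp_atLeast_0) simp
      also have "\<dots> = ennreal (z j * (1 / (\<Sum>i\<in>I. z i))) * g (normalize_vec I z)"
        using elim by (subst ennreal_mult'') (auto simp: mult_ac)
      finally show ?case using j by (simp add: normalize_vec_def)
    qed
  qed
  also have "\<dots> = (\<integral>\<^sup>+\<theta>. \<integral>\<^sup>+z. (ennreal (z j) * g (normalize_vec I z)) * (ennreal (exp (- \<theta> * (\<Sum>i\<in>I. z i))) * indicator {0..} \<theta>) \<partial>gamma_vec I a \<partial>lborel)"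
    by (rule P.Fubini') measurable
  also have "\<dots> = (\<integral>\<^sup>+\<theta>. ennreal (a j) * (\<integral>\<^sup>+z. g z \<partial>Dir I a') * (ennreal ((1 + \<theta>) powr (- s - 1)) * indicator {0..} \<theta>) \<partial>lborel)"
  proof (intro nn_integral_cong)
    fix \<theta> :: real
    show "(\<integral>\<^sup>+z. (ennreal (z j) * g (normalize_vec I z)) * (ennreal (exp (- \<theta> * (\<Sum>i\<in>I. z i))) * indicator {0..} \<theta>) \<partial>gamma_vec I a) =
      ennreal (a j) * (\<integral>\<^sup>+z. g z \<partial>Dir I a') * (ennreal ((1 + \<theta>) powr (- s - 1)) * indicator {0..} \<theta>)"
    proof (cases "\<theta> \<ge> 0")
      case True
      then have "(\<integral>\<^sup>+z. (ennreal (z j) * g (normalize_vec I z)) * (ennreal (exp (- \<theta> * (\<Sum>i\<in>I. z i))) * indicator {0..} \<theta>) \<partial>gamma_vec I a) =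
        (\<integral>\<^sup>+z. ennreal (z j) * (g (normalize_vec I z) * ennreal (exp (- \<theta> * (\<Sum>i\<in>I. z i)))) \<partial>gamma_vec I a)"
        by (simp add: mult.assoc)
      also have "\<dots> = ennreal (a j) * (\<integral>\<^sup>+z. g (normalize_vec I z) * ennreal (exp (- \<theta> * (\<Sum>i\<in>I. z i))) \<partial>gamma_vec I a')"
        unfolding a'_def using I j by (intro gamma_vec_size_bias a) measurable
      also have "(\<integral>\<^sup>+z. g (normalize_vec I z) * ennreal (exp (- \<theta> * (\<Sum>i\<in>I. z i))) \<partial>gamma_vec I a') =
        (\<integral>\<^sup>+z. g (normalize_vec I z) * ennreal (exp (- ((1 + \<theta>) - 1) * (\<Sum>i\<in>I. z i))) \<partial>gamma_vec I a')" by simp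
      also have "\<dots> = ennreal ((1 + \<theta>) powr (- (\<Sum>i\<in>I. a' i))) * (\<integral>\<^sup>+z. g (normalize_vec I (\<lambda>i\<in>I. z i / (1 + \<theta>))) \<partial>gamma_vec I a')"
        using True I by (intro gamma_vec_tilt a') (auto, measurable)
      also have "(\<lambda>z. g (normalize_vec I (\<lambda>i\<in>I. z i / (1 + \<theta>)))) = (\<lambda>z. g (normalize_vec I z))"
        using True by (intro ext arg_cong[where f=g])
          (auto simp: normalize_vec_def sum_divide_distrib[symmetric] intro!: restrict_ext)
      also have "(\<integral>\<^sup>+z. g (normalize_vec I z) \<partial>gamma_vec I a') = (\<integral>\<^sup>+z. g z \<partial>Dir I a')"
        using I by (intro nn_integral_Dir[symmetric]) auto
      finally show ?thesis using True by (simp add: sa' mult_ac)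
    qed simp
  qed
  also have "\<dots> = ennreal (a j) * (\<integral>\<^sup>+z. g z \<partial>Dir I a') * ennreal (1 / s)"
    using nn_integral_powr_atLeast_0[OF s] by (subst nn_integral_cmult) auto
  also have "\<dots> = ennreal (a j * (1 / s)) * (\<integral>\<^sup>+z. g z \<partial>Dir I a')"
    using s a by (subst ennreal_mult'') (auto simp: mult_ac)
  finally show ?thesis by (simp add: s_def a'_def)
qed

text \<open>Sum the size-biasing identity over all coordinates, which add up to one.\<close>

lemma Dir_mixture:
  assumes a: "\<And>i. a i \<ge> 0" and I: "finite I" and s: "(\<Sum>i\<in>I. a i) > 0"
    and g [measurable]: "g \<in> borel_measurable (PiM I (\<lambda>_. borel))"
  shows "(\<Sum>j\<in>I. ennreal (a j / (\<Sum>i\<in>I. a i)) * (\<integral>\<^sup>+z. g z \<partial>Dir I (a(j := a j + 1)))) = (\<integral>\<^sup>+z. g z \<partial>Dir I a)"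
proof -
  have "(\<Sum>j\<in>I. ennreal (a j / (\<Sum>i\<in>I. a i)) * (\<integral>\<^sup>+z. g z \<partial>Dir I (a(j := a j + 1)))) =
    (\<Sum>j\<in>I. (\<integral>\<^sup>+z. ennreal (z j) * g z \<partial>Dir I a))"
    using assms by (intro sum.cong refl Dir_size_bias[symmetric]) auto
  also have "\<dots> = (\<integral>\<^sup>+z. (\<Sum>j\<in>I. ennreal (z j) * g z) \<partial>Dir I a)"
    by (intro nn_integral_sum[symmetric]) measurable
  also have "\<dots> = (\<integral>\<^sup>+z. g z \<partial>Dir I a)"
  proof (rule nn_integral_cong_AE)
    show "AE z in Dir I a. (\<Sum>j\<in>I. ennreal (z j) * g z) = g z"
      using AE_Dir[where a=a and I=I, OF a I s]
      by eventually_elim (simp add: sum_distrib_right[symmetric] sum_ennreal)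
  qed
  finally show ?thesis .
qed

text \<open>The vector \<open>(z + r e\<^sub>j) / (1 + r)\<close>, where \<open>e\<^sub>j\<close> is the \<open>j\<close>-th unit vector.\<close>

definition stick_vec :: "'i set \<Rightarrow> 'i \<Rightarrow> real \<Rightarrow> ('i \<Rightarrow> real) \<Rightarrow> 'i \<Rightarrow> real" where
  "stick_vec I j r z = (\<lambda>i\<in>I. (z i + r * indicator {j} i) / (1 + r))"

lemma measurable_stick_vec [measurable]:
  "finite I \<Longrightarrow> (\<lambda>(r, z). stick_vec I j r z) \<in> borel \<Otimes>\<^sub>M PiM I (\<lambda>_. borel) \<rightarrow>\<^sub>M PiM I (\<lambda>_. borel)"
  unfolding stick_vec_def case_prod_beta' by measurable

text \<open>In terms of gamma variables, raising the \<open>j\<close>-th parameter by one adds an exponential variable \<open>y\<close> to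
\<open>z\<^sub>j\<close>. With \<open>y = S r\<close>, where \<open>S\<close> is the sum of the \<open>z\<^sub>i\<close>, the normalised vector turns into
\<open>stick_vec I j r\<close> of the old one. The factor \<open>S e\<^sup>-\<^sup>r\<^sup>S\<close> of this substitution is removed by
tilting, which yields the density of \<open>r\<close>, and by size-biasing over all coordinates, whose
mixture is the original Dirichlet law again.\<close>

lemma Dir_stick:
  assumes a: "\<And>i. a i \<ge> 0" and I: "finite I" and s: "(\<Sum>i\<in>I. a i) > 0" and j: "j \<in> I"
    and g [measurable]: "g \<in> borel_measurable (PiM I (\<lambda>_. borel))"
  shows "(\<integral>\<^sup>+r. \<integral>\<^sup>+z. g (stick_vec I j r z) \<partial>Dir I a \<partial>stick_law (\<Sum>i\<in>I. a i)) =
    (\<integral>\<^sup>+z. g z \<partial>Dir I (a(j := a j + 1)))"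
proof -
  define s where "s = (\<Sum>i\<in>I. a i)"
  have s: "s > 0" using assms by (simp add: s_def)
  define S where "S z = (\<Sum>i\<in>I. z i)" for z :: "'a \<Rightarrow> real"
  define G where "G r z = g (stick_vec I j r (normalize_vec I z))" for r z
  interpret G: prob_space "gamma_vec I a" using a by (rule prob_space_gamma_vec)
  interpret D: prob_space "Dir I a" using a I by (rule prob_space_Dir)
  interpret g1: prob_space "gamma_law 1" by (simp add: prob_space_gamma_law)
  interpret P: pair_sigma_finite lborel "gamma_vec I a" ..
  note [measurable] = measurable_normalize_vec[OF I]
  have jm [measurable]: "(\<lambda>z. z j) \<in> borel_measurable (PiM I (\<lambda>_. borel))"
    using j by measurable
  have Sm [measurable]: "S \<in> borel_measurable (PiM I (\<lambda>_. borel))" unfolding S_def by measurable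
  have stm: "(\<lambda>(r, z). stick_vec I j r z) \<in> borel \<Otimes>\<^sub>M PiM I (\<lambda>_. borel) \<rightarrow>\<^sub>M PiM I (\<lambda>_. borel)"
    using I by measurable
  have gst [measurable]: "(\<lambda>(r, z). g (stick_vec I j r z)) \<in> borel_measurable (borel \<Otimes>\<^sub>M PiM I (\<lambda>_. borel))"
    using measurable_compose[OF stm g] by (simp add: case_prod_beta)
  have Gm [measurable]: "(\<lambda>(r, z). G r z) \<in> borel_measurable (borel \<Otimes>\<^sub>M PiM I (\<lambda>_. borel))"
    unfolding G_def using gst by measurable
  have upd: "(\<lambda>(z, y). z(j := z j + y)) \<in> PiM I (\<lambda>_. borel) \<Otimes>\<^sub>M borel \<rightarrow>\<^sub>M PiM I (\<lambda>_. borel :: real measure)"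
    using j by (auto intro!: measurable_fun_upd[where J=I] simp: case_prod_beta' insert_absorb)
  have fm [measurable]: "(\<lambda>(z, y). g (normalize_vec I (z(j := z j + y)))) \<in> borel_measurable (PiM I (\<lambda>_. borel) \<Otimes>\<^sub>M borel)"
    using measurable_compose[OF measurable_compose[OF upd measurable_normalize_vec[OF I]] g] by (simp add: case_prod_beta)
  have "(\<integral>\<^sup>+z. g z \<partial>Dir I (a(j := a j + 1))) = (\<integral>\<^sup>+z. g (normalize_vec I z) \<partial>gamma_vec I (a(j := a j + 1)))"
    using I by (intro nn_integral_Dir) auto
  also have "\<dots> = (\<integral>\<^sup>+z. \<integral>\<^sup>+y. g (normalize_vec I (z(j := z j + y))) \<partial>gamma_law 1 \<partial>gamma_vec I a)"
    using I j by (intro gamma_vec_add_exponential[symmetric] a) measurable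
  also have "\<dots> = (\<integral>\<^sup>+z. \<integral>\<^sup>+r. ennreal (S z) * G r z * (ennreal (exp (- r * S z)) * indicator {0<..} r) \<partial>lborel \<partial>gamma_vec I a)"
  proof (rule nn_integral_cong_AE)
    show "AE z in gamma_vec I a. (\<integral>\<^sup>+y. g (normalize_vec I (z(j := z j + y))) \<partial>gamma_law 1) =
      (\<integral>\<^sup>+r. ennreal (S z) * G r z * (ennreal (exp (- r * S z)) * indicator {0<..} r) \<partial>lborel)"
      using AE_gamma_vec_sum_pos[where a=a and I=I, OF a I s[unfolded s_def]] AE_space
    proof eventually_elim
      case (elim z)
      then have S: "S z > 0" and z: "z \<in> space (PiM I (\<lambda>_. borel))" by (simp_all add: S_def space_gamma_vec)
      have [measurable]: "(\<lambda>y. g (normalize_vec I (z(j := z j + y)))) \<in> borel_measurable borel"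
        using measurable_compose[OF measurable_Pair1'[OF z] fm] by simp
      have "(\<integral>\<^sup>+y. g (normalize_vec I (z(j := z j + y))) \<partial>gamma_law 1) =
        (\<integral>\<^sup>+y. ennreal (exp (- y)) * g (normalize_vec I (z(j := z j + y))) * indicator {0<..} y \<partial>lborel)"
        by (rule nn_integral_gamma_law_1) measurable
      also have "\<dots> = (\<integral>\<^sup>+r. ennreal (S z) * (ennreal (exp (- (S z * r))) * g (normalize_vec I (z(j := z j + S z * r))) * indicator {0<..} r) \<partial>lborel)"
        using S by (intro nn_integral_scale_greaterThan_0) measurable
      also have "\<dots> = (\<integral>\<^sup>+r. ennreal (S z) * G r z * (ennreal (exp (- r * S z)) * indicator {0<..} r) \<partial>lborel)"
      proof (intro nn_integral_cong)
        fix r :: real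
        have *: "normalize_vec I (z(j := z j + S z * r)) = stick_vec I j r (normalize_vec I z)" if "r > 0"
        proof -
          have sm: "(\<Sum>i\<in>I. (z(j := z j + S z * r)) i) = S z * (1 + r)"
            using I j by (simp add: S_def sum.remove[of I j] algebra_simps)
          have "(z(j := z j + S z * r)) i / (S z * (1 + r)) = (z i / S z + r * indicator {j} i) / (1 + r)" for i
            using S that by (auto simp: indicator_def field_simps)
          then show ?thesis
            unfolding normalize_vec_def stick_vec_def sm by (auto simp: S_def intro!: restrict_ext)
        qed
        show "ennreal (S z) * (ennreal (exp (- (S z * r))) * g (normalize_vec I (z(j := z j + S z * r))) * indicator {0<..} r) =
          ennreal (S z) * G r z * (ennreal (exp (- r * S z)) * indicator {0<..} r)"
          using S * by (cases "r > 0") (simp_all add: G_def mult_ac)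
      qed
      finally show ?case .
    qed
  qed
  also have "\<dots> = (\<integral>\<^sup>+r. \<integral>\<^sup>+z. ennreal (S z) * G r z * (ennreal (exp (- r * S z)) * indicator {0<..} r) \<partial>gamma_vec I a \<partial>lborel)"
    by (rule P.Fubini') measurable
  also have "\<dots> = (\<integral>\<^sup>+r. ennreal (s * (1 + r) powr (- s - 1)) * (\<integral>\<^sup>+z. g (stick_vec I j r z) \<partial>Dir I a) * indicator {0<..} r \<partial>lborel)"
  proof (intro nn_integral_cong)
    fix r :: real
    show "(\<integral>\<^sup>+z. ennreal (S z) * G r z * (ennreal (exp (- r * S z)) * indicator {0<..} r) \<partial>gamma_vec I a) =
      ennreal (s * (1 + r) powr (- s - 1)) * (\<integral>\<^sup>+z. g (stick_vec I j r z) \<partial>Dir I a) * indicator {0<..} r"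
    proof (cases "r > 0")
      case True
      have [measurable]: "(\<lambda>z. g (stick_vec I j r z)) \<in> borel_measurable (PiM I (\<lambda>_. borel))"
        using measurable_compose[OF measurable_Pair1' gst, of r] by simp
      have [measurable]: "G r \<in> borel_measurable (PiM I (\<lambda>_. borel))"
        using measurable_compose[OF measurable_Pair1' Gm, of r] by simp
      have sc: "normalize_vec I (\<lambda>i\<in>I. z i / (1 + r)) = normalize_vec I z" for z
        using True by (auto simp: normalize_vec_def sum_divide_distrib[symmetric] intro!: restrict_ext)
      have S_sc: "S (\<lambda>i\<in>I. z i / (1 + r)) = 1 / (1 + r) * S z" for z
        by (simp add: S_def sum_divide_distrib[symmetric])
      have "(\<integral>\<^sup>+z. ennreal (S z) * G r z * (ennreal (exp (- r * S z)) * indicator {0<..} r) \<partial>gamma_vec I a) =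
        (\<integral>\<^sup>+z. (ennreal (S z) * G r z) * ennreal (exp (- ((1 + r) - 1) * (\<Sum>i\<in>I. z i))) \<partial>gamma_vec I a)"
        using True by (simp add: S_def)
      also have "\<dots> = ennreal ((1 + r) powr (- s)) * (\<integral>\<^sup>+z. ennreal (S (\<lambda>i\<in>I. z i / (1 + r))) * G r (\<lambda>i\<in>I. z i / (1 + r)) \<partial>gamma_vec I a)"
        unfolding s_def using True I by (intro gamma_vec_tilt a) (auto, measurable)
      also have "\<dots> = ennreal ((1 + r) powr (- s)) * (\<integral>\<^sup>+z. ennreal (1 / (1 + r)) * (ennreal (S z) * G r z) \<partial>gamma_vec I a)"
        unfolding S_sc G_def sc using True by (subst ennreal_mult') (auto simp: mult.assoc)
      also have "\<dots> = ennreal ((1 + r) powr (- s)) * (ennreal (1 / (1 + r)) * (\<integral>\<^sup>+z. ennreal (S z) * G r z \<partial>gamma_vec I a))"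
        by (subst nn_integral_cmult) auto
      also have "\<dots> = ennreal ((1 + r) powr (- s - 1)) * (\<integral>\<^sup>+z. ennreal (S z) * G r z \<partial>gamma_vec I a)"
        using True by (simp add: mult.assoc[symmetric] ennreal_mult''[symmetric] powr_diff)
      also have "(\<integral>\<^sup>+z. ennreal (S z) * G r z \<partial>gamma_vec I a) = (\<integral>\<^sup>+z. (\<Sum>k\<in>I. ennreal (z k) * G r z) \<partial>gamma_vec I a)"
      proof (rule nn_integral_cong_AE)
        show "AE z in gamma_vec I a. ennreal (S z) * G r z = (\<Sum>k\<in>I. ennreal (z k) * G r z)"
          using AE_gamma_vec[where a=a and I=I, OF a I]
          by eventually_elim (simp add: S_def sum_distrib_right[symmetric] sum_ennreal)
      qed
      also have "\<dots> = (\<Sum>k\<in>I. \<integral>\<^sup>+z. ennreal (z k) * G r z \<partial>gamma_vec I a)"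
      proof (rule nn_integral_sum)
        fix k assume "k \<in> I"
        then have [measurable]: "(\<lambda>z. z k) \<in> borel_measurable (PiM I (\<lambda>_. borel))"
          by (rule measurable_component_singleton)
        show "(\<lambda>z. ennreal (z k) * G r z) \<in> borel_measurable (gamma_vec I a)" by measurable
      qed
      also have "\<dots> = (\<Sum>k\<in>I. ennreal s * (ennreal (a k / s) * (\<integral>\<^sup>+z. g (stick_vec I j r z) \<partial>Dir I (a(k := a k + 1)))))"
      proof (intro sum.cong refl)
        fix k assume k: "k \<in> I"
        have "(\<integral>\<^sup>+z. ennreal (z k) * G r z \<partial>gamma_vec I a) = ennreal (a k) * (\<integral>\<^sup>+z. G r z \<partial>gamma_vec I (a(k := a k + 1)))"
          using I k by (intro gamma_vec_size_bias a) measurable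
        also have "(\<integral>\<^sup>+z. G r z \<partial>gamma_vec I (a(k := a k + 1))) = (\<integral>\<^sup>+z. g (stick_vec I j r z) \<partial>Dir I (a(k := a k + 1)))"
          unfolding G_def using I by (intro nn_integral_Dir[symmetric]) measurable
        also have "ennreal (a k) = ennreal s * ennreal (a k / s)"
          using s a by (simp add: ennreal_mult'[symmetric])
        finally show "(\<integral>\<^sup>+z. ennreal (z k) * G r z \<partial>gamma_vec I a) =
          ennreal s * (ennreal (a k / s) * (\<integral>\<^sup>+z. g (stick_vec I j r z) \<partial>Dir I (a(k := a k + 1))))"
          by (simp only: mult.assoc)
      qed
      also have "\<dots> = ennreal s * (\<integral>\<^sup>+z. g (stick_vec I j r z) \<partial>Dir I a)"
        unfolding sum_distrib_left[symmetric] s_def using I s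
        by (subst Dir_mixture[OF a]) (auto simp: s_def)
      finally show ?thesis
        using True s by (simp add: ennreal_mult mult_ac)
    qed simp
  qed
  also have "\<dots> = (\<integral>\<^sup>+r. \<integral>\<^sup>+z. g (stick_vec I j r z) \<partial>Dir I a \<partial>stick_law s)"
    by (rule nn_integral_stick_law[symmetric]) measurable
  finally show ?thesis by (simp add: s_def)
qed

section \<open>Uniqueness of stick-invariant laws\<close>

lemma measure_eqI_boxes:
  fixes Q Q' :: "('i \<Rightarrow> real) measure"
  assumes I: "finite I"
    and sets: "sets Q = sets (PiM I (\<lambda>_. borel))" "sets Q' = sets (PiM I (\<lambda>_. borel))"
    and fin: "finite_measure Q"
    and eq: "\<And>c. emeasure Q {z\<in>space (PiM I (\<lambda>_. borel)). \<forall>i\<in>I. z i \<le> c i} =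
        emeasure Q' {z\<in>space (PiM I (\<lambda>_. borel)). \<forall>i\<in>I. z i \<le> c i}"
  shows "Q = Q'"
proof -
  define box where "box c = {z\<in>space (PiM I (\<lambda>_. borel :: real measure)). \<forall>i\<in>I. z i \<le> c i}" for c
  define \<E> where "\<E> = range box"
  have sp: "space (PiM I (\<lambda>_. borel :: real measure)) = (\<Pi>\<^sub>E i\<in>I. UNIV)" by (simp add: space_PiM)
  have "sets (PiM I (\<lambda>_. borel :: real measure)) = sets (PiM I (\<lambda>_. sigma UNIV (range atMost)))"
    by (simp only: borel_eq_atMost)
  also have "\<dots> = sets (sigma (\<Pi>\<^sub>E i\<in>I. UNIV)
    {{f\<in>(\<Pi>\<^sub>E i\<in>I. UNIV). \<forall>i\<in>j. f i \<in> A i} | A j. j \<in> {I} \<and> A \<in> Pi j (\<lambda>_. range (atMost :: real \<Rightarrow> _))})"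
  proof (rule sets_PiM_sigma)
    fix i assume "i \<in> I"
    have "x \<in> (\<Union>n::nat. {..real n})" for x :: real using real_arch_simple[of x] by auto
    then have "UNIV = \<Union>(range (\<lambda>n::nat. {..real n}))" by auto
    then show "\<exists>S\<subseteq>range (atMost :: real \<Rightarrow> _). countable S \<and> UNIV = \<Union>S"
      by (intro exI[of _ "range (\<lambda>n::nat. {..real n})"]) auto
  qed (use I in auto)
  also have "{{f\<in>(\<Pi>\<^sub>E i\<in>I. UNIV). \<forall>i\<in>j. f i \<in> A i} | A j. j \<in> {I} \<and> A \<in> Pi j (\<lambda>_. range (atMost :: real \<Rightarrow> _))} = \<E>"
  proof (intro equalityI subsetI)
    fix X assume "X \<in> {{f\<in>(\<Pi>\<^sub>E i\<in>I. UNIV). \<forall>i\<in>j. f i \<in> A i} | A j. j \<in> {I} \<and> A \<in> Pi j (\<lambda>_. range (atMost :: real \<Rightarrow> _))}"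
    then obtain A where A: "A \<in> I \<rightarrow> range (atMost :: real \<Rightarrow> _)" "X = {f\<in>(\<Pi>\<^sub>E i\<in>I. UNIV). \<forall>i\<in>I. f i \<in> A i}"
      by auto
    then have "\<forall>i\<in>I. \<exists>c. A i = {..c}" by auto
    then obtain c where "\<forall>i\<in>I. A i = {..c i}" by metis
    then have "X = box c" unfolding A(2) box_def sp by auto
    then show "X \<in> \<E>" unfolding \<E>_def by blast
  next
    fix X assume "X \<in> \<E>"
    then obtain c where "X = box c" unfolding \<E>_def by blast
    then have "X = {f\<in>(\<Pi>\<^sub>E i\<in>I. UNIV). \<forall>i\<in>I. f i \<in> {..c i}}" by (auto simp: box_def sp)
    then show "X \<in> {{f\<in>(\<Pi>\<^sub>E i\<in>I. UNIV). \<forall>i\<in>j. f i \<in> A i} | A j. j \<in> {I} \<and> A \<in> Pi j (\<lambda>_. range (atMost :: real \<Rightarrow> _))}"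
      by (intro CollectI exI[of _ "\<lambda>i. {..c i}"] exI[of _ I]) auto
  qed
  also have "sets (sigma (\<Pi>\<^sub>E i\<in>I. UNIV) \<E>) = sigma_sets (space (PiM I (\<lambda>_. borel :: real measure))) \<E>"
    unfolding sp by (rule sets_measure_of) (auto simp: \<E>_def box_def sp)
  finally have sig: "sets (PiM I (\<lambda>_. borel :: real measure)) = sigma_sets (space (PiM I (\<lambda>_. borel :: real measure))) \<E>" .
  show ?thesis
  proof (rule measure_eqI_generator_eq[where E=\<E> and \<Omega>="space (PiM I (\<lambda>_. borel))" and A="\<lambda>n. box (\<lambda>_. real n)"])
    show "Int_stable \<E>"
      unfolding Int_stable_def
    proof (intro ballI)
      fix X Y assume "X \<in> \<E>" "Y \<in> \<E>"
      then obtain c c' where "X = box c" "Y = box c'" unfolding \<E>_def by blast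
      then have "X \<inter> Y = box (\<lambda>i. min (c i) (c' i))" by (auto simp: box_def)
      then show "X \<inter> Y \<in> \<E>" unfolding \<E>_def by blast
    qed
    show "\<E> \<subseteq> Pow (space (PiM I (\<lambda>_. borel)))" by (auto simp: \<E>_def box_def)
    show "range (\<lambda>n. box (\<lambda>_. real n)) \<subseteq> \<E>"
      unfolding \<E>_def by blast
    show "(\<Union>n. box (\<lambda>_. real n)) = space (PiM I (\<lambda>_. borel))"
    proof -
      have "\<exists>n::nat. \<forall>i\<in>I. z i \<le> real n" for z :: "'i \<Rightarrow> real"
      proof -
        obtain n where "Max (insert 0 (z ` I)) \<le> real n" using real_arch_simple by blast
        then show ?thesis using I by (intro exI[of _ n]) auto
      qed
      then show ?thesis unfolding box_def by blast
    qed
    show "emeasure Q (box (\<lambda>_. real i)) \<noteq> \<infinity>" for i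
      using finite_measure.emeasure_finite[OF fin] by simp
    show "sets Q = sigma_sets (space (PiM I (\<lambda>_. borel))) \<E>" "sets Q' = sigma_sets (space (PiM I (\<lambda>_. borel))) \<E>"
      using sets sig by simp_all
    show "emeasure Q X = emeasure Q' X" if "X \<in> \<E>" for X
      using that eq by (auto simp: \<E>_def box_def)
  qed
qed

text \<open>The transition operator of the Markov chain that replaces \<open>z\<close> by \<open>stick_vec I j r z\<close>, with \<open>j\<close>
chosen according to \<open>p\<close> and an independent \<open>r\<close>.\<close>

definition stick_step :: "'i set \<Rightarrow> real \<Rightarrow> ('i \<Rightarrow> real) \<Rightarrow> (('i \<Rightarrow> real) \<Rightarrow> real) \<Rightarrow> ('i \<Rightarrow> real) \<Rightarrow> real" where
  "stick_step I s p g z = (\<Sum>j\<in>I. p j * (\<integral>r. g (stick_vec I j r z) \<partial>stick_law s))"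

text \<open>Two vectors that are moved with the same \<open>j\<close> and \<open>r\<close> approach each other by the factor \<open>1 / (1 + r)\<close>,
whose mean is \<open>s / (s + 1)\<close>.\<close>

lemma stick_step:
  fixes g :: "('i \<Rightarrow> real) \<Rightarrow> real"
  assumes I: "finite I" and s: "s > 0" and p: "\<And>j. j \<in> I \<Longrightarrow> 0 \<le> p j" "(\<Sum>j\<in>I. p j) = 1"
    and g [measurable]: "g \<in> borel_measurable (PiM I (\<lambda>_. borel))" and g01: "\<And>z. 0 \<le> g z" "\<And>z. g z \<le> 1"
  shows measurable_stick_step: "stick_step I s p g \<in> borel_measurable (PiM I (\<lambda>_. borel))"
    and stick_step_nonneg: "0 \<le> stick_step I s p g z"
    and stick_step_le_1: "z \<in> space (PiM I (\<lambda>_. borel)) \<Longrightarrow> stick_step I s p g z \<le> 1"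
    and stick_step_lipschitz: "\<lbrakk>\<And>z z'. \<bar>g z - g z'\<bar> \<le> L * (\<Sum>i\<in>I. \<bar>z i - z' i\<bar>);
        z \<in> space (PiM I (\<lambda>_. borel)); z' \<in> space (PiM I (\<lambda>_. borel))\<rbrakk> \<Longrightarrow>
      \<bar>stick_step I s p g z - stick_step I s p g z'\<bar> \<le> s / (s + 1) * L * (\<Sum>i\<in>I. \<bar>z i - z' i\<bar>)"
proof -
  interpret S: prob_space "stick_law s" using s by (rule prob_space_stick_law)
  have stm: "(\<lambda>(r, z). stick_vec I j r z) \<in> borel \<Otimes>\<^sub>M PiM I (\<lambda>_. borel) \<rightarrow>\<^sub>M PiM I (\<lambda>_. borel)" for j
    using I by measurable
  have gst: "(\<lambda>(r, z). g (stick_vec I j r z)) \<in> borel_measurable (borel \<Otimes>\<^sub>M PiM I (\<lambda>_. borel))" for j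
    using measurable_compose[OF stm g] by (simp add: case_prod_beta)
  have gst' [measurable]: "(\<lambda>(z, r). g (stick_vec I j r z)) \<in> borel_measurable (PiM I (\<lambda>_. borel) \<Otimes>\<^sub>M stick_law s)" for j
    using measurable_compose[OF measurable_pair_swap' gst[of j]]
    by (simp add: case_prod_beta' cong: measurable_cong_sets sets_pair_measure_cong)
  show "stick_step I s p g \<in> borel_measurable (PiM I (\<lambda>_. borel))"
    unfolding stick_step_def
    by (intro borel_measurable_sum borel_measurable_times borel_measurable_const S.borel_measurable_lebesgue_integral gst')
  have gr: "(\<lambda>r. g (stick_vec I j r z)) \<in> borel_measurable (stick_law s)" if "z \<in> space (PiM I (\<lambda>_. borel))" for j z
    using measurable_compose[OF measurable_Pair2'[OF that] gst[of j]] by (simp cong: measurable_cong_sets)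
  have int: "integrable (stick_law s) (\<lambda>r. g (stick_vec I j r z))" if "z \<in> space (PiM I (\<lambda>_. borel))" for j z
    using g01 gr[OF that] by (intro S.integrable_const_bound[where B=1]) auto
  show "0 \<le> stick_step I s p g z"
    unfolding stick_step_def using p g01 by (intro sum_nonneg mult_nonneg_nonneg) auto
  show "stick_step I s p g z \<le> 1" if z: "z \<in> space (PiM I (\<lambda>_. borel))"
  proof -
    have "(\<integral>r. g (stick_vec I j r z) \<partial>stick_law s) \<le> 1" for j
      using g01 int[OF z] by (intro S.integral_le_const) auto
    then have "stick_step I s p g z \<le> (\<Sum>j\<in>I. p j * 1)"
      unfolding stick_step_def using p by (intro sum_mono mult_left_mono) auto
    then show ?thesis using p by simp
  qed
  assume L: "\<And>z z'. \<bar>g z - g z'\<bar> \<le> L * (\<Sum>i\<in>I. \<bar>z i - z' i\<bar>)"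
    and z: "z \<in> space (PiM I (\<lambda>_. borel))" "z' \<in> space (PiM I (\<lambda>_. borel))"
  define D where "D = (\<Sum>i\<in>I. \<bar>z i - z' i\<bar>)"
  have intr: "integrable (stick_law s) (\<lambda>r. 1 / (1 + r))"
  proof (rule S.integrable_const_bound[where B=1])
    show "AE r in stick_law s. norm (1 / (1 + r)) \<le> 1"
      using AE_stick_law_pos by eventually_elim simp
  qed simp
  define C where "C = s / (s + 1) * L * D"
  have j: "\<bar>(\<integral>r. g (stick_vec I j r z) \<partial>stick_law s) - (\<integral>r. g (stick_vec I j r z') \<partial>stick_law s)\<bar> \<le> C" for j
  proof -
    have "\<bar>(\<integral>r. g (stick_vec I j r z) \<partial>stick_law s) - (\<integral>r. g (stick_vec I j r z') \<partial>stick_law s)\<bar> =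
      \<bar>\<integral>r. g (stick_vec I j r z) - g (stick_vec I j r z') \<partial>stick_law s\<bar>"
      using int z by (subst Bochner_Integration.integral_diff) auto
    also have "\<dots> \<le> (\<integral>r. \<bar>g (stick_vec I j r z) - g (stick_vec I j r z')\<bar> \<partial>stick_law s)"
      by (rule integral_abs_bound)
    also have "\<dots> \<le> (\<integral>r. L * D * (1 / (1 + r)) \<partial>stick_law s)"
    proof (rule integral_mono_AE)
      show "AE r in stick_law s. \<bar>g (stick_vec I j r z) - g (stick_vec I j r z')\<bar> \<le> L * D * (1 / (1 + r))"
        using AE_stick_law_pos
      proof eventually_elim
        case (elim r)
        have "\<bar>g (stick_vec I j r z) - g (stick_vec I j r z')\<bar> \<le> L * (\<Sum>i\<in>I. \<bar>stick_vec I j r z i - stick_vec I j r z' i\<bar>)"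
          by (rule L)
        also have "(\<Sum>i\<in>I. \<bar>stick_vec I j r z i - stick_vec I j r z' i\<bar>) = D / (1 + r)"
          unfolding D_def sum_divide_distrib using elim
          by (intro sum.cong) (auto simp: stick_vec_def diff_divide_distrib[symmetric] abs_divide)
        finally show ?case by simp
      qed
      show "integrable (stick_law s) (\<lambda>r. \<bar>g (stick_vec I j r z) - g (stick_vec I j r z')\<bar>)"
        using int z by auto
      show "integrable (stick_law s) (\<lambda>r. L * D * (1 / (1 + r)))" using intr by (rule integrable_mult_right)
    qed
    also have "\<dots> = C"
      unfolding C_def using integral_stick_law[OF s] by (simp only: integral_mult_right_zero) simp
    finally show ?thesis .
  qed
  have "\<bar>stick_step I s p g z - stick_step I s p g z'\<bar> =
    \<bar>\<Sum>j\<in>I. p j * ((\<integral>r. g (stick_vec I j r z) \<partial>stick_law s) - (\<integral>r. g (stick_vec I j r z') \<partial>stick_law s))\<bar>"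
    unfolding stick_step_def by (simp add: sum_subtractf right_diff_distrib)
  also have "\<dots> \<le> (\<Sum>j\<in>I. \<bar>p j * ((\<integral>r. g (stick_vec I j r z) \<partial>stick_law s) - (\<integral>r. g (stick_vec I j r z') \<partial>stick_law s))\<bar>)"
    by (rule sum_abs)
  also have "\<dots> \<le> (\<Sum>j\<in>I. p j * C)"
    using p j by (intro sum_mono) (auto simp: abs_mult intro!: mult_left_mono)
  also have "\<dots> = C" using p by (simp add: sum_distrib_right[symmetric])
  finally show "\<bar>stick_step I s p g z - stick_step I s p g z'\<bar> \<le> s / (s + 1) * L * (\<Sum>i\<in>I. \<bar>z i - z' i\<bar>)"
    by (simp add: C_def D_def)
qed

text \<open>Invariance under the chain is stated for nonnegative functions because this is the form in which it
is verified; boundedness of the coordinates excludes no law of interest and starts the contraction.\<close>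

definition stick_invariant :: "'i set \<Rightarrow> real \<Rightarrow> ('i \<Rightarrow> real) \<Rightarrow> ('i \<Rightarrow> real) measure \<Rightarrow> bool" where
  "stick_invariant I s p Q \<longleftrightarrow> prob_space Q \<and> sets Q = sets (PiM I (\<lambda>_. borel)) \<and>
     (AE z in Q. \<forall>i\<in>I. \<bar>z i\<bar> \<le> 1) \<and>
     (\<forall>g\<in>borel_measurable (PiM I (\<lambda>_. borel)).
        (\<Sum>j\<in>I. ennreal (p j) * (\<integral>\<^sup>+r. \<integral>\<^sup>+z. g (stick_vec I j r z) \<partial>Q \<partial>stick_law s)) = (\<integral>\<^sup>+z. g z \<partial>Q))"

lemma integral_stick_step:
  assumes I: "finite I" and s: "s > 0" and p: "\<And>j. j \<in> I \<Longrightarrow> 0 \<le> p j" "(\<Sum>j\<in>I. p j) = 1"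
    and Q: "stick_invariant I s p Q"
    and g [measurable]: "g \<in> borel_measurable (PiM I (\<lambda>_. borel))" and g01: "\<And>z. 0 \<le> g z" "\<And>z. g z \<le> 1"
  shows "(\<integral>z. stick_step I s p g z \<partial>Q) = (\<integral>z. g z \<partial>Q)"
proof -
  interpret Q: prob_space Q using Q by (simp add: stick_invariant_def)
  have sQ [measurable_cong, simp]: "sets Q = sets (PiM I (\<lambda>_. borel))" using Q by (simp add: stick_invariant_def)
  have spQ: "space Q = space (PiM I (\<lambda>_. borel))" using sQ by (rule sets_eq_imp_space_eq)
  interpret S: prob_space "stick_law s" using s by (rule prob_space_stick_law)
  interpret P: pair_sigma_finite "stick_law s" Q ..
  have stm: "(\<lambda>(r, z). stick_vec I j r z) \<in> borel \<Otimes>\<^sub>M PiM I (\<lambda>_. borel) \<rightarrow>\<^sub>M PiM I (\<lambda>_. borel)" for j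
    using I by measurable
  have gst [measurable]: "(\<lambda>(r, z). g (stick_vec I j r z)) \<in> borel_measurable (borel \<Otimes>\<^sub>M PiM I (\<lambda>_. borel))" for j
    using measurable_compose[OF stm g] by (simp add: case_prod_beta)
  have gr: "(\<lambda>r. g (stick_vec I j r z)) \<in> borel_measurable (stick_law s)" if "z \<in> space (PiM I (\<lambda>_. borel))" for j z
    using measurable_compose[OF measurable_Pair2'[OF that] gst[of j]] by (simp cong: measurable_cong_sets)
  have int: "integrable (stick_law s) (\<lambda>r. g (stick_vec I j r z))" if "z \<in> space (PiM I (\<lambda>_. borel))" for j z
    using g01 gr[OF that] by (intro S.integrable_const_bound[where B=1]) auto
  note st = stick_step[OF I s p g g01]
  have "ennreal (\<integral>z. g z \<partial>Q) = (\<integral>\<^sup>+z. ennreal (g z) \<partial>Q)"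
    using g01 by (intro nn_integral_eq_integral[symmetric] Q.integrable_const_bound[where B=1]) auto
  also have "\<dots> = (\<Sum>j\<in>I. ennreal (p j) * (\<integral>\<^sup>+r. \<integral>\<^sup>+z. ennreal (g (stick_vec I j r z)) \<partial>Q \<partial>stick_law s))"
  proof -
    have inv: "\<forall>g\<in>borel_measurable (PiM I (\<lambda>_. borel)).
        (\<Sum>j\<in>I. ennreal (p j) * (\<integral>\<^sup>+r. \<integral>\<^sup>+z. g (stick_vec I j r z) \<partial>Q \<partial>stick_law s)) = (\<integral>\<^sup>+z. g z \<partial>Q)"
      using Q by (simp add: stick_invariant_def)
    have "(\<lambda>z. ennreal (g z)) \<in> borel_measurable (PiM I (\<lambda>_. borel))" by measurable
    from bspec[OF inv this] show ?thesis by (rule sym)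
  qed
  also have "\<dots> = (\<Sum>j\<in>I. ennreal (p j) * (\<integral>\<^sup>+z. \<integral>\<^sup>+r. ennreal (g (stick_vec I j r z)) \<partial>stick_law s \<partial>Q))"
    by (intro sum.cong refl arg_cong2[where f="(*)"] P.Fubini'[symmetric]) measurable
  also have "\<dots> = (\<Sum>j\<in>I. \<integral>\<^sup>+z. ennreal (p j) * (\<integral>\<^sup>+r. ennreal (g (stick_vec I j r z)) \<partial>stick_law s) \<partial>Q)"
    by (intro sum.cong refl nn_integral_cmult[symmetric]) measurable
  also have "\<dots> = (\<integral>\<^sup>+z. (\<Sum>j\<in>I. ennreal (p j) * (\<integral>\<^sup>+r. ennreal (g (stick_vec I j r z)) \<partial>stick_law s)) \<partial>Q)"
    by (intro nn_integral_sum[symmetric]) measurable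
  also have "\<dots> = (\<integral>\<^sup>+z. ennreal (stick_step I s p g z) \<partial>Q)"
  proof (intro nn_integral_cong)
    fix z assume "z \<in> space Q"
    then have z: "z \<in> space (PiM I (\<lambda>_. borel))" by (simp add: spQ)
    have "ennreal (p j) * (\<integral>\<^sup>+r. ennreal (g (stick_vec I j r z)) \<partial>stick_law s) =
      ennreal (p j * (\<integral>r. g (stick_vec I j r z) \<partial>stick_law s))" if "j \<in> I" for j
      using p(1)[OF that] g01 int[OF z] by (subst nn_integral_eq_integral) (auto simp: ennreal_mult)
    then show "(\<Sum>j\<in>I. ennreal (p j) * (\<integral>\<^sup>+r. ennreal (g (stick_vec I j r z)) \<partial>stick_law s)) = ennreal (stick_step I s p g z)"
      using p(1) g01 unfolding stick_step_def by (subst sum_ennreal[symmetric]) auto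
  qed
  also have "\<dots> = ennreal (\<integral>z. stick_step I s p g z \<partial>Q)"
  proof (intro nn_integral_eq_integral Q.integrable_const_bound[where B=1] AE_I2)
    fix z assume "z \<in> space Q"
    then show "norm (stick_step I s p g z) \<le> 1" using st(2)[of z] st(3)[of z] by (simp add: spQ)
  qed (use st(1,2) in \<open>auto cong: measurable_cong_sets\<close>)
  finally have "ennreal (\<integral>z. g z \<partial>Q) = ennreal (\<integral>z. stick_step I s p g z \<partial>Q)" .
  moreover have "0 \<le> (\<integral>z. g z \<partial>Q)" "0 \<le> (\<integral>z. stick_step I s p g z \<partial>Q)"
    using g01 st(2) by (auto intro!: integral_nonneg)
  ultimately show ?thesis by (simp add: ennreal_inj)
qed

text \<open>Replacing a Lipschitz function \<open>g\<close> by \<open>stick_step I s p g\<close> changes neither integral but reduces the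
Lipschitz constant by the factor \<open>s / (s + 1)\<close>.\<close>

lemma stick_invariant_lipschitz:
  assumes I: "finite I" and s: "s > 0" and p: "\<And>j. j \<in> I \<Longrightarrow> 0 \<le> p j" "(\<Sum>j\<in>I. p j) = 1"
    and Q: "stick_invariant I s p Q" and Q': "stick_invariant I s p Q'"
    and g [measurable]: "g \<in> borel_measurable (PiM I (\<lambda>_. borel))" and g01: "\<And>z. 0 \<le> g z" "\<And>z. g z \<le> 1"
    and ext: "\<And>z. g (restrict z I) = g z"
    and L: "\<And>z z'. \<bar>g z - g z'\<bar> \<le> L * (\<Sum>i\<in>I. \<bar>z i - z' i\<bar>)" "0 \<le> L"
  shows "\<bar>(\<integral>z. g z \<partial>Q) - (\<integral>z. g z \<partial>Q')\<bar> \<le> 2 * (s / (s + 1)) ^ n * L * real (card I)"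
  using g g01 ext L
proof (induction n arbitrary: g L)
  case 0
  have *: "\<bar>(\<integral>z. g z \<partial>R) - g (\<lambda>_. 0)\<bar> \<le> L * real (card I)" if R: "stick_invariant I s p R" for R
  proof -
    interpret R: prob_space R using R by (simp add: stick_invariant_def)
    have sR: "sets R = sets (PiM I (\<lambda>_. borel))" using R by (simp add: stick_invariant_def)
    have gR: "g \<in> borel_measurable R" using 0(1) sR by (simp cong: measurable_cong_sets)
    have int: "integrable R g" using 0(2,3) gR by (intro R.integrable_const_bound[where B=1]) auto
    have AE: "AE z in R. \<forall>i\<in>I. \<bar>z i\<bar> \<le> 1" using R by (simp add: stick_invariant_def)
    have "\<bar>(\<integral>z. g z \<partial>R) - g (\<lambda>_. 0)\<bar> = \<bar>\<integral>z. g z - g (\<lambda>_. 0) \<partial>R\<bar>"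
      using int by (simp add: R.prob_space)
    also have "\<dots> \<le> (\<integral>z. \<bar>g z - g (\<lambda>_. 0)\<bar> \<partial>R)" by (rule integral_abs_bound)
    also have "\<dots> \<le> L * real (card I)"
    proof (rule R.integral_le_const)
      show "AE z in R. \<bar>g z - g (\<lambda>_. 0)\<bar> \<le> L * real (card I)"
        using AE
      proof eventually_elim
        case (elim z)
        have "\<bar>g z - g (\<lambda>_. 0)\<bar> \<le> L * (\<Sum>i\<in>I. \<bar>z i - 0\<bar>)" by (rule 0(5))
        also have "\<dots> \<le> L * (\<Sum>i\<in>I. 1)" using elim 0(6) by (intro mult_left_mono sum_mono) auto
        finally show ?case by simp
      qed
    qed (use int in auto)
    finally show ?thesis .
  qed
  show ?case using *[OF Q] *[OF Q'] by simp
next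
  case (Suc n)
  have cut: "restrict z I \<in> space (PiM I (\<lambda>_. borel))" for z :: "'a \<Rightarrow> real" by (simp add: space_PiM)
  define h where "h z = stick_step I s p g (restrict z I)" for z
  have st1: "stick_step I s p g \<in> borel_measurable (PiM I (\<lambda>_. borel))"
    by (rule measurable_stick_step[OF I s p Suc.prems(1-3)])
  have st2: "0 \<le> stick_step I s p g z" for z
    by (rule stick_step_nonneg[OF I s p Suc.prems(1-3)])
  have st3: "stick_step I s p g z \<le> 1" if "z \<in> space (PiM I (\<lambda>_. borel))" for z
    by (rule stick_step_le_1[OF I s p Suc.prems(1-3) that])
  have st4: "\<bar>stick_step I s p g (restrict z I) - stick_step I s p g (restrict z' I)\<bar>
      \<le> s / (s + 1) * L * (\<Sum>i\<in>I. \<bar>restrict z I i - restrict z' I i\<bar>)" for z z'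
    by (rule stick_step_lipschitz[OF I s p Suc.prems(1-3,5) cut cut])
  have hz: "h z = stick_step I s p g z" if "z \<in> space (PiM I (\<lambda>_. borel))" for z
    using that by (simp add: h_def space_PiM PiE_restrict)
  have hm: "h \<in> borel_measurable (PiM I (\<lambda>_. borel))"
    using st1 by (subst measurable_cong[OF hz]) auto
  have hQ: "(\<integral>z. h z \<partial>R) = (\<integral>z. g z \<partial>R)" if R: "stick_invariant I s p R" for R
  proof -
    have "sets R = sets (PiM I (\<lambda>_. borel))" using R by (simp add: stick_invariant_def)
    then have "space R = space (PiM I (\<lambda>_. borel))" by (rule sets_eq_imp_space_eq)
    then have "(\<integral>z. h z \<partial>R) = (\<integral>z. stick_step I s p g z \<partial>R)"
      by (intro Bochner_Integration.integral_cong) (auto simp: hz)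
    then show ?thesis using integral_stick_step[OF I s p R Suc.prems(1-3)] by simp
  qed
  have "\<bar>(\<integral>z. h z \<partial>Q) - (\<integral>z. h z \<partial>Q')\<bar> \<le> 2 * (s / (s + 1)) ^ n * (s / (s + 1) * L) * real (card I)"
  proof (rule Suc.IH)
    show "0 \<le> h z" "h z \<le> 1" "h (restrict z I) = h z" for z
      using st2 st3[OF cut] by (auto simp: h_def)
    show "\<bar>h z - h z'\<bar> \<le> s / (s + 1) * L * (\<Sum>i\<in>I. \<bar>z i - z' i\<bar>)" for z z'
      using st4[of z z'] unfolding h_def by (simp only: restrict_apply' cong: sum.cong)
  qed (use hm s Suc.prems in auto)
  then show ?case by (simp add: hQ Q Q' mult_ac)
qed

text \<open>By contraction two invariant laws integrate Lipschitz functions in the same way, and the indicator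
of a box is a limit of bounded Lipschitz functions.\<close>

lemma stick_invariant_unique:
  assumes I: "finite I" and s: "s > 0" and p: "\<And>j. j \<in> I \<Longrightarrow> 0 \<le> p j" "(\<Sum>j\<in>I. p j) = 1"
    and Q: "stick_invariant I s p Q" and Q': "stick_invariant I s p Q'"
  shows "Q = Q'"
proof (rule measure_eqI_boxes[OF I])
  show sets: "sets Q = sets (PiM I (\<lambda>_. borel))" "sets Q' = sets (PiM I (\<lambda>_. borel))"
    using Q Q' by (auto simp: stick_invariant_def)
  show "finite_measure Q" using Q by (simp add: stick_invariant_def prob_space.finite_measure)
  fix c
  define box where "box = {z\<in>space (PiM I (\<lambda>_. borel)). \<forall>i\<in>I. z i \<le> (c i :: real)}"
  have box: "box \<in> sets (PiM I (\<lambda>_. borel))" unfolding box_def using I by measurable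
  \<comment> \<open>\<open>e\<close> is the distance to the box, so that the Lipschitz functions \<open>g k\<close> decrease to its indicator\<close>
  define e where "e z = (\<Sum>i\<in>I. max 0 (z i - c i))" for z
  define g where "g k z = max 0 (1 - real k * e z)" for k z
  have em [measurable]: "e \<in> borel_measurable (PiM I (\<lambda>_. borel))" unfolding e_def by measurable
  have gm [measurable]: "g k \<in> borel_measurable (PiM I (\<lambda>_. borel))" for k unfolding g_def by measurable
  have e0: "0 \<le> e z" for z unfolding e_def by (intro sum_nonneg) auto
  have g01: "0 \<le> g k z" "g k z \<le> 1" for k z using e0[of z] by (auto simp: g_def)
  have eL: "\<bar>e z - e z'\<bar> \<le> (\<Sum>i\<in>I. \<bar>z i - z' i\<bar>)" for z z'
    unfolding e_def sum_subtractf[symmetric] by (rule order_trans[OF sum_abs]) (auto intro!: sum_mono)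
  have gL: "\<bar>g k z - g k z'\<bar> \<le> real k * (\<Sum>i\<in>I. \<bar>z i - z' i\<bar>)" for k z z'
  proof -
    have "\<bar>g k z - g k z'\<bar> \<le> \<bar>real k * e z - real k * e z'\<bar>" by (auto simp: g_def)
    also have "\<dots> = real k * \<bar>e z - e z'\<bar>" by (simp add: abs_mult flip: right_diff_distrib)
    also have "\<dots> \<le> real k * (\<Sum>i\<in>I. \<bar>z i - z' i\<bar>)" using eL by (intro mult_left_mono) auto
    finally show ?thesis .
  qed
  have gr: "g k (restrict z I) = g k z" for k z by (simp add: g_def e_def)
  have eq: "(\<integral>z. g k z \<partial>Q) = (\<integral>z. g k z \<partial>Q')" for k
  proof -
    have "(\<lambda>n. 2 * (s / (s + 1)) ^ n * real k * real (card I)) \<longlonglongrightarrow> 2 * 0 * real k * real (card I)"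
      using s by (intro tendsto_intros LIMSEQ_realpow_zero) auto
    then have "\<bar>(\<integral>z. g k z \<partial>Q) - (\<integral>z. g k z \<partial>Q')\<bar> \<le> 2 * 0 * real k * real (card I)"
      using stick_invariant_lipschitz[OF I s p Q Q' gm g01 gr gL] by (intro LIMSEQ_le_const) auto
    then show ?thesis by simp
  qed
  have lim: "(\<lambda>k. \<integral>z. g k z \<partial>R) \<longlonglongrightarrow> measure R box" if R: "stick_invariant I s p R" for R
  proof -
    interpret R: prob_space R using R by (simp add: stick_invariant_def)
    have sR [measurable_cong, simp]: "sets R = sets (PiM I (\<lambda>_. borel))" using R by (simp add: stick_invariant_def)
    have spR: "space R = space (PiM I (\<lambda>_. borel))" using sR by (rule sets_eq_imp_space_eq)
    have "(\<lambda>k. \<integral>z. g k z \<partial>R) \<longlonglongrightarrow> (\<integral>z. indicator box z \<partial>R)"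
    proof (rule integral_dominated_convergence[where w="\<lambda>_. 1"])
      show "AE z in R. (\<lambda>k. g k z) \<longlonglongrightarrow> indicator box z"
      proof (rule AE_I2)
        fix z assume "z \<in> space R"
        then have z: "z \<in> space (PiM I (\<lambda>_. borel))" by (simp add: spR)
        show "(\<lambda>k. g k z) \<longlonglongrightarrow> indicator box z"
        proof (cases "z \<in> box")
          case True
          then have "e z = 0" by (auto simp: e_def box_def intro!: sum.neutral)
          then show ?thesis using True by (simp add: g_def)
        next
          case False
          then obtain i where i: "i \<in> I" "c i < z i" using z by (auto simp: box_def not_le)
          have "0 < max 0 (z i - c i)" using i by simp
          also have "\<dots> \<le> e z" unfolding e_def using I i by (intro member_le_sum) auto
          finally have pos: "0 < e z" .
          obtain K where K: "1 / e z \<le> real K" using real_arch_simple by blast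
          have "\<forall>\<^sub>F k in sequentially. g k z = 0"
            using eventually_ge_at_top[of K]
          proof eventually_elim
            case (elim k)
            then have "1 / e z \<le> real k" using K by linarith
            then have "1 \<le> real k * e z" using pos by (simp add: field_simps)
            then show ?case by (simp add: g_def)
          qed
          then show ?thesis using False by (simp add: tendsto_eventually)
        qed
      qed
      show "AE z in R. norm (g k z) \<le> 1" for k using g01 by simp
    qed (use box in auto)
    then show ?thesis using box by simp
  qed
  have "measure Q box = measure Q' box"
    using lim[OF Q] lim[OF Q'] unfolding eq by (rule LIMSEQ_unique)
  then show "emeasure Q {z\<in>space (PiM I (\<lambda>_. borel)). \<forall>i\<in>I. z i \<le> c i} =
        emeasure Q' {z\<in>space (PiM I (\<lambda>_. borel)). \<forall>i\<in>I. z i \<le> c i}"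
    using Q Q' unfolding box_def[symmetric] stick_invariant_def
    by (simp add: finite_measure.emeasure_eq_measure prob_space.finite_measure)
qed

lemma stick_invariant_Dir:
  assumes a: "\<And>i. a i \<ge> 0" and I: "finite I" and s: "(\<Sum>i\<in>I. a i) > 0"
  shows "stick_invariant I (\<Sum>i\<in>I. a i) (\<lambda>j. a j / (\<Sum>i\<in>I. a i)) (Dir I a)"
  unfolding stick_invariant_def
proof (intro conjI ballI)
  show "prob_space (Dir I a)" using a I by (rule prob_space_Dir)
  show "AE z in Dir I a. \<forall>i\<in>I. \<bar>z i\<bar> \<le> 1"
    using AE_Dir[where a=a and I=I, OF a I s]
  proof eventually_elim
    case (elim z)
    show ?case
    proof
      fix i assume i: "i \<in> I"
      have "z i \<le> (\<Sum>i\<in>I. z i)" using elim I i by (intro member_le_sum) auto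
      then show "\<bar>z i\<bar> \<le> 1" using elim i by simp
    qed
  qed
  fix g :: "('a \<Rightarrow> real) \<Rightarrow> ennreal" assume g: "g \<in> borel_measurable (PiM I (\<lambda>_. borel))"
  have "(\<Sum>j\<in>I. ennreal (a j / sum a I) * (\<integral>\<^sup>+r. \<integral>\<^sup>+z. g (stick_vec I j r z) \<partial>Dir I a \<partial>stick_law (sum a I))) =
    (\<Sum>j\<in>I. ennreal (a j / sum a I) * (\<integral>\<^sup>+z. g z \<partial>Dir I (a(j := a j + 1))))"
    by (intro sum.cong refl arg_cong2[where f="(*)"] Dir_stick[OF a I s _ g])
  also have "\<dots> = (\<integral>\<^sup>+z. g z \<partial>Dir I a)" using a I s g by (rule Dir_mixture)
  finally show "(\<Sum>j\<in>I. ennreal (a j / sum a I) * (\<integral>\<^sup>+r. \<integral>\<^sup>+z. g (stick_vec I j r z) \<partial>Dir I a \<partial>stick_law (sum a I))) =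
    (\<integral>\<^sup>+z. g z \<partial>Dir I a)" .
qed simp

section \<open>Sums of Borel measures\<close>

lemma sets_add_measure [simp, measurable_cong]: "sets (add_measure \<alpha> \<beta>) = sets borel"
  using sets.sigma_sets_eq[of "borel :: 'a measure"] by (simp add: add_measure_def)

lemma space_add_measure [simp]: "space (add_measure \<alpha> \<beta>) = UNIV"
  by (simp add: add_measure_def space_measure_of_conv)

lemma sets_sum_measure [simp, measurable_cong]: "sets (sum_measure I \<alpha>) = sets borel"
  using sets.sigma_sets_eq[of "borel :: 'a measure"] by (simp add: sum_measure_def)

lemma space_sum_measure [simp]: "space (sum_measure I \<alpha>) = UNIV"
  by (simp add: sum_measure_def space_measure_of_conv)

lemma emeasure_add_measure:
  assumes "sets \<alpha> = sets borel" "sets \<beta> = sets borel"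
  shows "emeasure (add_measure \<alpha> \<beta>) B = emeasure \<alpha> B + emeasure \<beta> B"
proof (cases "B \<in> sets borel")
  case True
  show ?thesis
  proof (rule emeasure_measure_of[OF add_measure_def])
    show "countably_additive (sets (add_measure \<alpha> \<beta>)) (\<lambda>B. emeasure \<alpha> B + emeasure \<beta> B)"
      using assms by (auto simp: countably_additive_def suminf_add[OF summableI summableI, symmetric] suminf_emeasure)
  qed (use True in \<open>auto simp: positive_def\<close>)
qed (use assms in \<open>simp add: emeasure_notin_sets\<close>)

lemma emeasure_sum_measure:
  assumes "\<And>i. i \<in> I \<Longrightarrow> sets (\<alpha> i) = sets borel"
  shows "emeasure (sum_measure I \<alpha>) B = (\<Sum>i\<in>I. emeasure (\<alpha> i) B)"
proof (cases "B \<in> sets borel")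
  case True
  show ?thesis
  proof (rule emeasure_measure_of[OF sum_measure_def])
    show "countably_additive (sets (sum_measure I \<alpha>)) (\<lambda>B. \<Sum>i\<in>I. emeasure (\<alpha> i) B)"
      unfolding countably_additive_def
    proof (intro allI impI)
      fix A :: "nat \<Rightarrow> 'b set"
      assume A: "range A \<subseteq> sets (sum_measure I \<alpha>)" "disjoint_family A"
      have "(\<Sum>n. \<Sum>i\<in>I. emeasure (\<alpha> i) (A n)) = (\<Sum>i\<in>I. \<Sum>n. emeasure (\<alpha> i) (A n))"
        by (intro suminf_sum summableI)
      also have "\<dots> = (\<Sum>i\<in>I. emeasure (\<alpha> i) (\<Union>n. A n))"
        using A assms by (intro sum.cong suminf_emeasure) auto
      finally show "(\<Sum>n. \<Sum>i\<in>I. emeasure (\<alpha> i) (A n)) = (\<Sum>i\<in>I. emeasure (\<alpha> i) (\<Union>n. A n))" .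
    qed
  qed (use True in \<open>auto simp: positive_def\<close>)
qed (use assms in \<open>simp add: emeasure_notin_sets\<close>)

lemma nn_integral_add_measure:
  assumes s: "sets \<alpha> = sets borel" "sets \<beta> = sets borel" and f: "f \<in> borel_measurable borel"
  shows "(\<integral>\<^sup>+x. f x \<partial>add_measure \<alpha> \<beta>) = (\<integral>\<^sup>+x. f x \<partial>\<alpha>) + (\<integral>\<^sup>+x. f x \<partial>\<beta>)"
  using f
proof (induction f rule: borel_measurable_induct)
  case (cong f g)
  moreover have "space \<alpha> = UNIV" "space \<beta> = UNIV" using s[THEN sets_eq_imp_space_eq] by auto
  ultimately show ?case by (simp cong: nn_integral_cong)
next
  case (set A)
  then show ?case using s by (simp add: emeasure_add_measure)
next
  case (mult u c)
  then show ?case using s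
    by (subst (1 2 3) nn_integral_cmult) (auto simp: distrib_left cong: measurable_cong_sets)
next
  case (add u v)
  then show ?case using s
    by (subst (1 2 3) nn_integral_add) (auto simp: ac_simps cong: measurable_cong_sets)
next
  case (seq U)
  have incU: "incseq U" by fact
  have Um: "U i \<in> borel_measurable borel" for i by fact
  have m: "\<And>i. U i \<in> borel_measurable \<alpha>" "\<And>i. U i \<in> borel_measurable \<beta>" "\<And>i. U i \<in> borel_measurable (add_measure \<alpha> \<beta>)"
    using Um s by (auto cong: measurable_cong_sets)
  have i: "incseq (\<lambda>i. \<integral>\<^sup>+x. U i x \<partial>M)" for M
    using incU by (auto simp: mono_def le_fun_def intro!: nn_integral_mono)
  have "(\<integral>\<^sup>+x. (SUP i. U i) x \<partial>M) = (SUP i. \<integral>\<^sup>+x. U i x \<partial>M)" if "\<And>i. U i \<in> borel_measurable M" for M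
    unfolding SUP_apply using that incU by (intro nn_integral_monotone_convergence_SUP)
  then show ?case
    using m i by (simp add: seq ennreal_SUP_add)
qed

lemma nn_integral_sum_measure:
  assumes I: "finite I" and s: "\<And>i. i \<in> I \<Longrightarrow> sets (\<alpha> i) = sets borel" and f: "f \<in> borel_measurable borel"
  shows "(\<integral>\<^sup>+x. f x \<partial>sum_measure I \<alpha>) = (\<Sum>i\<in>I. \<integral>\<^sup>+x. f x \<partial>\<alpha> i)"
  using I s
proof (induction I)
  case empty
  have "emeasure (sum_measure {} \<alpha>) A = 0" for A by (subst emeasure_sum_measure) simp_all
  then have "sum_measure {} \<alpha> = null_measure borel"
    by (intro measure_eqI) simp_all
  then show ?case by simp
next
  case (insert i I)
  have "sum_measure (insert i I) \<alpha> = add_measure (\<alpha> i) (sum_measure I \<alpha>)"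
  proof (rule measure_eqI)
    fix A
    have "emeasure (sum_measure (insert i I) \<alpha>) A = emeasure (\<alpha> i) A + (\<Sum>i\<in>I. emeasure (\<alpha> i) A)"
      using insert by (subst emeasure_sum_measure) auto
    moreover have "emeasure (sum_measure I \<alpha>) A = (\<Sum>i\<in>I. emeasure (\<alpha> i) A)"
      using insert by (subst emeasure_sum_measure) auto
    ultimately show "emeasure (sum_measure (insert i I) \<alpha>) A = emeasure (add_measure (\<alpha> i) (sum_measure I \<alpha>)) A"
      using insert by (simp add: emeasure_add_measure)
  qed simp
  then show ?case using insert f by (simp add: nn_integral_add_measure)
qed

lemma finite_measure_add_measure:
  assumes "sets \<alpha> = sets borel" "sets \<beta> = sets borel" "finite_measure \<alpha>" "finite_measure \<beta>"
  shows "finite_measure (add_measure \<alpha> \<beta>)"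
  using assms finite_measure.emeasure_finite[of \<alpha>] finite_measure.emeasure_finite[of \<beta>]
  by (intro finite_measureI) (simp add: emeasure_add_measure)

lemma measure_add_measure:
  assumes "sets \<alpha> = sets borel" "sets \<beta> = sets borel" "finite_measure \<alpha>" "finite_measure \<beta>"
  shows "measure (add_measure \<alpha> \<beta>) B = measure \<alpha> B + measure \<beta> B"
  using assms finite_measure.emeasure_finite[of \<alpha>] finite_measure.emeasure_finite[of \<beta>]
  by (simp add: measure_def emeasure_add_measure enn2real_plus less_top)

section \<open>Parameters of Dirichlet processes\<close>

definition dirichlet_param :: "'a::topological_space measure \<Rightarrow> bool" where
  "dirichlet_param \<alpha> \<longleftrightarrow> sets \<alpha> = sets borel \<and> finite_measure \<alpha> \<and> 0 < measure \<alpha> UNIV"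

definition normalized :: "'a measure \<Rightarrow> 'a measure" where
  "normalized \<alpha> = scale_measure (ennreal (1 / measure \<alpha> UNIV)) \<alpha>"

lemma sets_normalized [simp, measurable_cong]: "sets (normalized \<alpha>) = sets \<alpha>"
  by (simp add: normalized_def)

lemma dirichlet_paramD:
  assumes "dirichlet_param \<alpha>"
  shows "sets \<alpha> = sets borel" "space \<alpha> = UNIV" "finite_measure \<alpha>" "0 < measure \<alpha> UNIV"
  using assms sets_eq_imp_space_eq[of \<alpha> borel] by (auto simp: dirichlet_param_def)

lemma emeasure_normalized:
  assumes "dirichlet_param \<alpha>"
  shows "emeasure (normalized \<alpha>) B = ennreal (measure \<alpha> B / measure \<alpha> UNIV)"
  using dirichlet_paramD[OF assms]
  by (simp add: normalized_def finite_measure.emeasure_eq_measure ennreal_mult''[symmetric])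

lemma prob_space_normalized:
  assumes "dirichlet_param \<alpha>"
  shows "prob_space (normalized \<alpha>)"
proof
  have "space (normalized \<alpha>) = UNIV" using dirichlet_paramD[OF assms] by (simp add: normalized_def space_scale_measure)
  then show "emeasure (normalized \<alpha>) (space (normalized \<alpha>)) = 1"
    using dirichlet_paramD(4)[OF assms] by (simp add: emeasure_normalized[OF assms])
qed

lemma dirichlet_param_add_return:
  assumes "dirichlet_param \<alpha>"
  shows "dirichlet_param (add_measure \<alpha> (return borel x))"
  using dirichlet_paramD[OF assms]
  by (auto simp: dirichlet_param_def measure_add_measure finite_measure_add_measure
      prob_space.finite_measure prob_space_return measure_return)

lemma dirichlet_param_scale:
  assumes "c > 0"
  shows "sets \<nu> = sets borel \<Longrightarrow> prob_space \<nu> \<Longrightarrow> dirichlet_param (scale_measure (ennreal c) \<nu>)"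
  using assms sets_eq_imp_space_eq[of \<nu> borel] prob_space.prob_space[of \<nu>]
  by (auto simp: dirichlet_param_def prob_space.emeasure_space_1 ennreal_mult_eq_top_iff space_scale_measure
      finite_measure.emeasure_finite prob_space.finite_measure intro!: finite_measureI)

section \<open>Mixing a probability measure with an atom\<close>

text \<open>The measure \<open>(l + r \<delta>\<^sub>x) / (1 + r)\<close>. Truncation of \<open>r\<close> at 0 makes this a probability measure for
every real \<open>r\<close>; the law \<open>stick_law s\<close> lives on \<open>r > 0\<close>.\<close>

definition stick :: "real \<Rightarrow> 'a::topological_space borel_prob \<Rightarrow> 'a \<Rightarrow> 'a borel_prob" where
  "stick r l x = Borel_prob (scale_measure (ennreal (1 / (1 + max 0 r)))
     (add_measure (meas l) (scale_measure (ennreal (max 0 r)) (return borel x))))"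

lemma meas_stick:
  "meas (stick r l x) = scale_measure (ennreal (1 / (1 + max 0 r)))
     (add_measure (meas l) (scale_measure (ennreal (max 0 r)) (return borel x)))"
  unfolding stick_def
proof (rule meas_Borel_prob)
  interpret prob_space "meas l" by simp
  have 1: "emeasure (meas l) UNIV = 1" using emeasure_space_1 by simp
  have "ennreal (1 / (1 + c)) * (1 + ennreal c) = 1" if "0 \<le> c" for c
  proof -
    have "1 + ennreal c = ennreal (1 + c)" using that by simp
    then show ?thesis using that by (simp add: ennreal_mult''[symmetric] del: ennreal_plus)
  qed
  from this[of "max 0 r"] show "prob_space (scale_measure (ennreal (1 / (1 + max 0 r)))
     (add_measure (meas l) (scale_measure (ennreal (max 0 r)) (return borel x))))"
    by (intro prob_spaceI) (simp add: space_scale_measure emeasure_add_measure 1)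
qed simp

lemma measure_stick:
  assumes "B \<in> sets borel"
  shows "measure (meas (stick r l x)) B = (measure (meas l) B + max 0 r * indicator B x) / (1 + max 0 r)"
proof -
  have *: "ennreal (1 / (1 + c)) * (ennreal m + ennreal c * indicator B x) = ennreal ((m + c * indicator B x) / (1 + c))"
    if "0 \<le> c" "0 \<le> m" for c m :: real
    using that by (cases "x \<in> B") (simp_all add: ennreal_mult''[symmetric] ennreal_plus[symmetric] del: ennreal_plus)
  have "emeasure (meas (stick r l x)) B = ennreal ((measure (meas l) B + max 0 r * indicator B x) / (1 + max 0 r))"
    using assms *[of "max 0 r" "measure (meas l) B"] unfolding meas_stick
    by (simp add: emeasure_add_measure emeasure_meas)
  then show ?thesis by (simp add: measure_def)
qed

lemma measurable_stick:
  "(\<lambda>(r, l, x). stick r l x) \<in> borel \<Otimes>\<^sub>M borel \<Otimes>\<^sub>M borel \<rightarrow>\<^sub>M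
     (borel :: 'a::{metric_space, second_countable_topology} borel_prob measure)"
proof (rule measurable_borel_probI)
  fix G :: "'a set" assume "open G"
  then have [measurable]: "G \<in> sets borel" by simp
  show "(\<lambda>p. measure (meas (case p of (r, l, x) \<Rightarrow> stick r l x)) G) \<in> borel_measurable (borel \<Otimes>\<^sub>M borel \<Otimes>\<^sub>M borel)"
    by (simp add: case_prod_beta' measure_stick)
qed

text \<open>On a partition, mixing in an atom at \<open>x\<close> acts on the cell that contains \<open>x\<close>; this links the process
to \<open>stick_vec\<close>.\<close>

lemma eval_vec_stick:
  assumes B: "borel_partition d B" and j: "j \<le> d" "x \<in> B j" and r: "0 \<le> r"
  shows "eval_vec d B (stick r l x) = stick_vec {..d} j r (eval_vec d B l)"
proof -
  have "indicator (B i) x = (indicator {j} i :: real)" if "i \<le> d" for i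
    using B j that by (auto simp: borel_partition_def disjoint_family_on_def indicator_def)
  then show ?thesis
    using B r by (auto simp: eval_vec_def stick_vec_def borel_partition_def measure_stick intro!: restrict_ext)
qed

lemma borel_prob_eqI:
  "(\<And>B. B \<in> sets borel \<Longrightarrow> measure (meas u) B = measure (meas v) B) \<Longrightarrow> u = (v :: 'a::metric_space borel_prob)"
  by (rule meas_eqI) simp

section \<open>Uniqueness of Dirichlet processes\<close>

lemma is_dirichlet_process_iff:
  "is_dirichlet_process \<alpha> Q \<longleftrightarrow> sets Q = sets borel \<and> prob_space Q \<and>
     (\<forall>d B. borel_partition d B \<longrightarrow>
        distr Q (PiM {..d} (\<lambda>_. borel)) (eval_vec d B) = Dir {..d} (\<lambda>i. measure \<alpha> (B i)))"
  unfolding is_dirichlet_process_def borel_partition_def eval_vec_def ..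

lemma Dir_cong: "(\<And>i. i \<in> I \<Longrightarrow> a i = b i) \<Longrightarrow> Dir I a = Dir I b"
  unfolding Dir_def by (intro arg_cong[where f="\<lambda>M. distr M _ _"] PiM_cong) auto

lemma sum_measure_partition:
  assumes \<alpha>: "dirichlet_param \<alpha>" and B: "borel_partition d B"
  shows "(\<Sum>i\<le>d. measure \<alpha> (B i)) = measure \<alpha> UNIV"
proof -
  have "measure \<alpha> (\<Union>i\<in>{..d}. B i) = (\<Sum>i\<le>d. measure \<alpha> (B i))"
    using B dirichlet_paramD[OF \<alpha>] unfolding borel_partition_def
    by (intro finite_measure.finite_measure_finite_Union) auto
  then show ?thesis using B by (simp add: borel_partition_def)
qed

lemma nn_integral_partition:
  assumes B: "borel_partition d B" and \<nu>: "sets \<nu> = sets borel"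
    and F: "\<And>x j. j \<le> d \<Longrightarrow> x \<in> B j \<Longrightarrow> F x = c j"
  shows "(\<integral>\<^sup>+x. F x \<partial>\<nu>) = (\<Sum>j\<le>d. c j * emeasure \<nu> (B j))"
proof -
  have "F x = (\<Sum>j\<le>d. c j * indicator (B j) x)" for x
  proof -
    have "x \<in> (\<Union>i\<le>d. B i)" using B by (simp add: borel_partition_def)
    then obtain j where j: "j \<le> d" "x \<in> B j" by blast
    have "c i * indicator (B i) x = (if i = j then c j else 0)" if "i \<le> d" for i
      using B j that by (auto simp: borel_partition_def disjoint_family_on_def indicator_def)
    then have "(\<Sum>j\<le>d. c j * indicator (B j) x) = (\<Sum>i\<le>d. if i = j then c j else 0)"
      by (intro sum.cong) auto
    then show ?thesis using j F by simp
  qed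
  then have "(\<integral>\<^sup>+x. F x \<partial>\<nu>) = (\<integral>\<^sup>+x. (\<Sum>j\<le>d. c j * indicator (B j) x) \<partial>\<nu>)" by simp
  also have "\<dots> = (\<Sum>j\<le>d. \<integral>\<^sup>+x. c j * indicator (B j) x \<partial>\<nu>)"
    using B \<nu> by (intro nn_integral_sum) (auto simp: borel_partition_def)
  also have "\<dots> = (\<Sum>j\<le>d. c j * emeasure \<nu> (B j))"
    using B \<nu> by (intro sum.cong nn_integral_cmult_indicator) (auto simp: borel_partition_def)
  finally show ?thesis .
qed

lemma measure_eqI_nn_integral:
  assumes s: "sets M = sets N" and eq: "\<And>g :: _ \<Rightarrow> ennreal. g \<in> borel_measurable N \<Longrightarrow> (\<integral>\<^sup>+x. g x \<partial>M) = (\<integral>\<^sup>+x. g x \<partial>N)"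
  shows "M = N"
proof (rule measure_eqI[OF s])
  fix A assume "A \<in> sets M"
  then show "emeasure M A = emeasure N A" using eq[of "indicator A"] s by simp
qed

lemma is_dirichlet_process_unique:
  fixes Q :: "'a::{metric_space, second_countable_topology} borel_prob measure"
  assumes Q: "is_dirichlet_process \<alpha> Q" and Q': "is_dirichlet_process \<alpha> Q'"
  shows "Q = Q'"
proof (rule measure_eqI_eval_vec[where C=UNIV])
  have "prob_space Q" "sets Q = sets borel" using Q by (simp_all add: is_dirichlet_process_iff)
  then show "emeasure Q UNIV \<noteq> \<infinity>" by (simp add: finite_measure.emeasure_finite prob_space.finite_measure)
qed (use Q Q' in \<open>auto simp: is_dirichlet_process_iff\<close>)

text \<open>On every partition this is \<open>Dir_stick\<close> for the cell that contains \<open>x\<close>.\<close>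

lemma is_dirichlet_process_add_return:
  fixes Q :: "'a::{metric_space, second_countable_topology} borel_prob measure"
  assumes \<alpha>: "dirichlet_param \<alpha>" and Q: "is_dirichlet_process \<alpha> Q"
  shows "is_dirichlet_process (add_measure \<alpha> (return borel x))
    (distr (stick_law (measure \<alpha> UNIV) \<Otimes>\<^sub>M Q) borel (\<lambda>(r, l). stick r l x))"
  unfolding is_dirichlet_process_iff
proof (intro conjI allI impI)
  note \<alpha>' = dirichlet_paramD[OF \<alpha>]
  define s where "s = measure \<alpha> UNIV"
  interpret S: prob_space "stick_law s" using \<alpha>' unfolding s_def by (intro prob_space_stick_law)
  have sQ [measurable_cong]: "sets Q = sets borel" using Q by (simp add: is_dirichlet_process_iff)
  interpret Q: prob_space Q using Q by (simp add: is_dirichlet_process_iff)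
  interpret P: pair_prob_space "stick_law s" Q ..
  have m: "(\<lambda>(r, l). stick r l x) \<in> stick_law s \<Otimes>\<^sub>M Q \<rightarrow>\<^sub>M borel"
  proof -
    have "(\<lambda>p. (fst p, snd p, x)) \<in> stick_law s \<Otimes>\<^sub>M Q \<rightarrow>\<^sub>M borel \<Otimes>\<^sub>M borel \<Otimes>\<^sub>M borel" by measurable
    from measurable_compose[OF this measurable_stick] show ?thesis by (simp add: case_prod_beta')
  qed
  show "prob_space (distr (stick_law (measure \<alpha> UNIV) \<Otimes>\<^sub>M Q) borel (\<lambda>(r, l). stick r l x))"
    using P.prob_space_distr[OF m] by (simp add: s_def)
  fix d and B :: "nat \<Rightarrow> 'a set" assume B: "borel_partition d B"
  obtain j where j: "j \<le> d" "x \<in> B j" using B unfolding borel_partition_def by blast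
  define a where "a i = measure \<alpha> (B i)" for i
  have a: "0 \<le> a i" for i by (simp add: a_def)
  have sa: "(\<Sum>i\<in>{..d}. a i) = s" unfolding a_def s_def by (rule sum_measure_partition[OF \<alpha> B])
  have s: "(\<Sum>i\<in>{..d}. a i) > 0" unfolding sa s_def by (rule \<alpha>'(4))
  have "Dir {..d} (\<lambda>i. measure (add_measure \<alpha> (return borel x)) (B i)) = Dir {..d} (a(j := a j + 1))"
  proof (rule Dir_cong)
    fix i assume i: "i \<in> {..d}"
    then have "indicator (B i) x = (indicator {j} i :: real)"
      using B j by (auto simp: borel_partition_def disjoint_family_on_def indicator_def)
    then show "measure (add_measure \<alpha> (return borel x)) (B i) = (a(j := a j + 1)) i"
      using \<alpha>' B i by (simp add: measure_add_measure prob_space.finite_measure prob_space_return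
          measure_return borel_partition_def a_def indicator_def)
  qed
  moreover have "distr (distr (stick_law s \<Otimes>\<^sub>M Q) borel (\<lambda>(r, l). stick r l x)) (PiM {..d} (\<lambda>_. borel)) (eval_vec d B) =
    Dir {..d} (a(j := a j + 1))"
  proof (rule measure_eqI_nn_integral)
    fix g :: "(nat \<Rightarrow> real) \<Rightarrow> ennreal" assume "g \<in> borel_measurable (Dir {..d} (a(j := a j + 1)))"
    then have g [measurable]: "g \<in> borel_measurable (PiM {..d} (\<lambda>_. borel))" by (simp cong: measurable_cong_sets)
    note [measurable] = measurable_eval_vec[OF B] m
    have m2: "(\<lambda>p. g (eval_vec d B (case p of (r, l) \<Rightarrow> stick r l x))) \<in> borel_measurable (stick_law s \<Otimes>\<^sub>M Q)"
      using measurable_compose[OF measurable_compose[OF m measurable_eval_vec[OF B]] g] .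
    have stm: "(\<lambda>(r, z). stick_vec {..d} j r z) \<in> borel \<Otimes>\<^sub>M PiM {..d} (\<lambda>_. borel) \<rightarrow>\<^sub>M PiM {..d} (\<lambda>_. borel)"
      by measurable
    have gr: "(\<lambda>z. g (stick_vec {..d} j r z)) \<in> borel_measurable (PiM {..d} (\<lambda>_. borel))" for r
      using measurable_compose[OF measurable_Pair1' measurable_compose[OF stm g], of r] by simp
    have "(\<integral>\<^sup>+z. g z \<partial>distr (distr (stick_law s \<Otimes>\<^sub>M Q) borel (\<lambda>(r, l). stick r l x)) (PiM {..d} (\<lambda>_. borel)) (eval_vec d B)) =
      (\<integral>\<^sup>+p. g (eval_vec d B (case p of (r, l) \<Rightarrow> stick r l x)) \<partial>(stick_law s \<Otimes>\<^sub>M Q))"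
      by (simp add: nn_integral_distr)
    also have "\<dots> = (\<integral>\<^sup>+r. \<integral>\<^sup>+l. g (eval_vec d B (stick r l x)) \<partial>Q \<partial>stick_law s)"
      using Q.nn_integral_fst[OF m2] by simp
    also have "\<dots> = (\<integral>\<^sup>+r. \<integral>\<^sup>+z. g (stick_vec {..d} j r z) \<partial>Dir {..d} a \<partial>stick_law s)"
    proof (intro nn_integral_cong_AE)
      show "AE r in stick_law s. (\<integral>\<^sup>+l. g (eval_vec d B (stick r l x)) \<partial>Q) = (\<integral>\<^sup>+z. g (stick_vec {..d} j r z) \<partial>Dir {..d} a)"
        using AE_stick_law_pos
      proof eventually_elim
        case (elim r)
        have "Dir {..d} a = distr Q (PiM {..d} (\<lambda>_. borel)) (eval_vec d B)"
          using Q B by (simp add: is_dirichlet_process_iff a_def[abs_def])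
        then have "(\<integral>\<^sup>+z. g (stick_vec {..d} j r z) \<partial>Dir {..d} a) = (\<integral>\<^sup>+l. g (stick_vec {..d} j r (eval_vec d B l)) \<partial>Q)"
          using gr by (simp add: nn_integral_distr)
        then show ?case using elim by (simp add: eval_vec_stick[OF B j])
      qed
    qed
    also have "\<dots> = (\<integral>\<^sup>+z. g z \<partial>Dir {..d} (a(j := a j + 1)))"
      using Dir_stick[OF a _ s _ g, of j] j by (simp add: sa)
    finally show "(\<integral>\<^sup>+z. g z \<partial>distr (distr (stick_law s \<Otimes>\<^sub>M Q) borel (\<lambda>(r, l). stick r l x)) (PiM {..d} (\<lambda>_. borel)) (eval_vec d B)) =
      (\<integral>\<^sup>+z. g z \<partial>Dir {..d} (a(j := a j + 1)))" .
  qed simp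
  ultimately show "distr (distr (stick_law (measure \<alpha> UNIV) \<Otimes>\<^sub>M Q) borel (\<lambda>(r, l). stick r l x)) (PiM {..d} (\<lambda>_. borel)) (eval_vec d B) =
    Dir {..d} (\<lambda>i. measure (add_measure \<alpha> (return borel x)) (B i))"
    by (simp add: s_def)
qed simp

section \<open>Existence of Dirichlet processes\<close>

text \<open>In a sequence of pairs of odds and locations, the fraction of the stick that is left after \<open>n\<close> pieces
have been broken off, each piece taking \<open>r / (1 + r)\<close> of the remainder.\<close>

definition stick_rest :: "(nat \<Rightarrow> real \<times> 'a) \<Rightarrow> nat \<Rightarrow> real" where
  "stick_rest \<omega> n = (\<Prod>i<n. 1 / (1 + max 0 (fst (\<omega> i))))"

definition stick_weight :: "(nat \<Rightarrow> real \<times> 'a) \<Rightarrow> nat \<Rightarrow> real" where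
  "stick_weight \<omega> k = stick_rest \<omega> k - stick_rest \<omega> (Suc k)"

text \<open>The purely atomic measure with the stick-breaking weights. The weights almost surely add up to
one, but to have a probability measure for every sequence their deficit is placed as an additional
atom at the point \<open>undefined\<close>. With this convention the recursion in
\<open>stick_breaking_case_nat\<close> holds for every sequence without exception.\<close>

definition stick_breaking :: "(nat \<Rightarrow> real \<times> 'a::topological_space) \<Rightarrow> 'a borel_prob" where
  "stick_breaking \<omega> = Borel_prob (add_measure
     (distr (density (count_space UNIV) (\<lambda>k. ennreal (stick_weight \<omega> k))) borel (\<lambda>k. snd (\<omega> k)))
     (scale_measure (ennreal (1 - (\<Sum>k. stick_weight \<omega> k))) (return borel undefined)))"

lemma stick_weight_nonneg: "0 \<le> stick_weight \<omega> k"
proof -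
  have "0 \<le> stick_rest \<omega> k" unfolding stick_rest_def by (intro prod_nonneg) auto
  then have "stick_rest \<omega> k * (1 / (1 + max 0 (fst (\<omega> k)))) \<le> stick_rest \<omega> k * 1"
    by (intro mult_left_mono) auto
  then show ?thesis by (simp add: stick_weight_def stick_rest_def)
qed

lemma sum_stick_weight: "(\<Sum>k<n. stick_weight \<omega> k) = 1 - stick_rest \<omega> n"
  unfolding stick_weight_def by (induction n) (auto simp: stick_rest_def)

lemma sum_stick_weight_le: "(\<Sum>k<n. stick_weight \<omega> k) \<le> 1"
  unfolding sum_stick_weight stick_rest_def by (auto intro!: prod_nonneg)

lemma summable_stick_weight: "summable (stick_weight \<omega>)"
  by (rule summableI_nonneg_bounded[OF stick_weight_nonneg sum_stick_weight_le])

lemma summable_stick_weight_indicator: "summable (\<lambda>k. stick_weight \<omega> k * indicator B (x k))"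
  by (rule summable_comparison_test'[OF summable_stick_weight[of \<omega>], of 0]) (auto simp: indicator_def stick_weight_nonneg)

lemma suminf_stick_weight_le: "(\<Sum>k. stick_weight \<omega> k) \<le> 1"
  using suminf_le_const[OF summable_stick_weight] sum_stick_weight_le by blast

lemma measure_stick_breaking:
  assumes B: "B \<in> sets borel"
  shows "measure (meas (stick_breaking \<omega>)) B =
    (\<Sum>k. stick_weight \<omega> k * indicator B (snd (\<omega> k))) + (1 - (\<Sum>k. stick_weight \<omega> k)) * indicator B undefined"
proof -
  define \<nu> where "\<nu> = add_measure
     (distr (density (count_space UNIV) (\<lambda>k. ennreal (stick_weight \<omega> k))) borel (\<lambda>k. snd (\<omega> k)))
     (scale_measure (ennreal (1 - (\<Sum>k. stick_weight \<omega> k))) (return borel undefined))"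
  have nn: "0 \<le> (\<Sum>k. stick_weight \<omega> k * indicator B (snd (\<omega> k)))" for B
    by (intro suminf_nonneg summable_stick_weight_indicator) (simp add: stick_weight_nonneg)
  have em: "emeasure \<nu> B = ennreal ((\<Sum>k. stick_weight \<omega> k * indicator B (snd (\<omega> k))) + (1 - (\<Sum>k. stick_weight \<omega> k)) * indicator B undefined)"
    if B: "B \<in> sets borel" for B
  proof -
    have "emeasure (distr (density (count_space UNIV) (\<lambda>k. ennreal (stick_weight \<omega> k))) borel (\<lambda>k. snd (\<omega> k))) B =
      (\<integral>\<^sup>+k. ennreal (stick_weight \<omega> k) * indicator ((\<lambda>k. snd (\<omega> k)) -` B) k \<partial>count_space UNIV)"
      using B by (subst emeasure_distr) (auto simp: emeasure_density)
    also have "\<dots> = (\<Sum>k. ennreal (stick_weight \<omega> k * indicator B (snd (\<omega> k))))"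
      unfolding nn_integral_count_space_nat using stick_weight_nonneg
      by (intro suminf_cong) (auto simp: indicator_def)
    also have "\<dots> = ennreal (\<Sum>k. stick_weight \<omega> k * indicator B (snd (\<omega> k)))"
      by (intro suminf_ennreal2 summable_stick_weight_indicator) (simp add: stick_weight_nonneg)
    finally have "emeasure \<nu> B = ennreal (\<Sum>k. stick_weight \<omega> k * indicator B (snd (\<omega> k))) +
      ennreal (1 - (\<Sum>k. stick_weight \<omega> k)) * indicator B undefined"
      using B unfolding \<nu>_def by (subst emeasure_add_measure) auto
    then show ?thesis
      using nn[of B] suminf_stick_weight_le[of \<omega>]
      by (auto simp: indicator_def ennreal_plus[symmetric] simp del: ennreal_plus)
  qed
  have "prob_space \<nu>"
    using em[of UNIV] by (intro prob_spaceI) (simp add: \<nu>_def)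
  moreover have "sets \<nu> = sets borel" by (simp add: \<nu>_def)
  ultimately have "meas (stick_breaking \<omega>) = \<nu>"
    unfolding stick_breaking_def \<nu>_def[symmetric] by (rule_tac meas_Borel_prob)
  moreover have "0 \<le> (1 - (\<Sum>k. stick_weight \<omega> k)) * indicator B undefined"
    using suminf_stick_weight_le[of \<omega>] by simp
  ultimately show ?thesis
    using nn[of B] by (simp only: measure_def em[OF B] enn2real_ennreal add_nonneg_nonneg)
qed

text \<open>The first piece is an atom at \<open>x\<close>, and the remaining ones form a rescaled stick-breaking measure.
This makes the law of the construction a fixed point of mixing in a random atom.\<close>

lemma stick_breaking_case_nat:
  fixes \<omega> :: "nat \<Rightarrow> real \<times> 'a::metric_space"
  shows "stick_breaking (case_nat (r, x) \<omega>) = stick r (stick_breaking \<omega>) x"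
proof (rule borel_prob_eqI)
  fix B :: "'a set" assume B: "B \<in> sets borel"
  define c where "c = 1 + max 0 r"
  have c: "c > 0" by (simp add: c_def)
  have rest0: "stick_rest (case_nat (r, x) \<omega>) 0 = 1" by (simp add: stick_rest_def)
  have restS: "stick_rest (case_nat (r, x) \<omega>) (Suc n) = stick_rest \<omega> n / c" for n
    unfolding stick_rest_def c_def by (subst prod.lessThan_Suc_shift) simp
  have w0: "stick_weight (case_nat (r, x) \<omega>) 0 = 1 - 1 / c"
    by (simp add: stick_weight_def rest0 restS) (simp add: stick_rest_def)
  have wS: "stick_weight (case_nat (r, x) \<omega>) (Suc k) = stick_weight \<omega> k / c" for k
    by (simp add: stick_weight_def restS diff_divide_distrib)
  have sw: "(\<Sum>k. stick_weight (case_nat (r, x) \<omega>) k) = (1 - 1 / c) + (\<Sum>k. stick_weight \<omega> k) / c"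
    using suminf_split_head[OF summable_stick_weight[of "case_nat (r, x) \<omega>"]] suminf_divide[OF summable_stick_weight[of \<omega>], of c]
    by (simp add: w0 wS)
  have swB: "(\<Sum>k. stick_weight (case_nat (r, x) \<omega>) k * indicator B (snd (case_nat (r, x) \<omega> k))) =
    (1 - 1 / c) * indicator B x + (\<Sum>k. stick_weight \<omega> k * indicator B (snd (\<omega> k))) / c"
    using suminf_split_head[OF summable_stick_weight_indicator[of "case_nat (r, x) \<omega>" B "\<lambda>k. snd (case_nat (r, x) \<omega> k)"]]
      suminf_divide[OF summable_stick_weight_indicator[of \<omega> B "\<lambda>k. snd (\<omega> k)"], of c]
    by (simp add: w0 wS)
  have m: "max 0 r = c - 1" by (simp add: c_def)
  have alg: "(1 - 1 / c) * i + S / c + (1 - ((1 - 1 / c) + W / c)) * k = (S + (1 - W) * k + (c - 1) * i) / c" for i k S W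
    using c by (simp add: field_simps)
  show "measure (meas (stick_breaking (case_nat (r, x) \<omega>))) B = measure (meas (stick r (stick_breaking \<omega>) x)) B"
    unfolding measure_stick[OF B] measure_stick_breaking[OF B] sw swB c_def[symmetric] m alg by simp
qed

lemma measurable_stick_breaking:
  assumes M: "sets M = sets (borel \<Otimes>\<^sub>M borel)"
  shows "stick_breaking \<in> PiM UNIV (\<lambda>_. M) \<rightarrow>\<^sub>M (borel :: 'a::{metric_space, second_countable_topology} borel_prob measure)"
proof (rule measurable_borel_probI)
  fix G :: "'a set" assume "open G"
  then have [measurable]: "G \<in> sets borel" by simp
  note M [measurable_cong]
  have [measurable]: "(\<lambda>\<omega>. fst (\<omega> i)) \<in> borel_measurable (PiM UNIV (\<lambda>_. M))" for i
    by measurable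
  have [measurable]: "(\<lambda>\<omega>. snd (\<omega> i)) \<in> PiM UNIV (\<lambda>_. M) \<rightarrow>\<^sub>M borel" for i
    by measurable
  have [measurable]: "(\<lambda>\<omega>. stick_weight \<omega> k) \<in> borel_measurable (PiM UNIV (\<lambda>_. M))" for k
    unfolding stick_weight_def stick_rest_def by measurable
  show "(\<lambda>\<omega>. measure (meas (stick_breaking \<omega>)) G) \<in> borel_measurable (PiM UNIV (\<lambda>_. M))"
    by (subst measure_stick_breaking) measurable
qed

text \<open>The law of the stick-breaking measure, with independent odds distributed as \<open>stick_law s\<close> and
locations distributed as \<open>\<alpha> / s\<close>, is a fixed point. On a partition, both this law and the
Dirichlet law are therefore stick-invariant for the cell probabilities, hence equal.\<close>

theorem is_dirichlet_process_exists:
  fixes \<alpha> :: "'a::{metric_space, second_countable_topology} measure"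
  assumes \<alpha>: "dirichlet_param \<alpha>"
  shows "\<exists>Q. is_dirichlet_process \<alpha> Q"
proof -
  note \<alpha>' = dirichlet_paramD[OF \<alpha>]
  define s where "s = measure \<alpha> UNIV"
  have s0: "s > 0" using \<alpha>' by (simp add: s_def)
  define \<nu> where "\<nu> = normalized \<alpha>"
  have s\<nu> [measurable_cong, simp]: "sets \<nu> = sets borel" using \<alpha>' by (simp add: \<nu>_def)
  interpret S: prob_space "stick_law s" using s0 by (rule prob_space_stick_law)
  interpret N: prob_space \<nu> unfolding \<nu>_def using \<alpha> by (rule prob_space_normalized)
  interpret SN: pair_prob_space "stick_law s" \<nu> ..
  define M where "M = stick_law s \<Otimes>\<^sub>M \<nu>"
  have sM [measurable_cong]: "sets M = sets (borel \<Otimes>\<^sub>M borel)"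
    unfolding M_def by (intro sets_pair_measure_cong) simp_all
  interpret M: prob_space M unfolding M_def by (intro prob_space_pair S.prob_space_axioms N.prob_space_axioms)
  interpret W: product_prob_space "\<lambda>_::nat. M" UNIV ..
  interpret W: sequence_space M ..
  let ?W = "PiM (UNIV :: nat set) (\<lambda>_. M)"
  interpret MW: pair_prob_space M ?W ..
  define Q where "Q = distr ?W borel (stick_breaking :: _ \<Rightarrow> 'a borel_prob)"
  have sb: "stick_breaking \<in> ?W \<rightarrow>\<^sub>M (borel :: 'a borel_prob measure)" by (rule measurable_stick_breaking[OF sM])
  have sQ [measurable_cong, simp]: "sets Q = sets borel" by (simp add: Q_def)
  interpret Q: prob_space Q unfolding Q_def using sb by (rule W.prob_space_distr)
  have m: "(\<lambda>(r, l, x). stick r l (x::'a)) \<in> borel \<Otimes>\<^sub>M borel \<Otimes>\<^sub>M borel \<rightarrow>\<^sub>M borel" by (rule measurable_stick)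
  have fix_point: "(\<integral>\<^sup>+l. g l \<partial>Q) = (\<integral>\<^sup>+r. \<integral>\<^sup>+x. \<integral>\<^sup>+l. g (stick r l x) \<partial>Q \<partial>\<nu> \<partial>stick_law s)"
    if g: "g \<in> borel_measurable borel" for g :: "'a borel_prob \<Rightarrow> ennreal"
  proof -
    have m1: "(\<lambda>((r, x), l). g (stick r l x)) \<in> borel_measurable (M \<Otimes>\<^sub>M borel)"
    proof -
      have "(\<lambda>p. (fst (fst p), snd p, snd (fst p))) \<in> M \<Otimes>\<^sub>M borel \<rightarrow>\<^sub>M borel \<Otimes>\<^sub>M borel \<Otimes>\<^sub>M borel" by measurable
      from measurable_compose[OF this measurable_compose[OF m g]] show ?thesis by (simp add: case_prod_beta')
    qed
    have cn: "(\<lambda>(s, \<omega>). case_nat s \<omega>) \<in> M \<Otimes>\<^sub>M ?W \<rightarrow>\<^sub>M ?W" by measurable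
    have gsb: "(\<lambda>\<omega>. g (stick_breaking \<omega>)) \<in> borel_measurable ?W" using measurable_compose[OF sb g] .
    have "(\<integral>\<^sup>+l. g l \<partial>Q) = (\<integral>\<^sup>+\<omega>. g (stick_breaking \<omega>) \<partial>?W)"
      unfolding Q_def using sb g by (simp add: nn_integral_distr)
    also have "\<dots> = (\<integral>\<^sup>+\<omega>. g (stick_breaking \<omega>) \<partial>distr (M \<Otimes>\<^sub>M ?W) ?W (\<lambda>(s, \<omega>). case_nat s \<omega>))"
      by (simp only: W.PiM_iter)
    also have "\<dots> = (\<integral>\<^sup>+p. g (stick_breaking (case p of (s, \<omega>) \<Rightarrow> case_nat s \<omega>)) \<partial>(M \<Otimes>\<^sub>M ?W))"
      by (rule nn_integral_distr[OF cn]) (use gsb in simp)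
    also have "\<dots> = (\<integral>\<^sup>+s. \<integral>\<^sup>+\<omega>. g (stick_breaking (case_nat s \<omega>)) \<partial>?W \<partial>M)"
      using W.nn_integral_fst[OF measurable_compose[OF cn gsb]] by simp
    also have "\<dots> = (\<integral>\<^sup>+p. (case p of (r, x) \<Rightarrow> \<integral>\<^sup>+l. g (stick r l x) \<partial>Q) \<partial>M)"
    proof (intro nn_integral_cong)
      fix p :: "real \<times> 'a"
      obtain r x where p: "p = (r, x)" by (cases p)
      have "(\<lambda>l. g (stick r l x)) \<in> borel_measurable borel"
        using measurable_compose[OF measurable_Pair1' m1, of "(r, x)"] sets_eq_imp_space_eq[OF sM]
        by (simp add: space_pair_measure)
      then show "(\<integral>\<^sup>+\<omega>. g (stick_breaking (case_nat p \<omega>)) \<partial>?W) = (case p of (r, x) \<Rightarrow> \<integral>\<^sup>+l. g (stick r l x) \<partial>Q)"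
        unfolding Q_def p using sb by (simp add: nn_integral_distr stick_breaking_case_nat)
    qed
    also have "\<dots> = (\<integral>\<^sup>+r. \<integral>\<^sup>+x. \<integral>\<^sup>+l. g (stick r l x) \<partial>Q \<partial>\<nu> \<partial>stick_law s)"
    proof -
      have "(\<lambda>p. \<integral>\<^sup>+l. g (stick (fst p) l (snd p)) \<partial>Q) \<in> borel_measurable M"
        using m1 by (intro Q.borel_measurable_nn_integral) (simp add: case_prod_beta' cong: measurable_cong_sets sets_pair_measure_cong)
      then show ?thesis
        unfolding M_def by (subst N.nn_integral_fst[symmetric]) (simp_all add: case_prod_beta')
    qed
    finally show ?thesis .
  qed
  have "distr Q (PiM {..d} (\<lambda>_. borel)) (eval_vec d B) = Dir {..d} (\<lambda>i. measure \<alpha> (B i))"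
    if B: "borel_partition d B" for d B
  proof -
    define a where "a i = measure \<alpha> (B i)" for i
    have a: "0 \<le> a i" for i by (simp add: a_def)
    have sa: "(\<Sum>i\<in>{..d}. a i) = s" unfolding a_def s_def by (rule sum_measure_partition[OF \<alpha> B])
    have sa0: "0 < (\<Sum>i\<in>{..d}. a i)" using sa s0 by simp
    let ?Q = "distr Q (PiM {..d} (\<lambda>_. borel)) (eval_vec d B)"
    have ev: "eval_vec d B \<in> Q \<rightarrow>\<^sub>M PiM {..d} (\<lambda>_. borel)" using measurable_eval_vec[OF B] by (simp cong: measurable_cong_sets)
    have "stick_invariant {..d} s (\<lambda>j. a j / s) ?Q"
      unfolding stick_invariant_def
    proof (intro conjI ballI)
      show "prob_space ?Q" using ev by (rule Q.prob_space_distr)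
      show "AE z in ?Q. \<forall>i\<in>{..d}. \<bar>z i\<bar> \<le> 1"
      proof (subst AE_distr_iff[OF ev])
        show "{z \<in> space (PiM {..d} (\<lambda>_. borel)). \<forall>i\<in>{..d}. \<bar>z i\<bar> \<le> (1::real)} \<in> sets (PiM {..d} (\<lambda>_. borel))"
          by measurable
        show "AE l in Q. \<forall>i\<in>{..d}. \<bar>eval_vec d B l i\<bar> \<le> 1"
          by (intro AE_I2) (auto simp: eval_vec_def prob_space.prob_le_1)
      qed
      fix g :: "(nat \<Rightarrow> real) \<Rightarrow> ennreal" assume g: "g \<in> borel_measurable (PiM {..d} (\<lambda>_. borel))"
      have ge: "(\<lambda>l. g (eval_vec d B l)) \<in> borel_measurable borel"
        using measurable_compose[OF measurable_eval_vec[OF B] g] .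
      have stm: "(\<lambda>(r, z). stick_vec {..d} j r z) \<in> borel \<Otimes>\<^sub>M PiM {..d} (\<lambda>_. borel) \<rightarrow>\<^sub>M PiM {..d} (\<lambda>_. borel)" for j
        by measurable
      have gst: "(\<lambda>p. g (case p of (r, z) \<Rightarrow> stick_vec {..d} j r z)) \<in> borel_measurable (borel \<Otimes>\<^sub>M PiM {..d} (\<lambda>_. borel))" for j
        using measurable_compose[OF stm g] .
      define F where "F j r = (\<integral>\<^sup>+z. g (stick_vec {..d} j r z) \<partial>?Q)" for j r
      have Fm: "F j \<in> borel_measurable (stick_law s)" for j
      proof -
        interpret Q': prob_space ?Q using ev by (rule Q.prob_space_distr)
        show ?thesis unfolding F_def using gst[of j]
          by (intro Q'.borel_measurable_nn_integral) (simp add: case_prod_beta' cong: measurable_cong_sets sets_pair_measure_cong)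
      qed
      have F: "F j r = (\<integral>\<^sup>+l. g (stick_vec {..d} j r (eval_vec d B l)) \<partial>Q)" for j r
        unfolding F_def using ev measurable_compose[OF measurable_Pair1' gst, of r j]
        by (subst nn_integral_distr) auto
      have "(\<integral>\<^sup>+z. g z \<partial>?Q) = (\<integral>\<^sup>+l. g (eval_vec d B l) \<partial>Q)"
        by (rule nn_integral_distr[OF ev]) (use g in simp)
      also have "\<dots> = (\<integral>\<^sup>+r. \<integral>\<^sup>+x. \<integral>\<^sup>+l. g (eval_vec d B (stick r l x)) \<partial>Q \<partial>\<nu> \<partial>stick_law s)"
        using ge by (rule fix_point)
      also have "\<dots> = (\<integral>\<^sup>+r. (\<Sum>j\<le>d. F j r * ennreal (a j / s)) \<partial>stick_law s)"
      proof (rule nn_integral_cong_AE)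
        show "AE r in stick_law s. (\<integral>\<^sup>+x. \<integral>\<^sup>+l. g (eval_vec d B (stick r l x)) \<partial>Q \<partial>\<nu>) = (\<Sum>j\<le>d. F j r * ennreal (a j / s))"
          using AE_stick_law_pos
        proof eventually_elim
          case (elim r)
          have "(\<integral>\<^sup>+x. \<integral>\<^sup>+l. g (eval_vec d B (stick r l x)) \<partial>Q \<partial>\<nu>) = (\<Sum>j\<le>d. F j r * emeasure \<nu> (B j))"
            using elim by (intro nn_integral_partition[OF B]) (simp_all add: F eval_vec_stick[OF B])
          then show ?case by (simp add: \<nu>_def emeasure_normalized[OF \<alpha>] a_def s_def)
        qed
      qed
      also have "\<dots> = (\<Sum>j\<le>d. \<integral>\<^sup>+r. F j r * ennreal (a j / s) \<partial>stick_law s)"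
        using Fm by (intro nn_integral_sum) auto
      also have "\<dots> = (\<Sum>j\<le>d. ennreal (a j / s) * (\<integral>\<^sup>+r. F j r \<partial>stick_law s))"
        using Fm by (intro sum.cong) (auto simp: nn_integral_multc mult.commute)
      finally show "(\<Sum>j\<in>{..d}. ennreal (a j / s) * (\<integral>\<^sup>+r. \<integral>\<^sup>+z. g (stick_vec {..d} j r z) \<partial>?Q \<partial>stick_law s)) = (\<integral>\<^sup>+z. g z \<partial>?Q)"
        by (simp add: F_def)
    qed simp
    moreover have "stick_invariant {..d} s (\<lambda>j. a j / s) (Dir {..d} a)"
      using stick_invariant_Dir[of a "{..d}", OF a _ sa0] by (simp add: sa)
    ultimately have "?Q = Dir {..d} a"
      using s0 a sa by (intro stick_invariant_unique[of "{..d}" s "\<lambda>j. a j / s"]) (auto simp: sum_divide_distrib[symmetric])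
    then show ?thesis by (simp add: a_def[abs_def])
  qed
  then have "is_dirichlet_process \<alpha> Q"
    unfolding is_dirichlet_process_iff by (auto intro: Q.prob_space_axioms)
  then show ?thesis ..
qed

lemma is_dirichlet_process_dirichlet_process:
  fixes \<alpha> :: "'a::{metric_space, second_countable_topology} measure"
  assumes "dirichlet_param \<alpha>"
  shows "is_dirichlet_process \<alpha> (\<D> \<alpha>)"
  unfolding dirichlet_process_def
  using is_dirichlet_process_exists[OF assms] is_dirichlet_process_unique by (blast intro: theI)

lemma dirichlet_process_eqI:
  fixes \<alpha> :: "'a::{metric_space, second_countable_topology} measure"
  assumes "is_dirichlet_process \<alpha> Q"
  shows "\<D> \<alpha> = Q"
  unfolding dirichlet_process_def
  using assms is_dirichlet_process_unique by (blast intro: the_equality)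

lemma
  fixes \<alpha> :: "'a::{metric_space, second_countable_topology} measure"
  assumes "dirichlet_param \<alpha>"
  shows sets_dirichlet_process [simp]: "sets (\<D> \<alpha>) = sets borel"
    and space_dirichlet_process [simp]: "space (\<D> \<alpha>) = UNIV"
    and prob_space_dirichlet_process: "prob_space (\<D> \<alpha>)"
  using is_dirichlet_process_dirichlet_process[OF assms] sets_eq_imp_space_eq[of "\<D> \<alpha>" borel]
  by (auto simp: is_dirichlet_process_iff)

lemma nn_integral_dirichlet_process_eval_vec:
  fixes \<alpha> :: "'a::{metric_space, second_countable_topology} measure"
  assumes \<alpha>: "dirichlet_param \<alpha>" and B: "borel_partition d B" and g: "g \<in> borel_measurable (PiM {..d} (\<lambda>_. borel))"
  shows "(\<integral>\<^sup>+l. g (eval_vec d B l) \<partial>\<D> \<alpha>) = (\<integral>\<^sup>+z. g z \<partial>Dir {..d} (\<lambda>i. measure \<alpha> (B i)))"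
proof -
  have "eval_vec d B \<in> \<D> \<alpha> \<rightarrow>\<^sub>M PiM {..d} (\<lambda>_. borel)"
    using measurable_eval_vec[OF B] \<alpha> by (simp cong: measurable_cong_sets)
  from nn_integral_distr[OF this, of g] g
  show ?thesis
    using is_dirichlet_process_dirichlet_process[OF \<alpha>] B by (simp add: is_dirichlet_process_iff)
qed

lemma dirichlet_process_add_return:
  fixes \<alpha> :: "'a::{metric_space, second_countable_topology} measure"
  assumes \<alpha>: "dirichlet_param \<alpha>"
  shows "\<D> (add_measure \<alpha> (return borel x)) =
    distr (stick_law (measure \<alpha> UNIV) \<Otimes>\<^sub>M \<D> \<alpha>) borel (\<lambda>(r, l). stick r l x)"
  by (intro dirichlet_process_eqI is_dirichlet_process_add_return is_dirichlet_process_dirichlet_process \<alpha>)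

text \<open>\<open>\<D>\<close> is defined by a description, from which nothing about dependence on the parameter can be read
off. But \<open>\<D>(\<alpha> + \<delta>\<^sub>x)\<close> is the image of a product law under \<open>stick\<close>, which is jointly measurable; so
measurability propagates along the adding of atoms, as long as the total mass is constant.\<close>

lemma measurable_dirichlet_process_add_return_kernel:
  fixes \<alpha> :: "'b \<Rightarrow> 'a::{metric_space, second_countable_topology} measure"
  assumes \<alpha>: "\<And>y. y \<in> space N \<Longrightarrow> dirichlet_param (\<alpha> y)" and mass: "\<And>y. y \<in> space N \<Longrightarrow> measure (\<alpha> y) UNIV = s"
    and D: "(\<lambda>y. \<D> (\<alpha> y)) \<in> N \<rightarrow>\<^sub>M prob_algebra borel" and x: "x \<in> N \<rightarrow>\<^sub>M borel" and s: "s > 0"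
  shows "(\<lambda>y. \<D> (add_measure (\<alpha> y) (return borel (x y)))) \<in> N \<rightarrow>\<^sub>M prob_algebra borel"
proof -
  note [measurable] = D x measurable_stick
  have sl [measurable]: "(\<lambda>y. stick_law s) \<in> N \<rightarrow>\<^sub>M prob_algebra borel"
    using s by (intro measurable_const) (simp add: space_prob_algebra prob_space_stick_law)
  have m: "(\<lambda>(y, r, l). stick r l (x y)) \<in> N \<Otimes>\<^sub>M borel \<Otimes>\<^sub>M borel \<rightarrow>\<^sub>M borel"
  proof -
    have "(\<lambda>p. (fst (snd p), snd (snd p), x (fst p))) \<in> N \<Otimes>\<^sub>M borel \<Otimes>\<^sub>M borel \<rightarrow>\<^sub>M borel \<Otimes>\<^sub>M borel \<Otimes>\<^sub>M borel" by measurable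
    from measurable_compose[OF this measurable_stick] show ?thesis by (simp add: case_prod_beta')
  qed
  have "(\<lambda>y. distr (stick_law s \<Otimes>\<^sub>M \<D> (\<alpha> y)) borel (\<lambda>(r, l). stick r l (x y))) \<in> N \<rightarrow>\<^sub>M prob_algebra borel"
    using m by measurable
  moreover have "\<D> (add_measure (\<alpha> y) (return borel (x y))) =
    distr (stick_law s \<Otimes>\<^sub>M \<D> (\<alpha> y)) borel (\<lambda>(r, l). stick r l (x y))" if "y \<in> space N" for y
    using dirichlet_process_add_return[OF \<alpha>[OF that]] mass[OF that] by simp
  ultimately show ?thesis
    using measurable_cong[of N "\<lambda>y. \<D> (add_measure (\<alpha> y) (return borel (x y)))"
      "\<lambda>y. distr (stick_law s \<Otimes>\<^sub>M \<D> (\<alpha> y)) borel (\<lambda>(r, l). stick r l (x y))"] by blast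
qed

text \<open>Both sides define finite measures in \<open>L\<close>. They agree on the evaluation vectors of all partitions that
refine \<open>C\<close>, because there \<open>l(C)\<close> is a sum of coordinates and \<open>Dir_size_bias\<close> applies to each of them.\<close>

lemma dirichlet_process_size_bias_set:
  fixes \<alpha> :: "'a::{metric_space, second_countable_topology} measure"
  assumes \<alpha>: "dirichlet_param \<alpha>" and L: "L \<in> sets borel" and C: "C \<in> sets borel"
  shows "(\<integral>\<^sup>+l. indicator L l * emeasure (meas l) C \<partial>\<D> \<alpha>) =
    (\<integral>\<^sup>+x. indicator C x * emeasure (\<D> (add_measure \<alpha> (return borel x))) L \<partial>normalized \<alpha>)"
proof -
  note \<alpha>' = dirichlet_paramD[OF \<alpha>]
  define s where "s = measure \<alpha> UNIV"
  have s0: "s > 0" using \<alpha>' by (simp add: s_def)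
  define K where "K x = \<D> (add_measure \<alpha> (return borel x))" for x :: 'a
  have Kx: "sets (K x) = sets borel" "prob_space (K x)" for x
    unfolding K_def by (simp_all add: dirichlet_param_add_return[OF \<alpha>] prob_space_dirichlet_process)
  have K [measurable]: "K \<in> borel \<rightarrow>\<^sub>M prob_algebra borel"
    unfolding K_def using \<alpha> s0 prob_space_dirichlet_process[OF \<alpha>]
    by (intro measurable_dirichlet_process_add_return_kernel[where s=s] measurable_const)
      (auto simp: space_prob_algebra s_def)
  have Ks: "K \<in> density (normalized \<alpha>) (indicator C) \<rightarrow>\<^sub>M subprob_algebra borel"
    using measurable_prob_algebraD[OF K] \<alpha>'(1) by (simp cong: measurable_cong_sets)
  have sN: "sets (normalized \<alpha>) = sets borel" "space (normalized \<alpha>) = UNIV"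
    using \<alpha>' by (simp_all add: normalized_def space_scale_measure)
  have em [measurable]: "(\<lambda>l. emeasure (meas l) C) \<in> borel_measurable (\<D> \<alpha>)"
    using measurable_eval[OF C] \<alpha> by (simp add: emeasure_meas cong: measurable_cong_sets)
  interpret D: prob_space "\<D> \<alpha>" using \<alpha> by (rule prob_space_dirichlet_process)
  \<comment> \<open>the two sides of the identity as measures in \<open>L\<close>\<close>
  define Q1 where "Q1 = density (\<D> \<alpha>) (\<lambda>l. emeasure (meas l) C)"
  define Q2 where "Q2 = density (normalized \<alpha>) (indicator C) \<bind> K"
  have sQ1: "sets Q1 = sets borel" using \<alpha> by (simp add: Q1_def)
  have sQ2: "sets Q2 = sets borel"
    unfolding Q2_def using Kx by (intro sets_bind) (auto simp: sN)
  have nQ2: "(\<integral>\<^sup>+l. g l \<partial>Q2) = (\<integral>\<^sup>+x. indicator C x * (\<integral>\<^sup>+l. g l \<partial>K x) \<partial>normalized \<alpha>)"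
    if g: "g \<in> borel_measurable borel" for g :: "_ \<Rightarrow> ennreal"
  proof -
    have "(\<integral>\<^sup>+l. g l \<partial>Q2) = (\<integral>\<^sup>+x. (\<integral>\<^sup>+l. g l \<partial>K x) \<partial>density (normalized \<alpha>) (indicator C))"
      unfolding Q2_def using g Ks by (rule nn_integral_bind)
    also have "\<dots> = (\<integral>\<^sup>+x. indicator C x * (\<integral>\<^sup>+l. g l \<partial>K x) \<partial>normalized \<alpha>)"
    proof (rule nn_integral_density)
      show "(\<lambda>x. \<integral>\<^sup>+l. g l \<partial>K x) \<in> borel_measurable (normalized \<alpha>)"
        using measurable_compose[OF measurable_prob_algebraD[OF K] nn_integral_measurable_subprob_algebra[OF g]] sN
        by (simp cong: measurable_cong_sets)
    qed (use C sN in \<open>simp cong: measurable_cong_sets\<close>)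
    finally show ?thesis .
  qed
  have nQ1: "(\<integral>\<^sup>+l. g l \<partial>Q1) = (\<integral>\<^sup>+l. emeasure (meas l) C * g l \<partial>\<D> \<alpha>)"
    if g: "g \<in> borel_measurable borel" for g :: "_ \<Rightarrow> ennreal"
    unfolding Q1_def using g em \<alpha> by (intro nn_integral_density) (auto cong: measurable_cong_sets)
  have "Q1 = Q2"
  proof (rule measure_eqI_eval_vec[OF sQ1 sQ2 _ C])
    have "emeasure Q1 UNIV = (\<integral>\<^sup>+l. emeasure (meas l) C \<partial>\<D> \<alpha>)"
      unfolding Q1_def using \<alpha> by (subst emeasure_density) (auto simp: sets.top[of "\<D> \<alpha>", simplified])
    also have "\<dots> \<le> (\<integral>\<^sup>+l. 1 \<partial>\<D> \<alpha>)"
      by (intro nn_integral_mono) (simp add: emeasure_meas prob_space.prob_le_1)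
    also have "\<dots> = 1" using D.emeasure_space_1 by simp
    finally show "emeasure Q1 UNIV \<noteq> \<infinity>" by (auto simp: top_unique)
    fix d B J assume B: "borel_partition d B" and J: "J \<subseteq> {..d}" "C = (\<Union>i\<in>J. B i)"
    define a where "a i = measure \<alpha> (B i)" for i
    have a: "0 \<le> a i" for i by (simp add: a_def)
    have sa: "(\<Sum>i\<in>{..d}. a i) = s" unfolding a_def s_def by (rule sum_measure_partition[OF \<alpha> B])
    have sa0: "0 < (\<Sum>i\<in>{..d}. a i)" using sa s0 by simp
    have finJ: "finite J" using J(1) by (rule finite_subset) simp
    show "distr Q1 (PiM {..d} (\<lambda>_. borel)) (eval_vec d B) = distr Q2 (PiM {..d} (\<lambda>_. borel)) (eval_vec d B)"
    proof (rule measure_eqI_nn_integral)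
      fix g :: "(nat \<Rightarrow> real) \<Rightarrow> ennreal" assume "g \<in> borel_measurable (distr Q2 (PiM {..d} (\<lambda>_. borel)) (eval_vec d B))"
      then have g [measurable]: "g \<in> borel_measurable (PiM {..d} (\<lambda>_. borel))" by simp
      note ev = measurable_eval_vec[OF B]
      have ge: "(\<lambda>l. g (eval_vec d B l)) \<in> borel_measurable borel"
        using measurable_compose[OF ev g] .
      have zi [measurable]: "(\<lambda>z. z i) \<in> borel_measurable (PiM {..d} (\<lambda>_. borel))" if "i \<in> J" for i
        using that J(1) by (intro measurable_component_singleton) auto
      have "(\<integral>\<^sup>+z. g z \<partial>distr Q1 (PiM {..d} (\<lambda>_. borel)) (eval_vec d B)) = (\<integral>\<^sup>+l. emeasure (meas l) C * g (eval_vec d B l) \<partial>\<D> \<alpha>)"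
        using ev sQ1 by (simp add: nn_integral_distr nQ1[OF ge] cong: measurable_cong_sets)
      also have "\<dots> = (\<integral>\<^sup>+l. (\<lambda>z. (\<Sum>i\<in>J. ennreal (z i)) * g z) (eval_vec d B l) \<partial>\<D> \<alpha>)"
      proof (intro nn_integral_cong)
        fix l :: "'a borel_prob"
        have "emeasure (meas l) C = (\<Sum>i\<in>J. ennreal (eval_vec d B l i))"
          using J measure_meas_UN[OF B J(1), of l]
          by (subst sum_ennreal) (auto simp: emeasure_meas eval_vec_def intro!: arg_cong[where f=ennreal] sum.cong)
        then show "emeasure (meas l) C * g (eval_vec d B l) = (\<lambda>z. (\<Sum>i\<in>J. ennreal (z i)) * g z) (eval_vec d B l)"
          by simp
      qed
      also have "\<dots> = (\<integral>\<^sup>+z. (\<Sum>i\<in>J. ennreal (z i)) * g z \<partial>Dir {..d} a)"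
        unfolding a_def using zi by (intro nn_integral_dirichlet_process_eval_vec[OF \<alpha> B]) measurable
      also have "\<dots> = (\<Sum>i\<in>J. \<integral>\<^sup>+z. ennreal (z i) * g z \<partial>Dir {..d} a)"
        unfolding sum_distrib_right using zi by (intro nn_integral_sum) (auto cong: measurable_cong_sets)
      also have "\<dots> = (\<Sum>i\<in>J. ennreal (a i / s) * (\<integral>\<^sup>+z. g z \<partial>Dir {..d} (a(i := a i + 1))))"
        using J(1) by (intro sum.cong refl) (subst Dir_size_bias[OF a _ sa0 _ g], auto simp: sa)
      also have "\<dots> = (\<Sum>i\<le>d. indicator J i * (\<integral>\<^sup>+z. g z \<partial>Dir {..d} (a(i := a i + 1))) * ennreal (a i / s))"
        using J(1) by (intro sum.mono_neutral_cong_left) (auto simp: mult.commute)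
      also have "\<dots> = (\<Sum>i\<le>d. indicator J i * (\<integral>\<^sup>+z. g z \<partial>Dir {..d} (a(i := a i + 1))) * emeasure (normalized \<alpha>) (B i))"
        by (simp add: emeasure_normalized[OF \<alpha>] a_def s_def)
      also have "\<dots> = (\<integral>\<^sup>+x. indicator C x * (\<integral>\<^sup>+l. g (eval_vec d B l) \<partial>K x) \<partial>normalized \<alpha>)"
      proof (rule nn_integral_partition[OF B sN(1), symmetric])
        fix x j assume j: "j \<le> d" "x \<in> B j"
        have ind: "indicator (B i) x = (indicator {j} i :: real)" if "i \<le> d" for i
          using B j that by (auto simp: borel_partition_def disjoint_family_on_def indicator_def)
        have uniq: "i = j" if "i \<le> d" "x \<in> B i" for i
          using B j that unfolding borel_partition_def disjoint_family_on_def by blast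
        have "x \<in> C \<longleftrightarrow> j \<in> J"
        proof
          assume "x \<in> C"
          then obtain i where "i \<in> J" "x \<in> B i" unfolding J(2) by blast
          then show "j \<in> J" using J(1) uniq[of i] by auto
        next
          assume "j \<in> J"
          then show "x \<in> C" unfolding J(2) using j(2) by blast
        qed
        moreover have "(\<integral>\<^sup>+l. g (eval_vec d B l) \<partial>K x) = (\<integral>\<^sup>+z. g z \<partial>Dir {..d} (a(j := a j + 1)))"
        proof -
          have "Dir {..d} (\<lambda>i. measure (add_measure \<alpha> (return borel x)) (B i)) = Dir {..d} (a(j := a j + 1))"
            using \<alpha>' B ind by (intro Dir_cong) (simp add: measure_add_measure prob_space.finite_measure prob_space_return
              measure_return borel_partition_def a_def indicator_def)
          then show ?thesis
            unfolding K_def by (subst nn_integral_dirichlet_process_eval_vec[OF dirichlet_param_add_return[OF \<alpha>] B g]) simp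
        qed
        ultimately show "indicator C x * (\<integral>\<^sup>+l. g (eval_vec d B l) \<partial>K x) = indicator J j * (\<integral>\<^sup>+z. g z \<partial>Dir {..d} (a(j := a j + 1)))"
          by (simp add: indicator_def)
      qed
      also have "\<dots> = (\<integral>\<^sup>+z. g z \<partial>distr Q2 (PiM {..d} (\<lambda>_. borel)) (eval_vec d B))"
        using ev sQ2 by (simp add: nn_integral_distr nQ2[OF ge] cong: measurable_cong_sets)
      finally show "(\<integral>\<^sup>+z. g z \<partial>distr Q1 (PiM {..d} (\<lambda>_. borel)) (eval_vec d B)) =
        (\<integral>\<^sup>+z. g z \<partial>distr Q2 (PiM {..d} (\<lambda>_. borel)) (eval_vec d B))" .
    qed simp
  qed
  moreover have "indicator L \<in> borel_measurable (borel :: 'a borel_prob measure)" using L by simp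
  ultimately show ?thesis
    using nQ1[of "indicator L"] nQ2[of "indicator L"] L Kx by (simp add: K_def mult.commute)
qed

section \<open>Disintegration\<close>

lemma measure_eqI_rectangles:
  assumes s: "sets R = sets (A \<Otimes>\<^sub>M B)" "sets R' = sets (A \<Otimes>\<^sub>M B)" and fin: "finite_measure R"
    and eq: "\<And>a b. a \<in> sets A \<Longrightarrow> b \<in> sets B \<Longrightarrow> emeasure R (a \<times> b) = emeasure R' (a \<times> b)"
  shows "R = R'"
proof (rule measure_eqI_generator_eq[where E="{a \<times> b | a b. a \<in> sets A \<and> b \<in> sets B}" and \<Omega>="space A \<times> space B"
      and A="\<lambda>_. space A \<times> space B"])
  show "Int_stable {a \<times> b | a b. a \<in> sets A \<and> b \<in> sets B}" by (rule Int_stable_pair_measure_generator)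
  show "{a \<times> b | a b. a \<in> sets A \<and> b \<in> sets B} \<subseteq> Pow (space A \<times> space B)" by (rule pair_measure_closed)
  show "emeasure R X = emeasure R' X" if "X \<in> {a \<times> b | a b. a \<in> sets A \<and> b \<in> sets B}" for X
    using that eq by auto
  show "emeasure R (space A \<times> space B) \<noteq> \<infinity>" using finite_measure.emeasure_finite[OF fin] by simp
  show "range (\<lambda>_. space A \<times> space B) \<subseteq> {a \<times> b | a b. a \<in> sets A \<and> b \<in> sets B}" by blast
qed (use s in \<open>auto simp: sets_pair_measure\<close>)

text \<open>The joint law of \<open>(x, y)\<close> with \<open>x\<close> distributed as \<open>M\<close> and \<open>y\<close> as \<open>K x\<close> is assembled from these kernels.\<close>

lemma measurable_kernel_pair:
  assumes K: "K \<in> A \<rightarrow>\<^sub>M prob_algebra B"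
  shows "(\<lambda>x. distr (K x) (A \<Otimes>\<^sub>M B) (\<lambda>y. (x, y))) \<in> A \<rightarrow>\<^sub>M prob_algebra (A \<Otimes>\<^sub>M B)"
proof -
  note [measurable] = K
  show ?thesis by measurable
qed

lemma nn_integral_kernel_pair:
  assumes M: "sets M = sets A" "space M \<noteq> {}" and K: "K \<in> A \<rightarrow>\<^sub>M prob_algebra B" and f: "f \<in> borel_measurable (A \<Otimes>\<^sub>M B)"
  shows "(\<integral>\<^sup>+p. f p \<partial>(M \<bind> (\<lambda>x. distr (K x) (A \<Otimes>\<^sub>M B) (\<lambda>y. (x, y))))) = (\<integral>\<^sup>+x. \<integral>\<^sup>+y. f (x, y) \<partial>K x \<partial>M)"
proof -
  have k: "(\<lambda>x. distr (K x) (A \<Otimes>\<^sub>M B) (\<lambda>y. (x, y))) \<in> M \<rightarrow>\<^sub>M subprob_algebra (A \<Otimes>\<^sub>M B)"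
    using measurable_prob_algebraD[OF measurable_kernel_pair[OF K]] M by (simp cong: measurable_cong_sets)
  have "(\<integral>\<^sup>+p. f p \<partial>(M \<bind> (\<lambda>x. distr (K x) (A \<Otimes>\<^sub>M B) (\<lambda>y. (x, y))))) =
    (\<integral>\<^sup>+x. \<integral>\<^sup>+p. f p \<partial>distr (K x) (A \<Otimes>\<^sub>M B) (\<lambda>y. (x, y)) \<partial>M)"
    using f k by (rule nn_integral_bind)
  also have "\<dots> = (\<integral>\<^sup>+x. \<integral>\<^sup>+y. f (x, y) \<partial>K x \<partial>M)"
  proof (intro nn_integral_cong)
    fix x assume "x \<in> space M"
    then have x: "x \<in> space A" using sets_eq_imp_space_eq[OF M(1)] by simp
    then have "sets (K x) = sets B" using measurable_space[OF K x] by (simp add: space_prob_algebra)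
    then have "(\<lambda>y. (x, y)) \<in> K x \<rightarrow>\<^sub>M A \<Otimes>\<^sub>M B" using x by (simp cong: measurable_cong_sets)
    then show "(\<integral>\<^sup>+p. f p \<partial>distr (K x) (A \<Otimes>\<^sub>M B) (\<lambda>y. (x, y))) = (\<integral>\<^sup>+y. f (x, y) \<partial>K x)"
      using f by (simp add: nn_integral_distr)
  qed
  finally show ?thesis .
qed

lemma kernel_pair:
  assumes M: "sets M = sets A" "prob_space M" and K: "K \<in> A \<rightarrow>\<^sub>M prob_algebra B"
  shows prob_space_kernel_pair: "prob_space (M \<bind> (\<lambda>x. distr (K x) (A \<Otimes>\<^sub>M B) (\<lambda>y. (x, y))))"
    and sets_kernel_pair: "sets (M \<bind> (\<lambda>x. distr (K x) (A \<Otimes>\<^sub>M B) (\<lambda>y. (x, y)))) = sets (A \<Otimes>\<^sub>M B)"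
proof -
  have "M \<in> space (prob_algebra A)" using M by (simp add: space_prob_algebra)
  then have "(\<lambda>_. M) \<in> count_space (UNIV :: unit set) \<rightarrow>\<^sub>M prob_algebra A" by (rule measurable_const)
  from measurable_space[OF measurable_bind_prob_space[OF this measurable_kernel_pair[OF K]], of "()"]
  have "M \<bind> (\<lambda>x. distr (K x) (A \<Otimes>\<^sub>M B) (\<lambda>y. (x, y))) \<in> space (prob_algebra (A \<Otimes>\<^sub>M B))" by simp
  then show "prob_space (M \<bind> (\<lambda>x. distr (K x) (A \<Otimes>\<^sub>M B) (\<lambda>y. (x, y))))"
    "sets (M \<bind> (\<lambda>x. distr (K x) (A \<Otimes>\<^sub>M B) (\<lambda>y. (x, y)))) = sets (A \<Otimes>\<^sub>M B)"
    by (auto simp: space_prob_algebra)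
qed

text \<open>A law on a product space is determined by rectangles, so an identity of rectangle probabilities
extends to all nonnegative functions. In this way set-wise identities (Bayes' rule,
conditional laws) turn into identities of iterated integrals.\<close>

lemma nn_integral_disintegration:
  assumes M: "sets M = sets A" "prob_space M" and K: "K \<in> A \<rightarrow>\<^sub>M prob_algebra B"
    and R: "sets R = sets (A \<Otimes>\<^sub>M B)"
    and eq: "\<And>a b. a \<in> sets A \<Longrightarrow> b \<in> sets B \<Longrightarrow> (\<integral>\<^sup>+x. indicator a x * emeasure (K x) b \<partial>M) = emeasure R (a \<times> b)"
    and f: "f \<in> borel_measurable (A \<Otimes>\<^sub>M B)"
  shows "(\<integral>\<^sup>+x. \<integral>\<^sup>+y. f (x, y) \<partial>K x \<partial>M) = (\<integral>\<^sup>+p. f p \<partial>R)"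
proof -
  let ?R = "M \<bind> (\<lambda>x. distr (K x) (A \<Otimes>\<^sub>M B) (\<lambda>y. (x, y)))"
  have ne: "space M \<noteq> {}" using M(2) by (rule prob_space.not_empty)
  have "?R = R"
  proof (rule measure_eqI_rectangles[OF sets_kernel_pair[OF M K] R])
    show "finite_measure ?R" using prob_space_kernel_pair[OF M K] by (rule prob_space.finite_measure)
    fix a b assume ab: "a \<in> sets A" "b \<in> sets B"
    have "emeasure ?R (a \<times> b) = (\<integral>\<^sup>+p. indicator (a \<times> b) p \<partial>?R)"
      using ab sets_kernel_pair[OF M K] by simp
    also have "\<dots> = (\<integral>\<^sup>+x. \<integral>\<^sup>+y. indicator (a \<times> b) (x, y) \<partial>K x \<partial>M)"
      using ab by (intro nn_integral_kernel_pair M(1) ne K) auto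
    also have "\<dots> = (\<integral>\<^sup>+x. indicator a x * emeasure (K x) b \<partial>M)"
    proof (intro nn_integral_cong)
      fix x assume "x \<in> space M"
      then have "x \<in> space A" using sets_eq_imp_space_eq[OF M(1)] by simp
      then have "sets (K x) = sets B" using measurable_space[OF K] by (simp add: space_prob_algebra)
      then show "(\<integral>\<^sup>+y. indicator (a \<times> b) (x, y) \<partial>K x) = indicator a x * emeasure (K x) b"
        using ab(2) by (simp add: indicator_times nn_integral_cmult)
    qed
    finally show "emeasure ?R (a \<times> b) = emeasure R (a \<times> b)" by (simp add: eq[OF ab])
  qed
  then show ?thesis using nn_integral_kernel_pair[OF M(1) ne K f] by simp
qed

lemma nn_integral_disintegration2:
  assumes M: "sets M = sets A" "prob_space M" and K: "K \<in> A \<rightarrow>\<^sub>M prob_algebra B"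
    and M': "sets M' = sets B" "prob_space M'" and K': "K' \<in> B \<rightarrow>\<^sub>M prob_algebra A"
    and eq: "\<And>a b. a \<in> sets A \<Longrightarrow> b \<in> sets B \<Longrightarrow>
      (\<integral>\<^sup>+x. indicator a x * emeasure (K x) b \<partial>M) = (\<integral>\<^sup>+y. indicator b y * emeasure (K' y) a \<partial>M')"
    and f: "f \<in> borel_measurable (A \<Otimes>\<^sub>M B)"
  shows "(\<integral>\<^sup>+x. \<integral>\<^sup>+y. f (x, y) \<partial>K x \<partial>M) = (\<integral>\<^sup>+y. \<integral>\<^sup>+x. f (x, y) \<partial>K' y \<partial>M')"
proof -
  let ?R = "M \<bind> (\<lambda>x. distr (K x) (A \<Otimes>\<^sub>M B) (\<lambda>y. (x, y)))"
  have ne: "space M \<noteq> {}" using M(2) by (rule prob_space.not_empty)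
  have sR [measurable_cong]: "sets ?R = sets (A \<Otimes>\<^sub>M B)" using M K by (rule sets_kernel_pair)
  define S where "S = distr ?R (B \<Otimes>\<^sub>M A) (\<lambda>(x, y). (y, x))"
  have sw: "(\<lambda>(x, y). (y, x)) \<in> ?R \<rightarrow>\<^sub>M B \<Otimes>\<^sub>M A" by measurable
  have nS: "(\<integral>\<^sup>+p. g p \<partial>S) = (\<integral>\<^sup>+x. \<integral>\<^sup>+y. g (y, x) \<partial>K x \<partial>M)" if g: "g \<in> borel_measurable (B \<Otimes>\<^sub>M A)" for g :: "_ \<Rightarrow> ennreal"
  proof -
    have "(\<integral>\<^sup>+p. g p \<partial>S) = (\<integral>\<^sup>+p. g (case p of (x, y) \<Rightarrow> (y, x)) \<partial>?R)"
      unfolding S_def by (rule nn_integral_distr[OF sw]) (use g in simp)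
    also have "\<dots> = (\<integral>\<^sup>+x. \<integral>\<^sup>+y. g (case (x, y) of (x, y) \<Rightarrow> (y, x)) \<partial>K x \<partial>M)"
      using measurable_compose[OF measurable_pair_swap' g] by (intro nn_integral_kernel_pair M(1) ne K)
    finally show ?thesis by simp
  qed
  have "(\<integral>\<^sup>+y. \<integral>\<^sup>+x. (\<lambda>(y, x). f (x, y)) (y, x) \<partial>K' y \<partial>M') = (\<integral>\<^sup>+p. (\<lambda>(y, x). f (x, y)) p \<partial>S)"
  proof (rule nn_integral_disintegration[OF M' K'])
    show "sets S = sets (B \<Otimes>\<^sub>M A)" by (simp add: S_def)
    show "(\<lambda>(y, x). f (x, y)) \<in> borel_measurable (B \<Otimes>\<^sub>M A)"
      using measurable_compose[OF measurable_pair_swap' f] by (simp add: case_prod_beta')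
    fix b a assume ab: "b \<in> sets B" "a \<in> sets A"
    have "emeasure S (b \<times> a) = (\<integral>\<^sup>+p. indicator (b \<times> a) p \<partial>S)"
      using ab by (simp add: S_def)
    also have "\<dots> = (\<integral>\<^sup>+x. \<integral>\<^sup>+y. indicator (b \<times> a) (y, x) \<partial>K x \<partial>M)"
      using ab by (intro nS) auto
    also have "\<dots> = (\<integral>\<^sup>+x. indicator a x * emeasure (K x) b \<partial>M)"
    proof (intro nn_integral_cong)
      fix x assume "x \<in> space M"
      then have "x \<in> space A" using sets_eq_imp_space_eq[OF M(1)] by simp
      then have "sets (K x) = sets B" using measurable_space[OF K] by (simp add: space_prob_algebra)
      then show "(\<integral>\<^sup>+y. indicator (b \<times> a) (y, x) \<partial>K x) = indicator a x * emeasure (K x) b"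
        using ab(1) nn_integral_multc[of "indicator b" "K x" "indicator a x"]
        by (simp add: indicator_times mult.commute)
    qed
    finally show "(\<integral>\<^sup>+y. indicator b y * emeasure (K' y) a \<partial>M') = emeasure S (b \<times> a)"
      by (simp add: eq[OF ab(2,1)])
  qed
  also have "\<dots> = (\<integral>\<^sup>+x. \<integral>\<^sup>+y. (\<lambda>(y, x). f (x, y)) (y, x) \<partial>K x \<partial>M)"
    using measurable_compose[OF measurable_pair_swap' f] by (intro nS) (simp add: case_prod_beta')
  finally show ?thesis by simp
qed

lemma has_cond_law_nn_integral:
  assumes P: "prob_space P" and c: "has_cond_law P X MX Z MZ K" and f: "f \<in> borel_measurable (MX \<Otimes>\<^sub>M MZ)"
  shows "(\<integral>\<^sup>+\<omega>. f (X \<omega>, Z \<omega>) \<partial>P) = (\<integral>\<^sup>+\<omega>. \<integral>\<^sup>+x. f (x, Z \<omega>) \<partial>K (Z \<omega>) \<partial>P)"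
proof -
  interpret prob_space P by fact
  have X [measurable]: "X \<in> P \<rightarrow>\<^sub>M MX" and Z [measurable]: "Z \<in> P \<rightarrow>\<^sub>M MZ" and K: "K \<in> MZ \<rightarrow>\<^sub>M prob_algebra MX"
    and eq: "\<And>A B. A \<in> sets MX \<Longrightarrow> B \<in> sets MZ \<Longrightarrow> emeasure P {\<omega>\<in>space P. X \<omega> \<in> A \<and> Z \<omega> \<in> B} =
        (\<integral>\<^sup>+\<omega>. emeasure (K (Z \<omega>)) A * indicator B (Z \<omega>) \<partial>P)"
    using c by (auto simp: has_cond_law_def)
  have f': "(\<lambda>(z, x). f (x, z)) \<in> borel_measurable (MZ \<Otimes>\<^sub>M MX)"
    using measurable_compose[OF measurable_pair_swap' f] by (simp add: case_prod_beta')
  have "(\<integral>\<^sup>+z. \<integral>\<^sup>+x. (\<lambda>(z, x). f (x, z)) (z, x) \<partial>K z \<partial>distr P MZ Z) =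
    (\<integral>\<^sup>+p. (\<lambda>(z, x). f (x, z)) p \<partial>distr P (MZ \<Otimes>\<^sub>M MX) (\<lambda>\<omega>. (Z \<omega>, X \<omega>)))"
  proof (rule nn_integral_disintegration[OF _ _ K _ _ f'])
    show "prob_space (distr P MZ Z)" by (rule prob_space_distr) measurable
    fix a b assume ab: "a \<in> sets MZ" "b \<in> sets MX"
    have "emeasure (distr P (MZ \<Otimes>\<^sub>M MX) (\<lambda>\<omega>. (Z \<omega>, X \<omega>))) (a \<times> b) = emeasure P {\<omega>\<in>space P. X \<omega> \<in> b \<and> Z \<omega> \<in> a}"
      using ab by (subst emeasure_distr) (auto intro!: arg_cong[where f="emeasure P"])
    also have "\<dots> = (\<integral>\<^sup>+\<omega>. indicator a (Z \<omega>) * emeasure (K (Z \<omega>)) b \<partial>P)"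
      using eq[OF ab(2,1)] by (simp add: mult.commute)
    also have "\<dots> = (\<integral>\<^sup>+z. indicator a z * emeasure (K z) b \<partial>distr P MZ Z)"
    proof (rule nn_integral_distr[OF Z, symmetric])
      have "(\<lambda>z. emeasure (K z) b) \<in> borel_measurable MZ"
        using measurable_compose[OF measurable_prob_algebraD[OF K] measurable_emeasure_subprob_algebra[OF ab(2)]] .
      then show "(\<lambda>z. indicator a z * emeasure (K z) b) \<in> borel_measurable (distr P MZ Z)"
        using ab by simp
    qed
    finally show "(\<integral>\<^sup>+z. indicator a z * emeasure (K z) b \<partial>distr P MZ Z) =
      emeasure (distr P (MZ \<Otimes>\<^sub>M MX) (\<lambda>\<omega>. (Z \<omega>, X \<omega>))) (a \<times> b)" by simp
  qed simp_all
  moreover have "(\<integral>\<^sup>+p. (\<lambda>(z, x). f (x, z)) p \<partial>distr P (MZ \<Otimes>\<^sub>M MX) (\<lambda>\<omega>. (Z \<omega>, X \<omega>))) = (\<integral>\<^sup>+\<omega>. f (X \<omega>, Z \<omega>) \<partial>P)"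
    by (subst nn_integral_distr) (use f' in simp_all)
  moreover have "(\<integral>\<^sup>+z. \<integral>\<^sup>+x. (\<lambda>(z, x). f (x, z)) (z, x) \<partial>K z \<partial>distr P MZ Z) = (\<integral>\<^sup>+\<omega>. \<integral>\<^sup>+x. f (x, Z \<omega>) \<partial>K (Z \<omega>) \<partial>P)"
  proof (subst nn_integral_distr[OF Z])
    show "(\<lambda>z. \<integral>\<^sup>+x. (\<lambda>(z, x). f (x, z)) (z, x) \<partial>K z) \<in> borel_measurable (distr P MZ Z)"
      using nn_integral_measurable_subprob_algebra2[OF _ measurable_prob_algebraD[OF K], of "\<lambda>z x. f (x, z)"] f' by simp
  qed simp
  ultimately show ?thesis by simp
qed

section \<open>Posteriors of Dirichlet processes\<close>

text \<open>Conjugacy for one observation: drawing \<open>l\<close> from \<open>\<D>(\<alpha>)\<close> and then \<open>x\<close> from \<open>l\<close> gives the same joint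
law as drawing \<open>x\<close> from the normalised \<open>\<alpha>\<close> and then \<open>l\<close> from \<open>\<D>(\<alpha> + \<delta>\<^sub>x)\<close>.\<close>

theorem dirichlet_process_size_bias:
  fixes \<alpha> :: "'a::{metric_space, second_countable_topology} measure"
  assumes \<alpha>: "dirichlet_param \<alpha>" and f: "f \<in> borel_measurable (borel \<Otimes>\<^sub>M borel)"
  shows "(\<integral>\<^sup>+l. \<integral>\<^sup>+x. f (l, x) \<partial>meas l \<partial>\<D> \<alpha>) =
    (\<integral>\<^sup>+x. \<integral>\<^sup>+l. f (l, x) \<partial>\<D> (add_measure \<alpha> (return borel x)) \<partial>normalized \<alpha>)"
proof (rule nn_integral_disintegration2[OF _ _ measurable_meas _ _ _ _ f])
  note \<alpha>' = dirichlet_paramD[OF \<alpha>]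
  show "(\<lambda>x. \<D> (add_measure \<alpha> (return borel x))) \<in> borel \<rightarrow>\<^sub>M prob_algebra borel"
    using \<alpha> \<alpha>' prob_space_dirichlet_process[OF \<alpha>]
    by (intro measurable_dirichlet_process_add_return_kernel[where s="measure \<alpha> UNIV"] measurable_const)
      (auto simp: space_prob_algebra)
qed (use assms in \<open>auto simp: prob_space_dirichlet_process prob_space_normalized dirichlet_process_size_bias_set dirichlet_paramD(1)\<close>)

definition posterior :: "'a::topological_space measure \<Rightarrow> nat \<Rightarrow> (nat \<Rightarrow> 'a) \<Rightarrow> 'a measure" where
  "posterior \<alpha> n x = add_measure \<alpha> (sum_measure {1..n} (\<lambda>i. return borel (x i)))"

lemma sets_posterior [simp]: "sets (posterior \<alpha> n x) = sets borel"
  by (simp add: posterior_def)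

lemma emeasure_posterior:
  "sets \<alpha> = sets borel \<Longrightarrow> emeasure (posterior \<alpha> n x) B = emeasure \<alpha> B + (\<Sum>i=1..n. emeasure (return borel (x i)) B)"
  by (simp add: posterior_def emeasure_add_measure emeasure_sum_measure)

lemma posterior_0: "sets \<alpha> = sets borel \<Longrightarrow> posterior \<alpha> 0 x = \<alpha>"
  by (intro measure_eqI) (simp_all add: emeasure_posterior)

lemma posterior_Suc:
  assumes "sets \<alpha> = sets borel"
  shows "posterior \<alpha> (Suc n) x = add_measure (posterior \<alpha> n x) (return borel (x (Suc n)))"
  using assms by (intro measure_eqI) (simp_all add: emeasure_posterior emeasure_add_measure add.assoc)

lemma posterior_cong: "(\<And>i. i \<in> {1..n} \<Longrightarrow> x i = x' i) \<Longrightarrow> posterior \<alpha> n x = posterior \<alpha> n x'"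
proof -
  assume "\<And>i. i \<in> {1..n} \<Longrightarrow> x i = x' i"
  then have "(\<Sum>i\<in>{1..n}. emeasure (return borel (x i)) B) = (\<Sum>i\<in>{1..n}. emeasure (return borel (x' i)) B)" for B
    by (intro sum.cong) auto
  then show ?thesis by (simp only: posterior_def sum_measure_def)
qed

lemma dirichlet_param_posterior:
  assumes "dirichlet_param \<alpha>"
  shows "dirichlet_param (posterior \<alpha> n x)"
  by (induction n) (use assms in \<open>simp_all add: posterior_0 posterior_Suc dirichlet_param_add_return dirichlet_paramD(1)\<close>)

lemma measure_posterior_UNIV:
  assumes \<alpha>: "dirichlet_param \<alpha>"
  shows "measure (posterior \<alpha> n x) UNIV = measure \<alpha> UNIV + real n"
proof (induction n)
  case (Suc n)
  have "finite_measure (posterior \<alpha> n x)" using dirichlet_param_posterior[OF \<alpha>] by (rule dirichlet_paramD)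
  then show ?case
    using Suc dirichlet_paramD[OF \<alpha>]
    by (simp add: posterior_Suc measure_add_measure prob_space.finite_measure prob_space_return measure_return)
qed (simp add: posterior_0 dirichlet_paramD[OF \<alpha>])

lemma measurable_posterior:
  fixes \<alpha> :: "'a::{metric_space, second_countable_topology} measure"
  assumes \<alpha>: "dirichlet_param \<alpha>" and x: "\<And>i. i \<in> {1..n} \<Longrightarrow> x i \<in> N \<rightarrow>\<^sub>M borel"
  shows "(\<lambda>y. \<D> (posterior \<alpha> n (\<lambda>i. x i y))) \<in> N \<rightarrow>\<^sub>M prob_algebra borel"
  using x
proof (induction n)
  case 0
  have "\<D> \<alpha> \<in> space (prob_algebra borel)"
    using \<alpha> by (simp add: space_prob_algebra prob_space_dirichlet_process)
  then show ?case by (simp add: posterior_0 dirichlet_paramD(1)[OF \<alpha>])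
next
  case (Suc n)
  have "(\<lambda>y. \<D> (add_measure (posterior \<alpha> n (\<lambda>i. x i y)) (return borel (x (Suc n) y)))) \<in> N \<rightarrow>\<^sub>M prob_algebra borel"
  proof (rule measurable_dirichlet_process_add_return_kernel)
    show "(\<lambda>y. \<D> (posterior \<alpha> n (\<lambda>i. x i y))) \<in> N \<rightarrow>\<^sub>M prob_algebra borel"
      using Suc.prems by (intro Suc.IH) auto
    show "measure (posterior \<alpha> n (\<lambda>i. x i y)) UNIV = measure \<alpha> UNIV + real n" for y
      by (rule measure_posterior_UNIV[OF \<alpha>])
    show "0 < measure \<alpha> UNIV + real n" using dirichlet_paramD[OF \<alpha>] by simp
  qed (use Suc.prems \<alpha> in \<open>auto intro: dirichlet_param_posterior\<close>)
  then show ?case by (simp add: posterior_Suc dirichlet_paramD[OF \<alpha>])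
qed

lemma measurable_posterior_PiM:
  fixes \<alpha> :: "'a::{metric_space, second_countable_topology} measure"
  assumes \<alpha>: "dirichlet_param \<alpha>"
  shows "(\<lambda>x. \<D> (posterior \<alpha> n x)) \<in> PiM {1..n} (\<lambda>_. borel) \<rightarrow>\<^sub>M prob_algebra borel"
  using measurable_posterior[OF \<alpha>, of n "\<lambda>i x. x i"] by simp

lemma measurable_PiM_meas:
  fixes m :: "'i \<Rightarrow> 'b \<Rightarrow> 'a::metric_space borel_prob"
  assumes I: "finite I" and m: "\<And>i. i \<in> I \<Longrightarrow> m i \<in> N \<rightarrow>\<^sub>M borel"
  shows "(\<lambda>y. PiM I (\<lambda>i. meas (m i y))) \<in> N \<rightarrow>\<^sub>M prob_algebra (PiM I (\<lambda>_. borel))"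
proof (rule measurable_prob_algebra_generated[OF sets_PiM Int_stable_prod_algebra prod_algebra_sets_into_space])
  fix y
  show "prob_space (PiM I (\<lambda>i. meas (m i y)))" by (intro prob_space_PiM) simp
  show "sets (PiM I (\<lambda>i. meas (m i y))) = sets (PiM I (\<lambda>_. borel))" by (intro sets_PiM_cong) simp_all
next
  fix A :: "('i \<Rightarrow> 'a) set" assume "A \<in> prod_algebra I (\<lambda>_. borel)"
  then obtain E where E: "A = Pi\<^sub>E I E" "E \<in> (\<Pi> i\<in>I. sets borel)"
    by (rule prod_algebraE_all)
  then have A: "A = Pi\<^sub>E I E" "E i \<in> sets borel" if "i \<in> I" for i
    using that by auto
  have A1: "A = Pi\<^sub>E I E" by fact
  have "emeasure (PiM I (\<lambda>i. meas (m i y))) A = (\<Prod>i\<in>I. ennreal (measure (meas (m i y)) (E i)))" for y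
  proof -
    interpret product_sigma_finite "\<lambda>i. meas (m i y)"
      by (simp add: product_sigma_finite_def prob_space_imp_sigma_finite)
    show ?thesis unfolding A1 using I A(2) by (subst emeasure_PiM) (auto simp: emeasure_meas)
  qed
  moreover have "(\<lambda>y. \<Prod>i\<in>I. ennreal (measure (meas (m i y)) (E i))) \<in> borel_measurable N"
    by (intro borel_measurable_prod_ennreal measurable_compose[OF _ measurable_ennreal]
      measurable_compose[OF m measurable_eval] A(2))
  ultimately show "(\<lambda>y. emeasure (PiM I (\<lambda>i. meas (m i y))) A) \<in> borel_measurable N" by simp
qed

lemma nn_integral_PiM_meas_Suc:
  fixes l :: "'a::metric_space borel_prob"
  assumes "f \<in> borel_measurable (PiM {1..Suc n} (\<lambda>_. borel))"
  shows "(\<integral>\<^sup>+x. f x \<partial>PiM {1..Suc n} (\<lambda>_. meas l)) = (\<integral>\<^sup>+x. \<integral>\<^sup>+z. f (x(Suc n := z)) \<partial>meas l \<partial>PiM {1..n} (\<lambda>_. meas l))"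
proof -
  interpret product_sigma_finite "\<lambda>_. meas l"
    by (simp add: product_sigma_finite_def prob_space_imp_sigma_finite)
  have i: "{1..Suc n} = insert (Suc n) {1..n}" by auto
  have "f \<in> borel_measurable (PiM (insert (Suc n) {1..n}) (\<lambda>_. meas l))"
    using assms[unfolded i] by (simp cong: measurable_cong_sets sets_PiM_cong)
  then show ?thesis unfolding i by (intro product_nn_integral_insert) auto
qed

lemma nn_integral_normalized:
  assumes \<alpha>: "dirichlet_param \<alpha>" and f: "f \<in> borel_measurable borel"
  shows "(\<integral>\<^sup>+x. f x \<partial>normalized \<alpha>) = ennreal (1 / measure \<alpha> UNIV) * (\<integral>\<^sup>+x. f x \<partial>\<alpha>)"
  unfolding normalized_def using f dirichlet_paramD[OF \<alpha>]
  by (intro nn_integral_scale_measure) (simp cong: measurable_cong_sets)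

lemma nn_integral_posterior:
  assumes "sets \<alpha> = sets borel" and f: "f \<in> borel_measurable borel"
  shows "(\<integral>\<^sup>+x. f x \<partial>posterior \<alpha> n x0) = (\<integral>\<^sup>+x. f x \<partial>\<alpha>) + (\<Sum>i=1..n. f (x0 i))"
proof (induction n)
  case (Suc n)
  then show ?case
    using assms by (simp add: posterior_Suc nn_integral_add_measure nn_integral_return add.assoc)
qed (simp add: posterior_0 assms)

lemma measurable_PiM_fun_upd_Suc:
  "(\<lambda>(x, z). x(Suc n := z)) \<in> PiM {1..n} (\<lambda>_. M) \<Otimes>\<^sub>M M \<rightarrow>\<^sub>M PiM {1..Suc n} (\<lambda>_. M)"
proof -
  have i: "{1..Suc n} = insert (Suc n) {1..n}" by auto
  show ?thesis unfolding i by (rule measurable_add_dim)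
qed

lemma measurable_nn_integral_kernel:
  assumes K: "K \<in> M \<rightarrow>\<^sub>M prob_algebra N" and f: "f \<in> borel_measurable (M \<Otimes>\<^sub>M N)"
  shows "(\<lambda>x. \<integral>\<^sup>+y. f (x, y) \<partial>K x) \<in> borel_measurable M"
  using nn_integral_measurable_subprob_algebra2[of "\<lambda>x y. f (x, y)" M N K] f measurable_prob_algebraD[OF K] by simp

text \<open>The posterior given a sample of size \<open>n\<close>. The law of the sample is written as the mixture of product
measures with a mixing variable \<open>l'\<close>, and \<open>l\<close> is then drawn anew from the posterior. The induction step
applies conjugacy for one observation to \<open>posterior \<alpha> n x\<close>. It expresses the sample of size
\<open>Suc n\<close> through the predictive law on both sides, once for \<open>f\<close> and once for the integral of \<open>f\<close>
against the posterior, which depends on the sample alone.\<close>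

theorem dirichlet_process_posterior:
  fixes \<alpha> :: "'a::{metric_space, second_countable_topology} measure"
  assumes \<alpha>: "dirichlet_param \<alpha>" and f: "f \<in> borel_measurable (borel \<Otimes>\<^sub>M PiM {1..n} (\<lambda>_. borel))"
  shows "(\<integral>\<^sup>+l. \<integral>\<^sup>+x. f (l, x) \<partial>PiM {1..n} (\<lambda>_. meas l) \<partial>\<D> \<alpha>) =
    (\<integral>\<^sup>+l'. \<integral>\<^sup>+x. \<integral>\<^sup>+l. f (l, x) \<partial>\<D> (posterior \<alpha> n x) \<partial>PiM {1..n} (\<lambda>_. meas l') \<partial>\<D> \<alpha>)"
  using f
proof (induction n arbitrary: f)
  case 0
  interpret D: prob_space "\<D> \<alpha>" using \<alpha> by (rule prob_space_dirichlet_process)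
  show ?case
    using D.emeasure_space_1
    by (simp add: PiM_empty nn_integral_count_space_finite posterior_0 dirichlet_paramD(1)[OF \<alpha>])
next
  case (Suc n)
  note [measurable] = Suc.prems
  note post = dirichlet_param_posterior[OF \<alpha>]
  have K1: "(\<lambda>l. PiM {1..n} (\<lambda>_. meas l)) \<in> borel \<rightarrow>\<^sub>M prob_algebra (PiM {1..n} (\<lambda>_. borel :: 'a measure))"
    using measurable_PiM_meas[of "{1..n}" "\<lambda>_ l. l" borel] by simp
  have upd: "(\<lambda>(x, z). x(Suc n := z)) \<in> PiM {1..n} (\<lambda>_. borel) \<Otimes>\<^sub>M borel \<rightarrow>\<^sub>M PiM {1..Suc n} (\<lambda>_. borel :: 'a measure)"
    by (rule measurable_PiM_fun_upd_Suc)
  have step: "(\<integral>\<^sup>+l. \<integral>\<^sup>+x. g (l, x) \<partial>PiM {1..Suc n} (\<lambda>_. meas l) \<partial>\<D> \<alpha>) =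
     (\<integral>\<^sup>+l'. \<integral>\<^sup>+x. \<integral>\<^sup>+z. \<integral>\<^sup>+l. g (l, x(Suc n := z)) \<partial>\<D> (posterior \<alpha> (Suc n) (x(Suc n := z))) \<partial>normalized (posterior \<alpha> n x)
       \<partial>PiM {1..n} (\<lambda>_. meas l') \<partial>\<D> \<alpha>)"
    if g [measurable]: "g \<in> borel_measurable (borel \<Otimes>\<^sub>M PiM {1..Suc n} (\<lambda>_. borel))" for g :: "'a borel_prob \<times> (nat \<Rightarrow> 'a) \<Rightarrow> ennreal"
  proof -
    have gz: "(\<lambda>((l, x), z). g (l, x(Suc n := z))) \<in> borel_measurable ((borel \<Otimes>\<^sub>M PiM {1..n} (\<lambda>_. borel)) \<Otimes>\<^sub>M borel)"
    proof -
      have "(\<lambda>p. (fst (fst p), (snd (fst p))(Suc n := snd p))) \<in> (borel \<Otimes>\<^sub>M PiM {1..n} (\<lambda>_. borel)) \<Otimes>\<^sub>M borel \<rightarrow>\<^sub>M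
          (borel :: 'a borel_prob measure) \<Otimes>\<^sub>M PiM {1..Suc n} (\<lambda>_. borel :: 'a measure)"
      proof (rule measurable_Pair)
        have "(\<lambda>p. (snd (fst p), snd p)) \<in> ((borel :: 'a borel_prob measure) \<Otimes>\<^sub>M PiM {1..n} (\<lambda>_. borel)) \<Otimes>\<^sub>M borel \<rightarrow>\<^sub>M
          PiM {1..n} (\<lambda>_. borel :: 'a measure) \<Otimes>\<^sub>M (borel :: 'a measure)" by measurable
        from measurable_compose[OF this upd]
        show "(\<lambda>p. (snd (fst p))(Suc n := snd p)) \<in> ((borel :: 'a borel_prob measure) \<Otimes>\<^sub>M PiM {1..n} (\<lambda>_. borel)) \<Otimes>\<^sub>M borel \<rightarrow>\<^sub>M
          PiM {1..Suc n} (\<lambda>_. borel :: 'a measure)" by simp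
      qed measurable
      from measurable_compose[OF this g] show ?thesis by (simp add: case_prod_beta')
    qed
    have gl: "(\<lambda>x. g (l, x)) \<in> borel_measurable (PiM {1..Suc n} (\<lambda>_. borel))" for l
      using measurable_compose[OF measurable_Pair1' g, of l] by simp
    have fz: "(\<lambda>p. \<integral>\<^sup>+z. g (fst p, (snd p)(Suc n := z)) \<partial>meas (fst p)) \<in> borel_measurable (borel \<Otimes>\<^sub>M PiM {1..n} (\<lambda>_. borel))"
    proof -
      have k: "(\<lambda>p. meas (fst p)) \<in> borel \<Otimes>\<^sub>M PiM {1..n} (\<lambda>_. borel) \<rightarrow>\<^sub>M prob_algebra (borel :: 'a measure)" by measurable
      have "(\<lambda>p. \<integral>\<^sup>+z. (\<lambda>((l, x), z). g (l, x(Suc n := z))) (p, z) \<partial>meas (fst p)) \<in> borel_measurable (borel \<Otimes>\<^sub>M PiM {1..n} (\<lambda>_. borel))"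
        by (rule measurable_nn_integral_kernel[OF k gz])
      then show ?thesis by (simp add: case_prod_beta')
    qed
    have "(\<integral>\<^sup>+l. \<integral>\<^sup>+x. g (l, x) \<partial>PiM {1..Suc n} (\<lambda>_. meas l) \<partial>\<D> \<alpha>) =
      (\<integral>\<^sup>+l. \<integral>\<^sup>+x. (\<lambda>p. \<integral>\<^sup>+z. g (fst p, (snd p)(Suc n := z)) \<partial>meas (fst p)) (l, x) \<partial>PiM {1..n} (\<lambda>_. meas l) \<partial>\<D> \<alpha>)"
      by (simp only: nn_integral_PiM_meas_Suc[OF gl] fst_conv snd_conv)
    also have "\<dots> = (\<integral>\<^sup>+l'. \<integral>\<^sup>+x. \<integral>\<^sup>+l. (\<lambda>p. \<integral>\<^sup>+z. g (fst p, (snd p)(Suc n := z)) \<partial>meas (fst p)) (l, x) \<partial>\<D> (posterior \<alpha> n x)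
       \<partial>PiM {1..n} (\<lambda>_. meas l') \<partial>\<D> \<alpha>)"
      by (rule Suc.IH[OF fz])
    also have "\<dots> = (\<integral>\<^sup>+l'. \<integral>\<^sup>+x. \<integral>\<^sup>+z. \<integral>\<^sup>+l. g (l, x(Suc n := z)) \<partial>\<D> (posterior \<alpha> (Suc n) (x(Suc n := z))) \<partial>normalized (posterior \<alpha> n x)
       \<partial>PiM {1..n} (\<lambda>_. meas l') \<partial>\<D> \<alpha>)"
    proof (intro nn_integral_cong)
      fix l' :: "'a borel_prob" and x assume "x \<in> space (PiM {1..n} (\<lambda>_. meas l'))"
      then have x: "x \<in> space (PiM {1..n} (\<lambda>_. borel :: 'a measure))" by (simp add: space_PiM)
      have p: "posterior \<alpha> (Suc n) (x(Suc n := z)) = add_measure (posterior \<alpha> n x) (return borel z)" for z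
        using posterior_cong[of n "x(Suc n := z)" x \<alpha>] by (simp add: posterior_Suc dirichlet_paramD(1)[OF \<alpha>])
      have "(\<lambda>p. ((fst p, x), snd p)) \<in> borel \<Otimes>\<^sub>M borel \<rightarrow>\<^sub>M ((borel :: 'a borel_prob measure) \<Otimes>\<^sub>M PiM {1..n} (\<lambda>_. borel :: 'a measure)) \<Otimes>\<^sub>M (borel :: 'a measure)"
        using x by measurable
      from measurable_compose[OF this gz]
      have "(\<lambda>p. g (fst p, x(Suc n := snd p))) \<in> borel_measurable (borel \<Otimes>\<^sub>M borel)" by simp
      from dirichlet_process_size_bias[OF post this]
      show "(\<integral>\<^sup>+l. (\<lambda>p. \<integral>\<^sup>+z. g (fst p, (snd p)(Suc n := z)) \<partial>meas (fst p)) (l, x) \<partial>\<D> (posterior \<alpha> n x)) =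
        (\<integral>\<^sup>+z. \<integral>\<^sup>+l. g (l, x(Suc n := z)) \<partial>\<D> (posterior \<alpha> (Suc n) (x(Suc n := z))) \<partial>normalized (posterior \<alpha> n x))"
        unfolding p by simp
    qed
    finally show ?thesis .
  qed
  \<comment> \<open>since \<open>H\<close> does not depend on \<open>l\<close>, \<open>step\<close> for \<open>H\<close> and \<open>step\<close> for \<open>f\<close> have the same right-hand side\<close>
  define H where "H x = (\<integral>\<^sup>+l. f (l, x) \<partial>\<D> (posterior \<alpha> (Suc n) x))" for x
  have H: "H \<in> borel_measurable (PiM {1..Suc n} (\<lambda>_. borel))"
    unfolding H_def
    using measurable_nn_integral_kernel[OF measurable_posterior_PiM[OF \<alpha>], of "\<lambda>(x, l). f (l, x)" "Suc n"]
      measurable_compose[OF measurable_pair_swap' Suc.prems] by (simp add: case_prod_beta')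
  have "(\<integral>\<^sup>+l'. \<integral>\<^sup>+x. H x \<partial>PiM {1..Suc n} (\<lambda>_. meas l') \<partial>\<D> \<alpha>) =
    (\<integral>\<^sup>+l'. \<integral>\<^sup>+x. (\<lambda>p. H (snd p)) (l', x) \<partial>PiM {1..Suc n} (\<lambda>_. meas l') \<partial>\<D> \<alpha>)" by simp
  also have "\<dots> = (\<integral>\<^sup>+l'. \<integral>\<^sup>+x. \<integral>\<^sup>+z. \<integral>\<^sup>+l. (\<lambda>p. H (snd p)) (l, x(Suc n := z)) \<partial>\<D> (posterior \<alpha> (Suc n) (x(Suc n := z))) \<partial>normalized (posterior \<alpha> n x)
       \<partial>PiM {1..n} (\<lambda>_. meas l') \<partial>\<D> \<alpha>)"
    by (rule step[OF measurable_compose[OF measurable_snd H]])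
  also have "\<dots> = (\<integral>\<^sup>+l'. \<integral>\<^sup>+x. \<integral>\<^sup>+z. H (x(Suc n := z)) \<partial>normalized (posterior \<alpha> n x)
       \<partial>PiM {1..n} (\<lambda>_. meas l') \<partial>\<D> \<alpha>)"
    using prob_space.emeasure_space_1[OF prob_space_dirichlet_process[OF post]] post by simp
  also have "\<dots> = (\<integral>\<^sup>+l. \<integral>\<^sup>+x. f (l, x) \<partial>PiM {1..Suc n} (\<lambda>_. meas l) \<partial>\<D> \<alpha>)"
    unfolding H_def by (rule step[symmetric]) measurable
  finally show ?case by (simp add: H_def)
qed

text \<open>The Polya urn: the mean of \<open>\<D>(\<alpha>')\<close> is the normalised \<open>\<alpha>'\<close>, taken at the posterior parameter.\<close>

theorem dirichlet_process_predictive: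
  fixes \<alpha> :: "'a::{metric_space, second_countable_topology} measure"
  assumes \<alpha>: "dirichlet_param \<alpha>" and g: "g \<in> borel_measurable (PiM {1..Suc n} (\<lambda>_. borel))"
  shows "(\<integral>\<^sup>+l. \<integral>\<^sup>+x. g x \<partial>PiM {1..Suc n} (\<lambda>_. meas l) \<partial>\<D> \<alpha>) =
    (\<integral>\<^sup>+l. \<integral>\<^sup>+x. ennreal (1 / (measure \<alpha> UNIV + real n)) *
        ((\<integral>\<^sup>+z. g (x(Suc n := z)) \<partial>\<alpha>) + (\<Sum>i=1..n. g (x(Suc n := x i)))) \<partial>PiM {1..n} (\<lambda>_. meas l) \<partial>\<D> \<alpha>)"
proof -
  note post = dirichlet_param_posterior[OF \<alpha>]
  have upd: "(\<lambda>(x, z). x(Suc n := z)) \<in> PiM {1..n} (\<lambda>_. borel) \<Otimes>\<^sub>M borel \<rightarrow>\<^sub>M PiM {1..Suc n} (\<lambda>_. borel :: 'a measure)"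
    by (rule measurable_PiM_fun_upd_Suc)
  have gz: "(\<lambda>(x, z). g (x(Suc n := z))) \<in> borel_measurable (PiM {1..n} (\<lambda>_. borel) \<Otimes>\<^sub>M borel)"
    using measurable_compose[OF upd g] by (simp add: case_prod_beta')
  have fz: "(\<lambda>p. \<integral>\<^sup>+z. g ((snd p)(Suc n := z)) \<partial>meas (fst p)) \<in> borel_measurable (borel \<Otimes>\<^sub>M PiM {1..n} (\<lambda>_. borel))"
  proof -
    have k: "(\<lambda>p. meas (fst p)) \<in> borel \<Otimes>\<^sub>M PiM {1..n} (\<lambda>_. borel) \<rightarrow>\<^sub>M prob_algebra (borel :: 'a measure)" by measurable
    have "(\<lambda>p. (snd (fst p), snd p)) \<in> ((borel :: 'a borel_prob measure) \<Otimes>\<^sub>M PiM {1..n} (\<lambda>_. borel)) \<Otimes>\<^sub>M borel \<rightarrow>\<^sub>M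
          PiM {1..n} (\<lambda>_. borel :: 'a measure) \<Otimes>\<^sub>M (borel :: 'a measure)" by measurable
    from measurable_nn_integral_kernel[OF k measurable_compose[OF this gz]]
    show ?thesis by simp
  qed
  have gx: "(\<lambda>z. g (x(Suc n := z))) \<in> borel_measurable borel" if "x \<in> space (PiM {1..n} (\<lambda>_. borel :: 'a measure))" for x
    using measurable_compose[OF measurable_Pair1'[OF that] gz] by simp
  have "(\<integral>\<^sup>+l. \<integral>\<^sup>+x. g x \<partial>PiM {1..Suc n} (\<lambda>_. meas l) \<partial>\<D> \<alpha>) =
    (\<integral>\<^sup>+l. \<integral>\<^sup>+x. (\<lambda>p. \<integral>\<^sup>+z. g ((snd p)(Suc n := z)) \<partial>meas (fst p)) (l, x) \<partial>PiM {1..n} (\<lambda>_. meas l) \<partial>\<D> \<alpha>)"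
    by (simp only: nn_integral_PiM_meas_Suc[OF g] fst_conv snd_conv)
  also have "\<dots> = (\<integral>\<^sup>+l'. \<integral>\<^sup>+x. \<integral>\<^sup>+l. (\<lambda>p. \<integral>\<^sup>+z. g ((snd p)(Suc n := z)) \<partial>meas (fst p)) (l, x) \<partial>\<D> (posterior \<alpha> n x)
       \<partial>PiM {1..n} (\<lambda>_. meas l') \<partial>\<D> \<alpha>)"
    by (rule dirichlet_process_posterior[OF \<alpha> fz])
  also have "\<dots> = (\<integral>\<^sup>+l. \<integral>\<^sup>+x. ennreal (1 / (measure \<alpha> UNIV + real n)) *
        ((\<integral>\<^sup>+z. g (x(Suc n := z)) \<partial>\<alpha>) + (\<Sum>i=1..n. g (x(Suc n := x i)))) \<partial>PiM {1..n} (\<lambda>_. meas l) \<partial>\<D> \<alpha>)"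
  proof (intro nn_integral_cong)
    fix l' :: "'a borel_prob" and x assume "x \<in> space (PiM {1..n} (\<lambda>_. meas l'))"
    then have x: "x \<in> space (PiM {1..n} (\<lambda>_. borel :: 'a measure))" by (simp add: space_PiM)
    have "(\<lambda>p. g (x(Suc n := snd p))) \<in> borel_measurable ((borel :: 'a borel_prob measure) \<Otimes>\<^sub>M borel)"
      by (rule measurable_compose[OF measurable_snd gx[OF x]])
    from dirichlet_process_size_bias[OF post this]
    have "(\<integral>\<^sup>+l. \<integral>\<^sup>+z. g (x(Suc n := z)) \<partial>meas l \<partial>\<D> (posterior \<alpha> n x)) =
      (\<integral>\<^sup>+z. g (x(Suc n := z)) \<partial>normalized (posterior \<alpha> n x))"
      using prob_space.emeasure_space_1[OF prob_space_dirichlet_process[OF dirichlet_param_add_return[OF post]]]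
        dirichlet_param_add_return[OF post] by simp
    also have "\<dots> = ennreal (1 / (measure \<alpha> UNIV + real n)) * ((\<integral>\<^sup>+z. g (x(Suc n := z)) \<partial>\<alpha>) + (\<Sum>i=1..n. g (x(Suc n := x i))))"
      using gx[OF x] by (simp add: nn_integral_normalized[OF post] nn_integral_posterior dirichlet_paramD(1)[OF \<alpha>] measure_posterior_UNIV[OF \<alpha>])
    finally show "(\<integral>\<^sup>+l. (\<lambda>p. \<integral>\<^sup>+z. g ((snd p)(Suc n := z)) \<partial>meas (fst p)) (l, x) \<partial>\<D> (posterior \<alpha> n x)) =
      ennreal (1 / (measure \<alpha> UNIV + real n)) * ((\<integral>\<^sup>+z. g (x(Suc n := z)) \<partial>\<alpha>) + (\<Sum>i=1..n. g (x(Suc n := x i))))" by simp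
  qed
  finally show ?thesis .
qed

section \<open>Independent rows\<close>

lemma indep_vars_coordinates:
  assumes I: "I \<noteq> {}" and M: "\<And>i. i \<in> I \<Longrightarrow> prob_space (M i)"
  shows "prob_space.indep_vars (PiM I M) M (\<lambda>i x. x i) I"
proof -
  interpret prob_space "PiM I M" using M by (rule prob_space_PiM)
  have "distr (PiM I M) (PiM I M) (\<lambda>x. \<lambda>i\<in>I. x i) = distr (PiM I M) (PiM I M) (\<lambda>x. x)"
    by (intro distr_cong) (auto simp: space_PiM PiE_restrict)
  also have "\<dots> = PiM I M" by (simp add: distr_id2)
  also have "\<dots> = PiM I (\<lambda>i. distr (PiM I M) (M i) (\<lambda>x. x i))"
    using M by (intro PiM_cong) (simp_all add: distr_PiM_component)
  finally show ?thesis
    using I by (subst indep_vars_iff_distr_eq_PiM') auto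
qed

text \<open>Disjoint blocks of coordinates of a product measure are independent, and the first \<open>N\<close> entries of
row \<open>i\<close> form an i.i.d. sample from \<open>m i\<close>.\<close>

lemma emeasure_PiM_rows:
  fixes m :: "nat \<Rightarrow> 'a::topological_space borel_prob" and M N :: nat
  assumes M: "1 \<le> M" and A: "\<And>i. i \<in> {1..M} \<Longrightarrow> A i \<in> sets (PiM {1..N} (\<lambda>_. borel))"
  shows "emeasure (PiM ({1..} \<times> {1..}) (\<lambda>(i, j). meas (m i)))
      {x \<in> space (PiM ({1..} \<times> {1..}) (\<lambda>_. borel)). \<forall>i\<in>{1..M}. (\<lambda>j\<in>{1..N}. x (i, j)) \<in> A i} =
    (\<Prod>i=1..M. emeasure (PiM {1..N} (\<lambda>_. meas (m i))) (A i))"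
proof -
  let ?I = "{1..} \<times> {1..} :: (nat \<times> nat) set"
  define \<nu> where "\<nu> p = meas (m (fst p))" for p :: "nat \<times> nat"
  have \<nu>: "prob_space (\<nu> p)" "sets (\<nu> p) = sets borel" for p by (simp_all add: \<nu>_def)
  define R where "R = PiM ?I \<nu>"
  have eq: "PiM ?I (\<lambda>(i, j). meas (m i)) = R"
    unfolding R_def \<nu>_def by (simp add: case_prod_beta')
  interpret prob_space R unfolding R_def by (intro prob_space_PiM \<nu>)
  have sp: "space R = space (PiM ?I (\<lambda>_. borel))"
    unfolding R_def by (intro sets_eq_imp_space_eq sets_PiM_cong) (simp_all add: \<nu>)
  have sets\<nu>: "sets (PiM {1..N} (\<lambda>j. \<nu> (i, j))) = sets (PiM {1..N} (\<lambda>_. borel))" for i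
    by (intro sets_PiM_cong) (simp_all add: \<nu>)
  have A': "A i \<in> sets (PiM {1..N} (\<lambda>j. \<nu> (i, j)))" if "i \<in> {1..M}" for i
    by (simp only: sets\<nu> A[OF that])
  define Y where "Y i x = (\<lambda>j\<in>{1..N}. x (i, j))" for i and x :: "nat \<times> nat \<Rightarrow> 'a"
  have "indep_vars \<nu> (\<lambda>p x. x p) ?I"
    unfolding R_def by (rule indep_vars_coordinates) (auto simp: \<nu>)
  then have "indep_vars (\<lambda>i. PiM ({i} \<times> {1..N}) \<nu>) (\<lambda>i x. restrict (\<lambda>p. x p) ({i} \<times> {1..N})) {1..M}"
    by (rule indep_vars_restrict) (auto simp: disjoint_family_on_def)
  then have "indep_vars (\<lambda>i. PiM {1..N} (\<lambda>j. \<nu> (i, j))) (\<lambda>i x. Y i (restrict (\<lambda>p. x p) ({i} \<times> {1..N}))) {1..M}"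
  proof (rule indep_vars_compose2)
    fix i
    show "Y i \<in> PiM ({i} \<times> {1..N}) \<nu> \<rightarrow>\<^sub>M PiM {1..N} (\<lambda>j. \<nu> (i, j))"
      unfolding Y_def by (intro measurable_restrict measurable_component_singleton) auto
  qed
  moreover have "Y i (restrict (\<lambda>p. x p) ({i} \<times> {1..N})) = Y i x" for i x
    by (auto simp: Y_def intro!: restrict_ext)
  ultimately have ind: "indep_vars (\<lambda>i. PiM {1..N} (\<lambda>j. \<nu> (i, j))) Y {1..M}" by simp
  have "emeasure R {x \<in> space R. \<forall>i\<in>{1..M}. Y i x \<in> A i} = ennreal (prob (\<Inter>i\<in>{1..M}. Y i -` A i \<inter> space R))"
    unfolding emeasure_eq_measure using M by (intro arg_cong[where f=ennreal] arg_cong[where f=prob]) auto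
  also have "prob (\<Inter>i\<in>{1..M}. Y i -` A i \<inter> space R) = (\<Prod>i\<in>{1..M}. prob (Y i -` A i \<inter> space R))"
    using M A' by (intro indep_varsD_finite[OF ind]) auto
  also have "\<dots> = (\<Prod>i\<in>{1..M}. measure (PiM {1..N} (\<lambda>_. meas (m i))) (A i))"
  proof (intro prod.cong refl)
    fix i assume i: "i \<in> {1..M}"
    have d: "distr R (PiM {1..N} (\<lambda>j. \<nu> (i, j))) (Y i) = PiM {1..N} (\<lambda>j. \<nu> (i, j))"
      unfolding R_def Y_def using i by (intro distr_PiM_reindex \<nu>) (auto simp: inj_on_def)
    have "Y i \<in> R \<rightarrow>\<^sub>M PiM {1..N} (\<lambda>j. \<nu> (i, j))" using ind i by (auto simp: indep_vars_def)
    then have "prob (Y i -` A i \<inter> space R) = measure (distr R (PiM {1..N} (\<lambda>j. \<nu> (i, j))) (Y i)) (A i)"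
      using A'[OF i] by (intro measure_distr[symmetric])
    then show "prob (Y i -` A i \<inter> space R) = measure (PiM {1..N} (\<lambda>_. meas (m i))) (A i)"
      unfolding d by (simp add: \<nu>_def)
  qed
  also have "ennreal \<dots> = (\<Prod>i=1..M. emeasure (PiM {1..N} (\<lambda>_. meas (m i))) (A i))"
    by (subst prod_ennreal[symmetric])
      (auto intro!: prod.cong simp: finite_measure.emeasure_eq_measure prob_space.finite_measure prob_space_PiM)
  finally show ?thesis unfolding eq sp Y_def .
qed

section \<open>Weak convergence\<close>

text \<open>Discretised layer-cake formula: counting the multiples of \<open>c\<close> below \<open>y\<close> recovers \<open>y\<close> up to \<open>c\<close>.\<close>

lemma layer_sum_bounds:
  fixes y c :: real
  assumes "0 \<le> y" "y \<le> real N * c" "0 < c"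
  shows "(\<Sum>j=1..N. c * (if real j * c < y then 1 else 0)) \<le> y"
    and "y \<le> c + (\<Sum>j=1..N. c * (if real j * c < y then 1 else 0))"
proof -
  have "(\<Sum>j=1..N. c * (if real j * c < y then 1 else 0)) \<le> y \<and> y \<le> c + (\<Sum>j=1..N. c * (if real j * c < y then 1 else 0))"
    using assms(2)
  proof (induction N)
    case (Suc N)
    have last: "\<not> real (Suc N) * c < y" using Suc.prems by simp
    show ?case
    proof (cases "y \<le> real N * c")
      case True
      then show ?thesis using Suc.IH last by (simp add: algebra_simps)
    next
      case False
      have "real j * c < y" if "j \<in> {1..N}" for j
      proof -
        have "real j * c \<le> real N * c" using that assms by (intro mult_right_mono) auto
        then show ?thesis using False by simp
      qed
      then have "(\<Sum>j=1..N. c * (if real j * c < y then 1 else 0)) = (\<Sum>j=1..N. c)"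
        by (intro sum.cong) auto
      then have "(\<Sum>j=1..Suc N. c * (if real j * c < y then 1 else 0)) = real N * c"
        using last by simp
      then show ?thesis using False Suc.prems by (simp add: algebra_simps)
    qed
  qed (use assms in simp)
  then show "(\<Sum>j=1..N. c * (if real j * c < y then 1 else 0)) \<le> y"
    "y \<le> c + (\<Sum>j=1..N. c * (if real j * c < y then 1 else 0))" by auto
qed

text \<open>After a shift by \<open>B\<close> the function \<open>f\<close> is nonnegative, and it exceeds the layer sum over its finitely
many open superlevel sets, whose limiting mass is bounded from below by assumption.\<close>

lemma integral_ge_eventually:
  fixes \<nu> :: "nat \<Rightarrow> 'a::topological_space measure" and f :: "'a \<Rightarrow> real"
  assumes s: "\<And>n. sets (\<nu> n) = sets borel" "sets \<nu>' = sets borel"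
    and fin: "\<And>n. finite_measure (\<nu> n)" "finite_measure \<nu>'"
    and mass: "(\<lambda>n. measure (\<nu> n) UNIV) \<longlonglongrightarrow> measure \<nu>' UNIV"
    and G: "\<And>G e. open G \<Longrightarrow> 0 < e \<Longrightarrow> \<forall>\<^sub>F n in sequentially. measure \<nu>' G - e < measure (\<nu> n) G"
    and f: "continuous_on UNIV f" "\<And>x. \<bar>f x\<bar> \<le> B" and e: "0 < e"
  shows "\<forall>\<^sub>F n in sequentially. (\<integral>x. f x \<partial>\<nu>') - e < (\<integral>x. f x \<partial>\<nu> n)"
proof -
  have B: "0 \<le> B" using f(2)[of undefined] by simp
  define m where "m = measure \<nu>' UNIV"
  have m: "0 \<le> m" by (simp add: m_def)
  define c where "c = e / (2 * (m + 1))"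
  have c: "0 < c" using e m by (simp add: c_def)
  obtain N where N: "2 * B / c \<le> real N" using real_arch_simple by blast
  then have N: "2 * B \<le> real N * c" using c by (simp add: field_simps)
  define \<delta> where "\<delta> = e / (2 * (real N * c + B + 1))"
  have pos: "0 < real N * c + B + 1" using B c by (simp add: add_nonneg_pos)
  have \<delta>: "0 < \<delta>" using e pos by (simp add: \<delta>_def)
  define U where "U j = {x. real j * c < f x + B}" for j
  have U: "open (U j)" for j
    unfolding U_def using f(1) by (intro open_Collect_less continuous_intros)
  have fm: "f \<in> borel_measurable borel" using f(1) by (rule borel_measurable_continuous_onI)
  define g where "g x = (\<Sum>j=1..N. c * indicator (U j) x)" for x
  have gb: "g x \<le> f x + B" "f x + B \<le> c + g x" for x
  proof -
    have "0 \<le> f x + B" "f x + B \<le> real N * c" using f(2)[of x] N by auto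
    from layer_sum_bounds[OF this c]
    moreover have "g x = (\<Sum>j=1..N. c * (if real j * c < f x + B then 1 else 0))"
      unfolding g_def U_def by (intro sum.cong) auto
    ultimately show "g x \<le> f x + B" "f x + B \<le> c + g x" by simp_all
  qed
  have int: "integrable R f" "integrable R g" "(\<integral>x. g x \<partial>R) = (\<Sum>j=1..N. c * measure R (U j))"
    if "sets R = sets borel" "finite_measure R" for R :: "'a measure"
  proof -
    interpret R: finite_measure R by fact
    have [simp]: "space R = UNIV" using sets_eq_imp_space_eq[OF that(1)] by simp
    show "integrable R f"
      using f(2) fm that(1) by (intro R.integrable_const_bound[where B=B]) (auto cong: measurable_cong_sets)
    have i: "integrable R (\<lambda>x. c * indicator (U j) x :: real)" for j
      using U that(1)
      by (intro integrable_mult_right integrable_real_indicator) (auto simp: less_top[symmetric] R.emeasure_finite)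
    then show "integrable R g" unfolding g_def by (intro Bochner_Integration.integrable_sum)
    show "(\<integral>x. g x \<partial>R) = (\<Sum>j=1..N. c * measure R (U j))"
      unfolding g_def using i U that(1) by (subst Bochner_Integration.integral_sum) auto
  qed
  have fin_ev: "\<forall>\<^sub>F n in sequentially. \<forall>j\<in>{1..N}. measure \<nu>' (U j) - \<delta> < measure (\<nu> n) (U j)"
    using G[OF U \<delta>] by (intro eventually_ball_finite) auto
  have "\<forall>\<^sub>F n in sequentially. measure (\<nu> n) UNIV < m + \<delta>"
    using mass \<delta> unfolding m_def by (intro order_tendstoD) auto
  with fin_ev show ?thesis
  proof eventually_elim
    case (elim n)
    interpret n: finite_measure "\<nu> n" by (rule fin)
    interpret l: finite_measure \<nu>' by (rule fin)
    have sp: "space (\<nu> n) = UNIV" "space \<nu>' = UNIV" using s[THEN sets_eq_imp_space_eq] by auto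
    have "(\<integral>x. f x \<partial>\<nu>') + B * m = (\<integral>x. f x + B \<partial>\<nu>')"
      using int[OF s(2) fin(2)] by (simp add: sp m_def)
    also have "\<dots> \<le> (\<integral>x. c + g x \<partial>\<nu>')"
      using int[OF s(2) fin(2)] gb by (intro integral_mono) auto
    also have "\<dots> = c * m + (\<Sum>j=1..N. c * measure \<nu>' (U j))"
      using int[OF s(2) fin(2)] by (simp add: sp m_def)
    also have "(\<Sum>j=1..N. c * measure \<nu>' (U j)) \<le> (\<Sum>j=1..N. c * (measure (\<nu> n) (U j) + \<delta>))"
      using elim(1) c by (intro sum_mono mult_left_mono) (auto simp: diff_less_eq less_imp_le)
    also have "\<dots> = (\<integral>x. g x \<partial>\<nu> n) + real N * c * \<delta>"
      using int(3)[OF s(1) fin(1), of n] by (simp add: sum.distrib distrib_left)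
    also have "(\<integral>x. g x \<partial>\<nu> n) \<le> (\<integral>x. f x + B \<partial>\<nu> n)"
      using int[OF s(1) fin(1), of n] gb by (intro integral_mono) auto
    also have "\<dots> = (\<integral>x. f x \<partial>\<nu> n) + B * measure (\<nu> n) UNIV"
      using int[OF s(1) fin(1), of n] by (simp add: sp)
    also have "B * measure (\<nu> n) UNIV \<le> B * (m + \<delta>)" using elim(2) B by (intro mult_left_mono) auto
    finally have "(\<integral>x. f x \<partial>\<nu>') \<le> (\<integral>x. f x \<partial>\<nu> n) + (c * m + (real N * c + B) * \<delta>)"
      by (simp add: algebra_simps)
    moreover have "c * m < e / 2"
      using e m by (simp add: c_def field_simps)
    moreover have "(real N * c + B) * \<delta> < e / 2"
      using e pos by (simp add: \<delta>_def field_simps)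
    ultimately show ?case by linarith
  qed
qed

text \<open>The portmanteau criterion: lower bounds on open sets together with convergence of the total mass
give lower bounds for integrals, and the same argument for \<open>- f\<close> gives upper bounds.\<close>

lemma weakly_convergesI:
  fixes \<nu> :: "nat \<Rightarrow> 'a::topological_space measure"
  assumes s: "\<And>n. sets (\<nu> n) = sets borel" "sets \<nu>' = sets borel"
    and fin: "\<And>n. finite_measure (\<nu> n)" "finite_measure \<nu>'"
    and mass: "(\<lambda>n. measure (\<nu> n) UNIV) \<longlonglongrightarrow> measure \<nu>' UNIV"
    and G: "\<And>G e. open G \<Longrightarrow> 0 < e \<Longrightarrow> \<forall>\<^sub>F n in sequentially. measure \<nu>' G - e < measure (\<nu> n) G"
  shows "weakly_converges \<nu> \<nu>'"
  unfolding weakly_converges_def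
proof (intro allI impI)
  fix f :: "'a \<Rightarrow> real" assume f: "continuous_on UNIV f \<and> bounded (range f)"
  then obtain B where B: "\<And>x. \<bar>f x\<bar> \<le> B" by (auto simp: bounded_iff)
  show "(\<lambda>n. \<integral>x. f x \<partial>\<nu> n) \<longlonglongrightarrow> (\<integral>x. f x \<partial>\<nu>')"
  proof (rule tendstoI)
    fix e :: real assume e: "0 < e"
    have "\<forall>\<^sub>F n in sequentially. (\<integral>x. f x \<partial>\<nu>') - e < (\<integral>x. f x \<partial>\<nu> n)"
      using f B e by (intro integral_ge_eventually[OF s fin mass G]) auto
    moreover have "\<forall>\<^sub>F n in sequentially. (\<integral>x. - f x \<partial>\<nu>') - e < (\<integral>x. - f x \<partial>\<nu> n)"
      using f B e by (intro integral_ge_eventually[OF s fin mass G, where B=B]) (auto intro: continuous_intros)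
    ultimately show "\<forall>\<^sub>F n in sequentially. dist (\<integral>x. f x \<partial>\<nu> n) (\<integral>x. f x \<partial>\<nu>') < e"
      by eventually_elim (auto simp: dist_real_def)
  qed
qed

text \<open>An open set is exhausted by finite unions of basic sets, and already one of them carries its mass up
to \<open>e\<close>.\<close>

lemma measure_open_ge_eventually:
  fixes \<nu> :: "nat \<Rightarrow> 'a::topological_space measure"
  assumes \<B>: "topological_basis \<B>" "countable \<B>"
    and s: "\<And>n. sets (\<nu> n) = sets borel" "sets \<nu>' = sets borel"
    and fin: "\<And>n. finite_measure (\<nu> n)" "finite_measure \<nu>'"
    and lim: "\<And>S. finite S \<Longrightarrow> S \<subseteq> \<B> \<Longrightarrow> (\<lambda>n. measure (\<nu> n) (\<Union>S)) \<longlonglongrightarrow> measure \<nu>' (\<Union>S)"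
    and G: "open G" and e: "0 < e"
  shows "\<forall>\<^sub>F n in sequentially. measure \<nu>' G - e < measure (\<nu> n) G"
proof -
  interpret l: finite_measure \<nu>' by (rule fin)
  define \<C> where "\<C> = {B\<in>\<B>. B \<subseteq> G}"
  have opn: "open B" if "B \<in> \<B>" for B using \<B>(1) that by (rule topological_basis_open)
  have un: "\<Union>\<C> = G"
  proof
    show "G \<subseteq> \<Union>\<C>"
    proof
      fix x assume "x \<in> G"
      then obtain B where "B \<in> \<B>" "x \<in> B" "B \<subseteq> G" using topological_basisE[OF \<B>(1) G] by metis
      then show "x \<in> \<Union>\<C>" by (auto simp: \<C>_def)
    qed
  qed (auto simp: \<C>_def)
  have "\<exists>S. finite S \<and> S \<subseteq> \<C> \<and> measure \<nu>' G - e < measure \<nu>' (\<Union>S)"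
  proof (cases "\<C> = {}")
    case True
    then show ?thesis using un e by (intro exI[of _ "{}"]) auto
  next
    case False
    have "countable \<C>" using \<B>(2) by (simp add: \<C>_def)
    then have range: "range (from_nat_into \<C>) = \<C>" using False by (intro range_from_nat_into)
    define W where "W n = from_nat_into \<C> ` {..n::nat}" for n
    have W: "W n \<subseteq> \<C>" for n using range by (auto simp: W_def)
    have "(\<Union>n. W n) = range (from_nat_into \<C>)" by (auto simp: W_def)
    moreover have "(\<Union>n. \<Union>(W n)) = \<Union>(\<Union>n. W n)" by blast
    ultimately have WU: "(\<Union>n. \<Union>(W n)) = G" using un range by simp
    have "(\<lambda>n. measure \<nu>' (\<Union>(W n))) \<longlonglongrightarrow> measure \<nu>' (\<Union>n. \<Union>(W n))"
    proof (rule l.finite_Lim_measure_incseq)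
      show "range (\<lambda>n. \<Union>(W n)) \<subseteq> sets \<nu>'"
        using W opn s(2) by (auto simp: \<C>_def intro!: borel_open open_Union)
      show "incseq (\<lambda>n. \<Union>(W n))" by (force simp: W_def incseq_def)
    qed
    then have "\<forall>\<^sub>F n in sequentially. measure \<nu>' G - e < measure \<nu>' (\<Union>(W n))"
      using e unfolding WU by (intro order_tendstoD) auto
    then obtain n where "measure \<nu>' G - e < measure \<nu>' (\<Union>(W n))" by (auto simp: eventually_sequentially)
    then show ?thesis using W by (intro exI[of _ "W n"]) (auto simp: W_def)
  qed
  then obtain S where S: "finite S" "S \<subseteq> \<C>" "measure \<nu>' G - e < measure \<nu>' (\<Union>S)" by blast
  have "\<forall>\<^sub>F n in sequentially. measure \<nu>' G - e < measure (\<nu> n) (\<Union>S)"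
    using lim[of S] S by (intro order_tendstoD) (auto simp: \<C>_def)
  then show ?thesis
  proof eventually_elim
    case (elim n)
    have "measure (\<nu> n) (\<Union>S) \<le> measure (\<nu> n) G"
      using S(2) un s G by (intro finite_measure.finite_measure_mono fin) auto
    then show ?case using elim by simp
  qed
qed

section \<open>Strong law of large numbers\<close>

text \<open>Hoeffding's inequality bounds the probability of a deviation by a geometric sequence, and the
Borel-Cantelli lemma applies.\<close>

lemma strong_law_bounded:
  fixes X :: "nat \<Rightarrow> 'w \<Rightarrow> real"
  assumes P: "prob_space P" and ind: "prob_space.indep_vars P (\<lambda>_. borel) X {1..}"
    and bnd: "\<And>i \<omega>. 1 \<le> i \<Longrightarrow> \<omega> \<in> space P \<Longrightarrow> 0 \<le> X i \<omega> \<and> X i \<omega> \<le> C" and C: "0 < C"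
    and m: "\<And>i. 1 \<le> i \<Longrightarrow> (\<integral>\<omega>. X i \<omega> \<partial>P) = m"
  shows "AE \<omega> in P. (\<lambda>n. (\<Sum>i=1..n. X i \<omega>) / real n) \<longlonglongrightarrow> m"
proof -
  interpret prob_space P by fact
  have rv [measurable]: "random_variable borel (X i)" if "1 \<le> i" for i
    using ind that by (auto simp: indep_vars_def)
  have rvs [measurable]: "(\<lambda>\<omega>. \<Sum>i=1..n. X i \<omega>) \<in> borel_measurable P" for n
    using rv by (intro borel_measurable_sum) auto
  define E where "E e n = {\<omega>\<in>space P. \<bar>(\<Sum>i=1..n. X i \<omega>) - real n * m\<bar> \<ge> real n * e}" for e n
  have E [measurable]: "E e n \<in> sets P" for e n unfolding E_def by measurable
  have bound: "prob (E e n) \<le> 2 * exp (- 2 * e\<^sup>2 / C\<^sup>2) ^ n" if e: "e > 0" for e n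
  proof (cases "n = 0")
    case True
    have "prob (E e n) \<le> 2" by (rule order_trans[OF prob_le_1]) simp
    then show ?thesis using True by simp
  next
    case False
    interpret Hoeffding_ineq P "{1..n}" X "\<lambda>_. 0" "\<lambda>_. C" "real n * m"
    proof unfold_locales
      show "indep_vars (\<lambda>_. borel) X {1..n}" using ind by (rule indep_vars_subset) auto
      show "AE x in P. X i x \<in> {0..C}" if "i \<in> {1..n}" for i
        using bnd that by (intro AE_I2) auto
    qed (simp_all add: m)
    have "prob {\<omega>\<in>space P. \<bar>(\<Sum>i\<in>{1..n}. X i \<omega>) - real n * m\<bar> \<ge> real n * e} \<le>
      2 * exp (- 2 * (real n * e)\<^sup>2 / (\<Sum>i\<in>{1..n}. (C - 0)\<^sup>2))"
      using False C e by (intro Hoeffding_ineq_abs_ge) auto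
    also have "- 2 * (real n * e)\<^sup>2 / (\<Sum>i\<in>{1..n}. (C - 0)\<^sup>2) = real n * (- 2 * e\<^sup>2 / C\<^sup>2)"
      using False C by (simp add: power2_eq_square field_simps)
    also have "exp (real n * (- 2 * e\<^sup>2 / C\<^sup>2)) = exp (- 2 * e\<^sup>2 / C\<^sup>2) ^ n"
      by (rule exp_of_nat_mult)
    finally show ?thesis by (simp add: E_def)
  qed
  have ev: "AE \<omega> in P. \<forall>\<^sub>F n in sequentially. \<omega> \<in> space P - E e n" if e: "e > 0" for e
  proof (rule borel_cantelli_AE1)
    have "summable (\<lambda>n. 2 * exp (- 2 * e\<^sup>2 / C\<^sup>2) ^ n)"
      using e C by (intro summable_mult summable_geometric) auto
    then show "summable (\<lambda>n. prob (E e n))"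
      using bound[OF e] by (intro summable_comparison_test[OF _ \<open>summable _\<close>]) auto
  qed (auto simp: emeasure_eq_measure)
  have "AE \<omega> in P. \<forall>j::nat. \<forall>\<^sub>F n in sequentially. \<omega> \<in> space P - E (inverse (real (Suc j))) n"
    by (intro AE_all_countable[THEN iffD2] allI ev) simp
  then show ?thesis
  proof eventually_elim
    case (elim \<omega>)
    show ?case
    proof (rule tendstoI)
      fix e :: real assume "e > 0"
      then obtain j where j: "inverse (real (Suc j)) < e" using reals_Archimedean by blast
      have "\<forall>\<^sub>F n in sequentially. \<omega> \<in> space P - E (inverse (real (Suc j))) n" using elim by blast
      then show "\<forall>\<^sub>F n in sequentially. dist ((\<Sum>i=1..n. X i \<omega>) / real n) m < e"
        using eventually_gt_at_top[of 0]
      proof eventually_elim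
        case (elim n)
        then have "\<bar>(\<Sum>i=1..n. X i \<omega>) - real n * m\<bar> < real n * inverse (real (Suc j))" by (auto simp: E_def)
        then have "\<bar>(\<Sum>i=1..n. X i \<omega>) - real n * m\<bar> / real n < inverse (real (Suc j))"
          using elim by (simp add: pos_divide_less_eq mult.commute)
        moreover have "(\<Sum>i=1..n. X i \<omega>) / real n - m = ((\<Sum>i=1..n. X i \<omega>) - real n * m) / real n"
          using elim by (simp add: diff_divide_distrib)
        ultimately show ?case using j elim by (simp add: dist_real_def abs_divide)
      qed
    qed
  qed
qed

section \<open>The nested Dirichlet process\<close>

definition row_prob :: "nat \<Rightarrow> (nat \<Rightarrow> 'a::topological_space) set \<Rightarrow> 'a borel_prob \<Rightarrow> real" where
  "row_prob N A l = measure (PiM {1..N} (\<lambda>_. meas l)) A"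

lemma row_prob_bounds [simp]: "0 \<le> row_prob N A l" "row_prob N A l \<le> 1"
  by (auto simp: row_prob_def intro!: prob_space.prob_le_1 prob_space_PiM)

lemma emeasure_PiM_meas: "emeasure (PiM {1..N::nat} (\<lambda>_. meas l)) A = ennreal (row_prob N A l)"
  by (simp add: row_prob_def finite_measure.emeasure_eq_measure prob_space.finite_measure prob_space_PiM)

lemma measurable_PiM_meas_const:
  "(\<lambda>l. PiM {1..n::nat} (\<lambda>_. meas l)) \<in> borel \<rightarrow>\<^sub>M prob_algebra (PiM {1..n} (\<lambda>_. borel :: 'a::metric_space measure))"
  using measurable_PiM_meas[of "{1..n}" "\<lambda>_ l. l" borel] by simp

lemma measurable_row_prob [measurable]:
  fixes A :: "(nat \<Rightarrow> 'a::metric_space) set"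
  assumes "A \<in> sets (PiM {1..N} (\<lambda>_. borel))"
  shows "row_prob N A \<in> borel_measurable borel"
  unfolding row_prob_def[abs_def]
  by (rule measurable_compose[OF measurable_PiM_meas_const measurable_measure_prob_algebra[OF assms]])

lemma sets_PiM_meas [simp]: "sets (PiM I (\<lambda>i. meas (m i))) = sets (PiM I (\<lambda>_. borel))"
  by (intro sets_PiM_cong) simp_all

text \<open>The hidden measures are conditionally i.i.d. given \<open>\<pi>\<close>; any finite number of them therefore is a
sample from the outer Dirichlet process.\<close>

lemma nested_hidden_law:
  fixes \<rho> :: "'a::polish_space borel_prob"
  assumes P: "prob_space P" and nd: "nested_dirichlet P \<kappa> \<epsilon> \<rho> \<pi> \<mu> \<xi>"
    and h: "h \<in> borel_measurable (PiM {1..n} (\<lambda>_. borel))"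
  shows "(\<integral>\<^sup>+\<omega>. h (\<lambda>i\<in>{1..n}. \<mu> i \<omega>) \<partial>P) =
    (\<integral>\<^sup>+w. \<integral>\<^sup>+x. h x \<partial>PiM {1..n} (\<lambda>_. meas w) \<partial>\<D> (scale_measure \<kappa> (\<D> (scale_measure \<epsilon> (meas \<rho>)))))"
proof -
  have \<pi>: "\<pi> \<in> P \<rightarrow>\<^sub>M borel" and D: "distr P borel \<pi> = \<D> (scale_measure \<kappa> (\<D> (scale_measure \<epsilon> (meas \<rho>))))"
    and c: "has_cond_law P (\<lambda>\<omega>. \<lambda>i\<in>{1..}. \<mu> i \<omega>) (PiM {1..} (\<lambda>_. borel)) \<pi> borel (\<lambda>w. PiM {1..} (\<lambda>_. meas w))"
    using nd by (auto simp: nested_dirichlet_def)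
  have r: "(\<lambda>x. \<lambda>i\<in>{1..n}. x i) \<in> PiM {1..} (\<lambda>_. borel) \<rightarrow>\<^sub>M PiM {1..n} (\<lambda>_. borel :: 'a borel_prob measure)"
    by (intro measurable_restrict measurable_component_singleton) auto
  have "(\<integral>\<^sup>+\<omega>. h (\<lambda>i\<in>{1..n}. \<mu> i \<omega>) \<partial>P) = (\<integral>\<^sup>+\<omega>. (\<lambda>p. h (\<lambda>i\<in>{1..n}. fst p i)) (\<lambda>i\<in>{1..}. \<mu> i \<omega>, \<pi> \<omega>) \<partial>P)"
    by (intro nn_integral_cong arg_cong[where f=h]) (auto intro!: restrict_ext)
  also have "\<dots> = (\<integral>\<^sup>+\<omega>. \<integral>\<^sup>+x. (\<lambda>p. h (\<lambda>i\<in>{1..n}. fst p i)) (x, \<pi> \<omega>) \<partial>PiM {1..} (\<lambda>_. meas (\<pi> \<omega>)) \<partial>P)"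
    by (rule has_cond_law_nn_integral[OF P c])
      (rule measurable_compose[OF measurable_fst measurable_compose[OF r h]])
  also have "\<dots> = (\<integral>\<^sup>+\<omega>. \<integral>\<^sup>+x. h x \<partial>PiM {1..n} (\<lambda>_. meas (\<pi> \<omega>)) \<partial>P)"
  proof (intro nn_integral_cong)
    fix \<omega>
    have d: "distr (PiM {1..} (\<lambda>_. meas (\<pi> \<omega>))) (PiM {1..n} (\<lambda>_. meas (\<pi> \<omega>))) (\<lambda>x. \<lambda>i\<in>{1..n}. x i) = PiM {1..n} (\<lambda>_. meas (\<pi> \<omega>))"
      by (rule distr_PiM_reindex[where f="\<lambda>i. i"]) (auto simp: prob_space_meas)
    have r': "(\<lambda>x. \<lambda>i\<in>{1..n}. x i) \<in> PiM {1..} (\<lambda>_. meas (\<pi> \<omega>)) \<rightarrow>\<^sub>M PiM {1..n} (\<lambda>_. meas (\<pi> \<omega>))"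
      using r by (simp cong: measurable_cong_sets)
    have "(\<integral>\<^sup>+x. h x \<partial>PiM {1..n} (\<lambda>_. meas (\<pi> \<omega>))) =
      (\<integral>\<^sup>+x. h x \<partial>distr (PiM {1..} (\<lambda>_. meas (\<pi> \<omega>))) (PiM {1..n} (\<lambda>_. meas (\<pi> \<omega>))) (\<lambda>x. \<lambda>i\<in>{1..n}. x i))"
      by (simp only: d)
    also have "\<dots> = (\<integral>\<^sup>+x. h (\<lambda>i\<in>{1..n}. x i) \<partial>PiM {1..} (\<lambda>_. meas (\<pi> \<omega>)))"
      by (rule nn_integral_distr[OF r']) (use h in \<open>simp cong: measurable_cong_sets\<close>)
    finally show "(\<integral>\<^sup>+x. (\<lambda>p. h (\<lambda>i\<in>{1..n}. fst p i)) (x, \<pi> \<omega>) \<partial>PiM {1..} (\<lambda>_. meas (\<pi> \<omega>))) =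
      (\<integral>\<^sup>+x. h x \<partial>PiM {1..n} (\<lambda>_. meas (\<pi> \<omega>)))" by simp
  qed
  also have "\<dots> = (\<integral>\<^sup>+w. \<integral>\<^sup>+x. h x \<partial>PiM {1..n} (\<lambda>_. meas w) \<partial>distr P borel \<pi>)"
  proof (rule nn_integral_distr[OF \<pi>, symmetric])
    have "(\<lambda>w. \<integral>\<^sup>+x. h x \<partial>PiM {1..n} (\<lambda>_. meas w)) \<in> borel_measurable borel"
      by (rule measurable_compose[OF measurable_prob_algebraD[OF measurable_PiM_meas_const] nn_integral_measurable_subprob_algebra[OF h]])
    then show "(\<lambda>w. \<integral>\<^sup>+x. h x \<partial>PiM {1..n} (\<lambda>_. meas w)) \<in> borel_measurable (distr P borel \<pi>)" by simp
  qed
  finally show ?thesis by (simp only: D)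
qed

lemma nested_measurable:
  fixes \<rho> :: "'a::polish_space borel_prob"
  assumes nd: "nested_dirichlet P \<kappa> \<epsilon> \<rho> \<pi> \<mu> \<xi>"
  shows measurable_nested_hidden: "1 \<le> i \<Longrightarrow> \<mu> i \<in> P \<rightarrow>\<^sub>M borel"
    and measurable_nested_row: "1 \<le> i \<Longrightarrow> row \<xi> i N \<in> P \<rightarrow>\<^sub>M PiM {1..N} (\<lambda>_. borel)"
proof -
  have m: "(\<lambda>\<omega>. \<lambda>i\<in>{1..}. \<mu> i \<omega>) \<in> P \<rightarrow>\<^sub>M PiM {1..} (\<lambda>_. borel)"
    and x: "(\<lambda>\<omega>. \<lambda>(i, j)\<in>{1..}\<times>{1..}. \<xi> i j \<omega>) \<in> P \<rightarrow>\<^sub>M PiM ({1..}\<times>{1..}) (\<lambda>_. borel)"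
    using nd by (auto simp: nested_dirichlet_def has_cond_law_def)
  show "\<mu> i \<in> P \<rightarrow>\<^sub>M borel" if "1 \<le> i"
    using measurable_compose[OF m measurable_component_singleton[of i]] that by simp
  show "row \<xi> i N \<in> P \<rightarrow>\<^sub>M PiM {1..N} (\<lambda>_. borel)" if i: "1 \<le> i"
    unfolding row_def[abs_def]
  proof (rule measurable_restrict)
    fix j assume j: "j \<in> {1..N}"
    have "(\<lambda>\<omega>. (\<lambda>(i, j)\<in>{1..}\<times>{1..}. \<xi> i j \<omega>) (i, j)) \<in> P \<rightarrow>\<^sub>M borel"
      by (rule measurable_compose[OF x measurable_component_singleton]) (use i j in simp)
    then show "\<xi> i j \<in> P \<rightarrow>\<^sub>M borel" using i j by simp
  qed
qed

text \<open>Given the hidden measures the events about the rows are independent, with conditional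
probabilities \<open>row_prob\<close>. In expectations, conditioning on the observations amounts to
multiplication by the likelihood.\<close>

lemma nested_rows_law:
  fixes \<rho> :: "'a::polish_space borel_prob"
  assumes P: "prob_space P" and nd: "nested_dirichlet P \<kappa> \<epsilon> \<rho> \<pi> \<mu> \<xi>" and M: "1 \<le> M"
    and A: "\<And>m. m \<in> {1..M} \<Longrightarrow> A m \<in> sets (PiM {1..N} (\<lambda>_. borel))"
    and g: "g \<in> borel_measurable (PiM {1..n} (\<lambda>_. borel))"
  shows "(\<integral>\<^sup>+\<omega>. g (\<lambda>i\<in>{1..n}. \<mu> i \<omega>) * indicator {\<omega>. \<forall>m\<in>{1..M}. row \<xi> m N \<omega> \<in> A m} \<omega> \<partial>P) =
    (\<integral>\<^sup>+\<omega>. g (\<lambda>i\<in>{1..n}. \<mu> i \<omega>) * ennreal (\<Prod>m=1..M. row_prob N (A m) (\<mu> m \<omega>)) \<partial>P)"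
proof -
  let ?I = "{1..} \<times> {1..} :: (nat \<times> nat) set"
  let ?X = "\<lambda>\<omega>. \<lambda>(i, j)\<in>?I. \<xi> i j \<omega>"
  let ?Z = "\<lambda>\<omega>. (\<pi> \<omega>, \<lambda>i\<in>{1..}. \<mu> i \<omega>)"
  let ?MX = "PiM ?I (\<lambda>_. borel :: 'a measure)"
  let ?MZ = "(borel :: 'a borel_prob borel_prob measure) \<Otimes>\<^sub>M PiM {1..} (\<lambda>_. borel :: 'a borel_prob measure)"
  have c: "has_cond_law P ?X ?MX ?Z ?MZ (\<lambda>(w, m). PiM ?I (\<lambda>(i, j). meas (m i)))"
    using nd by (auto simp: nested_dirichlet_def)
  define E where "E = {x \<in> space ?MX. \<forall>i\<in>{1..M}. (\<lambda>j\<in>{1..N}. x (i, j)) \<in> A i}"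
  have E: "E \<in> sets ?MX"
  proof -
    have "E = (\<Inter>i\<in>{1..M}. (\<lambda>x. \<lambda>j\<in>{1..N}. x (i, j)) -` A i \<inter> space ?MX)"
      using M by (auto simp: E_def)
    also have "\<dots> \<in> sets ?MX"
    proof (intro sets.finite_INT)
      fix i assume i: "i \<in> {1..M}"
      have "(\<lambda>x. \<lambda>j\<in>{1..N}. x (i, j)) \<in> ?MX \<rightarrow>\<^sub>M PiM {1..N} (\<lambda>_. borel)"
        using i by (intro measurable_restrict measurable_component_singleton) auto
      then show "(\<lambda>x. \<lambda>j\<in>{1..N}. x (i, j)) -` A i \<inter> space ?MX \<in> sets ?MX"
        using A[OF i] by (rule measurable_sets)
    qed (use M in auto)
    finally show ?thesis .
  qed
  have r: "(\<lambda>x. \<lambda>i\<in>{1..n}. x i) \<in> PiM {1..} (\<lambda>_. borel) \<rightarrow>\<^sub>M PiM {1..n} (\<lambda>_. borel :: 'a borel_prob measure)"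
    by (intro measurable_restrict measurable_component_singleton) auto
  define G where "G z = g (\<lambda>i\<in>{1..n}. snd z i)" for z :: "'a borel_prob borel_prob \<times> (nat \<Rightarrow> 'a borel_prob)"
  have G: "G \<in> borel_measurable ?MZ"
    unfolding G_def[abs_def] by (rule measurable_compose[OF measurable_snd measurable_compose[OF r g]])
  have Gm: "G (?Z \<omega>) = g (\<lambda>i\<in>{1..n}. \<mu> i \<omega>)" for \<omega>
    unfolding G_def by (intro arg_cong[where f=g]) (auto intro!: restrict_ext)
  have XE: "?X \<omega> \<in> E \<longleftrightarrow> (\<forall>m\<in>{1..M}. row \<xi> m N \<omega> \<in> A m)" for \<omega>
  proof -
    have "(\<lambda>j\<in>{1..N}. ?X \<omega> (i, j)) = row \<xi> i N \<omega>" if "i \<in> {1..M}" for i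
      using that by (auto simp: row_def intro!: restrict_ext)
    then show ?thesis by (auto simp: E_def space_PiM)
  qed
  have "(\<integral>\<^sup>+\<omega>. g (\<lambda>i\<in>{1..n}. \<mu> i \<omega>) * indicator {\<omega>. \<forall>m\<in>{1..M}. row \<xi> m N \<omega> \<in> A m} \<omega> \<partial>P) =
    (\<integral>\<^sup>+\<omega>. (\<lambda>p. G (snd p) * indicator E (fst p)) (?X \<omega>, ?Z \<omega>) \<partial>P)"
    by (intro nn_integral_cong) (simp only: fst_conv snd_conv Gm indicator_def XE mem_Collect_eq)
  also have "\<dots> = (\<integral>\<^sup>+\<omega>. \<integral>\<^sup>+x. (\<lambda>p. G (snd p) * indicator E (fst p)) (x, ?Z \<omega>) \<partial>(case ?Z \<omega> of (w, m) \<Rightarrow> PiM ?I (\<lambda>(i, j). meas (m i))) \<partial>P)"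
    by (rule has_cond_law_nn_integral[OF P c borel_measurable_times_ennreal[OF measurable_compose[OF measurable_snd G]
      measurable_compose[OF measurable_fst borel_measurable_indicator[OF E]]]])
  also have "\<dots> = (\<integral>\<^sup>+\<omega>. g (\<lambda>i\<in>{1..n}. \<mu> i \<omega>) * ennreal (\<Prod>m=1..M. row_prob N (A m) (\<mu> m \<omega>)) \<partial>P)"
  proof (intro nn_integral_cong)
    fix \<omega>
    let ?m = "\<lambda>i\<in>{1..}. \<mu> i \<omega>"
    let ?R = "PiM ?I (\<lambda>(i, j). meas (?m i))"
    have sR: "sets ?R = sets ?MX" by (intro sets_PiM_cong) auto
    have "(\<integral>\<^sup>+x. (\<lambda>p. G (snd p) * indicator E (fst p)) (x, ?Z \<omega>) \<partial>?R) = (\<integral>\<^sup>+x. g (\<lambda>i\<in>{1..n}. \<mu> i \<omega>) * indicator E x \<partial>?R)"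
      by (simp only: fst_conv snd_conv Gm)
    also have "\<dots> = g (\<lambda>i\<in>{1..n}. \<mu> i \<omega>) * emeasure ?R E"
      using E by (intro nn_integral_cmult_indicator) (simp only: sR)
    also have "emeasure ?R E = (\<Prod>i=1..M. emeasure (PiM {1..N} (\<lambda>_. meas (?m i))) (A i))"
      unfolding E_def by (rule emeasure_PiM_rows[OF M A])
    also have "\<dots> = ennreal (\<Prod>m=1..M. row_prob N (A m) (\<mu> m \<omega>))"
      unfolding emeasure_PiM_meas by (subst prod_ennreal) (auto intro!: arg_cong[where f=ennreal] prod.cong)
    finally show "(\<integral>\<^sup>+x. (\<lambda>p. G (snd p) * indicator E (fst p)) (x, ?Z \<omega>) \<partial>(case ?Z \<omega> of (w, m) \<Rightarrow> PiM ?I (\<lambda>(i, j). meas (m i)))) =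
      g (\<lambda>i\<in>{1..n}. \<mu> i \<omega>) * ennreal (\<Prod>m=1..M. row_prob N (A m) (\<mu> m \<omega>))" by (simp only: prod.case)
  qed
  finally show ?thesis .
qed

lemma nested_param:
  fixes \<rho> :: "'a::{metric_space, second_countable_topology} borel_prob" and \<kappa> \<epsilon> :: real
  assumes "0 < \<kappa>" "0 < \<epsilon>"
  shows "dirichlet_param (scale_measure (ennreal \<epsilon>) (meas \<rho>))"
    and "dirichlet_param (scale_measure (ennreal \<kappa>) (\<D> (scale_measure (ennreal \<epsilon>) (meas \<rho>))))"
    and "measure (scale_measure (ennreal \<kappa>) (\<D> (scale_measure (ennreal \<epsilon>) (meas \<rho>)))) UNIV = \<kappa>"
proof -
  show 1: "dirichlet_param (scale_measure (ennreal \<epsilon>) (meas \<rho>))"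
    using assms by (intro dirichlet_param_scale) simp_all
  then show "dirichlet_param (scale_measure (ennreal \<kappa>) (\<D> (scale_measure (ennreal \<epsilon>) (meas \<rho>))))"
    using assms by (intro dirichlet_param_scale) (simp_all add: prob_space_dirichlet_process)
  interpret prob_space "\<D> (scale_measure (ennreal \<epsilon>) (meas \<rho>))" using 1 by (rule prob_space_dirichlet_process)
  show "measure (scale_measure (ennreal \<kappa>) (\<D> (scale_measure (ennreal \<epsilon>) (meas \<rho>)))) UNIV = \<kappa>"
  proof -
    have "measure (\<D> (scale_measure (ennreal \<epsilon>) (meas \<rho>))) UNIV = 1" using prob_space 1 by simp
    then show ?thesis using assms by simp
  qed
qed

lemma nested_predictive:
  fixes \<rho> :: "'a::{metric_space, second_countable_topology} borel_prob" and \<kappa> \<epsilon> :: real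
  assumes \<kappa>: "0 < \<kappa>" "0 < \<epsilon>" and g: "g \<in> borel_measurable (PiM {1..Suc n} (\<lambda>_. borel))"
  shows "(\<integral>\<^sup>+w. \<integral>\<^sup>+x. g x \<partial>PiM {1..Suc n} (\<lambda>_. meas w) \<partial>\<D> (scale_measure \<kappa> (\<D> (scale_measure \<epsilon> (meas \<rho>))))) =
    (\<integral>\<^sup>+w. \<integral>\<^sup>+x. ennreal (1 / (\<kappa> + real n)) *
        (ennreal \<kappa> * (\<integral>\<^sup>+l. g (x(Suc n := l)) \<partial>\<D> (scale_measure \<epsilon> (meas \<rho>))) + (\<Sum>i=1..n. g (x(Suc n := x i))))
      \<partial>PiM {1..n} (\<lambda>_. meas w) \<partial>\<D> (scale_measure \<kappa> (\<D> (scale_measure \<epsilon> (meas \<rho>)))))"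
  unfolding dirichlet_process_predictive[OF nested_param(2)[OF \<kappa>] g] nested_param(3)[OF \<kappa>]
proof (intro nn_integral_cong)
  fix w :: "'a borel_prob borel_prob" and x assume "x \<in> space (PiM {1..n} (\<lambda>_. meas w))"
  then have x: "x \<in> space (PiM {1..n} (\<lambda>_. borel :: 'a borel_prob measure))" by (simp add: space_PiM)
  have "(\<lambda>l. g (x(Suc n := l))) \<in> borel_measurable borel"
    using measurable_compose[OF measurable_compose[OF measurable_Pair1'[OF x] measurable_PiM_fun_upd_Suc] g] by simp
  then have "(\<integral>\<^sup>+l. g (x(Suc n := l)) \<partial>scale_measure (ennreal \<kappa>) (\<D> (scale_measure (ennreal \<epsilon>) (meas \<rho>)))) =
    ennreal \<kappa> * (\<integral>\<^sup>+l. g (x(Suc n := l)) \<partial>\<D> (scale_measure (ennreal \<epsilon>) (meas \<rho>)))"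
    using nested_param(1)[OF \<kappa>, of \<rho>] by (intro nn_integral_scale_measure) (simp cong: measurable_cong_sets)
  then show "ennreal (1 / (\<kappa> + real n)) *
        ((\<integral>\<^sup>+l. g (x(Suc n := l)) \<partial>scale_measure (ennreal \<kappa>) (\<D> (scale_measure (ennreal \<epsilon>) (meas \<rho>)))) + (\<Sum>i=1..n. g (x(Suc n := x i)))) =
    ennreal (1 / (\<kappa> + real n)) *
        (ennreal \<kappa> * (\<integral>\<^sup>+l. g (x(Suc n := l)) \<partial>\<D> (scale_measure (ennreal \<epsilon>) (meas \<rho>))) + (\<Sum>i=1..n. g (x(Suc n := x i))))"
    by simp
qed

text \<open>Each hidden measure has the law \<open>\<D>(\<epsilon>\<rho>)\<close>: the mean of a Dirichlet process is its normalised parameter.\<close>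

lemma nested_mean:
  fixes \<rho> :: "'a::{metric_space, second_countable_topology} borel_prob" and \<kappa> \<epsilon> :: real and i n :: nat
  assumes \<kappa>: "0 < \<kappa>" "0 < \<epsilon>" and g: "g \<in> borel_measurable borel" and i: "i \<in> {1..n}"
  shows "(\<integral>\<^sup>+w. \<integral>\<^sup>+x. g (x i) \<partial>PiM {1..n} (\<lambda>_. meas w) \<partial>\<D> (scale_measure \<kappa> (\<D> (scale_measure \<epsilon> (meas \<rho>))))) =
    (\<integral>\<^sup>+l. g l \<partial>\<D> (scale_measure \<epsilon> (meas \<rho>)))"
proof -
  let ?Q = "\<D> (scale_measure \<epsilon> (meas \<rho>))"
  have marg: "(\<integral>\<^sup>+x. g (x j) \<partial>PiM {1..k} (\<lambda>_. meas w)) = (\<integral>\<^sup>+l. g l \<partial>meas w)" if j: "j \<in> {1..k}"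
    for j k :: nat and w :: "'a borel_prob borel_prob"
  proof -
    have c: "(\<lambda>x. x j) \<in> PiM {1..k} (\<lambda>_. meas w) \<rightarrow>\<^sub>M meas w" using j by (rule measurable_component_singleton)
    have "(\<integral>\<^sup>+l. g l \<partial>distr (PiM {1..k} (\<lambda>_. meas w)) (meas w) (\<lambda>x. x j)) = (\<integral>\<^sup>+x. g (x j) \<partial>PiM {1..k} (\<lambda>_. meas w))"
      using g by (intro nn_integral_distr[OF c]) (simp cong: measurable_cong_sets)
    moreover have "distr (PiM {1..k} (\<lambda>_. meas w)) (meas w) (\<lambda>x. x j) = meas w"
      using j by (intro distr_PiM_component) simp_all
    ultimately show ?thesis by simp
  qed
  have x1: "(\<lambda>x. g (x 1)) \<in> borel_measurable (PiM {1..Suc 0} (\<lambda>_. borel))"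
    by (intro measurable_compose[OF _ g] measurable_component_singleton) simp
  have "(\<integral>\<^sup>+w. \<integral>\<^sup>+x. g (x i) \<partial>PiM {1..n} (\<lambda>_. meas w) \<partial>\<D> (scale_measure \<kappa> ?Q)) =
    (\<integral>\<^sup>+w. \<integral>\<^sup>+x. g (x 1) \<partial>PiM {1..Suc 0} (\<lambda>_. meas w) \<partial>\<D> (scale_measure \<kappa> ?Q))"
  proof (intro nn_integral_cong)
    fix w :: "'a borel_prob borel_prob"
    have "(1::nat) \<in> {1..Suc 0}" by simp
    from marg[of i n w] marg[OF this, of w] i
    show "(\<integral>\<^sup>+x. g (x i) \<partial>PiM {1..n} (\<lambda>_. meas w)) = (\<integral>\<^sup>+x. g (x 1) \<partial>PiM {1..Suc 0} (\<lambda>_. meas w))"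
      by (simp only:)
  qed
  also have "\<dots> = ennreal (1 / \<kappa>) * (ennreal \<kappa> * (\<integral>\<^sup>+l. g l \<partial>?Q))"
    using nested_predictive[OF \<kappa> x1, of \<rho>] prob_space.emeasure_space_1[OF prob_space_dirichlet_process[OF nested_param(2)[OF \<kappa>, of \<rho>]]]
      nested_param(2)[OF \<kappa>, of \<rho>]
    by (simp add: PiM_empty nn_integral_count_space_finite)
  also have "\<dots> = (\<integral>\<^sup>+l. g l \<partial>?Q)"
    using \<kappa> by (simp add: mult.assoc[symmetric] ennreal_mult''[symmetric])
  finally show ?thesis .
qed

text \<open>A row is i.i.d. given its hidden measure, whose law is \<open>\<D>(\<epsilon>\<rho>)\<close> by \<open>nested_mean\<close>.\<close>

lemma row_law_mixture:
  fixes \<rho> :: "'a::polish_space borel_prob"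
  assumes P: "prob_space P" and nd: "nested_dirichlet P \<kappa> \<epsilon> \<rho> \<pi> \<mu> \<xi>" and \<kappa>: "0 < \<kappa>" "0 < \<epsilon>"
    and h: "h \<in> borel_measurable (PiM {1..N} (\<lambda>_. borel))"
  shows "(\<integral>\<^sup>+x. h x \<partial>row_law P \<xi> N) = (\<integral>\<^sup>+l. \<integral>\<^sup>+x. h x \<partial>PiM {1..N} (\<lambda>_. meas l) \<partial>\<D> (scale_measure \<epsilon> (meas \<rho>)))"
proof -
  let ?Q = "\<D> (scale_measure \<epsilon> (meas \<rho>))"
  have rw: "row \<xi> 1 N \<in> P \<rightarrow>\<^sub>M PiM {1..N} (\<lambda>_. borel)" using measurable_nested_row[OF nd] by simp
  have k: "(\<lambda>l. PiM {1..N} (\<lambda>_. meas l)) \<in> ?Q \<rightarrow>\<^sub>M subprob_algebra (PiM {1..N} (\<lambda>_. borel))"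
    using measurable_prob_algebraD[OF measurable_PiM_meas_const[of N]] nested_param(1)[OF \<kappa>, of \<rho>]
    by (simp cong: measurable_cong_sets)
  have "row_law P \<xi> N = ?Q \<bind> (\<lambda>l. PiM {1..N} (\<lambda>_. meas l))"
  proof (rule measure_eqI)
    show s: "sets (row_law P \<xi> N) = sets (?Q \<bind> (\<lambda>l. PiM {1..N} (\<lambda>_. meas l)))"
      using nested_param(1)[OF \<kappa>, of \<rho>] by (subst sets_bind) (auto simp: row_law_def)
    fix B assume "B \<in> sets (row_law P \<xi> N)"
    then have B: "B \<in> sets (PiM {1..N} (\<lambda>_. borel))" by (simp add: row_law_def)
    have q: "row_prob N B \<in> borel_measurable borel" by (rule measurable_row_prob[OF B])
    have x1: "(\<lambda>x. ennreal (row_prob N B (x 1))) \<in> borel_measurable (PiM {1..Suc 0} (\<lambda>_. borel))"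
      by (intro measurable_compose[OF _ measurable_ennreal] measurable_compose[OF _ q] measurable_component_singleton) simp
    have "emeasure (row_law P \<xi> N) B = emeasure P (row \<xi> 1 N -` B \<inter> space P)"
      unfolding row_law_def by (rule emeasure_distr[OF rw B])
    also have "\<dots> = (\<integral>\<^sup>+\<omega>. (\<lambda>_. 1) (\<lambda>i\<in>{1..Suc 0}. \<mu> i \<omega>) * indicator {\<omega>. \<forall>m\<in>{1..1}. row \<xi> m N \<omega> \<in> B} \<omega> \<partial>P)"
      unfolding nn_integral_indicator[OF measurable_sets[OF rw B], symmetric]
      by (intro nn_integral_cong) (auto simp: indicator_def)
    also have "\<dots> = (\<integral>\<^sup>+\<omega>. (\<lambda>_. 1) (\<lambda>i\<in>{1..Suc 0}. \<mu> i \<omega>) * ennreal (\<Prod>m=1..1. row_prob N B (\<mu> m \<omega>)) \<partial>P)"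
      using B by (intro nested_rows_law[OF P nd]) auto
    also have "\<dots> = (\<integral>\<^sup>+\<omega>. (\<lambda>x. ennreal (row_prob N B (x 1))) (\<lambda>i\<in>{1..Suc 0}. \<mu> i \<omega>) \<partial>P)" by simp
    also have "\<dots> = (\<integral>\<^sup>+w. \<integral>\<^sup>+x. ennreal (row_prob N B (x 1)) \<partial>PiM {1..Suc 0} (\<lambda>_. meas w) \<partial>\<D> (scale_measure \<kappa> ?Q))"
      by (rule nested_hidden_law[OF P nd x1])
    also have "\<dots> = (\<integral>\<^sup>+l. ennreal (row_prob N B l) \<partial>?Q)"
      by (rule nested_mean[OF \<kappa> measurable_compose[OF q measurable_ennreal]]) simp
    also have "\<dots> = (\<integral>\<^sup>+l. emeasure (PiM {1..N} (\<lambda>_. meas l)) B \<partial>?Q)" by (simp only: emeasure_PiM_meas)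
    also have "\<dots> = emeasure (?Q \<bind> (\<lambda>l. PiM {1..N} (\<lambda>_. meas l))) B"
      using k B nested_param(1)[OF \<kappa>, of \<rho>] by (intro emeasure_bind[symmetric]) auto
    finally show "emeasure (row_law P \<xi> N) B = emeasure (?Q \<bind> (\<lambda>l. PiM {1..N} (\<lambda>_. meas l))) B" .
  qed
  then show ?thesis using nn_integral_bind[OF h k] by simp
qed

section \<open>Weighted simulations\<close>

lemma sum_sim_weight:
  assumes m: "1 \<le> m"
  shows "(\<Sum>i=1..m. sim_weight \<kappa> N \<rho>N A m v i) = (\<Sum>i=1..<m. row_prob N (A m) (v i)) + \<kappa> * measure \<rho>N (A m)"
proof -
  have "{1..m} = insert m {1..<m}" using m by auto
  then show ?thesis by (simp add: sim_weight_def row_prob_def)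
qed

lemma ennreal_mult_divide_cancel:
  assumes "0 < c"
  shows "ennreal c * (x / ennreal c) = x"
proof -
  have "ennreal c * (x / ennreal c) = x * ennreal c / ennreal c"
    by (simp only: ennreal_times_divide mult.commute)
  then show ?thesis using assms by (simp add: mult_divide_eq_ennreal)
qed

text \<open>Bayes' rule for one row: drawing a row conditioned on lying in \<open>B\<close> and then a measure from the
posterior is the same as tilting \<open>\<D>(\<epsilon>\<rho>)\<close> by the likelihood of \<open>B\<close>.\<close>

lemma nn_integral_row_posterior:
  fixes \<rho> :: "'a::polish_space borel_prob" and \<epsilon> :: real
  assumes \<epsilon>: "0 < \<epsilon>" and s\<rho>N: "sets \<rho>N = sets (PiM {1..N} (\<lambda>_. borel))" and p\<rho>N: "prob_space \<rho>N"
    and mix: "\<And>h. h \<in> borel_measurable (PiM {1..N} (\<lambda>_. borel)) \<Longrightarrow>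
      (\<integral>\<^sup>+x. h x \<partial>\<rho>N) = (\<integral>\<^sup>+l. \<integral>\<^sup>+x. h x \<partial>PiM {1..N} (\<lambda>_. meas l) \<partial>\<D> (scale_measure \<epsilon> (meas \<rho>)))"
    and B: "B \<in> sets (PiM {1..N} (\<lambda>_. borel))" and pos: "0 < measure \<rho>N B"
    and g: "g \<in> borel_measurable borel"
  shows "ennreal (measure \<rho>N B) * (\<integral>\<^sup>+l. g l \<partial>(uniform_measure \<rho>N B \<bind> (\<lambda>x. \<D> (posterior (scale_measure \<epsilon> (meas \<rho>)) N x)))) =
    (\<integral>\<^sup>+l. g l * ennreal (row_prob N B l) \<partial>\<D> (scale_measure \<epsilon> (meas \<rho>)))"
proof -
  have par: "dirichlet_param (scale_measure (ennreal \<epsilon>) (meas \<rho>))"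
    using \<epsilon> by (intro dirichlet_param_scale) simp_all
  let ?K = "\<lambda>x. \<D> (posterior (scale_measure \<epsilon> (meas \<rho>)) N x)"
  have K: "?K \<in> PiM {1..N} (\<lambda>_. borel) \<rightarrow>\<^sub>M prob_algebra borel" by (rule measurable_posterior_PiM[OF par])
  have K': "?K \<in> uniform_measure \<rho>N B \<rightarrow>\<^sub>M subprob_algebra borel"
    using measurable_prob_algebraD[OF K] s\<rho>N by (simp cong: measurable_cong_sets)
  have Kg: "(\<lambda>x. \<integral>\<^sup>+l. g l \<partial>?K x) \<in> borel_measurable (PiM {1..N} (\<lambda>_. borel))"
    by (rule measurable_compose[OF measurable_prob_algebraD[OF K] nn_integral_measurable_subprob_algebra[OF g]])
  have gB: "(\<lambda>p. g (fst p) * indicator B (snd p)) \<in> borel_measurable (borel \<Otimes>\<^sub>M PiM {1..N} (\<lambda>_. borel))"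
    by (rule borel_measurable_times_ennreal[OF measurable_compose[OF measurable_fst g] measurable_compose[OF measurable_snd borel_measurable_indicator[OF B]]])
  have em: "emeasure \<rho>N B = ennreal (measure \<rho>N B)"
    using p\<rho>N by (simp add: finite_measure.emeasure_eq_measure prob_space.finite_measure)
  have "(\<integral>\<^sup>+l. g l \<partial>(uniform_measure \<rho>N B \<bind> ?K)) = (\<integral>\<^sup>+x. \<integral>\<^sup>+l. g l \<partial>?K x \<partial>uniform_measure \<rho>N B)"
    by (rule nn_integral_bind[OF g K'])
  also have "\<dots> = (\<integral>\<^sup>+x. (\<integral>\<^sup>+l. g l \<partial>?K x) * indicator B x \<partial>\<rho>N) / ennreal (measure \<rho>N B)"
    unfolding em[symmetric] using Kg B s\<rho>N by (intro nn_integral_uniform_measure) (auto cong: measurable_cong_sets)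
  finally have "ennreal (measure \<rho>N B) * (\<integral>\<^sup>+l. g l \<partial>(uniform_measure \<rho>N B \<bind> ?K)) =
    (\<integral>\<^sup>+x. (\<integral>\<^sup>+l. g l \<partial>?K x) * indicator B x \<partial>\<rho>N)"
    by (simp only: ennreal_mult_divide_cancel[OF pos])
  also have "\<dots> = (\<integral>\<^sup>+l'. \<integral>\<^sup>+x. (\<integral>\<^sup>+l. g l \<partial>?K x) * indicator B x \<partial>PiM {1..N} (\<lambda>_. meas l') \<partial>\<D> (scale_measure \<epsilon> (meas \<rho>)))"
    by (rule mix[OF borel_measurable_times_ennreal[OF Kg borel_measurable_indicator[OF B]]])
  also have "\<dots> = (\<integral>\<^sup>+l'. \<integral>\<^sup>+x. \<integral>\<^sup>+l. (\<lambda>p. g (fst p) * indicator B (snd p)) (l, x) \<partial>?K x \<partial>PiM {1..N} (\<lambda>_. meas l') \<partial>\<D> (scale_measure \<epsilon> (meas \<rho>)))"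
  proof (intro nn_integral_cong)
    fix x :: "nat \<Rightarrow> 'a"
    have "g \<in> borel_measurable (?K x)"
      using g dirichlet_param_posterior[OF par] by (simp cong: measurable_cong_sets)
    then show "(\<integral>\<^sup>+l. g l \<partial>?K x) * indicator B x = (\<integral>\<^sup>+l. (\<lambda>p. g (fst p) * indicator B (snd p)) (l, x) \<partial>?K x)"
      by (simp add: nn_integral_multc)
  qed
  also have "\<dots> = (\<integral>\<^sup>+l. \<integral>\<^sup>+x. (\<lambda>p. g (fst p) * indicator B (snd p)) (l, x) \<partial>PiM {1..N} (\<lambda>_. meas l) \<partial>\<D> (scale_measure \<epsilon> (meas \<rho>)))"
    by (rule dirichlet_process_posterior[OF par gB, symmetric])
  also have "\<dots> = (\<integral>\<^sup>+l. g l * ennreal (row_prob N B l) \<partial>\<D> (scale_measure \<epsilon> (meas \<rho>)))"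
    using B by (intro nn_integral_cong) (simp add: nn_integral_cmult_indicator emeasure_PiM_meas[unfolded One_nat_def])
  finally show ?thesis .
qed

text \<open>The simulation kernel without its normalising factor is the Polya step tilted by the likelihood of
the current observation.\<close>

lemma nn_integral_sim_kernel:
  fixes \<rho> :: "'a::polish_space borel_prob" and \<kappa> \<epsilon> :: real
  assumes \<kappa>: "0 < \<kappa>" and \<epsilon>: "0 < \<epsilon>"
    and s\<rho>N: "sets \<rho>N = sets (PiM {1..N} (\<lambda>_. borel))" and p\<rho>N: "prob_space \<rho>N"
    and mix: "\<And>h. h \<in> borel_measurable (PiM {1..N} (\<lambda>_. borel)) \<Longrightarrow>
      (\<integral>\<^sup>+x. h x \<partial>\<rho>N) = (\<integral>\<^sup>+l. \<integral>\<^sup>+x. h x \<partial>PiM {1..N} (\<lambda>_. meas l) \<partial>\<D> (scale_measure \<epsilon> (meas \<rho>)))"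
    and B: "A m \<in> sets (PiM {1..N} (\<lambda>_. borel))" and pos: "0 < measure \<rho>N (A m)" and m: "1 \<le> m"
    and g: "g \<in> borel_measurable borel"
  shows "ennreal (\<Sum>i=1..m. sim_weight \<kappa> N \<rho>N A m v i) * (\<integral>\<^sup>+l. g l \<partial>sim_kernel \<kappa> \<epsilon> \<rho> N \<rho>N A m v) =
    ennreal \<kappa> * (\<integral>\<^sup>+l. g l * ennreal (row_prob N (A m) l) \<partial>\<D> (scale_measure \<epsilon> (meas \<rho>))) +
    (\<Sum>i=1..<m. ennreal (row_prob N (A m) (v i)) * g (v i))"
proof -
  have par: "dirichlet_param (scale_measure (ennreal \<epsilon>) (meas \<rho>))"
    using \<epsilon> by (intro dirichlet_param_scale) simp_all
  define t where "t = sim_weight \<kappa> N \<rho>N A m v"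
  define W where "W = (\<Sum>i=1..m. t i)"
  have W: "0 < W"
    unfolding W_def t_def sum_sim_weight[OF m] using \<kappa> pos by (intro add_nonneg_pos sum_nonneg) auto
  define U where "U = uniform_measure \<rho>N (A m) \<bind> (\<lambda>x. \<D> (posterior (scale_measure \<epsilon> (meas \<rho>)) N x))"
  have sU: "sets U = sets borel"
    unfolding U_def
  proof (rule sets_bind)
    show "space (uniform_measure \<rho>N (A m)) \<noteq> {}" using prob_space.not_empty[OF p\<rho>N] by simp
  qed (use dirichlet_param_posterior[OF par] in simp)
  define S where "S = sum_measure {1..<m} (\<lambda>i. scale_measure (ennreal (t i)) (return borel (v i)))"
  have sS: "sets S = sets borel" by (simp add: S_def)
  have k: "sim_kernel \<kappa> \<epsilon> \<rho> N \<rho>N A m v =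
    scale_measure (ennreal (1 / W)) (add_measure (scale_measure (ennreal (t m)) U) S)"
    unfolding sim_kernel_def Let_def t_def[symmetric] W_def S_def U_def posterior_def ..
  have nU: "(\<integral>\<^sup>+l. g l \<partial>scale_measure (ennreal (t m)) U) = ennreal (t m) * (\<integral>\<^sup>+l. g l \<partial>U)"
    using g sU by (intro nn_integral_scale_measure) (simp cong: measurable_cong_sets)
  have nS: "(\<integral>\<^sup>+l. g l \<partial>S) = (\<Sum>i=1..<m. ennreal (t i) * g (v i))"
    unfolding S_def using g
    by (subst nn_integral_sum_measure) (auto simp: nn_integral_scale_measure nn_integral_return)
  have "(\<integral>\<^sup>+l. g l \<partial>sim_kernel \<kappa> \<epsilon> \<rho> N \<rho>N A m v) =
    ennreal (1 / W) * (\<integral>\<^sup>+l. g l \<partial>add_measure (scale_measure (ennreal (t m)) U) S)"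
    unfolding k using g by (intro nn_integral_scale_measure) (simp cong: measurable_cong_sets)
  also have "(\<integral>\<^sup>+l. g l \<partial>add_measure (scale_measure (ennreal (t m)) U) S) =
    ennreal (t m) * (\<integral>\<^sup>+l. g l \<partial>U) + (\<Sum>i=1..<m. ennreal (t i) * g (v i))"
    using g sU sS by (subst nn_integral_add_measure) (simp_all add: nU nS)
  also have "ennreal (t m) = ennreal \<kappa> * ennreal (measure \<rho>N (A m))"
    using \<kappa> by (simp add: t_def sim_weight_def ennreal_mult)
  also have "ennreal \<kappa> * ennreal (measure \<rho>N (A m)) * (\<integral>\<^sup>+l. g l \<partial>U) =
    ennreal \<kappa> * (\<integral>\<^sup>+l. g l * ennreal (row_prob N (A m) l) \<partial>\<D> (scale_measure \<epsilon> (meas \<rho>)))"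
  proof -
    have "ennreal (measure \<rho>N (A m)) * (\<integral>\<^sup>+l. g l \<partial>U) = (\<integral>\<^sup>+l. g l * ennreal (row_prob N (A m) l) \<partial>\<D> (scale_measure \<epsilon> (meas \<rho>)))"
      unfolding U_def by (rule nn_integral_row_posterior[OF \<epsilon> s\<rho>N p\<rho>N _ B pos g]) (rule mix)
    then show ?thesis by (simp only: mult.assoc)
  qed
  also have "(\<Sum>i=1..<m. ennreal (t i) * g (v i)) = (\<Sum>i=1..<m. ennreal (row_prob N (A m) (v i)) * g (v i))"
    by (intro sum.cong) (auto simp: t_def sim_weight_def row_prob_def)
  finally have "ennreal W * (\<integral>\<^sup>+l. g l \<partial>sim_kernel \<kappa> \<epsilon> \<rho> N \<rho>N A m v) = (ennreal W * ennreal (1 / W)) *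
    (ennreal \<kappa> * (\<integral>\<^sup>+l. g l * ennreal (row_prob N (A m) l) \<partial>\<D> (scale_measure \<epsilon> (meas \<rho>))) +
      (\<Sum>i=1..<m. ennreal (row_prob N (A m) (v i)) * g (v i)))"
    by (simp only: mult.assoc)
  also have "ennreal W * ennreal (1 / W) = 1" using W by (simp add: ennreal_mult''[symmetric])
  finally show ?thesis by (simp add: W_def t_def)
qed

text \<open>The total weight of the first \<open>n\<close> steps as a function of the simulated measures; in a weighted
simulation the weights \<open>t\<close> are determined by these.\<close>

definition sim_total_weight ::
  "real \<Rightarrow> nat \<Rightarrow> (nat \<Rightarrow> 'a::polish_space) measure \<Rightarrow> (nat \<Rightarrow> (nat \<Rightarrow> 'a) set) \<Rightarrow> nat \<Rightarrow> (nat \<Rightarrow> 'a borel_prob) \<Rightarrow> real" where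
  "sim_total_weight \<kappa> N \<rho>N A n v = (\<Prod>m=1..n. 1 / (\<kappa> + real m - 1) * (\<Sum>i=1..m. sim_weight \<kappa> N \<rho>N A m v i))"

lemma sim_total_weight_Suc:
  "sim_total_weight \<kappa> N \<rho>N A (Suc n) v =
    sim_total_weight \<kappa> N \<rho>N A n v * (1 / (\<kappa> + real n) * (\<Sum>i=1..Suc n. sim_weight \<kappa> N \<rho>N A (Suc n) v i))"
  unfolding sim_total_weight_def by (subst prod.cl_ivl_Suc) simp

lemma sim_total_weight_cong:
  assumes "\<And>i. i \<in> {1..<n} \<Longrightarrow> v i = v' i"
  shows "sim_total_weight \<kappa> N \<rho>N A n v = sim_total_weight \<kappa> N \<rho>N A n v'"
  unfolding sim_total_weight_def
  by (intro prod.cong refl arg_cong2[where f="(*)"] sum.cong) (auto simp: sim_weight_def assms)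

lemma sim_total_weight_nonneg:
  assumes "0 < \<kappa>"
  shows "0 \<le> sim_total_weight \<kappa> N \<rho>N A n v"
  unfolding sim_total_weight_def
proof (rule prod_nonneg)
  fix m assume "m \<in> {1..n}"
  then show "0 \<le> 1 / (\<kappa> + real m - 1) * (\<Sum>i=1..m. sim_weight \<kappa> N \<rho>N A m v i)"
    using assms by (intro mult_nonneg_nonneg sum_nonneg) (auto simp: sim_weight_def)
qed

lemma sim_total_weight_pos:
  assumes "0 < \<kappa>" "\<And>m. m \<in> {1..n} \<Longrightarrow> 0 < measure \<rho>N (A m)"
  shows "0 < sim_total_weight \<kappa> N \<rho>N A n v"
  unfolding sim_total_weight_def
proof (rule prod_pos)
  fix m assume m: "m \<in> {1..n}"
  then have "0 < (\<Sum>i=1..m. sim_weight \<kappa> N \<rho>N A m v i)"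
    using assms by (subst sum_sim_weight) (auto intro!: add_nonneg_pos sum_nonneg)
  then show "0 < 1 / (\<kappa> + real m - 1) * (\<Sum>i=1..m. sim_weight \<kappa> N \<rho>N A m v i)"
    using m assms(1) by simp
qed

lemma sim_total_weight_le_1:
  assumes \<kappa>: "0 < \<kappa>" and p: "prob_space \<rho>N"
  shows "sim_total_weight \<kappa> N \<rho>N A n v \<le> 1"
  unfolding sim_total_weight_def
proof (rule prod_le_1)
  fix m assume m: "m \<in> {1..n}"
  have "(\<Sum>i=1..<m. row_prob N (A m) (v i)) \<le> (\<Sum>i=1..<m. 1)" by (intro sum_mono) simp
  moreover have "\<kappa> * measure \<rho>N (A m) \<le> \<kappa> * 1" using \<kappa> prob_space.prob_le_1[OF p] by (intro mult_left_mono) auto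
  ultimately have "(\<Sum>i=1..m. sim_weight \<kappa> N \<rho>N A m v i) \<le> \<kappa> + real m - 1"
    using m by (subst sum_sim_weight) (auto simp: of_nat_diff)
  moreover have "0 \<le> (\<Sum>i=1..m. sim_weight \<kappa> N \<rho>N A m v i)"
    using \<kappa> by (intro sum_nonneg) (auto simp: sim_weight_def)
  ultimately show "0 \<le> 1 / (\<kappa> + real m - 1) * (\<Sum>i=1..m. sim_weight \<kappa> N \<rho>N A m v i) \<and>
    1 / (\<kappa> + real m - 1) * (\<Sum>i=1..m. sim_weight \<kappa> N \<rho>N A m v i) \<le> 1"
    using m \<kappa> by (simp add: divide_le_eq_1)
qed

lemma measurable_sim_total_weight:
  assumes A: "\<And>m. m \<in> {1..n} \<Longrightarrow> A m \<in> sets (PiM {1..N} (\<lambda>_. borel))"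
    and u: "\<And>i. i \<in> {1..<n} \<Longrightarrow> u i \<in> M \<rightarrow>\<^sub>M borel"
  shows "(\<lambda>x. sim_total_weight \<kappa> N \<rho>N A n (\<lambda>i. u i x)) \<in> borel_measurable M"
  unfolding sim_total_weight_def
proof (intro borel_measurable_prod borel_measurable_times borel_measurable_const)
  fix m assume m: "m \<in> {1..n}"
  have "(\<lambda>x. (\<Sum>i=1..<m. row_prob N (A m) (u i x)) + \<kappa> * measure \<rho>N (A m)) \<in> borel_measurable M"
    using m by (intro borel_measurable_add borel_measurable_sum borel_measurable_const
      measurable_compose[OF u measurable_row_prob[OF A]]) auto
  then show "(\<lambda>x. \<Sum>i=1..m. sim_weight \<kappa> N \<rho>N A m (\<lambda>i. u i x) i) \<in> borel_measurable M"
    using m by (subst sum_sim_weight) auto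
qed

text \<open>Induction over the steps of the simulation. In step \<open>Suc n\<close> the weight factor cancels the
normalising constant of the kernel, which leaves the tilted Polya step; the induction hypothesis
replaces the first \<open>n\<close> simulated measures by hidden ones, weighted with their likelihood, and the
predictive rule adds the hidden measure \<open>Suc n\<close>.\<close>

lemma simulation_identity:
  fixes \<rho> :: "'a::polish_space borel_prob" and \<kappa> \<epsilon> :: real and u :: "nat \<Rightarrow> 'w \<Rightarrow> 'a borel_prob"
  assumes P: "prob_space P" and \<kappa>: "0 < \<kappa>" and \<epsilon>: "0 < \<epsilon>"
    and s\<rho>N: "sets \<rho>N = sets (PiM {1..N} (\<lambda>_. borel))" and p\<rho>N: "prob_space \<rho>N"
    and mix: "\<And>h. h \<in> borel_measurable (PiM {1..N} (\<lambda>_. borel)) \<Longrightarrow>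
      (\<integral>\<^sup>+x. h x \<partial>\<rho>N) = (\<integral>\<^sup>+l. \<integral>\<^sup>+x. h x \<partial>PiM {1..N} (\<lambda>_. meas l) \<partial>\<D> (scale_measure \<epsilon> (meas \<rho>)))"
    and A: "\<And>m. m \<in> {1..M} \<Longrightarrow> A m \<in> sets (PiM {1..N} (\<lambda>_. borel))"
    and pos: "\<And>m. m \<in> {1..M} \<Longrightarrow> 0 < measure \<rho>N (A m)"
    and c: "\<And>m. m \<in> {1..M} \<Longrightarrow> has_cond_law P (u m) borel
        (\<lambda>\<omega>. \<lambda>i\<in>{1..<m}. u i \<omega>) (PiM {1..<m} (\<lambda>_. borel)) (sim_kernel \<kappa> \<epsilon> \<rho> N \<rho>N A m)"
    and n: "n \<le> M" and h: "h \<in> borel_measurable (PiM {1..n} (\<lambda>_. borel))"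
  shows "(\<integral>\<^sup>+\<omega>. ennreal (sim_total_weight \<kappa> N \<rho>N A n (\<lambda>i. u i \<omega>)) * h (\<lambda>i\<in>{1..n}. u i \<omega>) \<partial>P) =
    (\<integral>\<^sup>+w. \<integral>\<^sup>+x. ennreal (\<Prod>m=1..n. row_prob N (A m) (x m)) * h x \<partial>PiM {1..n} (\<lambda>_. meas w)
      \<partial>\<D> (scale_measure \<kappa> (\<D> (scale_measure \<epsilon> (meas \<rho>)))))"
  using n h
proof (induction n arbitrary: h)
  case 0
  have "prob_space (\<D> (scale_measure \<kappa> (\<D> (scale_measure \<epsilon> (meas \<rho>)))))"
    using nested_param(2)[OF \<kappa> \<epsilon>, of \<rho>] by (rule prob_space_dirichlet_process)
  from prob_space.emeasure_space_1[OF this] prob_space.emeasure_space_1[OF P] show ?case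
    by (simp add: sim_total_weight_def PiM_empty nn_integral_count_space_finite)
next
  case (Suc n)
  let ?m = "Suc n"
  let ?Q = "\<D> (scale_measure \<epsilon> (meas \<rho>))"
  let ?q = "row_prob N (A ?m)"
  note h = Suc.prems(2)
  have mM: "?m \<in> {1..M}" using Suc.prems by simp
  have iv: "{1..<?m} = {1..n}" by auto
  have q: "?q \<in> borel_measurable borel" by (rule measurable_row_prob[OF A[OF mM]])
  have upd: "(\<lambda>(x, z). x(?m := z)) \<in> PiM {1..n} (\<lambda>_. borel) \<Otimes>\<^sub>M borel \<rightarrow>\<^sub>M PiM {1..?m} (\<lambda>_. borel :: 'a borel_prob measure)"
    by (rule measurable_PiM_fun_upd_Suc)
  have hz: "(\<lambda>p. h ((fst p)(?m := snd p))) \<in> borel_measurable (PiM {1..n} (\<lambda>_. borel) \<Otimes>\<^sub>M borel)"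
    using measurable_compose[OF upd h] by (simp only: case_prod_beta)
  have hx: "(\<lambda>l. h (z(?m := l))) \<in> borel_measurable borel" if "z \<in> space (PiM {1..n} (\<lambda>_. borel :: 'a borel_prob measure))" for z
    using measurable_compose[OF measurable_Pair1'[OF that] hz] by simp
  have sQ: "sets ?Q = sets borel" using nested_param(1)[OF \<kappa> \<epsilon>, of \<rho>] by simp
  have pQ: "prob_space ?Q" using nested_param(1)[OF \<kappa> \<epsilon>, of \<rho>] by (rule prob_space_dirichlet_process)
  have comp: "(\<lambda>z. z i) \<in> PiM {1..n} (\<lambda>_. borel) \<rightarrow>\<^sub>M (borel :: 'a borel_prob measure)" if "i \<in> {1..n}" for i
    using that by (rule measurable_component_singleton)
  have svm: "(\<lambda>z. sim_total_weight \<kappa> N \<rho>N A ?m z) \<in> borel_measurable (PiM {1..n} (\<lambda>_. borel))"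
    using measurable_sim_total_weight[of ?m A N "\<lambda>i z. z i" "PiM {1..n} (\<lambda>_. borel)" \<kappa> \<rho>N] A Suc.prems(1) comp by simp
  \<comment> \<open>the tilted Polya step applied to \<open>h\<close>\<close>
  define h' where "h' z = ennreal (1 / (\<kappa> + real n)) * (ennreal \<kappa> * (\<integral>\<^sup>+l. h (z(?m := l)) * ennreal (?q l) \<partial>?Q) +
    (\<Sum>i=1..n. ennreal (?q (z i)) * h (z(?m := z i))))" for z
  have h': "h' \<in> borel_measurable (PiM {1..n} (\<lambda>_. borel))"
  proof -
    interpret Q: prob_space ?Q by (rule pQ)
    have 1: "(\<lambda>p. h ((fst p)(?m := snd p)) * ennreal (?q (snd p))) \<in> borel_measurable (PiM {1..n} (\<lambda>_. borel) \<Otimes>\<^sub>M ?Q)"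
      using borel_measurable_times_ennreal[OF hz measurable_compose[OF measurable_compose[OF measurable_snd q] measurable_ennreal]] sQ
      by (simp cong: measurable_cong_sets sets_pair_measure_cong)
    have 2: "(\<lambda>z. h (z(?m := z i))) \<in> borel_measurable (PiM {1..n} (\<lambda>_. borel))" if "i \<in> {1..n}" for i
      using measurable_compose[OF measurable_Pair[OF measurable_ident comp[OF that]] hz] by simp
    have 3: "(\<lambda>z. \<integral>\<^sup>+l. h (z(?m := l)) * ennreal (?q l) \<partial>?Q) \<in> borel_measurable (PiM {1..n} (\<lambda>_. borel))"
      using Q.borel_measurable_nn_integral[of "\<lambda>z l. h (z(?m := l)) * ennreal (?q l)" "PiM {1..n} (\<lambda>_. borel)"] 1
      by (simp add: case_prod_beta')
    show ?thesis
      unfolding h'_def[abs_def]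
      by (intro borel_measurable_times_ennreal borel_measurable_add borel_measurable_const borel_measurable_sum 2 3
        measurable_compose[OF measurable_compose[OF comp q] measurable_ennreal])
  qed
  have Zu: "sim_total_weight \<kappa> N \<rho>N A ?m (\<lambda>i. u i \<omega>) = sim_total_weight \<kappa> N \<rho>N A ?m (\<lambda>i\<in>{1..<?m}. u i \<omega>)"
    "(\<lambda>i\<in>{1..?m}. u i \<omega>) = (\<lambda>i\<in>{1..<?m}. u i \<omega>)(?m := u ?m \<omega>)"
    "sim_total_weight \<kappa> N \<rho>N A n (\<lambda>i. u i \<omega>) = sim_total_weight \<kappa> N \<rho>N A n (\<lambda>i\<in>{1..<?m}. u i \<omega>)" for \<omega>
    by (auto intro!: sim_total_weight_cong simp: fun_eq_iff restrict_def)
  define F where "F p = ennreal (sim_total_weight \<kappa> N \<rho>N A ?m (snd p)) * h ((snd p)(?m := fst p))" for p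
  have F: "F \<in> borel_measurable (borel \<Otimes>\<^sub>M PiM {1..<?m} (\<lambda>_. borel))"
    unfolding F_def[abs_def] iv
    by (rule borel_measurable_times_ennreal[OF measurable_compose[OF measurable_compose[OF measurable_snd svm] measurable_ennreal]])
      (use measurable_compose[OF measurable_pair_swap' hz] in \<open>simp add: case_prod_beta'\<close>)
  have "(\<integral>\<^sup>+\<omega>. ennreal (sim_total_weight \<kappa> N \<rho>N A ?m (\<lambda>i. u i \<omega>)) * h (\<lambda>i\<in>{1..?m}. u i \<omega>) \<partial>P) =
    (\<integral>\<^sup>+\<omega>. F (u ?m \<omega>, \<lambda>i\<in>{1..<?m}. u i \<omega>) \<partial>P)"
    unfolding F_def fst_conv snd_conv Zu(1,2) ..
  also have "\<dots> = (\<integral>\<^sup>+\<omega>. \<integral>\<^sup>+l. F (l, \<lambda>i\<in>{1..<?m}. u i \<omega>) \<partial>sim_kernel \<kappa> \<epsilon> \<rho> N \<rho>N A ?m (\<lambda>i\<in>{1..<?m}. u i \<omega>) \<partial>P)"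
    by (rule has_cond_law_nn_integral[OF P c[OF mM] F])
  also have "\<dots> = (\<integral>\<^sup>+\<omega>. ennreal (sim_total_weight \<kappa> N \<rho>N A n (\<lambda>i. u i \<omega>)) * h' (\<lambda>i\<in>{1..n}. u i \<omega>) \<partial>P)"
  proof (intro nn_integral_cong)
    fix \<omega>
    define z where "z = (\<lambda>i\<in>{1..<?m}. u i \<omega>)"
    have z: "z \<in> space (PiM {1..n} (\<lambda>_. borel :: 'a borel_prob measure))" by (unfold z_def iv space_PiM) simp
    let ?K = "sim_kernel \<kappa> \<epsilon> \<rho> N \<rho>N A ?m z"
    have sK: "sets ?K = sets borel" by (simp add: sim_kernel_def Let_def)
    let ?W = "\<Sum>i=1..?m. sim_weight \<kappa> N \<rho>N A ?m z i"
    have W0: "0 \<le> ?W" using \<kappa> by (intro sum_nonneg) (auto simp: sim_weight_def)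
    have "(\<integral>\<^sup>+l. F (l, z) \<partial>?K) = ennreal (sim_total_weight \<kappa> N \<rho>N A ?m z) * (\<integral>\<^sup>+l. h (z(?m := l)) \<partial>?K)"
      unfolding F_def fst_conv snd_conv using hx[OF z] sK by (intro nn_integral_cmult) (simp cong: measurable_cong_sets)
    also have "ennreal (sim_total_weight \<kappa> N \<rho>N A ?m z) = ennreal (sim_total_weight \<kappa> N \<rho>N A n z) * ennreal (1 / (\<kappa> + real n)) * ennreal ?W"
    proof -
      have div: "0 < 1 / (\<kappa> + real n)" using \<kappa> by (intro divide_pos_pos) simp_all
      have "ennreal (a * (b * c)) = ennreal a * ennreal b * ennreal c" if "0 \<le> a" "0 \<le> b" "0 \<le> c" for a b c
        using that by (simp add: ennreal_mult mult.assoc)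
      from this[OF sim_total_weight_nonneg[OF \<kappa>] less_imp_le[OF div] W0] show ?thesis
        unfolding sim_total_weight_Suc .
    qed
    also have "\<dots> * (\<integral>\<^sup>+l. h (z(?m := l)) \<partial>?K) = ennreal (sim_total_weight \<kappa> N \<rho>N A n z) * (ennreal (1 / (\<kappa> + real n)) * (ennreal ?W * (\<integral>\<^sup>+l. h (z(?m := l)) \<partial>?K)))"
      by (simp only: mult.assoc)
    also have "ennreal (1 / (\<kappa> + real n)) * (ennreal ?W * (\<integral>\<^sup>+l. h (z(?m := l)) \<partial>?K)) = h' z"
    proof -
      have "ennreal ?W * (\<integral>\<^sup>+l. h (z(?m := l)) \<partial>?K) =
        ennreal \<kappa> * (\<integral>\<^sup>+l. h (z(?m := l)) * ennreal (?q l) \<partial>?Q) + (\<Sum>i=1..<?m. ennreal (?q (z i)) * h (z(?m := z i)))"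
        using nn_integral_sim_kernel[where g="\<lambda>l. h (z(?m := l))" and A=A and m="?m" and v=z and N=N and \<rho>N=\<rho>N
          and \<kappa>=\<kappa> and \<epsilon>=\<epsilon> and \<rho>=\<rho>, OF \<kappa> \<epsilon> s\<rho>N p\<rho>N mix A[OF mM] pos[OF mM] _ hx[OF z]] by simp
      then show ?thesis by (simp only: h'_def iv)
    qed
    finally have "(\<integral>\<^sup>+l. F (l, z) \<partial>?K) = ennreal (sim_total_weight \<kappa> N \<rho>N A n z) * h' z" .
    then show "(\<integral>\<^sup>+l. F (l, \<lambda>i\<in>{1..<?m}. u i \<omega>) \<partial>sim_kernel \<kappa> \<epsilon> \<rho> N \<rho>N A ?m (\<lambda>i\<in>{1..<?m}. u i \<omega>)) =
      ennreal (sim_total_weight \<kappa> N \<rho>N A n (\<lambda>i. u i \<omega>)) * h' (\<lambda>i\<in>{1..n}. u i \<omega>)"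
      unfolding z_def Zu(3) iv .
  qed
  also have "\<dots> = (\<integral>\<^sup>+w. \<integral>\<^sup>+x. ennreal (\<Prod>m=1..n. row_prob N (A m) (x m)) * h' x \<partial>PiM {1..n} (\<lambda>_. meas w)
      \<partial>\<D> (scale_measure \<kappa> ?Q))"
    using Suc.prems(1) by (intro Suc.IH h') simp
  also have "\<dots> = (\<integral>\<^sup>+w. \<integral>\<^sup>+x. ennreal (\<Prod>m=1..?m. row_prob N (A m) (x m)) * h x \<partial>PiM {1..?m} (\<lambda>_. meas w)
      \<partial>\<D> (scale_measure \<kappa> ?Q))"
  proof -
    define g where "g x = ennreal (\<Prod>m=1..?m. row_prob N (A m) (x m)) * h x" for x
    have g: "g \<in> borel_measurable (PiM {1..?m} (\<lambda>_. borel))"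
      unfolding g_def[abs_def]
    proof (intro borel_measurable_times_ennreal measurable_compose[OF _ measurable_ennreal] borel_measurable_prod h)
      fix m assume m: "m \<in> {1..?m}"
      then have "A m \<in> sets (PiM {1..N} (\<lambda>_. borel))" using Suc.prems(1) by (intro A) auto
      from measurable_compose[OF measurable_component_singleton[OF m] measurable_row_prob[OF this]]
      show "(\<lambda>x. row_prob N (A m) (x m)) \<in> borel_measurable (PiM {1..?m} (\<lambda>_. borel))" .
    qed
    have gu: "g (x(?m := l)) = ennreal (\<Prod>m=1..n. row_prob N (A m) (x m)) * (h (x(?m := l)) * ennreal (?q l))" for x l
    proof -
      have "(\<Prod>m=1..?m. row_prob N (A m) ((x(?m := l)) m)) = (\<Prod>m=1..n. row_prob N (A m) (x m)) * ?q l"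
        by (subst prod.cl_ivl_Suc) simp
      then show ?thesis
        unfolding g_def by (simp add: ennreal_mult'' mult_ac prod_nonneg)
    qed
    show ?thesis
      unfolding g_def[symmetric] nested_predictive[OF \<kappa> \<epsilon> g]
    proof (intro nn_integral_cong)
      fix w :: "'a borel_prob borel_prob" and x assume "x \<in> space (PiM {1..n} (\<lambda>_. meas w))"
      then have x: "x \<in> space (PiM {1..n} (\<lambda>_. borel :: 'a borel_prob measure))" by (simp add: space_PiM)
      have "(\<lambda>l. h (x(?m := l)) * ennreal (?q l)) \<in> borel_measurable ?Q"
        using borel_measurable_times_ennreal[OF hx[OF x] measurable_compose[OF q measurable_ennreal]] sQ by (simp cong: measurable_cong_sets)
      then have e: "(\<integral>\<^sup>+l. g (x(?m := l)) \<partial>?Q) =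
        ennreal (\<Prod>m=1..n. row_prob N (A m) (x m)) * (\<integral>\<^sup>+l. h (x(?m := l)) * ennreal (?q l) \<partial>?Q)"
        unfolding gu by (rule nn_integral_cmult)
        have s: "(\<Sum>i=1..n. g (x(?m := x i))) =
          ennreal (\<Prod>m=1..n. row_prob N (A m) (x m)) * (\<Sum>i=1..n. ennreal (?q (x i)) * h (x(?m := x i)))"
          unfolding gu sum_distrib_left by (intro sum.cong refl) (simp only: mult.commute)
        have alg: "c * (k * (p * i + r)) = k * (p * (c * i) + c * r)" for c k p i r :: ennreal
          by (simp only: distrib_left mult_ac)
      show "ennreal (\<Prod>m=1..n. row_prob N (A m) (x m)) * h' x =
        ennreal (1 / (\<kappa> + real n)) * (ennreal \<kappa> * (\<integral>\<^sup>+l. g (x(?m := l)) \<partial>?Q) + (\<Sum>i=1..n. g (x(?m := x i))))"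
        unfolding h'_def e s by (rule alg)
    qed
  qed
  finally show ?case .
qed

section \<open>Prediction given the observations\<close>

lemma nn_integral_affine:
  assumes f: "f \<in> borel_measurable M" and g: "\<And>i. i \<in> I \<Longrightarrow> g i \<in> borel_measurable M"
  shows "(\<integral>\<^sup>+x. c * (d * f x + (\<Sum>i\<in>I. g i x)) \<partial>M) = c * (d * (\<integral>\<^sup>+x. f x \<partial>M) + (\<Sum>i\<in>I. \<integral>\<^sup>+x. g i x \<partial>M))"
proof -
  have df: "(\<lambda>x. d * f x) \<in> borel_measurable M" using f by (intro borel_measurable_times_ennreal) auto
  have sg: "(\<lambda>x. \<Sum>i\<in>I. g i x) \<in> borel_measurable M" using g by (rule borel_measurable_sum)
  have "(\<integral>\<^sup>+x. c * (d * f x + (\<Sum>i\<in>I. g i x)) \<partial>M) = c * ((\<integral>\<^sup>+x. d * f x \<partial>M) + (\<integral>\<^sup>+x. (\<Sum>i\<in>I. g i x) \<partial>M))"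
    using nn_integral_cmult[OF borel_measurable_add[OF df sg], of c] nn_integral_add[OF df sg] by simp
  then show ?thesis using nn_integral_cmult[OF f, of d] nn_integral_sum[of I g M, OF g] by simp
qed

lemma emeasure_rows_event:
  fixes \<rho> :: "'a::polish_space borel_prob"
  assumes P: "prob_space P" and nd: "nested_dirichlet P \<kappa> \<epsilon> \<rho> \<pi> \<mu> \<xi>" and M: "1 \<le> M"
    and A: "\<And>m. m \<in> {1..M} \<Longrightarrow> A m \<in> sets (PiM {1..N} (\<lambda>_. borel))"
  shows "{\<omega>\<in>space P. \<forall>m\<in>{1..M}. row \<xi> m N \<omega> \<in> A m} \<in> sets P"
    and "emeasure P {\<omega>\<in>space P. \<forall>m\<in>{1..M}. row \<xi> m N \<omega> \<in> A m} =
      (\<integral>\<^sup>+w. \<integral>\<^sup>+x. ennreal (\<Prod>m=1..M. row_prob N (A m) (x m)) \<partial>PiM {1..M} (\<lambda>_. meas w)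
        \<partial>\<D> (scale_measure \<kappa> (\<D> (scale_measure \<epsilon> (meas \<rho>)))))"
proof -
  show E: "{\<omega>\<in>space P. \<forall>m\<in>{1..M}. row \<xi> m N \<omega> \<in> A m} \<in> sets P"
    using measurable_sets[OF measurable_nested_row[OF nd] A]
    by (intro sets.sets_Collect_finite_All) (auto simp: vimage_def Int_def conj_commute)
  have g: "(\<lambda>x. ennreal (\<Prod>m=1..M. row_prob N (A m) (x m))) \<in> borel_measurable (PiM {1..M} (\<lambda>_. borel))"
    by (intro measurable_compose[OF _ measurable_ennreal] borel_measurable_prod
      measurable_compose[OF _ measurable_row_prob[OF A]] measurable_component_singleton)
  have "emeasure P {\<omega>\<in>space P. \<forall>m\<in>{1..M}. row \<xi> m N \<omega> \<in> A m} =
    (\<integral>\<^sup>+\<omega>. (\<lambda>_. 1) (\<lambda>i\<in>{1..M}. \<mu> i \<omega>) * indicator {\<omega>. \<forall>m\<in>{1..M}. row \<xi> m N \<omega> \<in> A m} \<omega> \<partial>P)"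
    unfolding nn_integral_indicator[OF E, symmetric]
    by (intro nn_integral_cong) (auto simp: indicator_def)
  also have "\<dots> = (\<integral>\<^sup>+\<omega>. (\<lambda>_. 1) (\<lambda>i\<in>{1..M}. \<mu> i \<omega>) * ennreal (\<Prod>m=1..M. row_prob N (A m) (\<mu> m \<omega>)) \<partial>P)"
    by (rule nested_rows_law[OF P nd M A]) auto
  also have "\<dots> = (\<integral>\<^sup>+\<omega>. (\<lambda>x. ennreal (\<Prod>m=1..M. row_prob N (A m) (x m))) (\<lambda>i\<in>{1..M}. \<mu> i \<omega>) \<partial>P)"
    by simp
  also have "\<dots> = (\<integral>\<^sup>+w. \<integral>\<^sup>+x. ennreal (\<Prod>m=1..M. row_prob N (A m) (x m)) \<partial>PiM {1..M} (\<lambda>_. meas w)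
        \<partial>\<D> (scale_measure \<kappa> (\<D> (scale_measure \<epsilon> (meas \<rho>)))))"
    by (rule nested_hidden_law[OF P nd g])
  finally show "emeasure P {\<omega>\<in>space P. \<forall>m\<in>{1..M}. row \<xi> m N \<omega> \<in> A m} = \<dots>" .
qed

text \<open>The positive probability of the observations is \<open>E[L]\<close>, which is at most the expectation of
the single factor \<open>row_prob N (A m)\<close>, that is, \<open>\<rho>\<^sub>N(A\<^sub>m)\<close>. Positivity is needed to condition on \<open>A\<^sub>m\<close>
in the simulation.\<close>

lemma row_law_positive:
  fixes \<rho> :: "'a::polish_space borel_prob"
  assumes P: "prob_space P" and nd: "nested_dirichlet P \<kappa> \<epsilon> \<rho> \<pi> \<mu> \<xi>" and \<kappa>: "0 < \<kappa>" "0 < \<epsilon>"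
    and A: "\<And>m. m \<in> {1..M} \<Longrightarrow> A m \<in> sets (PiM {1..N} (\<lambda>_. borel))"
    and pos: "0 < measure P {\<omega>\<in>space P. \<forall>m\<in>{1..M}. row \<xi> m N \<omega> \<in> A m}" and m: "m \<in> {1..M}"
  shows "0 < measure (row_law P \<xi> N) (A m)"
proof -
  interpret P: prob_space P by (rule P)
  let ?Q = "\<D> (scale_measure \<epsilon> (meas \<rho>))"
  have q: "row_prob N (A m) \<in> borel_measurable borel" by (rule measurable_row_prob[OF A[OF m]])
  have row: "row \<xi> 1 N \<in> P \<rightarrow>\<^sub>M PiM {1..N} (\<lambda>_. borel)" using measurable_nested_row[OF nd] by simp
  interpret R: prob_space "row_law P \<xi> N"
    unfolding row_law_def by (rule P.prob_space_distr[OF row])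
  have M: "1 \<le> M" using m by simp
  have "0 < emeasure P {\<omega>\<in>space P. \<forall>m\<in>{1..M}. row \<xi> m N \<omega> \<in> A m}"
    using pos by (simp add: P.emeasure_eq_measure)
  also have "\<dots> = (\<integral>\<^sup>+w. \<integral>\<^sup>+x. ennreal (\<Prod>m=1..M. row_prob N (A m) (x m)) \<partial>PiM {1..M} (\<lambda>_. meas w)
        \<partial>\<D> (scale_measure \<kappa> ?Q))"
    by (rule emeasure_rows_event(2)[OF P nd M A])
  also have "\<dots> \<le> (\<integral>\<^sup>+w. \<integral>\<^sup>+x. ennreal (row_prob N (A m) (x m)) \<partial>PiM {1..M} (\<lambda>_. meas w)
        \<partial>\<D> (scale_measure \<kappa> ?Q))"
  proof (intro nn_integral_mono ennreal_leI)
    fix x :: "nat \<Rightarrow> 'a borel_prob"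
    have "(\<Prod>m=1..M. row_prob N (A m) (x m)) = row_prob N (A m) (x m) * (\<Prod>m\<in>{1..M} - {m}. row_prob N (A m) (x m))"
      using m by (intro prod.remove) auto
    also have "\<dots> \<le> row_prob N (A m) (x m) * 1"
      by (intro mult_left_mono prod_le_1) auto
    finally show "(\<Prod>m=1..M. row_prob N (A m) (x m)) \<le> row_prob N (A m) (x m)" by simp
  qed
  also have "\<dots> = (\<integral>\<^sup>+l. ennreal (row_prob N (A m) l) \<partial>?Q)"
    by (rule nested_mean[OF \<kappa> measurable_compose[OF q measurable_ennreal] m])
  also have "\<dots> = (\<integral>\<^sup>+l. \<integral>\<^sup>+x. indicator (A m) x \<partial>PiM {1..N} (\<lambda>_. meas l) \<partial>?Q)"
    unfolding emeasure_PiM_meas[symmetric] using A[OF m] by (intro nn_integral_cong) simp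
  also have "\<dots> = (\<integral>\<^sup>+x. indicator (A m) x \<partial>row_law P \<xi> N)"
    using A[OF m] by (intro row_law_mixture[symmetric, OF P nd \<kappa>]) simp
  also have "\<dots> = emeasure (row_law P \<xi> N) (A m)"
    using A[OF m] by (intro nn_integral_indicator) (simp add: row_law_def)
  finally show ?thesis by (simp add: R.emeasure_eq_measure)
qed

text \<open>The predictive rule for the function \<open>1\<^sub>B(x\<^sub>M\<^sub>+\<^sub>1) L(x\<^sub>1, \<dots>, x\<^sub>M)\<close>: the likelihood factor is not
affected by replacing the last coordinate.\<close>

lemma nested_predictive_given_rows:
  fixes \<rho> :: "'a::polish_space borel_prob"
  assumes P: "prob_space P" and nd: "nested_dirichlet P \<kappa> \<epsilon> \<rho> \<pi> \<mu> \<xi>" and \<kappa>: "0 < \<kappa>" "0 < \<epsilon>" and M: "1 \<le> M"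
    and A: "\<And>m. m \<in> {1..M} \<Longrightarrow> A m \<in> sets (PiM {1..N} (\<lambda>_. borel))" and B: "B \<in> sets borel"
  shows "emeasure P {\<omega>\<in>space P. \<mu> (Suc M) \<omega> \<in> B \<and> (\<forall>m\<in>{1..M}. row \<xi> m N \<omega> \<in> A m)} =
    ennreal (1 / (\<kappa> + real M)) *
      (ennreal \<kappa> * emeasure (\<D> (scale_measure \<epsilon> (meas \<rho>))) B * emeasure P {\<omega>\<in>space P. \<forall>m\<in>{1..M}. row \<xi> m N \<omega> \<in> A m} +
       (\<Sum>i=1..M. \<integral>\<^sup>+w. \<integral>\<^sup>+x. ennreal (\<Prod>m=1..M. row_prob N (A m) (x m)) * indicator B (x i) \<partial>PiM {1..M} (\<lambda>_. meas w)
         \<partial>\<D> (scale_measure \<kappa> (\<D> (scale_measure \<epsilon> (meas \<rho>))))))"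
proof -
  let ?Q = "\<D> (scale_measure \<epsilon> (meas \<rho>))"
  let ?D = "\<D> (scale_measure \<kappa> ?Q)"
  define L where "L x = ennreal (\<Prod>m=1..M. row_prob N (A m) (x m))" for x
  have sQ: "sets ?Q = sets borel" and pQ: "prob_space ?Q"
    using nested_param(1)[OF \<kappa>, of \<rho>] by (auto intro: prob_space_dirichlet_process)
  have sD: "sets ?D = sets borel"
    using nested_param(2)[OF \<kappa>, of \<rho>] by simp
  have Lm: "L \<in> borel_measurable (PiM {1..k} (\<lambda>_. borel))" if "M \<le> k" for k
    unfolding L_def[abs_def] using that
    by (intro measurable_compose[OF _ measurable_ennreal] borel_measurable_prod
      measurable_compose[OF _ measurable_row_prob[OF A]] measurable_component_singleton) auto
  have Bm: "(\<lambda>x. indicator B (x i) :: ennreal) \<in> borel_measurable (PiM {1..k} (\<lambda>_. borel))" if "i \<in> {1..k}" for i k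
    using B that by (intro measurable_compose[OF measurable_component_singleton] borel_measurable_indicator) auto
  have ker: "(\<lambda>w. PiM {1..M} (\<lambda>_. meas w)) \<in> ?D \<rightarrow>\<^sub>M prob_algebra (PiM {1..M} (\<lambda>_. borel :: 'a borel_prob measure))"
    using measurable_PiM_meas_const[of M] sD by (simp cong: measurable_cong_sets)
  have inner: "(\<lambda>w. \<integral>\<^sup>+x. f x \<partial>PiM {1..M} (\<lambda>_. meas w)) \<in> borel_measurable ?D"
    if f: "f \<in> borel_measurable (PiM {1..M} (\<lambda>_. borel :: 'a borel_prob measure))" for f :: "(nat \<Rightarrow> 'a borel_prob) \<Rightarrow> ennreal"
    using measurable_nn_integral_kernel[OF ker measurable_compose[OF measurable_snd f]] by (simp only: snd_conv)
  define g where "g x = indicator B (x (Suc M)) * L x" for x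
  have g: "g \<in> borel_measurable (PiM {1..Suc M} (\<lambda>_. borel))"
    unfolding g_def[abs_def] by (intro borel_measurable_times_ennreal Bm Lm) auto
  have gu: "g (x(Suc M := l)) = L x * indicator B l" for x l
    by (simp add: g_def L_def mult.commute)
  have E: "{\<omega>\<in>space P. \<mu> (Suc M) \<omega> \<in> B \<and> (\<forall>m\<in>{1..M}. row \<xi> m N \<omega> \<in> A m)} \<in> sets P"
    using sets.Int[OF measurable_sets[OF measurable_nested_hidden[OF nd, of "Suc M"] B] emeasure_rows_event(1)[OF P nd M A]]
    by (simp add: vimage_def Int_def conj_ac cong: conj_cong)
  have "emeasure P {\<omega>\<in>space P. \<mu> (Suc M) \<omega> \<in> B \<and> (\<forall>m\<in>{1..M}. row \<xi> m N \<omega> \<in> A m)} =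
    (\<integral>\<^sup>+\<omega>. (\<lambda>x. indicator B (x (Suc M))) (\<lambda>i\<in>{1..Suc M}. \<mu> i \<omega>) * indicator {\<omega>. \<forall>m\<in>{1..M}. row \<xi> m N \<omega> \<in> A m} \<omega> \<partial>P)"
    unfolding nn_integral_indicator[OF E, symmetric]
    by (intro nn_integral_cong) (auto simp: indicator_def)
  also have "\<dots> = (\<integral>\<^sup>+\<omega>. (\<lambda>x. indicator B (x (Suc M))) (\<lambda>i\<in>{1..Suc M}. \<mu> i \<omega>) * ennreal (\<Prod>m=1..M. row_prob N (A m) (\<mu> m \<omega>)) \<partial>P)"
    by (intro nested_rows_law[OF P nd M A] Bm) auto
  also have "\<dots> = (\<integral>\<^sup>+\<omega>. g (\<lambda>i\<in>{1..Suc M}. \<mu> i \<omega>) \<partial>P)"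
    by (simp add: g_def L_def)
  also have "\<dots> = (\<integral>\<^sup>+w. \<integral>\<^sup>+x. g x \<partial>PiM {1..Suc M} (\<lambda>_. meas w) \<partial>?D)"
    by (rule nested_hidden_law[OF P nd g])
  also have "\<dots> = (\<integral>\<^sup>+w. \<integral>\<^sup>+x. ennreal (1 / (\<kappa> + real M)) *
        (ennreal \<kappa> * (\<integral>\<^sup>+l. g (x(Suc M := l)) \<partial>?Q) + (\<Sum>i=1..M. g (x(Suc M := x i)))) \<partial>PiM {1..M} (\<lambda>_. meas w) \<partial>?D)"
    by (rule nested_predictive[OF \<kappa> g])
  also have "\<dots> = (\<integral>\<^sup>+w. \<integral>\<^sup>+x. ennreal (1 / (\<kappa> + real M)) *
        (ennreal \<kappa> * emeasure ?Q B * L x + (\<Sum>i=1..M. L x * indicator B (x i))) \<partial>PiM {1..M} (\<lambda>_. meas w) \<partial>?D)"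
    unfolding gu using B sQ by (simp add: nn_integral_cmult mult.assoc mult.commute[of "L _" "emeasure _ _"])
  also have "\<dots> = (\<integral>\<^sup>+w. ennreal (1 / (\<kappa> + real M)) *
        (ennreal \<kappa> * emeasure ?Q B * (\<integral>\<^sup>+x. L x \<partial>PiM {1..M} (\<lambda>_. meas w)) +
          (\<Sum>i=1..M. \<integral>\<^sup>+x. L x * indicator B (x i) \<partial>PiM {1..M} (\<lambda>_. meas w))) \<partial>?D)"
  proof (intro nn_integral_cong)
    fix w :: "'a borel_prob borel_prob"
    have 1: "L \<in> borel_measurable (PiM {1..M} (\<lambda>_. meas w))"
      "\<And>i. i \<in> {1..M} \<Longrightarrow> (\<lambda>x. L x * indicator B (x i)) \<in> borel_measurable (PiM {1..M} (\<lambda>_. meas w))"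
      using Lm[of M] Bm[of _ M] by (auto cong: measurable_cong_sets intro!: borel_measurable_times_ennreal)
    show "(\<integral>\<^sup>+x. ennreal (1 / (\<kappa> + real M)) *
        (ennreal \<kappa> * emeasure ?Q B * L x + (\<Sum>i=1..M. L x * indicator B (x i))) \<partial>PiM {1..M} (\<lambda>_. meas w)) =
      ennreal (1 / (\<kappa> + real M)) *
        (ennreal \<kappa> * emeasure ?Q B * (\<integral>\<^sup>+x. L x \<partial>PiM {1..M} (\<lambda>_. meas w)) +
          (\<Sum>i=1..M. \<integral>\<^sup>+x. L x * indicator B (x i) \<partial>PiM {1..M} (\<lambda>_. meas w)))"
      by (rule nn_integral_affine[OF 1])
  qed
  also have "\<dots> = ennreal (1 / (\<kappa> + real M)) *
      (ennreal \<kappa> * emeasure ?Q B * (\<integral>\<^sup>+w. \<integral>\<^sup>+x. L x \<partial>PiM {1..M} (\<lambda>_. meas w) \<partial>?D) +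
       (\<Sum>i=1..M. \<integral>\<^sup>+w. \<integral>\<^sup>+x. L x * indicator B (x i) \<partial>PiM {1..M} (\<lambda>_. meas w) \<partial>?D))"
  proof -
    have 1: "(\<lambda>w. \<integral>\<^sup>+x. L x \<partial>PiM {1..M} (\<lambda>_. meas w)) \<in> borel_measurable ?D"
      "\<And>i. i \<in> {1..M} \<Longrightarrow> (\<lambda>w. \<integral>\<^sup>+x. L x * indicator B (x i) \<partial>PiM {1..M} (\<lambda>_. meas w)) \<in> borel_measurable ?D"
      by (rule inner[OF Lm[OF order_refl]]) (rule inner[OF borel_measurable_times_ennreal[OF Lm[OF order_refl] Bm]])
    show ?thesis by (rule nn_integral_affine[OF 1])
  qed
  also have "(\<integral>\<^sup>+w. \<integral>\<^sup>+x. L x \<partial>PiM {1..M} (\<lambda>_. meas w) \<partial>?D) = emeasure P {\<omega>\<in>space P. \<forall>m\<in>{1..M}. row \<xi> m N \<omega> \<in> A m}"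
    unfolding L_def by (rule emeasure_rows_event(2)[symmetric, OF P nd M A])
  finally show ?thesis unfolding L_def .
qed

lemma total_weight_eq_sim_total_weight:
  assumes "weighted_simulation P \<kappa> \<epsilon> \<rho> M N \<rho>N A T Y t u" "\<omega> \<in> space P"
  shows "total_weight \<kappa> M t \<omega> = sim_total_weight \<kappa> N \<rho>N A M (\<lambda>i. u i \<omega>)"
  using assms unfolding total_weight_def sim_total_weight_def weighted_simulation_def
  by (intro prod.cong refl arg_cong2[where f="(*)"] sum.cong) auto

section \<open>Weighted empirical mixtures\<close>

text \<open>The averaged variables are one and the same function of the independent simulations, with values
in \<open>[0, 1]\<close>. Taking \<open>B = UNIV\<close> covers the total weights themselves.\<close>

lemma simulation_averages:
  fixes u :: "nat \<Rightarrow> nat \<Rightarrow> 'w \<Rightarrow> 'a::polish_space borel_prob"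
  assumes P: "prob_space P" and \<kappa>: "0 < \<kappa>" and p\<rho>N: "prob_space \<rho>N"
    and sim: "\<And>k. 1 \<le> k \<Longrightarrow> weighted_simulation P \<kappa> \<epsilon> \<rho> M N \<rho>N A T Y (t k) (u k)"
    and ind: "prob_space.indep_vars P (\<lambda>_. sim_space M) (\<lambda>k. sim_element M (t k) (u k)) {1..}"
    and B: "B \<in> sets borel" and m: "m \<in> {1..M}"
    and mean: "\<And>k. 1 \<le> k \<Longrightarrow> (\<integral>\<omega>. total_weight \<kappa> M (t k) \<omega> * indicator B (u k m \<omega>) \<partial>P) = b"
  shows "AE \<omega> in P. (\<lambda>K. (\<Sum>k=1..K. total_weight \<kappa> M (t k) \<omega> * indicator B (u k m \<omega>)) / real K) \<longlonglongrightarrow> b"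
proof (rule strong_law_bounded[OF P])
  interpret prob_space P by (rule P)
  \<comment> \<open>one function of the simulation for all indices \<open>k\<close>, since independence is inherited by such functions\<close>
  define F where "F p = (\<Prod>m=1..M. 1 / (\<kappa> + real m - 1) * (\<Sum>i=1..m. fst p (m, i))) * indicator B (snd p m)"
    for p :: "(nat \<times> nat \<Rightarrow> real) \<times> (nat \<Rightarrow> 'a borel_prob)"
  have F: "F \<in> borel_measurable (sim_space M)"
    unfolding F_def[abs_def] sim_space_def using m B
    by (intro borel_measurable_times borel_measurable_prod borel_measurable_const borel_measurable_sum
      measurable_compose[OF measurable_fst measurable_component_singleton]
      measurable_compose[OF measurable_compose[OF measurable_snd measurable_component_singleton] borel_measurable_indicator]) auto
  have "F (sim_element M t u \<omega>) = total_weight \<kappa> M t \<omega> * indicator B (u m \<omega>)"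
    for t and u :: "nat \<Rightarrow> 'w \<Rightarrow> 'a borel_prob" and \<omega>
    unfolding F_def total_weight_def sim_element_def using m by simp
  with indep_vars_compose2[OF ind, of "\<lambda>_. F" "\<lambda>_. borel"] F
  show "indep_vars (\<lambda>_. borel) (\<lambda>k \<omega>. total_weight \<kappa> M (t k) \<omega> * indicator B (u k m \<omega>)) {1..}" by simp
  show "0 \<le> total_weight \<kappa> M (t k) \<omega> * indicator B (u k m \<omega>) \<and> total_weight \<kappa> M (t k) \<omega> * indicator B (u k m \<omega>) \<le> 1"
    if "1 \<le> k" "\<omega> \<in> space P" for k \<omega>
    unfolding total_weight_eq_sim_total_weight[OF sim[OF that(1)] that(2)]
    using sim_total_weight_nonneg[OF \<kappa>, of N \<rho>N A M] sim_total_weight_le_1[OF \<kappa> p\<rho>N, of N A M] by (simp add: indicator_def)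
qed (use mean in auto)

text \<open>The random measures whose convergence is at stake, for fixed weights \<open>V k\<close> and points \<open>v k m\<close>, with
values in an arbitrary space so that images under a map have the same form.\<close>

definition weighted_mixture ::
  "real \<Rightarrow> nat \<Rightarrow> 'x::topological_space measure \<Rightarrow> (nat \<Rightarrow> real) \<Rightarrow> (nat \<Rightarrow> nat \<Rightarrow> 'x) \<Rightarrow> nat \<Rightarrow> 'x measure" where
  "weighted_mixture \<kappa> M Q V v K = scale_measure (ennreal (1 / (\<kappa> + real M)))
     (add_measure (scale_measure (ennreal \<kappa>) Q)
       (sum_measure {1..M} (\<lambda>m. scale_measure (ennreal (1 / (\<Sum>k=1..K. V k)))
         (sum_measure {1..K} (\<lambda>k. scale_measure (ennreal (V k)) (return borel (v k m)))))))"

lemma sets_weighted_mixture [simp]: "sets (weighted_mixture \<kappa> M Q V v K) = sets borel"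
  by (simp add: weighted_mixture_def)

lemma
  assumes \<kappa>: "0 < \<kappa>" and Q: "sets Q = sets borel" "prob_space Q" and V: "\<And>k. 1 \<le> k \<Longrightarrow> 0 \<le> V k"
  shows measure_weighted_mixture: "B \<in> sets borel \<Longrightarrow> measure (weighted_mixture \<kappa> M Q V v K) B =
      (\<kappa> * measure Q B + (\<Sum>m=1..M. (\<Sum>k=1..K. V k * indicator B (v k m)) / (\<Sum>k=1..K. V k))) / (\<kappa> + real M)"
    and finite_measure_weighted_mixture: "finite_measure (weighted_mixture \<kappa> M Q V v K)"
proof -
  interpret Q: prob_space Q by (rule Q)
  have S: "0 \<le> (\<Sum>k=1..K. V k)" using V by (intro sum_nonneg) auto
  have N: "0 \<le> (\<kappa> * measure Q B + (\<Sum>m=1..M. (\<Sum>k=1..K. V k * indicator B (v k m)) / (\<Sum>k=1..K. V k))) / (\<kappa> + real M)" for B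
    using \<kappa> V S by (intro divide_nonneg_nonneg add_nonneg_nonneg sum_nonneg mult_nonneg_nonneg) auto
  have e: "emeasure (weighted_mixture \<kappa> M Q V v K) B =
      ennreal ((\<kappa> * measure Q B + (\<Sum>m=1..M. (\<Sum>k=1..K. V k * indicator B (v k m)) / (\<Sum>k=1..K. V k))) / (\<kappa> + real M))"
    if B: "B \<in> sets borel" for B
  proof -
    have i: "emeasure (sum_measure {1..K} (\<lambda>k. scale_measure (ennreal (V k)) (return borel (v k m)))) B =
      ennreal (\<Sum>k=1..K. V k * indicator B (v k m))" for m
    proof -
      have "emeasure (sum_measure {1..K} (\<lambda>k. scale_measure (ennreal (V k)) (return borel (v k m)))) B =
        (\<Sum>k=1..K. ennreal (V k) * indicator B (v k m))"
        using B by (subst emeasure_sum_measure) auto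
      also have "\<dots> = (\<Sum>k=1..K. ennreal (V k * indicator B (v k m)))"
        by (intro sum.cong refl) (simp add: indicator_def)
      also have "\<dots> = ennreal (\<Sum>k=1..K. V k * indicator B (v k m))"
        using V by (intro sum_ennreal) auto
      finally show ?thesis .
    qed
    have I0: "0 \<le> (\<Sum>k=1..K. V k * indicator B (v k m))" for m using V by (intro sum_nonneg) auto
    have ii: "ennreal (1 / (\<Sum>k=1..K. V k)) * ennreal (\<Sum>k=1..K. V k * indicator B (v k m)) =
      ennreal ((\<Sum>k=1..K. V k * indicator B (v k m)) / (\<Sum>k=1..K. V k))" for m
      using S I0[of m] by (subst ennreal_mult[symmetric]) auto
    have "emeasure (weighted_mixture \<kappa> M Q V v K) B = ennreal (1 / (\<kappa> + real M)) *
      (ennreal \<kappa> * ennreal (measure Q B) + (\<Sum>m=1..M. ennreal ((\<Sum>k=1..K. V k * indicator B (v k m)) / (\<Sum>k=1..K. V k))))"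
      unfolding weighted_mixture_def emeasure_scale_measure
      by (subst emeasure_add_measure, simp add: Q(1), simp, subst emeasure_sum_measure, simp)
        (simp only: emeasure_scale_measure i ii Q.emeasure_eq_measure)
    also have "(\<Sum>m=1..M. ennreal ((\<Sum>k=1..K. V k * indicator B (v k m)) / (\<Sum>k=1..K. V k))) =
      ennreal (\<Sum>m=1..M. (\<Sum>k=1..K. V k * indicator B (v k m)) / (\<Sum>k=1..K. V k))"
      using I0 S by (intro sum_ennreal) auto
    also have "ennreal \<kappa> * ennreal (measure Q B) = ennreal (\<kappa> * measure Q B)"
      using \<kappa> by (simp add: ennreal_mult)
    also have "ennreal (\<kappa> * measure Q B) + ennreal (\<Sum>m=1..M. (\<Sum>k=1..K. V k * indicator B (v k m)) / (\<Sum>k=1..K. V k)) =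
      ennreal (\<kappa> * measure Q B + (\<Sum>m=1..M. (\<Sum>k=1..K. V k * indicator B (v k m)) / (\<Sum>k=1..K. V k)))"
      using \<kappa> I0 S by (intro ennreal_plus[symmetric] sum_nonneg[of _ "\<lambda>m. _ m / _"] divide_nonneg_nonneg) auto
    also have "ennreal (1 / (\<kappa> + real M)) * \<dots> = ennreal (1 / (\<kappa> + real M) * (\<kappa> * measure Q B + (\<Sum>m=1..M. (\<Sum>k=1..K. V k * indicator B (v k m)) / (\<Sum>k=1..K. V k))))"
      using \<kappa> by (intro ennreal_mult'[symmetric]) simp
    finally show ?thesis by simp
  qed
  show "B \<in> sets borel \<Longrightarrow> measure (weighted_mixture \<kappa> M Q V v K) B =
      (\<kappa> * measure Q B + (\<Sum>m=1..M. (\<Sum>k=1..K. V k * indicator B (v k m)) / (\<Sum>k=1..K. V k))) / (\<kappa> + real M)"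
    using e[of B] N[of B] by (rule measure_eq_emeasure_eq_ennreal[rotated])
  have "space (weighted_mixture \<kappa> M Q V v K) = space (borel :: 'a measure)"
    by (rule sets_eq_imp_space_eq) simp
  with e[of UNIV] show "finite_measure (weighted_mixture \<kappa> M Q V v K)"
    by (intro finite_measureI) simp
qed

lemma weighted_mixture_distr:
  fixes Q :: "'x::topological_space measure" and \<Phi> :: "'x \<Rightarrow> 'y::topological_space"
  assumes \<kappa>: "0 < \<kappa>" and Q: "sets Q = sets borel" "prob_space Q" and V: "\<And>k. 1 \<le> k \<Longrightarrow> 0 \<le> V k"
    and \<Phi>: "\<Phi> \<in> borel \<rightarrow>\<^sub>M borel" and B: "B \<in> sets borel"
  shows "measure (weighted_mixture \<kappa> M (distr Q borel \<Phi>) V (\<lambda>k m. \<Phi> (v k m)) K) B =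
    measure (weighted_mixture \<kappa> M Q V v K) (\<Phi> -` B)"
proof -
  interpret Q: prob_space Q by (rule Q)
  have \<Phi>Q: "\<Phi> \<in> Q \<rightarrow>\<^sub>M borel" using \<Phi> Q(1) by (simp cong: measurable_cong_sets)
  have sp: "space Q = UNIV" using sets_eq_imp_space_eq[OF Q(1)] by simp
  have B': "\<Phi> -` B \<in> sets borel" using measurable_sets[OF \<Phi> B] by simp
  have d: "measure (distr Q borel \<Phi>) B = measure Q (\<Phi> -` B)"
    using measure_distr[OF \<Phi>Q B] sp by simp
  have i: "indicator (\<Phi> -` B) x = (indicator B (\<Phi> x) :: real)" for x by (simp add: indicator_def)
  have dp: "prob_space (distr Q borel \<Phi>)" by (rule Q.prob_space_distr[OF \<Phi>Q])
  show ?thesis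
    by (subst measure_weighted_mixture[OF \<kappa> Q _ B'], erule V,
        subst measure_weighted_mixture[OF \<kappa> sets_distr dp _ B], erule V) (simp only: d i)
qed

lemma measure_weighted_mixture_UNIV:
  assumes \<kappa>: "0 < \<kappa>" and Q: "sets Q = sets borel" "prob_space Q" and V: "\<And>k. 1 \<le> k \<Longrightarrow> 0 < V k" and K: "1 \<le> K"
  shows "measure (weighted_mixture \<kappa> M Q V v K) UNIV = 1"
proof -
  have sp: "space Q = UNIV" using sets_eq_imp_space_eq[OF Q(1)] by simp
  have "0 < (\<Sum>k=1..K. V k)" using V K by (intro sum_pos) auto
  then show ?thesis
    using \<kappa> V prob_space.prob_space[OF Q(2)] sp
    by (subst measure_weighted_mixture[where V=V, OF \<kappa> Q less_imp_le[OF V]]) auto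
qed

text \<open>The factor \<open>1 / K\<close> cancels in the ratio of weighted sums.\<close>

lemma weighted_mixture_tendsto:
  assumes \<kappa>: "0 < \<kappa>" and Q: "sets Q = sets borel" "prob_space Q" and V: "\<And>k. 1 \<le> k \<Longrightarrow> 0 \<le> V k"
    and a: "(\<lambda>K. (\<Sum>k=1..K. V k) / real K) \<longlonglongrightarrow> a" "a \<noteq> 0" and B: "B \<in> sets borel"
    and b: "\<And>m. m \<in> {1..M} \<Longrightarrow> (\<lambda>K. (\<Sum>k=1..K. V k * indicator B (v k m)) / real K) \<longlonglongrightarrow> b m"
  shows "(\<lambda>K. measure (weighted_mixture \<kappa> M Q V v K) B) \<longlonglongrightarrow> (\<kappa> * measure Q B + (\<Sum>m=1..M. b m / a)) / (\<kappa> + real M)"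
proof -
  have "(\<lambda>K. (\<Sum>k=1..K. V k * indicator B (v k m)) / (\<Sum>k=1..K. V k)) \<longlonglongrightarrow> b m / a" if m: "m \<in> {1..M}" for m
  proof (rule Lim_transform_eventually[OF tendsto_divide[OF b[OF m] a]])
    show "\<forall>\<^sub>F K in sequentially. ((\<Sum>k=1..K. V k * indicator B (v k m)) / real K) / ((\<Sum>k=1..K. V k) / real K) =
      (\<Sum>k=1..K. V k * indicator B (v k m)) / (\<Sum>k=1..K. V k)"
      using eventually_gt_at_top[of 0] by eventually_elim simp
  qed
  moreover have "measure (weighted_mixture \<kappa> M Q V v K) B =
    (\<kappa> * measure Q B + (\<Sum>m=1..M. (\<Sum>k=1..K. V k * indicator B (v k m)) / (\<Sum>k=1..K. V k))) / (\<kappa> + real M)" for K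
    by (rule measure_weighted_mixture[OF \<kappa> Q _ B]) (rule V)
  ultimately show ?thesis
    using \<kappa> by (simp only:) (intro tendsto_divide[of _ "_ + _"] tendsto_add tendsto_sum tendsto_const, auto)
qed

text \<open>The right-hand side depends on the model alone, so that all simulations have the same mean.\<close>

lemma simulation_mean:
  fixes \<rho> :: "'a::polish_space borel_prob" and \<kappa> \<epsilon> :: real and u :: "nat \<Rightarrow> 'w \<Rightarrow> 'a borel_prob"
  assumes P: "prob_space P" and nd: "nested_dirichlet P \<kappa> \<epsilon> \<rho> \<pi> \<mu> \<xi>" and \<kappa>: "0 < \<kappa>" and \<epsilon>: "0 < \<epsilon>"
    and A: "\<And>m. m \<in> {1..M} \<Longrightarrow> A m \<in> sets (PiM {1..N} (\<lambda>_. borel))"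
    and pos: "\<And>m. m \<in> {1..M} \<Longrightarrow> 0 < measure (row_law P \<xi> N) (A m)"
    and sim: "weighted_simulation P \<kappa> \<epsilon> \<rho> M N (row_law P \<xi> N) A T Y t u"
    and B: "B \<in> sets borel" and m: "m \<in> {1..M}"
  shows "ennreal (\<integral>\<omega>. total_weight \<kappa> M t \<omega> * indicator B (u m \<omega>) \<partial>P) =
    (\<integral>\<^sup>+w. \<integral>\<^sup>+x. ennreal (\<Prod>m=1..M. row_prob N (A m) (x m)) * indicator B (x m) \<partial>PiM {1..M} (\<lambda>_. meas w)
      \<partial>\<D> (scale_measure \<kappa> (\<D> (scale_measure \<epsilon> (meas \<rho>)))))"
proof -
  interpret prob_space P by (rule P)
  have row: "row \<xi> 1 N \<in> P \<rightarrow>\<^sub>M PiM {1..N} (\<lambda>_. borel)" using measurable_nested_row[OF nd] by simp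
  have pR: "prob_space (row_law P \<xi> N)" unfolding row_law_def by (rule prob_space_distr[OF row])
  have sR: "sets (row_law P \<xi> N) = sets (PiM {1..N} (\<lambda>_. borel))" by (simp add: row_law_def)
  have c: "has_cond_law P (u m) borel (\<lambda>\<omega>. \<lambda>i\<in>{1..<m}. u i \<omega>) (PiM {1..<m} (\<lambda>_. borel))
      (sim_kernel \<kappa> \<epsilon> \<rho> N (row_law P \<xi> N) A m)" if "m \<in> {1..M}" for m
    using sim that by (simp add: weighted_simulation_def)
  then have um: "u m \<in> P \<rightarrow>\<^sub>M borel" if "m \<in> {1..M}" for m
    using that by (auto simp: has_cond_law_def)
  have sv: "(\<lambda>\<omega>. sim_total_weight \<kappa> N (row_law P \<xi> N) A M (\<lambda>i. u i \<omega>)) \<in> borel_measurable P"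
    by (rule measurable_sim_total_weight[OF A um]) auto
  have bound: "0 \<le> sim_total_weight \<kappa> N (row_law P \<xi> N) A M v" "sim_total_weight \<kappa> N (row_law P \<xi> N) A M v \<le> 1" for v
    by (rule sim_total_weight_nonneg[OF \<kappa>], rule sim_total_weight_le_1[OF \<kappa> pR])
  have h: "(\<lambda>x. indicator B (x m) :: ennreal) \<in> borel_measurable (PiM {1..M} (\<lambda>_. borel))"
    using B m by (intro measurable_compose[OF measurable_component_singleton] borel_measurable_indicator) auto
  have "(\<integral>\<omega>. total_weight \<kappa> M t \<omega> * indicator B (u m \<omega>) \<partial>P) =
    (\<integral>\<omega>. sim_total_weight \<kappa> N (row_law P \<xi> N) A M (\<lambda>i. u i \<omega>) * indicator B (u m \<omega>) \<partial>P)"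
    by (intro Bochner_Integration.integral_cong refl) (simp only: total_weight_eq_sim_total_weight[OF sim])
  also have "ennreal \<dots> = (\<integral>\<^sup>+\<omega>. ennreal (sim_total_weight \<kappa> N (row_law P \<xi> N) A M (\<lambda>i. u i \<omega>) * indicator B (u m \<omega>)) \<partial>P)"
  proof (rule nn_integral_eq_integral[symmetric])
    have "(\<lambda>\<omega>. indicator B (u m \<omega>) :: real) \<in> borel_measurable P"
      using measurable_compose[OF um[OF m] borel_measurable_indicator[OF B]] .
    then show "integrable P (\<lambda>\<omega>. sim_total_weight \<kappa> N (row_law P \<xi> N) A M (\<lambda>i. u i \<omega>) * indicator B (u m \<omega>))"
      using sv bound by (intro integrable_const_bound[where B=1] AE_I2 borel_measurable_times) (auto simp: indicator_def)
  qed (use bound in auto)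
  also have "\<dots> = (\<integral>\<^sup>+\<omega>. ennreal (sim_total_weight \<kappa> N (row_law P \<xi> N) A M (\<lambda>i. u i \<omega>)) *
      (\<lambda>x. indicator B (x m)) (\<lambda>i\<in>{1..M}. u i \<omega>) \<partial>P)"
    using m by (intro nn_integral_cong) (auto simp: indicator_def)
  also have "\<dots> = (\<integral>\<^sup>+w. \<integral>\<^sup>+x. ennreal (\<Prod>m=1..M. row_prob N (A m) (x m)) * indicator B (x m) \<partial>PiM {1..M} (\<lambda>_. meas w)
      \<partial>\<D> (scale_measure \<kappa> (\<D> (scale_measure \<epsilon> (meas \<rho>)))))"
    by (rule simulation_identity[OF P \<kappa> \<epsilon> sR pR _ A pos c order_refl h])
      (erule row_law_mixture[OF P nd \<kappa> \<epsilon>])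
  finally show ?thesis .
qed

lemma nested_predictive_via_simulation:
  fixes \<rho> :: "'a::polish_space borel_prob" and \<kappa> \<epsilon> :: real and u :: "nat \<Rightarrow> 'w \<Rightarrow> 'a borel_prob"
  assumes P: "prob_space P" and nd: "nested_dirichlet P \<kappa> \<epsilon> \<rho> \<pi> \<mu> \<xi>" and \<kappa>: "0 < \<kappa>" and \<epsilon>: "0 < \<epsilon>" and M: "1 \<le> M"
    and A: "\<And>m. m \<in> {1..M} \<Longrightarrow> A m \<in> sets (PiM {1..N} (\<lambda>_. borel))"
    and pos: "\<And>m. m \<in> {1..M} \<Longrightarrow> 0 < measure (row_law P \<xi> N) (A m)"
    and sim: "weighted_simulation P \<kappa> \<epsilon> \<rho> M N (row_law P \<xi> N) A T Y t u"
  shows "measure P {\<omega>\<in>space P. \<forall>m\<in>{1..M}. row \<xi> m N \<omega> \<in> A m} = (\<integral>\<omega>. total_weight \<kappa> M t \<omega> \<partial>P)"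
    and "B \<in> sets borel \<Longrightarrow> measure P {\<omega>\<in>space P. \<mu> (Suc M) \<omega> \<in> B \<and> (\<forall>m\<in>{1..M}. row \<xi> m N \<omega> \<in> A m)} =
      (\<kappa> * measure (\<D> (scale_measure \<epsilon> (meas \<rho>))) B * measure P {\<omega>\<in>space P. \<forall>m\<in>{1..M}. row \<xi> m N \<omega> \<in> A m} +
       (\<Sum>m=1..M. \<integral>\<omega>. total_weight \<kappa> M t \<omega> * indicator B (u m \<omega>) \<partial>P)) / (\<kappa> + real M)"
proof -
  interpret prob_space P by (rule P)
  let ?Q = "\<D> (scale_measure \<epsilon> (meas \<rho>))"
  interpret Q: prob_space ?Q using nested_param(1)[OF \<kappa> \<epsilon>, of \<rho>] by (rule prob_space_dirichlet_process)
  have mean: "ennreal (\<integral>\<omega>. total_weight \<kappa> M t \<omega> * indicator B (u m \<omega>) \<partial>P) =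
    (\<integral>\<^sup>+w. \<integral>\<^sup>+x. ennreal (\<Prod>m=1..M. row_prob N (A m) (x m)) * indicator B (x m) \<partial>PiM {1..M} (\<lambda>_. meas w)
      \<partial>\<D> (scale_measure \<kappa> ?Q))" if "B \<in> sets borel" "m \<in> {1..M}" for B m
    by (rule simulation_mean[OF P nd \<kappa> \<epsilon> _ _ sim that]) (erule A, erule pos)
  have nn: "0 \<le> (\<integral>\<omega>. total_weight \<kappa> M t \<omega> * indicator B (u m \<omega>) \<partial>P)" for B m
    using sim_total_weight_nonneg[OF \<kappa>, of N "row_law P \<xi> N" A M]
    by (intro Bochner_Integration.integral_nonneg_AE AE_I2) (simp add: total_weight_eq_sim_total_weight[OF sim])
  have M1: "1 \<in> {1..M}" using M by simp
  have "ennreal (measure P {\<omega>\<in>space P. \<forall>m\<in>{1..M}. row \<xi> m N \<omega> \<in> A m}) =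
    ennreal (\<integral>\<omega>. total_weight \<kappa> M t \<omega> * indicator UNIV (u 1 \<omega>) \<partial>P)"
    using mean[of UNIV 1] M1 emeasure_rows_event(2)[OF P nd M A] by (simp add: emeasure_eq_measure)
  with nn[of UNIV 1] show "measure P {\<omega>\<in>space P. \<forall>m\<in>{1..M}. row \<xi> m N \<omega> \<in> A m} = (\<integral>\<omega>. total_weight \<kappa> M t \<omega> \<partial>P)"
    by simp
  assume B: "B \<in> sets borel"
  let ?p = "measure P {\<omega>\<in>space P. \<forall>m\<in>{1..M}. row \<xi> m N \<omega> \<in> A m}"
  let ?b = "\<lambda>m. \<integral>\<omega>. total_weight \<kappa> M t \<omega> * indicator B (u m \<omega>) \<partial>P"
  have s: "(\<Sum>m=1..M. \<integral>\<^sup>+w. \<integral>\<^sup>+x. ennreal (\<Prod>m=1..M. row_prob N (A m) (x m)) * indicator B (x m) \<partial>PiM {1..M} (\<lambda>_. meas w)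
      \<partial>\<D> (scale_measure \<kappa> ?Q)) = ennreal (\<Sum>m=1..M. ?b m)"
    unfolding sum_ennreal[OF nn, symmetric] by (intro sum.cong refl mean[symmetric] B)
  have pred: "emeasure P {\<omega>\<in>space P. \<mu> (Suc M) \<omega> \<in> B \<and> (\<forall>m\<in>{1..M}. row \<xi> m N \<omega> \<in> A m)} =
    ennreal (1 / (\<kappa> + real M)) *
      (ennreal \<kappa> * emeasure ?Q B * emeasure P {\<omega>\<in>space P. \<forall>m\<in>{1..M}. row \<xi> m N \<omega> \<in> A m} +
       (\<Sum>m=1..M. \<integral>\<^sup>+w. \<integral>\<^sup>+x. ennreal (\<Prod>m=1..M. row_prob N (A m) (x m)) * indicator B (x m) \<partial>PiM {1..M} (\<lambda>_. meas w)
         \<partial>\<D> (scale_measure \<kappa> ?Q)))"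
    by (rule nested_predictive_given_rows[OF P nd \<kappa> \<epsilon> M _ B]) (erule A)
  have "ennreal (measure P {\<omega>\<in>space P. \<mu> (Suc M) \<omega> \<in> B \<and> (\<forall>m\<in>{1..M}. row \<xi> m N \<omega> \<in> A m)}) =
    ennreal (1 / (\<kappa> + real M)) * (ennreal \<kappa> * ennreal (measure ?Q B) * ennreal ?p + ennreal (\<Sum>m=1..M. ?b m))"
    using pred unfolding s emeasure_eq_measure Q.emeasure_eq_measure .
  also have "\<dots> = ennreal (1 / (\<kappa> + real M)) * ennreal (\<kappa> * measure ?Q B * ?p + (\<Sum>m=1..M. ?b m))"
  proof -
    have "ennreal (\<kappa> * measure ?Q B * ?p + (\<Sum>m=1..M. ?b m)) = ennreal (\<kappa> * measure ?Q B * ?p) + ennreal (\<Sum>m=1..M. ?b m)"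
      using \<kappa> nn by (intro ennreal_plus sum_nonneg mult_nonneg_nonneg) auto
    also have "ennreal (\<kappa> * measure ?Q B * ?p) = ennreal \<kappa> * ennreal (measure ?Q B) * ennreal ?p"
      using \<kappa> by (simp add: ennreal_mult)
    finally show ?thesis by (simp only:)
  qed
  also have "\<dots> = ennreal ((\<kappa> * measure ?Q B * ?p + (\<Sum>m=1..M. ?b m)) / (\<kappa> + real M))"
    using \<kappa> by (subst ennreal_mult'[symmetric]) auto
  finally show "measure P {\<omega>\<in>space P. \<mu> (Suc M) \<omega> \<in> B \<and> (\<forall>m\<in>{1..M}. row \<xi> m N \<omega> \<in> A m)} =
      (\<kappa> * measure ?Q B * ?p + (\<Sum>m=1..M. ?b m)) / (\<kappa> + real M)"
    using \<kappa> nn by (subst (asm) ennreal_inj) (auto intro!: divide_nonneg_nonneg add_nonneg_nonneg sum_nonneg)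
qed

text \<open>One realisation at a time: convergence of the averages on the finite unions of a countable base is
all that the randomness has to provide.\<close>

lemma weighted_mixture_open_liminf:
  fixes v :: "nat \<Rightarrow> nat \<Rightarrow> 'x::topological_space"
  assumes \<B>: "topological_basis \<B>" "countable \<B>"
    and \<kappa>: "0 < \<kappa>" and Q: "sets Q = sets borel" "prob_space Q" and V: "\<And>k. 1 \<le> k \<Longrightarrow> 0 \<le> V k"
    and a: "(\<lambda>K. (\<Sum>k=1..K. V k) / real K) \<longlonglongrightarrow> a" "a \<noteq> 0"
    and b: "\<And>S m. finite S \<Longrightarrow> S \<subseteq> \<B> \<Longrightarrow> m \<in> {1..M} \<Longrightarrow>
      (\<lambda>K. (\<Sum>k=1..K. V k * indicator (\<Union>S) (v k m)) / real K) \<longlonglongrightarrow> b m (\<Union>S)"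
    and \<nu>: "sets \<nu> = sets borel" "finite_measure \<nu>"
    and eq: "\<And>B. open B \<Longrightarrow> measure \<nu> B = (\<kappa> * measure Q B + (\<Sum>m=1..M. b m B / a)) / (\<kappa> + real M)"
    and G: "open G" and e: "0 < e"
  shows "\<forall>\<^sub>F K in sequentially. measure \<nu> G - e < measure (weighted_mixture \<kappa> M Q V v K) G"
proof (rule measure_open_ge_eventually[OF \<B> _ \<nu>(1) _ \<nu>(2) _ G e])
  show "finite_measure (weighted_mixture \<kappa> M Q V v K)" for K
    by (rule finite_measure_weighted_mixture[OF \<kappa> Q]) (rule V)
  fix S assume S: "finite S" "S \<subseteq> \<B>"
  have op: "open (\<Union>S)" using S(2) topological_basis_open[OF \<B>(1)] by blast
  show "(\<lambda>K. measure (weighted_mixture \<kappa> M Q V v K) (\<Union>S)) \<longlonglongrightarrow> measure \<nu> (\<Union>S)"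
    unfolding eq[OF op] using op by (intro weighted_mixture_tendsto[OF \<kappa> Q _ a] V b S) auto
qed simp

lemma weakly_converges_weighted_mixture:
  assumes \<kappa>: "0 < \<kappa>" and Q: "sets Q = sets borel" "prob_space Q" and V: "\<And>k. 1 \<le> k \<Longrightarrow> 0 < V k"
    and \<nu>: "sets \<nu> = sets borel" "prob_space \<nu>"
    and G: "\<And>G e. open G \<Longrightarrow> 0 < e \<Longrightarrow>
      \<forall>\<^sub>F K in sequentially. measure \<nu> G - e < measure (weighted_mixture \<kappa> M Q V v K) G"
  shows "weakly_converges (weighted_mixture \<kappa> M Q V v) \<nu>"
proof (rule weakly_convergesI[OF _ \<nu>(1) _ prob_space.finite_measure[OF \<nu>(2)] _ G])
  show "finite_measure (weighted_mixture \<kappa> M Q V v K)" for K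
    by (rule finite_measure_weighted_mixture[OF \<kappa> Q]) (rule less_imp_le[OF V])
  have \<nu>1: "measure \<nu> UNIV = 1"
    using prob_space.prob_space[OF \<nu>(2)] sets_eq_imp_space_eq[OF \<nu>(1)] by simp
  have "\<forall>\<^sub>F K in sequentially. measure (weighted_mixture \<kappa> M Q V v K) UNIV = measure \<nu> UNIV"
    unfolding \<nu>1 using eventually_ge_at_top[of 1]
  proof eventually_elim
    case (elim K)
    show ?case by (rule measure_weighted_mixture_UNIV[OF \<kappa> Q _ elim]) (rule V)
  qed
  then show "(\<lambda>K. measure (weighted_mixture \<kappa> M Q V v K) UNIV) \<longlonglongrightarrow> measure \<nu> UNIV"
    by (rule tendsto_eventually)
qed simp_all

lemma
  assumes P: "prob_space P" and E: "{\<omega>\<in>space P. E \<omega>} \<in> sets P" "0 < measure P {\<omega>\<in>space P. E \<omega>}"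
    and X: "X \<in> P \<rightarrow>\<^sub>M borel"
  shows sets_law_given: "sets (law_given P X E) = sets borel"
    and prob_space_law_given: "prob_space (law_given P X E)"
    and measure_law_given: "B \<in> sets borel \<Longrightarrow>
      measure (law_given P X E) B = measure P {\<omega>\<in>space P. X \<omega> \<in> B \<and> E \<omega>} / measure P {\<omega>\<in>space P. E \<omega>}"
proof -
  interpret prob_space P by (rule P)
  have e: "emeasure P {\<omega>\<in>space P. E \<omega>} \<noteq> 0" "emeasure P {\<omega>\<in>space P. E \<omega>} \<noteq> \<infinity>"
    using E(2) by (auto simp: emeasure_eq_measure)
  have X': "X \<in> uniform_measure P {\<omega>\<in>space P. E \<omega>} \<rightarrow>\<^sub>M borel" using X by (simp cong: measurable_cong_sets)
  show "sets (law_given P X E) = sets borel" by (simp add: law_given_def)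
  show "prob_space (law_given P X E)"
    unfolding law_given_def by (rule prob_space.prob_space_distr[OF prob_space_uniform_measure[OF e] X'])
  assume B: "B \<in> sets borel"
  have "measure (law_given P X E) B = measure (uniform_measure P {\<omega>\<in>space P. E \<omega>}) (X -` B \<inter> space P)"
    unfolding law_given_def by (subst measure_distr[OF X' B]) simp
  also have "\<dots> = measure P ({\<omega>\<in>space P. E \<omega>} \<inter> (X -` B \<inter> space P)) / measure P {\<omega>\<in>space P. E \<omega>}"
    by (rule measure_uniform_measure[OF e measurable_sets[OF X B]])
  also have "{\<omega>\<in>space P. E \<omega>} \<inter> (X -` B \<inter> space P) = {\<omega>\<in>space P. X \<omega> \<in> B \<and> E \<omega>}" by auto
  finally show "measure (law_given P X E) B = measure P {\<omega>\<in>space P. X \<omega> \<in> B \<and> E \<omega>} / measure P {\<omega>\<in>space P. E \<omega>}" .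
qed

text \<open>A point at which \<open>\<Phi>\<close> is continuous and whose image lies in \<open>G\<close> is an interior point of the preimage of
\<open>G\<close>, and the points of discontinuity are null. The event that \<open>X\<close> is a point of continuity is measurable
given \<open>E\<close> by hypothesis, since \<open>measure\<close> vanishes on nonmeasurable sets.\<close>

lemma measure_law_given_vimage_le_interior:
  fixes \<Phi> :: "'x::metric_space \<Rightarrow> 'y::topological_space"
  assumes P: "prob_space P" and E: "{\<omega>\<in>space P. E \<omega>} \<in> sets P" "0 < measure P {\<omega>\<in>space P. E \<omega>}"
    and X: "X \<in> P \<rightarrow>\<^sub>M borel" and \<Phi>: "\<Phi> \<in> borel \<rightarrow>\<^sub>M borel"
    and cont: "\<P>(\<omega> in P. X \<omega> \<in> - {v. \<not> isCont \<Phi> v} \<bar> E \<omega>) = 1" and G: "open G"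
  shows "measure (law_given P (\<lambda>\<omega>. \<Phi> (X \<omega>)) E) G \<le> measure (law_given P X E) (interior (\<Phi> -` G))"
proof -
  interpret prob_space P by (rule P)
  let ?E = "{\<omega>\<in>space P. E \<omega>}" and ?C = "{\<omega>\<in>space P. X \<omega> \<in> - {v. \<not> isCont \<Phi> v} \<and> E \<omega>}"
  let ?I = "{\<omega>\<in>space P. X \<omega> \<in> interior (\<Phi> -` G) \<and> E \<omega>}"
  have c: "measure P ?C = measure P ?E" using cont E(2) by (simp add: cond_prob_def)
  then have C: "?C \<in> sets P" using E(2) measure_notin_sets[of ?C P] by fastforce
  have m: "X -` B \<inter> space P \<inter> ?E \<in> sets P" if "B \<in> sets borel" for B
    using measurable_sets[OF X that] E(1) by blast
  have i: "?I \<in> sets P" using m[of "interior (\<Phi> -` G)"] by (simp add: vimage_def Int_def conj_ac cong: conj_cong)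
  have XP: "(\<lambda>\<omega>. \<Phi> (X \<omega>)) \<in> P \<rightarrow>\<^sub>M borel" by (rule measurable_compose[OF X \<Phi>])
  have sub: "{\<omega>\<in>space P. \<Phi> (X \<omega>) \<in> G \<and> E \<omega>} \<subseteq> ?I \<union> (?E - ?C)"
  proof
    fix \<omega> assume w: "\<omega> \<in> {\<omega>\<in>space P. \<Phi> (X \<omega>) \<in> G \<and> E \<omega>}"
    show "\<omega> \<in> ?I \<union> (?E - ?C)"
    proof (cases "isCont \<Phi> (X \<omega>)")
      case True
      from w G obtain U where "open U" "X \<omega> \<in> U" "\<forall>x\<in>U. \<Phi> x \<in> G"
        using True[unfolded continuous_at_open] by blast
      then have "X \<omega> \<in> interior (\<Phi> -` G)" by (intro interiorI[of U]) auto
      with w show ?thesis by simp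
    qed (use w in auto)
  qed
  have "measure P {\<omega>\<in>space P. \<Phi> (X \<omega>) \<in> G \<and> E \<omega>} \<le> measure P (?I \<union> (?E - ?C))"
    using sub i E(1) C by (intro finite_measure_mono) auto
  also have "\<dots> \<le> measure P ?I + measure P (?E - ?C)"
    using i E(1) C by (intro measure_Un_le) auto
  also have "measure P (?E - ?C) = 0"
    using c E(1) C by (subst finite_measure_Diff) auto
  finally show ?thesis
    using G E(2) by (subst measure_law_given[OF P E XP], simp, subst measure_law_given[OF P E X], simp)
      (simp add: divide_right_mono)
qed

theorem corollary4p2:
  fixes P :: "'w measure"
    and \<kappa> \<epsilon> :: real
    and \<rho> :: "'a::polish_space borel_prob"
    and \<pi> :: "'w \<Rightarrow> 'a borel_prob borel_prob"
    and \<mu> :: "nat \<Rightarrow> 'w \<Rightarrow> 'a borel_prob"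
    and \<xi> :: "nat \<Rightarrow> nat \<Rightarrow> 'w \<Rightarrow> 'a"
    and M N :: nat
    and T :: "'t set"
    and \<phi> :: "nat \<Rightarrow> (nat \<Rightarrow> 'a) \<Rightarrow> 't"
    and y :: "nat \<Rightarrow> 't"
    and t :: "nat \<Rightarrow> nat \<Rightarrow> nat \<Rightarrow> 'w \<Rightarrow> real"
    and u :: "nat \<Rightarrow> nat \<Rightarrow> 'w \<Rightarrow> 'a borel_prob"
  assumes "prob_space P"
    and "0 < \<kappa>" and "0 < \<epsilon>"
    and "nested_dirichlet P \<kappa> \<epsilon> \<rho> \<pi> \<mu> \<xi>"
    and "1 \<le> M" and "1 \<le> N"
    and "countable T"
    and "\<And>m. m \<in> {1..M} \<Longrightarrow> \<phi> m \<in> PiM {1..N} (\<lambda>_. borel) \<rightarrow>\<^sub>M count_space T"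
    and "y \<in> {1..M} \<rightarrow>\<^sub>E T"
    and "\<P>(\<omega> in P. obs \<phi> \<xi> M N \<omega> = y) > 0"
    and "\<And>k. 1 \<le> k \<Longrightarrow> weighted_simulation P \<kappa> \<epsilon> \<rho> M N (row_law P \<xi> N) (obs_set \<phi> y N) T
           (obs \<phi> \<xi> M N) (t k) (u k)"
    and "prob_space.indep_vars P (\<lambda>_. sim_space M) (\<lambda>k. sim_element M (t k) (u k)) {1..}"
  shows "(AE \<omega> in P. weakly_converges
            (\<lambda>K. scale_measure (ennreal (1 / (\<kappa> + real M)))
               (add_measure (scale_measure \<kappa> (\<D> (scale_measure \<epsilon> (meas \<rho>))))
                 (sum_measure {1..M} (\<lambda>m.
                   scale_measure (ennreal (1 / (\<Sum>k=1..K. total_weight \<kappa> M (t k) \<omega>)))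
                     (sum_measure {1..K} (\<lambda>k.
                       scale_measure (total_weight \<kappa> M (t k) \<omega>) (return borel (u k m \<omega>))))))))
            (law_given P (\<mu> (M + 1)) (\<lambda>\<omega>. obs \<phi> \<xi> M N \<omega> = y))) \<and>
         (\<forall>\<Phi> :: 'a borel_prob \<Rightarrow> 'b::metric_space.
            \<Phi> \<in> borel \<rightarrow>\<^sub>M borel \<longrightarrow>
            \<P>(\<omega> in P. \<mu> (M + 1) \<omega> \<in> - {v. \<not> isCont \<Phi> v} \<bar> obs \<phi> \<xi> M N \<omega> = y) = 1 \<longrightarrow>
            (AE \<omega> in P. weakly_converges
               (\<lambda>K. scale_measure (ennreal (1 / (\<kappa> + real M)))
                  (add_measure (scale_measure \<kappa> (distr (\<D> (scale_measure \<epsilon> (meas \<rho>))) borel \<Phi>))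
                    (sum_measure {1..M} (\<lambda>m.
                      scale_measure (ennreal (1 / (\<Sum>k=1..K. total_weight \<kappa> M (t k) \<omega>)))
                        (sum_measure {1..K} (\<lambda>k.
                          scale_measure (total_weight \<kappa> M (t k) \<omega>) (return borel (\<Phi> (u k m \<omega>)))))))))
               (law_given P (\<lambda>\<omega>. \<Phi> (\<mu> (M + 1) \<omega>)) (\<lambda>\<omega>. obs \<phi> \<xi> M N \<omega> = y))))"
proof -
  note P = assms(1) and \<kappa> = assms(2) and \<epsilon> = assms(3) and nd = assms(4) and M = assms(5)
    and \<phi> = assms(8) and y = assms(9) and Ypos = assms(10) and sim = assms(11) and ind = assms(12)
  interpret prob_space P by (rule P)
  define A where "A = obs_set \<phi> y N"
  let ?Q = "\<D> (scale_measure \<epsilon> (meas \<rho>))"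
  let ?Y = "\<lambda>\<omega>. obs \<phi> \<xi> M N \<omega> = y"
  let ?E = "{\<omega>\<in>space P. \<forall>m\<in>{1..M}. row \<xi> m N \<omega> \<in> A m}"
  let ?V = "\<lambda>\<omega> k. total_weight \<kappa> M (t k) \<omega>"
  have A: "A m \<in> sets (PiM {1..N} (\<lambda>_. borel))" if m: "m \<in> {1..M}" for m
  proof -
    have "{y m} \<in> sets (count_space T)" using y m by auto
    from measurable_sets[OF \<phi>[OF m] this] show ?thesis
      by (simp add: A_def obs_set_def vimage_def Int_def conj_commute)
  qed
  have Y: "?Y \<omega> \<longleftrightarrow> (\<forall>m\<in>{1..M}. row \<xi> m N \<omega> \<in> A m)" if "\<omega> \<in> space P" for \<omega>
  proof -
    have "row \<xi> m N \<omega> \<in> space (PiM {1..N} (\<lambda>_. borel))" if "m \<in> {1..M}" for m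
      using measurable_space[OF measurable_nested_row[OF nd]] \<open>\<omega> \<in> space P\<close> that by auto
    moreover have "?Y \<omega> \<longleftrightarrow> (\<forall>m\<in>{1..M}. \<phi> m (row \<xi> m N \<omega>) = y m)"
      using y unfolding obs_def by (auto simp: fun_eq_iff restrict_def PiE_def extensional_def)
    ultimately show ?thesis by (simp add: A_def obs_set_def)
  qed
  have EY: "{\<omega>\<in>space P. ?Y \<omega>} = ?E" using Y by blast
  have Em: "?E \<in> sets P" by (rule emeasure_rows_event(1)[OF P nd M]) (erule A)
  have E0: "0 < measure P ?E" using Ypos by (simp only: EY)
  have Ym: "{\<omega>\<in>space P. ?Y \<omega>} \<in> sets P" using Em by (simp only: EY)
  have pos: "0 < measure (row_law P \<xi> N) (A m)" if "m \<in> {1..M}" for m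
    by (rule row_law_positive[OF P nd \<kappa> \<epsilon> _ E0 that]) (erule A)
  have pR: "prob_space (row_law P \<xi> N)"
    unfolding row_law_def using measurable_nested_row[OF nd, of 1 N] by (intro prob_space_distr) simp
  have Q: "sets ?Q = sets borel" "prob_space ?Q"
    using nested_param(1)[OF \<kappa> \<epsilon>, of \<rho>] by (auto intro: prob_space_dirichlet_process)
  have sim': "weighted_simulation P \<kappa> \<epsilon> \<rho> M N (row_law P \<xi> N) A T (obs \<phi> \<xi> M N) (t k) (u k)" if "1 \<le> k" for k
    unfolding A_def by (rule sim[OF that])
  have \<mu>: "\<mu> (Suc M) \<in> P \<rightarrow>\<^sub>M borel" by (rule measurable_nested_hidden[OF nd]) simp
  \<comment> \<open>the first simulation stands for all of them in the definition of the limits\<close>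
  define b where "b m B = (\<integral>\<omega>. ?V \<omega> 1 * indicator B (u 1 m \<omega>) \<partial>P)" for m B
  have b: "(\<integral>\<omega>. ?V \<omega> k * indicator B (u k m \<omega>) \<partial>P) = b m B" if "1 \<le> k" "B \<in> sets borel" "m \<in> {1..M}" for k m B
  proof -
    have mean: "ennreal (\<integral>\<omega>. ?V \<omega> k * indicator B (u k m \<omega>) \<partial>P) =
      (\<integral>\<^sup>+w. \<integral>\<^sup>+x. ennreal (\<Prod>m=1..M. row_prob N (A m) (x m)) * indicator B (x m) \<partial>PiM {1..M} (\<lambda>_. meas w)
        \<partial>\<D> (scale_measure \<kappa> ?Q))" if "1 \<le> k" for k
      by (rule simulation_mean[OF P nd \<kappa> \<epsilon> _ _ sim'[OF that] \<open>B \<in> sets borel\<close> \<open>m \<in> {1..M}\<close>]) (erule A, erule pos)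
    have nn: "0 \<le> (\<integral>\<omega>. ?V \<omega> k * indicator B (u k m \<omega>) \<partial>P)" if "1 \<le> k" for k
      using sim_total_weight_nonneg[OF \<kappa>, of N "row_law P \<xi> N" A M]
      by (intro Bochner_Integration.integral_nonneg_AE AE_I2) (simp add: total_weight_eq_sim_total_weight[OF sim'[OF that]])
    show ?thesis
      unfolding b_def
      by (rule ennreal_inj[OF nn[OF that(1)] nn[OF order_refl], THEN iffD1]) (simp only: mean[OF that(1)] mean[OF order_refl])
  qed
  define a where "a = measure P ?E"
  have a: "b m UNIV = a" if "m \<in> {1..M}" for m
  proof -
    have "measure P ?E = (\<integral>\<omega>. ?V \<omega> 1 \<partial>P)"
      by (rule nested_predictive_via_simulation(1)[OF P nd \<kappa> \<epsilon> M _ _ sim'[OF order_refl]]) (erule A, erule pos)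
    then show ?thesis by (simp add: a_def b_def)
  qed
  have law: "measure (law_given P (\<mu> (Suc M)) ?Y) B = (\<kappa> * measure ?Q B + (\<Sum>m=1..M. b m B / a)) / (\<kappa> + real M)"
    if B: "B \<in> sets borel" for B
  proof -
    have "measure (law_given P (\<mu> (Suc M)) ?Y) B = measure P {\<omega>\<in>space P. \<mu> (Suc M) \<omega> \<in> B \<and> ?Y \<omega>} / a"
      unfolding a_def EY[symmetric] by (rule measure_law_given[OF P Ym Ypos \<mu> B])
    also have "{\<omega>\<in>space P. \<mu> (Suc M) \<omega> \<in> B \<and> ?Y \<omega>} = {\<omega>\<in>space P. \<mu> (Suc M) \<omega> \<in> B \<and> (\<forall>m\<in>{1..M}. row \<xi> m N \<omega> \<in> A m)}"
      using Y by blast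
    also have "measure P \<dots> = (\<kappa> * measure ?Q B * a + (\<Sum>m=1..M. b m B)) / (\<kappa> + real M)"
      unfolding a_def b_def
      by (rule nested_predictive_via_simulation(2)[OF P nd \<kappa> \<epsilon> M _ _ sim'[OF order_refl] B]) (erule A, erule pos)
    also have "\<dots> / a = (\<kappa> * measure ?Q B + (\<Sum>m=1..M. b m B / a)) / (\<kappa> + real M)"
      using E0 unfolding a_def[symmetric] sum_divide_distrib[symmetric] by (simp add: field_simps)
    finally show ?thesis .
  qed
  \<comment> \<open>from here on one null set serves all open sets, and hence both parts of the claim\<close>
  obtain \<B> :: "'a borel_prob set set" where \<B>: "countable \<B>" "topological_basis \<B>"
    using ex_countable_basis by blast
  have avg: "AE \<omega> in P. (\<lambda>K. (\<Sum>k=1..K. ?V \<omega> k * indicator B (u k m \<omega>)) / real K) \<longlonglongrightarrow> b m B"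
    if "B \<in> sets borel" "m \<in> {1..M}" for B m
    by (rule simulation_averages[OF P \<kappa> pR _ ind that]) (erule sim', rule b[OF _ that])
  have "countable ({S. finite S \<and> S \<subseteq> \<B>} \<times> {1..M})"
    using countable_Collect_finite_subset[OF \<B>(1)] by (intro countable_SIGMA) auto
  then have "AE \<omega> in P. \<forall>p\<in>{S. finite S \<and> S \<subseteq> \<B>} \<times> {1..M}.
    (\<lambda>K. (\<Sum>k=1..K. ?V \<omega> k * indicator (\<Union>(fst p)) (u k (snd p) \<omega>)) / real K) \<longlonglongrightarrow> b (snd p) (\<Union>(fst p))"
  proof (rule AE_ball_countable[THEN iffD2], intro ballI)
    fix p assume p: "p \<in> {S. finite S \<and> S \<subseteq> \<B>} \<times> {1..M}"
    then have "open (\<Union>(fst p))" using topological_basis_open[OF \<B>(2)] by (auto intro!: open_Union)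
    with p show "AE \<omega> in P. (\<lambda>K. (\<Sum>k=1..K. ?V \<omega> k * indicator (\<Union>(fst p)) (u k (snd p) \<omega>)) / real K) \<longlonglongrightarrow> b (snd p) (\<Union>(fst p))"
      by (intro avg) auto
  qed
  moreover have "AE \<omega> in P. (\<lambda>K. (\<Sum>k=1..K. ?V \<omega> k * indicator UNIV (u k 1 \<omega>)) / real K) \<longlonglongrightarrow> b 1 UNIV"
    using M by (intro avg) auto
  ultimately have "AE \<omega> in P. (\<forall>k\<ge>1. 0 < ?V \<omega> k) \<and> (\<forall>G e. open G \<longrightarrow> 0 < e \<longrightarrow>
      (\<forall>\<^sub>F K in sequentially. measure (law_given P (\<mu> (Suc M)) ?Y) G - e <
        measure (weighted_mixture \<kappa> M ?Q (?V \<omega>) (\<lambda>k m. u k m \<omega>) K) G))"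
    using AE_space
  proof eventually_elim
    case (elim \<omega>)
    have V: "0 < ?V \<omega> k" if "1 \<le> k" for k
      unfolding total_weight_eq_sim_total_weight[OF sim'[OF that] elim(3)] by (rule sim_total_weight_pos[OF \<kappa> pos])
    have lim: "(\<lambda>K. (\<Sum>k=1..K. ?V \<omega> k) / real K) \<longlonglongrightarrow> a"
      using elim(2) M by (simp add: a)
    have "\<forall>\<^sub>F K in sequentially. measure (law_given P (\<mu> (Suc M)) ?Y) G - e <
        measure (weighted_mixture \<kappa> M ?Q (?V \<omega>) (\<lambda>k m. u k m \<omega>) K) G" if "open G" "0 < e" for G e
    proof (rule weighted_mixture_open_liminf[where b=b, OF \<B>(2,1) \<kappa> Q _ lim _ _ _ _ _ that])
      show "finite_measure (law_given P (\<mu> (Suc M)) ?Y)"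
        using prob_space_law_given[OF P Ym Ypos \<mu>] by (rule prob_space.finite_measure)
      show "sets (law_given P (\<mu> (Suc M)) ?Y) = sets borel" by (rule sets_law_given[OF P Ym Ypos \<mu>])
      show "0 \<le> ?V \<omega> k" if "1 \<le> k" for k using V[OF that] by simp
      show "a \<noteq> 0" using E0 by (simp add: a_def)
      show "(\<lambda>K. (\<Sum>k=1..K. ?V \<omega> k * indicator (\<Union>S) (u k m \<omega>)) / real K) \<longlonglongrightarrow> b m (\<Union>S)"
        if "finite S" "S \<subseteq> \<B>" "m \<in> {1..M}" for S m
        using bspec[OF elim(1), of "(S, m)"] that by simp
      show "measure (law_given P (\<mu> (Suc M)) ?Y) B = (\<kappa> * measure ?Q B + (\<Sum>m=1..M. b m B / a)) / (\<kappa> + real M)"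
        if "open B" for B
        using that by (intro law) simp
    qed
    with V show ?case by blast
  qed
  note open_liminf = this
  show ?thesis
    unfolding weighted_mixture_def[symmetric] Suc_eq_plus1[symmetric]
  proof (intro conjI allI impI)
    show "AE \<omega> in P. weakly_converges (weighted_mixture \<kappa> M ?Q (?V \<omega>) (\<lambda>k m. u k m \<omega>)) (law_given P (\<mu> (Suc M)) ?Y)"
      using open_liminf
    proof eventually_elim
      case (elim \<omega>)
      then show ?case
        by (intro weakly_converges_weighted_mixture \<kappa> Q sets_law_given[OF P Ym Ypos \<mu>] prob_space_law_given[OF P Ym Ypos \<mu>]) auto
    qed
  next
    show "AE \<omega> in P. weakly_converges (weighted_mixture \<kappa> M (distr ?Q borel \<Phi>) (?V \<omega>) (\<lambda>k m. \<Phi> (u k m \<omega>)))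
      (law_given P (\<lambda>\<omega>. \<Phi> (\<mu> (Suc M) \<omega>)) ?Y)"
      if "\<Phi> \<in> borel \<rightarrow>\<^sub>M borel" "\<P>(\<omega> in P. \<mu> (Suc M) \<omega> \<in> - {v. \<not> isCont \<Phi> v} \<bar> ?Y \<omega>) = 1"
      for \<Phi> :: "'a borel_prob \<Rightarrow> 'b"
      using open_liminf
    proof eventually_elim
      case (elim \<omega>)
      note \<Phi> = that(1)
      have \<Phi>\<mu>: "(\<lambda>\<omega>. \<Phi> (\<mu> (Suc M) \<omega>)) \<in> P \<rightarrow>\<^sub>M borel" by (rule measurable_compose[OF \<mu> \<Phi>])
      have \<Phi>Q: "\<Phi> \<in> ?Q \<rightarrow>\<^sub>M borel" using \<Phi> Q(1) by (simp cong: measurable_cong_sets)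
      show ?case
      proof (rule weakly_converges_weighted_mixture[OF \<kappa> sets_distr prob_space.prob_space_distr[OF Q(2) \<Phi>Q] _
            sets_law_given[OF P Ym Ypos \<Phi>\<mu>] prob_space_law_given[OF P Ym Ypos \<Phi>\<mu>]])
        show "0 < ?V \<omega> k" if "1 \<le> k" for k using elim that by blast
        fix G :: "'b set" and e :: real assume G: "open G" and e: "0 < e"
        have le: "measure (weighted_mixture \<kappa> M ?Q (?V \<omega>) (\<lambda>k m. u k m \<omega>) K) (interior (\<Phi> -` G)) \<le>
          measure (weighted_mixture \<kappa> M (distr ?Q borel \<Phi>) (?V \<omega>) (\<lambda>k m. \<Phi> (u k m \<omega>)) K) G" for K
        proof -
          have nonneg: "0 \<le> ?V \<omega> k" if "1 \<le> k" for k using elim that by (simp add: less_imp_le)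
          have "\<Phi> -` G \<in> sets borel" using measurable_sets[OF \<Phi>, of G] G by simp
          then have "measure (weighted_mixture \<kappa> M ?Q (?V \<omega>) (\<lambda>k m. u k m \<omega>) K) (interior (\<Phi> -` G)) \<le>
            measure (weighted_mixture \<kappa> M ?Q (?V \<omega>) (\<lambda>k m. u k m \<omega>) K) (\<Phi> -` G)"
            by (intro finite_measure.finite_measure_mono[OF finite_measure_weighted_mixture[OF \<kappa> Q]] interior_subset nonneg) auto
          also have "\<dots> = measure (weighted_mixture \<kappa> M (distr ?Q borel \<Phi>) (?V \<omega>) (\<lambda>k m. \<Phi> (u k m \<omega>)) K) G"
            using G by (intro weighted_mixture_distr[symmetric, OF \<kappa> Q _ \<Phi>] nonneg) auto
          finally show ?thesis .
        qed
        have "\<forall>\<^sub>F K in sequentially. measure (law_given P (\<mu> (Suc M)) ?Y) (interior (\<Phi> -` G)) - e <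
          measure (weighted_mixture \<kappa> M ?Q (?V \<omega>) (\<lambda>k m. u k m \<omega>) K) (interior (\<Phi> -` G))"
          using elim e by blast
        then show "\<forall>\<^sub>F K in sequentially. measure (law_given P (\<lambda>\<omega>. \<Phi> (\<mu> (Suc M) \<omega>)) ?Y) G - e <
          measure (weighted_mixture \<kappa> M (distr ?Q borel \<Phi>) (?V \<omega>) (\<lambda>k m. \<Phi> (u k m \<omega>)) K) G"
          by eventually_elim
            (use measure_law_given_vimage_le_interior[OF P Ym Ypos \<mu> \<Phi> that(2) G] le in \<open>smt (verit)\<close>)
      qed
    qed
  qed
qed

end
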